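(* Let $T>0$, $x_0\in\mathbb{R}$, and let $H:[0,\infty)\to\mathbb{R}$ and $F,G:[0,\infty)\times\mathbb{R}\to\mathbb{R}$ be (jointly) continuous. Let $h:[0,\infty)\to[0,\infty)$ be continuous and nondecreasing, and let $K>0$ and $\theta\in(0,1]$ be constants, such that for all $u,v\ge0$ and $x,y\in\mathbb{R}$: - $|F(u,x)-F(u,y)|+|G(u,x)-G(u,y)|\le h(u)|x-y|$; - $|H(u)|+|F(u,x)|+|G(u,x)|\le h(u)(1+|x|)$; - $|H(u)-H(v)|+|F(u,x)-F(v,x)|+|G(u,x)-G(v,x)|\le K|u-v|^\theta(1+|x|)$. Let $X$ be the solution of the SDE $$X_t=x_0+\int_0^tH(E_r)\,\mathrm{d}r+\int_0^tF(E_r,X_r)\,\mathrm{d}E_r+\int_0^tG(E_r,X_r)\,\mathrm{d}B_{E_r},\qquad t\in[0,T].$$ Assume that the Laplace exponent $\psi$ of $D$ is regularly varying at $\infty$ with index $\beta\in(0,1)$ and that one of the following conditions holds: (a) $h$ is constant and $\beta\in(1/2,1)$; (b) $h$ is continuous, nondecreasing, and regularly varying at $\infty$ with index $q\ge0$, and $\beta\in\left(\frac{2q+1}{2q+2},1\right)$. For $\delta\in(0,1)$ let $X^\delta=(X^\delta_t)_{t\in[0,T]}$ be the Euler--Maruyama-type approximation process with step size $\delta$ defined in the context. Then there exists a constant $C>0$ not depending on $\delta$ such that for all $\delta\in(0,1)$, $$\mathbb{E}\Big[\sup_{0\le s\le T}|X_s-X^\delta_s|\Big]\le C\,\delta^{\min\{\theta,1/2\}}.$$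 Thus, $X^\delta$ converges strongly to $X$ uniformly on $[0,T]$ with order $\min\{\theta,1/2\}$.
   Context: Setting. $(\Omega,\mathcal{F},\mathbb{P})$ is a complete probability space with a filtration $(\mathcal{F}_t)_{t\ge0}$ satisfying the usual conditions; $B$ is a one-dimensional $(\mathcal{F}_t)$-adapted Brownian motion, independent of an $(\mathcal{F}_t)$-adapted subordinator $D$ with $D_0=0$, killing rate $0$, drift $0$ and infinite Lévy measure $\nu$. Its Laplace exponent is $\psi(s)=\int_0^\infty(1-e^{-sy})\,\nu(\mathrm{d}y)$, so $\mathbb{E}[e^{-sD_t}]=e^{-t\psi(s)}$. The probability space is the product $(\Omega_B\times\Omega_D,\mathcal{F}_B\times\mathcal{F}_D,\mathbb{P}_B\times\mathbb{P}_D)$, with $B$ depending only on the first coordinate and $D$ only on the second. The inverse of $D$ is $E_t:=\inf\{u>0:D_u>t\}$, which has continuous nondecreasing paths; $B\circ E=(B_{E_t})$ is a continuous $(\mathcal{F}_{E_t})$-martingale, and SDEs are understood as driven by continuous $(\mathcal{F}_{E_t})$-semimartingales. Under the stated assumptions the SDE has a unique strong solution, which is continuous. A function $f:(0,\infty)\to(0,\infty)$ is regularly varying at $\infty$ with index $p\in\mathbb{R}$ if $\lim_{s\to\infty}f(cs)/f(s)=c^p$ for every $c>0$. Approximation. Fix $\delta\in(0,1)$. Put $\tau_n:=D_{n\delta}$, $n=0,1,2,\dots$, and let $N$ be the random nonnegative integer with $T\in[D_{N\delta},D_{(N+1)\delta})$. Note $E_{\tau_n}=n\delta$ a.s. Set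 $X^\delta_0:=x_0$ and for $n=0,1,\dots,N-1$, $$X^\delta_{\tau_{n+1}}:=X^\delta_{\tau_n}+H(n\delta)(\tau_{n+1}-\tau_n)+F(n\delta,X^\delta_{\tau_n})\delta+G(n\delta,X^\delta_{\tau_n})(B_{(n+1)\delta}-B_{n\delta}).$$ Continuous interpolation: for $s\in[\tau_n,\tau_{n+1})$, $$X^\delta_s:=X^\delta_{\tau_n}+\int_{\tau_n}^sH(E_{\tau_n})\,\mathrm{d}r+\int_{\tau_n}^sF(E_{\tau_n},X^\delta_{\tau_n})\,\mathrm{d}E_r+\int_{\tau_n}^sG(E_{\tau_n},X^\delta_{\tau_n})\,\mathrm{d}B_{E_r}.$$ Strong convergence: $X^\delta$ converges strongly to $X$ uniformly on $[0,T]$ with order $\eta\in(0,\infty)$ if there exist finite positive constants $C,\delta_0$ such that $\mathbb{E}[\sup_{0\le t\le T}|X_t-X^\delta_t|]\le C\delta^\eta$ for all $\delta\in(0,\delta_0)$. *)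

theory Defs
  imports "HOL-Probability.Probability"
begin

text \<open>
  Processes on \<open>[0,\<infinity>)\<close> are functions \<open>real \<Rightarrow> 'a \<Rightarrow> real\<close> of which only the values at
  nonnegative times matter. Filtrations are indexed by all reals, so that the stopping times and
  pre-\<open>\<sigma>\<close>-algebras of the library can be used; a filtration on \<open>[0,\<infinity>)\<close> is extended to negative
  times by its value at 0, and all stopping times that occur are (almost surely) nonnegative.
\<close>

definition usual_filtration :: "'a measure \<Rightarrow> (real \<Rightarrow> 'a measure) \<Rightarrow> bool" where
  "usual_filtration M \<F> \<longleftrightarrow>
     filtration (space M) \<F> \<and>
     (\<forall>t. subalgebra M (\<F> t)) \<and>
     (\<forall>t. null_sets M \<subseteq> sets (\<F> t)) \<and>
     (\<forall>t. sets (\<F> t) = (\<Inter>u\<in>{t<..}. sets (\<F> u)))"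

definition brownian_motion :: "'a measure \<Rightarrow> (real \<Rightarrow> 'a measure) \<Rightarrow> (real \<Rightarrow> 'a \<Rightarrow> real) \<Rightarrow> bool" where
  "brownian_motion M \<F> W \<longleftrightarrow>
     (\<forall>t\<ge>0. W t \<in> borel_measurable (\<F> t)) \<and>
     (AE \<omega> in M. W 0 \<omega> = 0) \<and>
     (AE \<omega> in M. continuous_on {0..} (\<lambda>t. W t \<omega>)) \<and>
     (\<forall>s t. 0 \<le> s \<and> s < t \<longrightarrow>
        distributed M lborel (\<lambda>\<omega>. W t \<omega> - W s \<omega>) (\<lambda>x. ennreal (normal_density 0 (sqrt (t - s)) x)) \<and>
        prob_space.indep_set M (sets (\<F> s))
          (sets (vimage_algebra (space M) (\<lambda>\<omega>. W t \<omega> - W s \<omega>) borel)))"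

definition subordinator :: "'a measure \<Rightarrow> (real \<Rightarrow> 'a measure) \<Rightarrow> (real \<Rightarrow> 'a \<Rightarrow> real) \<Rightarrow> bool" where
  "subordinator M \<F> Y \<longleftrightarrow>
     (\<forall>t\<ge>0. Y t \<in> borel_measurable (\<F> t)) \<and>
     (AE \<omega> in M. Y 0 \<omega> = 0) \<and>
     (AE \<omega> in M. mono_on {0..} (\<lambda>t. Y t \<omega>) \<and> (\<forall>t\<ge>0. continuous (at_right t) (\<lambda>t. Y t \<omega>))) \<and>
     (\<forall>s t. 0 \<le> s \<and> s < t \<longrightarrow>
        prob_space.indep_set M
          (sigma_sets (space M) {Y r -` A \<inter> space M | r A. r \<in> {0..s} \<and> A \<in> sets borel})
          (sets (vimage_algebra (space M) (\<lambda>\<omega>. Y t \<omega> - Y s \<omega>) borel))) \<and>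
     (\<forall>s\<ge>0. \<forall>t\<ge>0. distr M borel (\<lambda>\<omega>. Y (s + t) \<omega> - Y s \<omega>) = distr M borel (Y t))"

definition subordinator_levy_measure :: "real measure \<Rightarrow> bool" where
  "subordinator_levy_measure \<nu> \<longleftrightarrow>
     sets \<nu> = sets borel \<and> emeasure \<nu> {..0} = 0 \<and> (\<integral>\<^sup>+ y. ennreal (min 1 y) \<partial>\<nu>) < \<infinity>"

definition laplace_exponent :: "real measure \<Rightarrow> real \<Rightarrow> real" where
  "laplace_exponent \<nu> s = (\<integral>y. 1 - exp (- s * y) \<partial>\<nu>)"

text \<open>A subordinator with killing rate 0, drift 0 and L\'evy measure \<open>\<nu>\<close>: by the
  L\'evy--Khintchine formula this is expressed by its Laplace transform.\<close>

definition pure_jump_subordinator ::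
    "'a measure \<Rightarrow> (real \<Rightarrow> 'a measure) \<Rightarrow> real measure \<Rightarrow> (real \<Rightarrow> 'a \<Rightarrow> real) \<Rightarrow> bool" where
  "pure_jump_subordinator M \<F> \<nu> Y \<longleftrightarrow>
     subordinator M \<F> Y \<and> subordinator_levy_measure \<nu> \<and>
     (\<forall>s\<ge>0. \<forall>t\<ge>0. (\<integral>\<omega>. exp (- s * Y t \<omega>) \<partial>M) = exp (- t * laplace_exponent \<nu> s))"

text \<open>Pathwise inverse; for the paths that occur the set is nonempty almost surely.\<close>

definition inverse_path :: "(real \<Rightarrow> real) \<Rightarrow> real \<Rightarrow> real" where
  "inverse_path d t = Inf {u. 0 < u \<and> t < d u}"

definition time_changed_filtration ::
    "'a measure \<Rightarrow> (real \<Rightarrow> 'a measure) \<Rightarrow> (real \<Rightarrow> 'a \<Rightarrow> real) \<Rightarrow> real \<Rightarrow> 'a measure" where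
  "time_changed_filtration M \<F> E t = filtration.pre_sigma (space M) \<F> (E t)"

definition regularly_varying :: "(real \<Rightarrow> real) \<Rightarrow> real \<Rightarrow> bool" where
  "regularly_varying f p \<longleftrightarrow>
     (\<forall>s>0. f s > 0) \<and> (\<forall>c>0. ((\<lambda>s. f (c * s) / f s) \<longlongrightarrow> c powr p) at_top)"

text \<open>The supremum of the distance of two paths, as an extended real so that it is meaningful for
  unbounded paths (on a null set) as well.\<close>

definition sup_dist :: "real set \<Rightarrow> (real \<Rightarrow> real) \<Rightarrow> (real \<Rightarrow> real) \<Rightarrow> ennreal" where
  "sup_dist A x y = (SUP t\<in>A. ennreal \<bar>x t - y t\<bar>)"

definition ucp_tendsto ::
    "'a measure \<Rightarrow> real set \<Rightarrow> (nat \<Rightarrow> real \<Rightarrow> 'a \<Rightarrow> real) \<Rightarrow> (real \<Rightarrow> 'a \<Rightarrow> real) \<Rightarrow> bool" where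
  "ucp_tendsto M A Y Z \<longleftrightarrow>
     (\<forall>\<epsilon>>0. (\<lambda>n. measure M {\<omega>\<in>space M. ennreal \<epsilon> < sup_dist A (\<lambda>t. Y n t \<omega>) (\<lambda>t. Z t \<omega>)})
        \<longlonglongrightarrow> 0)"

text \<open>
  Stochastic integrals over \<open>(0,t]\<close>, as in Protter's book. A simple predictable process is
  \<open>S = (\<Sum>i<k. \<xi>\<^sub>i 1\<^bsub>(\<sigma>\<^sub>i, \<sigma>\<^sub>i\<^sub>+\<^sub>1]\<^esub>)\<close> with finite stopping times \<open>0 \<le> \<sigma>\<^sub>0 \<le> \<dots> \<le> \<sigma>\<^sub>k\<close> and \<open>\<xi>\<^sub>i\<close> measurable
  with respect to the \<open>\<sigma>\<close>-algebra at \<open>\<sigma>\<^sub>i\<close>; its integral against \<open>Z\<close> is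
  \<open>J\<^sub>t = (\<Sum>i<k. \<xi>\<^sub>i (Z\<^bsub>t \<and> \<sigma>\<^sub>i\<^sub>+\<^sub>1\<^esub> - Z\<^bsub>t \<and> \<sigma>\<^sub>i\<^esub>))\<close>.
\<close>

definition simple_integral_pair ::
    "'a set \<Rightarrow> (real \<Rightarrow> 'a measure) \<Rightarrow> (real \<Rightarrow> 'a \<Rightarrow> real) \<Rightarrow>
     (real \<Rightarrow> 'a \<Rightarrow> real) \<Rightarrow> (real \<Rightarrow> 'a \<Rightarrow> real) \<Rightarrow> bool" where
  "simple_integral_pair \<Omega> \<G> Z S J \<longleftrightarrow>
     (\<exists>(k::nat) (\<sigma> :: nat \<Rightarrow> 'a \<Rightarrow> real) (\<xi> :: nat \<Rightarrow> 'a \<Rightarrow> real).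
        (\<forall>i\<le>k. stopping_time \<G> (\<sigma> i)) \<and>
        (\<forall>\<omega>\<in>\<Omega>. 0 \<le> \<sigma> 0 \<omega>) \<and>
        (\<forall>\<omega>\<in>\<Omega>. \<forall>i<k. \<sigma> i \<omega> \<le> \<sigma> (Suc i) \<omega>) \<and>
        (\<forall>i<k. \<xi> i \<in> borel_measurable (filtration.pre_sigma \<Omega> \<G> (\<sigma> i))) \<and>
        S = (\<lambda>t \<omega>. \<Sum>i<k. \<xi> i \<omega> * indicator {\<sigma> i \<omega> <.. \<sigma> (Suc i) \<omega>} t) \<and>
        J = (\<lambda>t \<omega>. \<Sum>i<k. \<xi> i \<omega> * (Z (min t (\<sigma> (Suc i) \<omega>)) \<omega> - Z (min t (\<sigma> i \<omega>)) \<omega>)))"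

text \<open>
  \<open>I\<close> is the stochastic integral process \<open>(\<integral>\<^sub>0\<^sup>t Y\<^sub>r dZ\<^sub>r)\<close>, \<open>0 \<le> t \<le> T\<close>, of an adapted process \<open>Y\<close> with
  continuous paths against a continuous \<open>\<G>\<close>-semimartingale \<open>Z\<close>: the value at \<open>Y\<close> of the
  extension, continuous with respect to uniform convergence in probability, of the integral from
  simple predictable processes. The simple processes approximating \<open>Y\<close> exist because they are dense;
  the integral does not depend on their choice.
\<close>

definition is_stochastic_integral ::
    "'a measure \<Rightarrow> (real \<Rightarrow> 'a measure) \<Rightarrow> real \<Rightarrow> (real \<Rightarrow> 'a \<Rightarrow> real) \<Rightarrow>
     (real \<Rightarrow> 'a \<Rightarrow> real) \<Rightarrow> (real \<Rightarrow> 'a \<Rightarrow> real) \<Rightarrow> bool" where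
  "is_stochastic_integral M \<G> T Z Y I \<longleftrightarrow>
     (\<forall>t\<in>{0..T}. I t \<in> borel_measurable (\<G> t)) \<and>
     (AE \<omega> in M. continuous_on {0..T} (\<lambda>t. I t \<omega>)) \<and>
     (\<exists>S J. (\<forall>n. simple_integral_pair (space M) \<G> Z (S n) (J n)) \<and> ucp_tendsto M {0<..T} S Y) \<and>
     (\<forall>S J. (\<forall>n. simple_integral_pair (space M) \<G> Z (S n) (J n)) \<and> ucp_tendsto M {0<..T} S Y
        \<longrightarrow> ucp_tendsto M {0..T} J I)"

text \<open>Continuous \<open>\<G>\<close>-adapted solutions on \<open>[0,T]\<close>; \<open>\<G>\<close> is meant to be the time-changed filtration.
  The integral against \<open>dE\<close> is the Lebesgue--Stieltjes integral along the continuous nondecreasing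
  paths of \<open>E\<close>.\<close>

definition solves_time_changed_SDE ::
    "'a measure \<Rightarrow> (real \<Rightarrow> 'a measure) \<Rightarrow> real \<Rightarrow> real \<Rightarrow> (real \<Rightarrow> real) \<Rightarrow>
     (real \<Rightarrow> real \<Rightarrow> real) \<Rightarrow> (real \<Rightarrow> real \<Rightarrow> real) \<Rightarrow>
     (real \<Rightarrow> 'a \<Rightarrow> real) \<Rightarrow> (real \<Rightarrow> 'a \<Rightarrow> real) \<Rightarrow> (real \<Rightarrow> 'a \<Rightarrow> real) \<Rightarrow> bool" where
  "solves_time_changed_SDE M \<G> T x0 H F G E B X \<longleftrightarrow>
     (\<forall>t\<in>{0..T}. X t \<in> borel_measurable (\<G> t)) \<and>
     (AE \<omega> in M. continuous_on {0..T} (\<lambda>t. X t \<omega>)) \<and>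
     (\<exists>I. is_stochastic_integral M \<G> T (\<lambda>t \<omega>. B (E t \<omega>) \<omega>) (\<lambda>t \<omega>. G (E t \<omega>) (X t \<omega>)) I \<and>
        (AE \<omega> in M. \<forall>t\<in>{0..T}.
           X t \<omega> = x0 + (LINT r:{0<..t}|lborel. H (E r \<omega>))
                      + (LINT r:{0<..t}|interval_measure (\<lambda>r. E r \<omega>). F (E r \<omega>) (X r \<omega>))
                      + I t \<omega>))"

text \<open>The Euler--Maruyama scheme, path by path: \<open>d\<close> is the path of the subordinator and \<open>w\<close> that of
  the Brownian motion. \<open>euler_grid \<dots> n\<close> is the value of the scheme at time \<open>d (n\<delta>)\<close>.\<close>

primrec euler_grid ::
    "(real \<Rightarrow> real) \<Rightarrow> (real \<Rightarrow> real \<Rightarrow> real) \<Rightarrow> (real \<Rightarrow> real \<Rightarrow> real) \<Rightarrow> real \<Rightarrow> real \<Rightarrow>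
     (real \<Rightarrow> real) \<Rightarrow> (real \<Rightarrow> real) \<Rightarrow> nat \<Rightarrow> real" where
  "euler_grid H F G x0 \<delta> d w 0 = x0"
| "euler_grid H F G x0 \<delta> d w (Suc n) =
     (let x = euler_grid H F G x0 \<delta> d w n; u = real n * \<delta>; v = real (Suc n) * \<delta>
      in x + H u * (d v - d u) + F u x * \<delta> + G u x * (w v - w u))"

text \<open>The continuous interpolation. On an interval \<open>[\<tau>\<^sub>n, \<tau>\<^sub>n\<^sub>+\<^sub>1)\<close> the integrands are frozen at time
  \<open>\<tau>\<^sub>n\<close>; the stochastic integral of such an integrand is the elementary one.\<close>

definition euler_maruyama ::
    "(real \<Rightarrow> real) \<Rightarrow> (real \<Rightarrow> real \<Rightarrow> real) \<Rightarrow> (real \<Rightarrow> real \<Rightarrow> real) \<Rightarrow> real \<Rightarrow> real \<Rightarrow>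
     (real \<Rightarrow> real) \<Rightarrow> (real \<Rightarrow> real) \<Rightarrow> real \<Rightarrow> real" where
  "euler_maruyama H F G x0 \<delta> d w s =
     (let e = inverse_path d;
          n = (THE n::nat. d (real n * \<delta>) \<le> s \<and> s < d (real (Suc n) * \<delta>));
          \<tau> = d (real n * \<delta>);
          x = euler_grid H F G x0 \<delta> d w n
      in x + (LINT r:{\<tau><..s}|lborel. H (e \<tau>))
           + (LINT r:{\<tau><..s}|interval_measure e. F (e \<tau>) x)
           + G (e \<tau>) x * (w (e s) - w (e \<tau>)))"

definition strongly_converges ::
    "'a measure \<Rightarrow> real \<Rightarrow> (real \<Rightarrow> 'a \<Rightarrow> real) \<Rightarrow> (real \<Rightarrow> real \<Rightarrow> 'a \<Rightarrow> real) \<Rightarrow> real \<Rightarrow> bool" where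
  "strongly_converges M T X Xd \<eta> \<longleftrightarrow>
     0 < \<eta> \<and>
     (\<exists>C>0. \<exists>\<delta>0>0. \<forall>\<delta>\<in>{0<..<\<delta>0}.
        (\<integral>\<^sup>+ \<omega>. sup_dist {0..T} (\<lambda>t. X t \<omega>) (\<lambda>t. Xd \<delta> t \<omega>) \<partial>M) \<le> ennreal (C * \<delta> powr \<eta>))"

end

theory Submission
  imports Defs
begin

text \<open>All estimates are made in the operational time \<open>u = E\<^sub>t\<close>. The Brownian motion keeps its martingale
  property for the filtration to which \<open>D\<close> is adapted, so the random clock becomes a deterministic one
  and no conditioning on \<open>D\<close> is needed. The stochastic integral enters only as a limit of Riemann sums;
  together with Doob's inequality for simple integrands, Fatou's lemma and a Gronwall argument this
  bounds the mean square of the error up to operational time \<open>u\<close> by \<open>c(u) \<delta>\<^sup>2\<^sup>\<eta>\<close>, where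
  \<open>\<eta> = min \<theta> (1/2)\<close> and \<open>c(u)\<close> is at most of order \<open>exp (b u\<^sup>r)\<close> for any \<open>r > 2 q + 2\<close>. On the other
  hand, a Chernoff bound gives \<open>P(E\<^sub>T \<ge> u) \<le> C exp (- a u\<^sup>p)\<close> for every \<open>p < 1 / (1 - \<beta>)\<close>. The hypothesis
  on \<open>\<beta>\<close> says exactly \<open>2 q + 2 < 1 / (1 - \<beta>)\<close>, so that the tail beats the growth of the constants when
  the errors on the layers \<open>n < E\<^sub>T \<le> n + 1\<close> are summed.\<close>

subsection \<open>Deterministic time changes and Euler paths\<close>

text \<open>In real time the blocks from \<open>D (n * \<delta>)\<close> to
  \<open>D ((n + 1) * \<delta>)\<close> are not short: one jump of \<open>D\<close> can cover all of
  \<open>[0, T]\<close>, and \<open>D\<close> need not have moments. Only the sum of the block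
  lengths cut at \<open>T\<close> is controlled, by \<open>T\<close>. In mean square this suffices:
  their squares sum to at most \<open>T\<^sup>2\<close>, each with weight \<open>\<delta>\<close> in
  operational time, which yields order 1/2. Moments enter only for the scheme: the Hoelder condition
  is applied at its values, and the error is first restricted to times up to which \<open>X\<close>
  is bounded by \<open>R\<close>. On a cell of operational time the error is dominated only by its
  value at the right end, so Gronwall's inequality is implicit and needs a small mesh; since
  \<open>\<delta>\<close> is prescribed, each block is cut into \<open>L\<close> cells. Partition
  points of real time become random operational times, so a Riemann sum is recovered as a limit of
  simple integrals on deterministic grids. The exponent \<open>2 q + 2\<close> arises because the
  mean square estimates bring \<open>h(u)\<^sup>2\<close>, the Cauchy-Schwarz inequality for the
  drift costs a factor \<open>u\<close>, and Gronwall's inequality over operational time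
  \<open>u\<close> another one.\<close>

locale time_change_path =
  fixes d :: "real \<Rightarrow> real"
  assumes zero: "d 0 = 0"
    and smono: "strict_mono_on {0..} d"
    and rcont: "\<And>t. 0 \<le> t \<Longrightarrow> continuous (at_right t) d"
    and unbounded: "\<And>x. \<exists>u\<ge>0. x < d u"
begin

abbreviation "e \<equiv> inverse_path d"

lemma less_iff: "0 \<le> s \<Longrightarrow> 0 \<le> t \<Longrightarrow> d s < d t \<longleftrightarrow> s < t"
  using smono by (simp add: strict_mono_on_less)

lemma le_iff: "0 \<le> s \<Longrightarrow> 0 \<le> t \<Longrightarrow> d s \<le> d t \<longleftrightarrow> s \<le> t"
  using less_iff[of t s] by auto

lemma nonneg: "0 \<le> t \<Longrightarrow> 0 \<le> d t"
  using le_iff[of 0 t] zero by simp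

lemma set_ne: "{u. 0 < u \<and> t < d u} \<noteq> {}"
proof -
  obtain u where u: "u \<ge> 0" "t < d u" using unbounded by blast
  have "d u < d (u + 1)" using u less_iff by simp
  then show ?thesis using u by (auto intro!: exI[of _ "u + 1"])
qed

lemma set_bdd: "bdd_below {u. 0 < u \<and> t < d u}"
  by (rule bdd_belowI[of _ 0]) auto

lemma inv_nonneg: "0 \<le> e t"
  unfolding inverse_path_def by (rule cInf_greatest[OF set_ne]) auto

text \<open>The Galois connection between \<open>d\<close> and its inverse, on which every later
  comparison of the two clocks rests. From \<open>e t \<le> v\<close> one first gets
  \<open>t < d w\<close> only for \<open>w > v\<close>; right continuity of \<open>d\<close> closes
  the gap.\<close>

lemma inv_le_iff:
  assumes "0 \<le> v"
  shows "e t \<le> v \<longleftrightarrow> t \<le> d v"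
proof
  assume "t \<le> d v"
  have "w \<ge> e t" if "v < w" for w
    unfolding inverse_path_def
    using that \<open>t \<le> d v\<close> less_iff[of v w] assms by (intro cInf_lower set_bdd) auto
  then show "e t \<le> v" by (rule dense_ge)
next
  assume ev: "e t \<le> v"
  have lt: "t < d w" if "v < w" for w
  proof -
    have "Inf {u. 0 < u \<and> t < d u} < w" using ev that by (simp add: inverse_path_def)
    then obtain u where "0 < u" "t < d u" "u < w"
      using cInf_less_iff[OF set_ne set_bdd] by auto
    then show ?thesis using less_iff[of u w] by simp
  qed
  show "t \<le> d v"
  proof (rule tendsto_lowerbound)
    show "(d \<longlongrightarrow> d v) (at_right v)" using rcont[OF assms] by (simp add: continuous_within)
    show "\<forall>\<^sub>F w in at_right v. t \<le> d w"
      unfolding eventually_at_right_field using lt by (auto intro!: exI[of _ "v+1"] less_imp_le)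
  qed simp
qed

lemma less_inv_iff: "0 \<le> v \<Longrightarrow> v < e t \<longleftrightarrow> d v < t"
  using inv_le_iff[of v t] by auto

lemma inv_d [simp]: "0 \<le> v \<Longrightarrow> e (d v) = v"
proof -
  assume v: "0 \<le> v"
  have "v \<le> e (d v)"
  proof (rule ccontr)
    assume "\<not> v \<le> e (d v)"
    then show False using inv_le_iff[of "e (d v)" "d v"] inv_nonneg v le_iff[OF v inv_nonneg] by force
  qed
  moreover have "e (d v) \<le> v" using inv_le_iff[OF v] by simp
  ultimately show ?thesis by simp
qed

lemma le_d_inv: "t \<le> d (e t)"
  using inv_le_iff[OF inv_nonneg] by blast

lemma inv_mono: "s \<le> t \<Longrightarrow> e s \<le> e t"
  using inv_le_iff[OF inv_nonneg, of s t] le_d_inv[of t] by simp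

lemma inv_min: "e (min s t) = min (e s) (e t)"
  using inv_mono[of s t] inv_mono[of t s] by (auto simp: min_def)

text \<open>Strict monotonicity of \<open>d\<close> excludes jumps of the inverse: the values of
  \<open>d\<close> slightly below and slightly above \<open>e t\<close> enclose a neighbourhood of
  \<open>t\<close>. Jumps of \<open>d\<close> only make the inverse flat.\<close>

lemma inv_cont: "isCont e t"
proof (rule isCont_def[THEN iffD2], rule LIM_I)
  fix r :: real assume r: "0 < r"
  define b where "b = d (e t + r / 2)"
  have "d (e t) < b" unfolding b_def using r inv_nonneg[of t] less_iff by simp
  then have b: "t < b" using le_d_inv[of t] by simp
  \<comment> \<open>The point \<open>e t - r / 2\<close> may be negative, where nothing is known
    about \<open>d\<close>; then nonnegativity of the inverse gives the bound.\<close>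
  have "\<exists>a<t. \<forall>x. a < x \<and> x \<le> t \<longrightarrow> e t - r < e x"
  proof (cases "e t - r / 2 < 0")
    case True
    have "e t - r < e x" for x using inv_nonneg[of x] True r by linarith
    then show ?thesis by (intro exI[of _ "t - 1"]) simp
  next
    case False
    define a where "a = d (e t - r / 2)"
    have "a < t" unfolding a_def using less_inv_iff[of "e t - r/2" t] False r by simp
    moreover have "e t - r < e x" if "a < x" for x
      using that less_inv_iff[of "e t - r/2" x] False r by (simp add: a_def)
    ultimately show ?thesis by blast
  qed
  then obtain a where a: "a < t" "\<And>x. a < x \<Longrightarrow> x \<le> t \<Longrightarrow> e t - r < e x" by blast
  have "norm (e x - e t) < r" if x: "norm (x - t) < min (t - a) (b - t)" for x
  proof (cases "x \<le> t")
    case True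
    then have "a < x" using x by (simp add: abs_if split: if_splits)
    then show ?thesis using a(2)[of x] True inv_mono[of x t] by (simp add: abs_if)
  next
    case False
    have "x < b" using x False by (auto simp: abs_if)
    then have "e x \<le> e t + r / 2"
      using inv_le_iff[of "e t + r / 2" x] inv_nonneg[of t] r b_def by simp
    then show ?thesis using False inv_mono[of t x] r by (auto simp: abs_if)
  qed
  moreover have "0 < min (t - a) (b - t)" using a b by simp
  ultimately show "\<exists>s>0. \<forall>x. x \<noteq> t \<and> norm (x - t) < s \<longrightarrow> norm (e x - e t) < r"
    by blast
qed

end

text \<open>Formulated for a measure with distribution function \<open>\<phi>\<close>, so that one
  induction serves Lebesgue measure and the measure of the inverse clock. Each cell contributes the
  deviation \<open>y k\<close> of the integrand times its mass.\<close>

lemma set_integral_step_bound: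
  fixes f :: "real \<Rightarrow> real"
  assumes sets: "sets \<mu> = sets borel"
    and em: "\<And>a b. a \<le> b \<Longrightarrow> emeasure \<mu> {a<..b} = ennreal (\<phi> b - \<phi> a)"
    and mono: "mono \<phi>"
    and p0: "p 0 = (0::real)" and p: "\<And>k. k < m \<Longrightarrow> p k \<le> p (Suc k)"
    and f: "set_integrable \<mu> {0<..p m} f"
    and bound: "\<And>k r. k < m \<Longrightarrow> p k < r \<Longrightarrow> r \<le> p (Suc k) \<Longrightarrow> \<bar>f r - c k\<bar> \<le> y k"
  shows "\<bar>(LINT r:{0<..p m}|\<mu>. f r) - (\<Sum>k<m. c k * (\<phi> (p (Suc k)) - \<phi> (p k)))\<bar>
           \<le> (\<Sum>k<m. y k * (\<phi> (p (Suc k)) - \<phi> (p k)))"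
  using p f bound
proof (induction m)
  case 0
  then show ?case by (simp add: p0 set_lebesgue_integral_def)
next
  case (Suc m)
  have p0m: "0 \<le> p k" if "k \<le> m" for k
    using that
  proof (induction k)
    case (Suc k)
    then show ?case using Suc.prems \<open>\<And>k. k < Suc m \<Longrightarrow> p k \<le> p (Suc k)\<close>[of k] by simp
  qed (simp add: p0)
  have le: "p m \<le> p (Suc m)" using Suc.prems(1) by simp
  have un: "{0<..p (Suc m)} = {0<..p m} \<union> {p m<..p (Suc m)}"
    using p0m[of m] le by auto
  have [measurable]: "{a<..b} \<in> sets \<mu>" for a b :: real using sets by simp
  have i1: "set_integrable \<mu> {0<..p m} f" and i2: "set_integrable \<mu> {p m<..p (Suc m)} f"
    using Suc.prems(2) unfolding un by (auto elim!: set_integrable_subset)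
  have split: "(LINT r:{0<..p (Suc m)}|\<mu>. f r)
      = (LINT r:{0<..p m}|\<mu>. f r) + (LINT r:{p m<..p (Suc m)}|\<mu>. f r)"
    unfolding un by (rule set_integral_Un[OF _ i1 i2]) auto
  have meas: "measure \<mu> {p m<..p (Suc m)} = \<phi> (p (Suc m)) - \<phi> (p m)"
    using em[OF le] monoD[OF mono le] by (simp add: measure_def)
  have fin: "emeasure \<mu> {p m<..p (Suc m)} < \<infinity>" using em[OF le] by simp
  have ic: "set_integrable \<mu> {p m<..p (Suc m)} (\<lambda>_. a)" for a :: real
    using fin by (simp add: set_integrable_def)
  have c: "(LINT r:{p m<..p (Suc m)}|\<mu>. a) = a * (\<phi> (p (Suc m)) - \<phi> (p m))" for a :: real
    using fin meas by (simp add: set_lebesgue_integral_def)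
  have "\<bar>(LINT r:{p m<..p (Suc m)}|\<mu>. f r) - c m * (\<phi> (p (Suc m)) - \<phi> (p m))\<bar>
      = \<bar>LINT r:{p m<..p (Suc m)}|\<mu>. (f r - c m)\<bar>"
    using set_integral_diff(2)[OF i2 ic] by (simp add: c)
  also have "\<dots> \<le> (LINT r:{p m<..p (Suc m)}|\<mu>. \<bar>f r - c m\<bar>)"
    using set_integral_norm_bound[OF set_integral_diff(1)[OF i2 ic]] by simp
  also have "\<dots> \<le> (LINT r:{p m<..p (Suc m)}|\<mu>. y m)"
    using set_integrable_abs[OF set_integral_diff(1)[OF i2 ic]] ic Suc.prems(3)
    by (intro set_integral_mono) auto
  finally have *: "\<bar>(LINT r:{p m<..p (Suc m)}|\<mu>. f r) - c m * (\<phi> (p (Suc m)) - \<phi> (p m))\<bar>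
      \<le> y m * (\<phi> (p (Suc m)) - \<phi> (p m))" by (simp add: c)
  have "\<bar>(LINT r:{0<..p m}|\<mu>. f r) - (\<Sum>k<m. c k * (\<phi> (p (Suc k)) - \<phi> (p k)))\<bar>
           \<le> (\<Sum>k<m. y k * (\<phi> (p (Suc k)) - \<phi> (p k)))"
    using i1 Suc.prems by (intro Suc.IH) auto
  then show ?case using * by (simp add: split)
qed

context time_change_path
begin

lemma emeasure_inv: "a \<le> b \<Longrightarrow> emeasure (interval_measure e) {a<..b} = ennreal (e b - e a)"
  by (rule emeasure_interval_measure_Ioc)
     (auto intro: inv_mono continuous_at_imp_continuous_at_within inv_cont)

lemma measure_inv: "a \<le> b \<Longrightarrow> measure (interval_measure e) {a<..b} = e b - e a"
  using emeasure_inv[of a b] inv_mono[of a b] by (simp add: measure_def)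

lemma ex_block:
  assumes "0 < \<delta>" "0 \<le> s"
  shows "\<exists>n. d (real n * \<delta>) \<le> s \<and> s < d (real (Suc n) * \<delta>)"
proof -
  have "\<exists>k. s < d (real (Suc k) * \<delta>)"
  proof -
    obtain u where u: "u \<ge> 0" "s < d u" using unbounded by blast
    obtain k where "u < real k * \<delta>" using reals_Archimedean3[OF assms(1)] by blast
    then have "u \<le> real (Suc k) * \<delta>" using assms by (simp add: algebra_simps)
    then have "d u \<le> d (real (Suc k) * \<delta>)" using u assms by (subst le_iff) auto
    then show ?thesis using u by (intro exI[of _ k]) simp
  qed
  then obtain k where k: "s < d (real (Suc k) * \<delta>)" "\<And>j. j < k \<Longrightarrow> \<not> s < d (real (Suc j) * \<delta>)"
    using exists_least_iff[of "\<lambda>k. s < d (real (Suc k) * \<delta>)"] by blast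
  have "d (real k * \<delta>) \<le> s"
    using k(2)[of "k - 1"] zero assms by (cases k) auto
  with k(1) show ?thesis by blast
qed

lemma block_unique:
  assumes "0 < \<delta>" "d (real n * \<delta>) \<le> s" "s < d (real (Suc n) * \<delta>)"
    "d (real k * \<delta>) \<le> s" "s < d (real (Suc k) * \<delta>)"
  shows "n = k"
proof -
  have "d (real n * \<delta>) < d (real (Suc k) * \<delta>)" "d (real k * \<delta>) < d (real (Suc n) * \<delta>)"
    using assms by linarith+
  then have "real n * \<delta> < real (Suc k) * \<delta>" "real k * \<delta> < real (Suc n) * \<delta>"
    using assms(1) less_iff by auto
  then have "n < Suc k" "k < Suc n" using assms(1) mult_less_cancel_right_pos by (simp_all only: of_nat_less_iff mult_less_cancel_right_pos)
  then show ?thesis by simp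
qed

end

section \<open>The Euler path on its blocks and on finer cells\<close>

locale euler_path = time_change_path +
  fixes w :: "real \<Rightarrow> real" and H :: "real \<Rightarrow> real" and F G :: "real \<Rightarrow> real \<Rightarrow> real"
    and x0 \<delta> :: real
  assumes delta_pos: "0 < \<delta>"
begin

abbreviation "xg \<equiv> euler_grid H F G x0 \<delta> d w"
abbreviation "xd \<equiv> euler_maruyama H F G x0 \<delta> d w"

lemma xd_block_less:
  assumes s: "d (real n * \<delta>) \<le> s" "s < d (real (Suc n) * \<delta>)"
  shows "xd s = xg n + H (real n * \<delta>) * (s - d (real n * \<delta>))
    + F (real n * \<delta>) (xg n) * (e s - real n * \<delta>)
    + G (real n * \<delta>) (xg n) * (w (e s) - w (real n * \<delta>))"
proof -
  have the: "(THE n::nat. d (real n * \<delta>) \<le> s \<and> s < d (real (Suc n) * \<delta>)) = n"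
    by (rule the_equality) (use s block_unique[OF delta_pos] in blast)+
  have nd: "0 \<le> real n * \<delta>" using delta_pos by simp
  have 1: "(LINT r:{d (real n * \<delta>)<..s}|lborel. c) = c * (s - d (real n * \<delta>))" for c :: real
    using s by (simp add: set_lebesgue_integral_def)
  have 2: "(LINT r:{d (real n * \<delta>)<..s}|interval_measure e. c) = c * (e s - real n * \<delta>)" for c :: real
    using s emeasure_inv[OF s(1)] measure_inv[OF s(1)] nd
    by (simp add: set_lebesgue_integral_def)
  show ?thesis
    unfolding euler_maruyama_def Let_def the 1 2 using nd by simp
qed

text \<open>At the right end of the block the interpolation has reached the next grid value, so the
  formula extends to it. Closed blocks fit the later conditions of the form
  \<open>t \<le> D v\<close>.\<close>

lemma xd_block:
  assumes s: "d (real n * \<delta>) \<le> s" "s \<le> d (real (Suc n) * \<delta>)"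
  shows "xd s = xg n + H (real n * \<delta>) * (s - d (real n * \<delta>))
    + F (real n * \<delta>) (xg n) * (e s - real n * \<delta>)
    + G (real n * \<delta>) (xg n) * (w (e s) - w (real n * \<delta>))"
proof (cases "s < d (real (Suc n) * \<delta>)")
  case True
  then show ?thesis using xd_block_less s by simp
next
  case False
  then have eq: "s = d (real (Suc n) * \<delta>)" using s by simp
  have "s < d (real (Suc (Suc n)) * \<delta>)" unfolding eq using delta_pos by (subst less_iff) auto
  then have "xd s = xg (Suc n)"
    using xd_block_less[of "Suc n" s] eq delta_pos by simp
  then show ?thesis using delta_pos inv_d[of "real (Suc n) * \<delta>"] unfolding eq
    by (simp add: Let_def algebra_simps)
qed

lemma xd_grid: "xd (d (real n * \<delta>)) = xg n"
  using xd_block[of n "d (real n * \<delta>)"] delta_pos by (simp add: le_iff algebra_simps)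

lemma xd_cells:
  assumes L: "0 < L" and e0: "\<delta> = real L * e0"
    and s: "0 \<le> s" "s \<le> d (real m * e0)"
  shows "xd s = x0 + (\<Sum>k<m. H (real (k div L) * \<delta>)
             * (min s (d (real (Suc k) * e0)) - min s (d (real k * e0))))
      + (\<Sum>k<m. F (real (k div L) * \<delta>) (xg (k div L))
             * (min (e s) (real (Suc k) * e0) - min (e s) (real k * e0)))
      + (\<Sum>k<m. G (real (k div L) * \<delta>) (xg (k div L))
             * (w (min (e s) (real (Suc k) * e0)) - w (min (e s) (real k * e0))))"
  using s
proof (induction m arbitrary: s)
  case 0
  then have "s = 0" using zero by simp
  then show ?case using xd_grid[of 0] zero by simp
next
  case (Suc m)
  have e0p: "0 < e0" using delta_pos e0 L by (simp add: zero_less_mult_iff)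
  show ?case
  proof (cases "s \<le> d (real m * e0)")
    case True
    have es: "e s \<le> real m * e0" using True e0p by (subst inv_le_iff) auto
    have "real m * e0 \<le> real (Suc m) * e0" using e0p by simp
    then have "d (real m * e0) \<le> d (real (Suc m) * e0)" using e0p by (subst le_iff) auto
    then have 1: "min s (d (real (Suc m) * e0)) = s" "min s (d (real m * e0)) = s"
      "min (e s) (real (Suc m) * e0) = e s" "min (e s) (real m * e0) = e s"
      using True es \<open>real m * e0 \<le> real (Suc m) * e0\<close> by (auto simp: min_def)
    show ?thesis using Suc.IH[OF Suc.prems(1) True] unfolding sum.lessThan_Suc 1 by simp
  next
    case False
    \<comment> \<open>The left end of the last cell. Earlier summands do not distinguish
      \<open>s\<close> from \<open>t\<close>, and both points lie in one block, whose formula gives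
      the increment.\<close>
    define t where "t = d (real m * e0)"
    have t: "0 \<le> t" "t \<le> s" using False nonneg[of "real m * e0"] e0p by (auto simp: t_def)
    have et: "e t = real m * e0" unfolding t_def using e0p by simp
    have es: "real m * e0 \<le> e s" "e s \<le> real (Suc m) * e0"
      using inv_mono[OF t(2)] Suc.prems e0p by (auto simp: et inv_le_iff)
    have mins: "min s (d (real k * e0)) = min t (d (real k * e0))"
      "min (e s) (real k * e0) = min (e t) (real k * e0)" if "k \<le> m" for k
    proof -
      have "real k * e0 \<le> real m * e0" using that e0p by simp
      then show "min (e s) (real k * e0) = min (e t) (real k * e0)" using es et by simp
      have "d (real k * e0) \<le> t" unfolding t_def
        using \<open>real k * e0 \<le> real m * e0\<close> e0p by (subst le_iff) auto
      then show "min s (d (real k * e0)) = min t (d (real k * e0))" using t by simp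
    qed
    define n where "n = m div L"
    have "real n * \<delta> = real (n * L) * e0" using e0 by simp
    also have "\<dots> \<le> real m * e0" unfolding n_def using e0p by (intro mult_right_mono) (auto simp del: of_nat_mult)
    finally have n1: "real n * \<delta> \<le> real m * e0" .
    have "Suc m \<le> Suc n * L" unfolding n_def using L by (metis Suc_leI dividend_less_div_times mult.commute mult_Suc)
    then have "real (Suc m) * e0 \<le> real (Suc n * L) * e0" using e0p by (intro mult_right_mono of_nat_mono) auto
    then have n2: "real (Suc m) * e0 \<le> real (Suc n) * \<delta>" using e0 by (simp add: algebra_simps)
    have dn: "0 \<le> real n * \<delta>" "0 \<le> real m * e0" using delta_pos e0p by auto
    have b: "d (real n * \<delta>) \<le> t" "d (real n * \<delta>) \<le> s" "s \<le> d (real (Suc n) * \<delta>)" "t \<le> d (real (Suc n) * \<delta>)"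
    proof -
      show "d (real n * \<delta>) \<le> t" unfolding t_def using n1 dn by (subst le_iff) auto
      then show "d (real n * \<delta>) \<le> s" using t by simp
      have "d (real (Suc m) * e0) \<le> d (real (Suc n) * \<delta>)" using n2 dn delta_pos e0p by (subst le_iff) auto
      then show "s \<le> d (real (Suc n) * \<delta>)" using Suc.prems by simp
      then show "t \<le> d (real (Suc n) * \<delta>)" using t by simp
    qed
    have "xd s - xd t = H (real n * \<delta>) * (s - t) + F (real n * \<delta>) (xg n) * (e s - e t)
        + G (real n * \<delta>) (xg n) * (w (e s) - w (e t))"
      using xd_block[OF b(2,3)] xd_block[OF b(1,4)] by (simp add: algebra_simps)
    moreover have "min s (d (real (Suc m) * e0)) = s" "min (e s) (real (Suc m) * e0) = e s"
      "min s (d (real m * e0)) = t" "min (e s) (real m * e0) = e t"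
      using Suc.prems es et t by (auto simp: t_def)
    moreover have "xd t = x0 + (\<Sum>k<m. H (real (k div L) * \<delta>)
             * (min s (d (real (Suc k) * e0)) - min s (d (real k * e0))))
      + (\<Sum>k<m. F (real (k div L) * \<delta>) (xg (k div L))
             * (min (e s) (real (Suc k) * e0) - min (e s) (real k * e0)))
      + (\<Sum>k<m. G (real (k div L) * \<delta>) (xg (k div L))
             * (w (min (e s) (real (Suc k) * e0)) - w (min (e s) (real k * e0))))"
      by (subst Suc.IH) (use t in \<open>auto simp: t_def[symmetric] mins simp del: of_nat_Suc intro!: arg_cong2[of _ _ _ _ plus] sum.cong\<close>)
    ultimately show ?thesis by (simp add: n_def)
  qed
qed

end

section \<open>Coefficient estimates up to an operational horizon\<close>

locale sde_coefficients =
  fixes H h :: "real \<Rightarrow> real" and F G :: "real \<Rightarrow> real \<Rightarrow> real" and K \<theta> :: real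
  assumes H_cont: "continuous_on {0..} H"
    and F_cont: "continuous_on ({0..} \<times> UNIV) (\<lambda>(u, x). F u x)"
    and G_cont: "continuous_on ({0..} \<times> UNIV) (\<lambda>(u, x). G u x)"
    and h_mono: "mono_on {0..} h"
    and h_nonneg: "\<And>u. 0 \<le> u \<Longrightarrow> 0 \<le> h u"
    and K_pos: "0 < K" and theta: "0 < \<theta>" "\<theta> \<le> 1"
    and lipschitz: "\<And>u x y. 0 \<le> u \<Longrightarrow> \<bar>F u x - F u y\<bar> + \<bar>G u x - G u y\<bar> \<le> h u * \<bar>x - y\<bar>"
    and growth: "\<And>u x. 0 \<le> u \<Longrightarrow> \<bar>H u\<bar> + \<bar>F u x\<bar> + \<bar>G u x\<bar> \<le> h u * (1 + \<bar>x\<bar>)"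
    and hoelder: "\<And>u v x. 0 \<le> u \<Longrightarrow> 0 \<le> v \<Longrightarrow>
           \<bar>H u - H v\<bar> + \<bar>F u x - F v x\<bar> + \<bar>G u x - G v x\<bar> \<le> K * \<bar>u - v\<bar> powr \<theta> * (1 + \<bar>x\<bar>)"
begin

lemma h_le: "0 \<le> u \<Longrightarrow> u \<le> U \<Longrightarrow> h u \<le> h U"
  using h_mono by (auto simp: mono_on_def)

lemma growth_le:
  assumes "0 \<le> u" "u \<le> U"
  shows "\<bar>H u\<bar> \<le> h U" "\<bar>F u x\<bar> \<le> h U * (1 + \<bar>x\<bar>)" "\<bar>G u x\<bar> \<le> h U * (1 + \<bar>x\<bar>)"
proof -
  have "h u * (1 + \<bar>x\<bar>) \<le> h U * (1 + \<bar>x\<bar>)" using h_le[OF assms] by (intro mult_right_mono) auto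
  then show "\<bar>F u x\<bar> \<le> h U * (1 + \<bar>x\<bar>)" "\<bar>G u x\<bar> \<le> h U * (1 + \<bar>x\<bar>)"
    using growth[OF assms(1), of x] by linarith+
  show "\<bar>H u\<bar> \<le> h U" using growth[OF assms(1), of 0] h_le[OF assms] by simp
qed

text \<open>Through the intermediate point \<open>(u, y)\<close>: the Lipschitz condition is used at
  time \<open>u\<close>, the Hoelder condition at state \<open>y\<close>. In the applications
  \<open>y\<close> is a grid value of the scheme, so the growth factor has known moments.\<close>

lemma increment_le:
  assumes "0 \<le> u" "u \<le> U" "0 \<le> v" "\<bar>u - v\<bar> \<le> \<rho>"
  shows "\<bar>H u - H v\<bar> \<le> K * \<rho> powr \<theta>"
    and "\<bar>F u x - F v y\<bar> \<le> h U * \<bar>x - y\<bar> + K * \<rho> powr \<theta> * (1 + \<bar>y\<bar>)"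
    and "\<bar>G u x - G v y\<bar> \<le> h U * \<bar>x - y\<bar> + K * \<rho> powr \<theta> * (1 + \<bar>y\<bar>)"
proof -
  have p: "K * \<bar>u - v\<bar> powr \<theta> \<le> K * \<rho> powr \<theta>"
    using assms K_pos theta by (intro mult_left_mono powr_mono2) auto
  then show "\<bar>H u - H v\<bar> \<le> K * \<rho> powr \<theta>"
    using hoelder[OF assms(1,3), of 0] by simp
  have 1: "K * \<bar>u - v\<bar> powr \<theta> * (1 + \<bar>y\<bar>) \<le> K * \<rho> powr \<theta> * (1 + \<bar>y\<bar>)"
    using p by (intro mult_right_mono) auto
  have 2: "h u * \<bar>x - y\<bar> \<le> h U * \<bar>x - y\<bar>" using h_le[OF assms(1,2)] by (intro mult_right_mono) auto
  show "\<bar>F u x - F v y\<bar> \<le> h U * \<bar>x - y\<bar> + K * \<rho> powr \<theta> * (1 + \<bar>y\<bar>)"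
    "\<bar>G u x - G v y\<bar> \<le> h U * \<bar>x - y\<bar> + K * \<rho> powr \<theta> * (1 + \<bar>y\<bar>)"
    using 1 2 lipschitz[OF assms(1), of x y] hoelder[OF assms(1,3), of y] by (simp_all only: abs_le_iff, linarith+)
qed

end

lemma set_integrable_continuous_on:
  fixes f :: "real \<Rightarrow> real"
  assumes "sets \<mu> = sets borel" "emeasure \<mu> {0<..t} < \<infinity>" "continuous_on {0..t} f"
  shows "set_integrable \<mu> {0<..t} f"
proof -
  have "bounded (f ` {0..t})"
    using assms(3) by (intro compact_imp_bounded compact_continuous_image) auto
  then obtain C where C: "\<And>r. r \<in> {0..t} \<Longrightarrow> norm (f r) \<le> C"
    unfolding bounded_iff by blast
  have "(\<lambda>r. indicator {0<..t} r *\<^sub>R f r) \<in> borel_measurable borel"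
    by (rule borel_measurable_continuous_on_indicator[OF _ continuous_on_subset[OF assms(3)]]) auto
  then have m: "(\<lambda>r. indicator {0<..t} r *\<^sub>R f r) \<in> borel_measurable \<mu>"
    using measurable_cong_sets[OF assms(1) refl] by blast
  show ?thesis
    unfolding set_integrable_def
    by (rule integrableI_bounded_set[where A="{0<..t}" and B=C])
       (use assms m C in \<open>auto simp: indicator_def less_top\<close>)
qed

locale euler_error_path = sde_coefficients H h F G K \<theta> + euler_path d w H F G x0 \<delta>
  for H h F G K \<theta> d w x0 \<delta>
begin

text \<open>The real time spent in the block is cut at \<open>T\<close>, so that the
  \<open>H\<close> terms add up to at most \<open>h U * T\<close> over all blocks. The weight of the
  Brownian increment stays inside the majorant \<open>V\<close>, since both are later estimated
  jointly by Doob's inequality.\<close>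

lemma xd_block_error:
  assumes r: "d (real n * \<delta>) \<le> r" "r \<le> d (real (Suc n) * \<delta>)" "r \<le> T"
    and U: "real (Suc n) * \<delta> \<le> U"
    and V: "\<And>v. real n * \<delta> \<le> v \<Longrightarrow> v \<le> real (Suc n) * \<delta> \<Longrightarrow> (1 + \<bar>xg n\<bar>) * \<bar>w v - w (real n * \<delta>)\<bar> \<le> V"
  shows "\<bar>xd r - xg n\<bar> \<le> h U * (min T (d (real (Suc n) * \<delta>)) - min T (d (real n * \<delta>)))
      + h U * (1 + \<bar>xg n\<bar>) * \<delta> + h U * V"
proof -
  have n: "0 \<le> real n * \<delta>" "real n * \<delta> \<le> U" using delta_pos U by (auto simp: algebra_simps)
  have er: "real n * \<delta> \<le> e r" "e r \<le> real (Suc n) * \<delta>"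
    using inv_mono[OF r(1)] n r(2) delta_pos by (auto simp: inv_le_iff)
  have hU: "0 \<le> h U" using h_nonneg n by auto
  have "\<bar>H (real n * \<delta>) * (r - d (real n * \<delta>))\<bar> \<le> h U * (r - d (real n * \<delta>))"
    unfolding abs_mult using growth_le(1)[OF n] r by (intro mult_mono) auto
  also have "\<dots> \<le> h U * (min T (d (real (Suc n) * \<delta>)) - min T (d (real n * \<delta>)))"
    using hU r by (intro mult_left_mono) auto
  finally have 1: "\<bar>H (real n * \<delta>) * (r - d (real n * \<delta>))\<bar> \<le> \<dots>" .
  have 2: "\<bar>F (real n * \<delta>) (xg n) * (e r - real n * \<delta>)\<bar> \<le> h U * (1 + \<bar>xg n\<bar>) * \<delta>"
    unfolding abs_mult by (intro mult_mono growth_le(2)[OF n]) (use er hU in \<open>auto simp: algebra_simps\<close>)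
  have "\<bar>G (real n * \<delta>) (xg n) * (w (e r) - w (real n * \<delta>))\<bar>
      \<le> h U * (1 + \<bar>xg n\<bar>) * \<bar>w (e r) - w (real n * \<delta>)\<bar>"
    unfolding abs_mult using growth_le(3)[OF n] by (intro mult_right_mono) auto
  also have "\<dots> \<le> h U * V"
    using mult_left_mono[OF V[OF er] hU] by (simp add: mult.assoc)
  finally have 3: "\<bar>G (real n * \<delta>) (xg n) * (w (e r) - w (real n * \<delta>))\<bar> \<le> h U * V" .
  show ?thesis unfolding xd_block[OF r(1,2)] using 1 2 3 by linarith
qed

lemma cell_in_block:
  assumes L: "0 < L" and e0: "\<delta> = real L * e0"
  shows "real (k div L) * \<delta> \<le> real k * e0" "real (Suc k) * e0 \<le> real (Suc (k div L)) * \<delta>"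
proof -
  have e0p: "0 < e0" using delta_pos e0 L by (simp add: zero_less_mult_iff)
  have "real (k div L) * \<delta> = real (k div L * L) * e0" using e0 by simp
  also have "\<dots> \<le> real k * e0" using e0p by (intro mult_right_mono of_nat_mono) auto
  finally show "real (k div L) * \<delta> \<le> real k * e0" .
  have "Suc k \<le> Suc (k div L) * L" using L by (metis Suc_leI dividend_less_div_times mult.commute mult_Suc)
  then have "real (Suc k) * e0 \<le> real (Suc (k div L) * L) * e0" using e0p by (intro mult_right_mono of_nat_mono) auto
  then show "real (Suc k) * e0 \<le> real (Suc (k div L)) * \<delta>" using e0 by (simp add: algebra_simps)
qed

lemma error_le:
  assumes L: "0 < L" and e0: "\<delta> = real L * e0"
    and t: "0 \<le> t" "t \<le> T" "t \<le> d (real m * e0)"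
    and X_cont: "continuous_on {0..T} X"
    and X: "X t = x0 + (LINT r:{0<..t}|lborel. H (e r))
        + (LINT r:{0<..t}|interval_measure e. F (e r) (X r)) + It"
    and y: "\<And>k. k < m \<Longrightarrow> 0 \<le> y k"
    and bound: "\<And>k r. k < m \<Longrightarrow> d (real k * e0) < r \<Longrightarrow> r \<le> d (real (Suc k) * e0) \<Longrightarrow> r \<le> t \<Longrightarrow>
      \<bar>F (e r) (X r) - F (real (k div L) * \<delta>) (xg (k div L))\<bar> \<le> y k"
  shows "\<bar>X t - xd t\<bar> \<le> K * \<delta> powr \<theta> * T + (\<Sum>k<m. e0 * y k)
    + \<bar>It - (\<Sum>k<m. G (real (k div L) * \<delta>) (xg (k div L))
             * (w (min (e t) (real (Suc k) * e0)) - w (min (e t) (real k * e0))))\<bar>"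
proof -
  have e0p: "0 < e0" using delta_pos e0 L by (simp add: zero_less_mult_iff)
  define p where "p k = min t (d (real k * e0))" for k :: nat
  have p0: "p 0 = 0" using t zero by (simp add: p_def)
  have pm: "p m = t" using t by (simp add: p_def)
  have ppos: "0 \<le> p k" for k using t nonneg[of "real k * e0"] e0p by (simp add: p_def)
  have p: "p k \<le> p (Suc k)" for k
    unfolding p_def using e0p by (intro min.mono order_refl) (simp add: le_iff)
  have ep: "e (p k) = min (e t) (real k * e0)" for k
    using inv_min[of t "d (real k * e0)"] e0p by (simp add: p_def)
  have Xc: "continuous_on {0..t} X" using X_cont t by (rule_tac continuous_on_subset) auto
  have ec: "continuous_on S e" for S
    by (auto intro: continuous_at_imp_continuous_on inv_cont)
  have Hc: "continuous_on {0..t} (\<lambda>r. H (e r))"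
    by (rule continuous_on_compose2[OF H_cont ec]) (auto simp: inv_nonneg)
  have "continuous_on {0..t} (\<lambda>r. case (e r, X r) of (u, x) \<Rightarrow> F u x)"
    by (rule continuous_on_compose2[OF F_cont continuous_on_Pair[OF ec Xc]]) (auto simp: inv_nonneg)
  then have Fc: "continuous_on {0..t} (\<lambda>r. F (e r) (X r))" by simp
  have cell: "k < m \<Longrightarrow> p k < r \<Longrightarrow> r \<le> p (Suc k) \<Longrightarrow>
      d (real k * e0) < r \<and> r \<le> d (real (Suc k) * e0) \<and> r \<le> t" for k r
    by (auto simp: p_def)
  have "\<bar>(LINT r:{0<..p m}|lborel. H (e r)) - (\<Sum>k<m. H (real (k div L) * \<delta>) * (p (Suc k) - p k))\<bar>
      \<le> (\<Sum>k<m. K * \<delta> powr \<theta> * (p (Suc k) - p k))"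
  proof (rule set_integral_step_bound[where \<phi>="\<lambda>x. x" and p=p and f="\<lambda>r. H (e r)"])
    show "set_integrable lborel {0<..p m} (\<lambda>r. H (e r))"
      unfolding pm using t by (intro set_integrable_continuous_on Hc) auto
    fix k r assume k: "k < m" "p k < r" "r \<le> p (Suc k)"
    note c = cell[OF k]
    have "real k * e0 \<le> e r" "e r \<le> real (Suc k) * e0"
      using inv_mono[of "d (real k * e0)" r] c e0p by (auto simp: inv_le_iff)
    then have "\<bar>e r - real (k div L) * \<delta>\<bar> \<le> \<delta>"
      using cell_in_block[OF L e0, of k] by (auto simp: abs_if algebra_simps)
    then show "\<bar>H (e r) - H (real (k div L) * \<delta>)\<bar> \<le> K * \<delta> powr \<theta>"
      using increment_le(1)[of "e r" "e r" "real (k div L) * \<delta>" \<delta>] inv_nonneg delta_pos by simp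
  qed (auto intro: monoI p0 p)
  also have "(\<Sum>k<m. K * \<delta> powr \<theta> * (p (Suc k) - p k)) = K * \<delta> powr \<theta> * (p m - p 0)"
    by (simp add: sum_distrib_left[symmetric] sum_lessThan_telescope)
  also have "\<dots> \<le> K * \<delta> powr \<theta> * T" unfolding pm p0 using t K_pos by (intro mult_left_mono) auto
  finally have 1: "\<bar>(LINT r:{0<..t}|lborel. H (e r)) - (\<Sum>k<m. H (real (k div L) * \<delta>) * (p (Suc k) - p k))\<bar>
      \<le> K * \<delta> powr \<theta> * T" by (simp add: pm)
  have "\<bar>(LINT r:{0<..p m}|interval_measure e. F (e r) (X r))
      - (\<Sum>k<m. F (real (k div L) * \<delta>) (xg (k div L)) * (e (p (Suc k)) - e (p k)))\<bar>
      \<le> (\<Sum>k<m. y k * (e (p (Suc k)) - e (p k)))"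
  proof (rule set_integral_step_bound[where \<phi>=e and p=p and f="\<lambda>r. F (e r) (X r)"])
    show "set_integrable (interval_measure e) {0<..p m} (\<lambda>r. F (e r) (X r))"
      unfolding pm using t emeasure_inv[of 0 t] by (intro set_integrable_continuous_on Fc) auto
  qed (use cell bound in \<open>auto intro: monoI inv_mono p0 p emeasure_inv\<close>)
  also have "\<dots> \<le> (\<Sum>k<m. e0 * y k)"
  proof (rule sum_mono)
    fix k assume "k \<in> {..<m}"
    moreover have "e (p (Suc k)) - e (p k) \<le> e0"
      unfolding ep using e0p by (auto simp: min_def algebra_simps)
    ultimately have "y k * (e (p (Suc k)) - e (p k)) \<le> y k * e0" using y by (intro mult_left_mono) auto
    then show "y k * (e (p (Suc k)) - e (p k)) \<le> e0 * y k" by (simp add: mult.commute)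
  qed
  finally have 2: "\<bar>(LINT r:{0<..t}|interval_measure e. F (e r) (X r))
      - (\<Sum>k<m. F (real (k div L) * \<delta>) (xg (k div L)) * (e (p (Suc k)) - e (p k)))\<bar>
      \<le> (\<Sum>k<m. e0 * y k)" by (simp add: pm)
  show ?thesis
    using 1[unfolded p_def] 2[unfolded ep] unfolding X xd_cells[OF L e0 t(1) t(3)] by linarith
qed

end

subsection \<open>Simple stochastic integrals\<close>

fun running_max :: "(nat \<Rightarrow> real) \<Rightarrow> nat \<Rightarrow> real" where
  "running_max a 0 = a 0"
| "running_max a (Suc n) = max (running_max a n) (a (Suc n))"

lemma le_running_max: "k \<le> n \<Longrightarrow> a k \<le> running_max a n"
  by (induction n) (auto simp: le_Suc_eq max_def)

lemma running_max_le: "(\<And>k. k \<le> n \<Longrightarrow> a k \<le> c) \<Longrightarrow> running_max a n \<le> c"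
  by (induction n) auto

lemma running_max_le_sum: "(\<And>k. 0 \<le> a k) \<Longrightarrow> running_max a n \<le> (\<Sum>k\<le>n. a k)"
  by (rule running_max_le) (auto intro: member_le_sum)

text \<open>If \<open>a\<close> is a submartingale, the sum has nonnegative expectation, and Doob's \<open>L\<^sup>2\<close> inequality
  follows.\<close>

lemma pathwise_doob:
  assumes "\<And>k. 0 \<le> a k"
  shows "(running_max a n)\<^sup>2 \<le> 4 * (a n)\<^sup>2 - 4 * (\<Sum>k<n. running_max a k * (a (Suc k) - a k))"
proof -
  define S where "S = running_max a"
  have "4 * (\<Sum>k<n. S k * (a (Suc k) - a k)) \<le> 4 * (S n * a n) - 2 * (S n)\<^sup>2"
  proof (induction n)
    case 0
    then show ?case by (simp add: S_def power2_eq_square)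
  next
    case (Suc n)
    \<comment> \<open>The expression \<open>4 * s * a - 2 * s\<^sup>2\<close> grows by
      \<open>2 * (a - s)\<^sup>2\<close> when \<open>s\<close> is raised to
      \<open>a\<close>.\<close>
    have "4 * (S n * a (Suc n)) - 2 * (S n)\<^sup>2 \<le> 4 * (S (Suc n) * a (Suc n)) - 2 * (S (Suc n))\<^sup>2"
    proof (cases "a (Suc n) \<le> S n")
      case True
      then show ?thesis by (simp add: S_def max_def)
    next
      case False
      then have "S (Suc n) = a (Suc n)" by (simp add: S_def)
      moreover have "0 \<le> 2 * (a (Suc n) - S n)\<^sup>2" by simp
      ultimately show ?thesis by (simp add: power2_eq_square algebra_simps)
    qed
    then show ?case using Suc by (simp add: algebra_simps)
  qed
  moreover have "0 \<le> (2 * a n - S n)\<^sup>2" by simp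
  ultimately show ?thesis unfolding S_def[symmetric] by (simp add: power2_eq_square algebra_simps)
qed

lemma integrable_mult_square:
  fixes f g :: "'a \<Rightarrow> real"
  assumes "f \<in> borel_measurable M" "g \<in> borel_measurable M"
    "integrable M (\<lambda>x. (f x)\<^sup>2)" "integrable M (\<lambda>x. (g x)\<^sup>2)"
  shows "integrable M (\<lambda>x. f x * g x)"
proof (rule Bochner_Integration.integrable_bound)
  show "integrable M (\<lambda>x. (f x)\<^sup>2 + (g x)\<^sup>2)" using assms by simp
  show "AE x in M. norm (f x * g x) \<le> norm ((f x)\<^sup>2 + (g x)\<^sup>2)"
  proof (rule AE_I2)
    fix x
    have "0 \<le> (\<bar>f x\<bar> - \<bar>g x\<bar>)\<^sup>2" "0 \<le> \<bar>f x\<bar> * \<bar>g x\<bar>" by simp_all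
    then have "\<bar>f x\<bar> * \<bar>g x\<bar> \<le> (f x)\<^sup>2 + (g x)\<^sup>2" unfolding power2_diff power2_abs by linarith
    then show "norm (f x * g x) \<le> norm ((f x)\<^sup>2 + (g x)\<^sup>2)" by (simp add: abs_mult)
  qed
qed (use assms in auto)

lemma integrable_add_square:
  fixes f g :: "'a \<Rightarrow> real"
  assumes "f \<in> borel_measurable M" "g \<in> borel_measurable M"
    "integrable M (\<lambda>x. (f x)\<^sup>2)" "integrable M (\<lambda>x. (g x)\<^sup>2)"
  shows "integrable M (\<lambda>x. (f x + g x)\<^sup>2)"
  using assms integrable_mult_square[OF assms] by (simp add: power2_sum mult.assoc)

lemma integrable_sum_square:
  fixes f :: "'i \<Rightarrow> 'a \<Rightarrow> real"
  assumes "finite I" "\<And>i. i \<in> I \<Longrightarrow> f i \<in> borel_measurable M"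
    "\<And>i. i \<in> I \<Longrightarrow> integrable M (\<lambda>x. (f i x)\<^sup>2)"
  shows "integrable M (\<lambda>x. (\<Sum>i\<in>I. f i x)\<^sup>2)"
  using assms
proof (induction I rule: finite_induct)
  case (insert i I)
  then have "integrable M (\<lambda>x. (f i x + (\<Sum>i\<in>I. f i x))\<^sup>2)"
    by (intro integrable_add_square) auto
  then show ?case using insert by simp
qed simp

text \<open>Two moment identities against weights known at the left end stand for the Brownian
  motion: they express that \<open>W\<close> and its square minus time are martingales, without
  conditional expectations. Continuity of every path is achieved later by a modification on a null
  set.\<close>

locale filtered_brownian = prob_space M for M :: "'a measure" +
  fixes Fil :: "real \<Rightarrow> 'a measure" and W :: "real \<Rightarrow> 'a \<Rightarrow> real"
  assumes subalg: "\<And>t. subalgebra M (Fil t)"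
    and Fil_mono: "\<And>s t. s \<le> t \<Longrightarrow> sets (Fil s) \<subseteq> sets (Fil t)"
    and W_adapted: "\<And>t. 0 \<le> t \<Longrightarrow> W t \<in> borel_measurable (Fil t)"
    and W_cont: "\<And>\<omega>. \<omega> \<in> space M \<Longrightarrow> continuous_on {0..} (\<lambda>t. W t \<omega>)"
    and W_mean: "\<And>s t Y. 0 \<le> s \<Longrightarrow> s \<le> t \<Longrightarrow> Y \<in> borel_measurable (Fil s) \<Longrightarrow> integrable M Y \<Longrightarrow>
        integrable M (\<lambda>\<omega>. Y \<omega> * (W t \<omega> - W s \<omega>)) \<and> (\<integral>\<omega>. Y \<omega> * (W t \<omega> - W s \<omega>) \<partial>M) = 0"
    and W_var: "\<And>s t Y. 0 \<le> s \<Longrightarrow> s \<le> t \<Longrightarrow> Y \<in> borel_measurable (Fil s) \<Longrightarrow> integrable M Y \<Longrightarrow>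
        integrable M (\<lambda>\<omega>. Y \<omega> * (W t \<omega> - W s \<omega>)\<^sup>2) \<and>
        (\<integral>\<omega>. Y \<omega> * (W t \<omega> - W s \<omega>)\<^sup>2 \<partial>M) = (t - s) * (\<integral>\<omega>. Y \<omega> \<partial>M)"
begin

lemma space_Fil [simp]: "space (Fil t) = space M"
  using subalg[of t] by (simp add: subalgebra_def)

lemma Fil_le: "f \<in> borel_measurable (Fil s) \<Longrightarrow> s \<le> t \<Longrightarrow> (f :: 'a \<Rightarrow> real) \<in> borel_measurable (Fil t)"
  by (rule measurable_from_subalg[rotated]) (auto simp: subalgebra_def dest: Fil_mono)

lemma Fil_M: "f \<in> borel_measurable (Fil s) \<Longrightarrow> (f :: 'a \<Rightarrow> real) \<in> borel_measurable M"
  by (rule measurable_from_subalg[OF subalg])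

lemma W_meas: "0 \<le> t \<Longrightarrow> W t \<in> borel_measurable M"
  using W_adapted Fil_M by blast

lemma square_mult_increment:
  assumes "0 \<le> s" "s \<le> t" "g \<in> borel_measurable (Fil s)" "integrable M (\<lambda>\<omega>. (g \<omega>)\<^sup>2)"
  shows "integrable M (\<lambda>\<omega>. (g \<omega> * (W t \<omega> - W s \<omega>))\<^sup>2)"
    and "(\<integral>\<omega>. (g \<omega> * (W t \<omega> - W s \<omega>))\<^sup>2 \<partial>M) = (t - s) * (\<integral>\<omega>. (g \<omega>)\<^sup>2 \<partial>M)"
  using W_var[of s t "\<lambda>\<omega>. (g \<omega>)\<^sup>2"] assms by (simp_all add: power_mult_distrib)

lemma orthogonal_increment:
  assumes "0 \<le> s" "s \<le> t" "g \<in> borel_measurable (Fil s)" "integrable M (\<lambda>\<omega>. (g \<omega>)\<^sup>2)"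
    "Z \<in> borel_measurable (Fil s)" "integrable M (\<lambda>\<omega>. (Z \<omega>)\<^sup>2)"
  shows "integrable M (\<lambda>\<omega>. Z \<omega> * (g \<omega> * (W t \<omega> - W s \<omega>)))"
    and "(\<integral>\<omega>. Z \<omega> * (g \<omega> * (W t \<omega> - W s \<omega>)) \<partial>M) = 0"
proof -
  have "integrable M (\<lambda>\<omega>. Z \<omega> * g \<omega>)"
    by (intro integrable_mult_square Fil_M[OF assms(3)] Fil_M[OF assms(5)] assms)
  moreover have "(\<lambda>\<omega>. Z \<omega> * g \<omega>) \<in> borel_measurable (Fil s)" using assms(3,5) by measurable
  ultimately show "integrable M (\<lambda>\<omega>. Z \<omega> * (g \<omega> * (W t \<omega> - W s \<omega>)))"
    and "(\<integral>\<omega>. Z \<omega> * (g \<omega> * (W t \<omega> - W s \<omega>)) \<partial>M) = 0"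
    using W_mean[OF assms(1,2), of "\<lambda>\<omega>. Z \<omega> * g \<omega>"] unfolding mult.assoc by blast+
qed

text \<open>The elementary Ito integral of a step process on a deterministic grid, as a process in
  its upper limit \<open>v\<close>.\<close>

definition simple_int :: "real \<Rightarrow> nat \<Rightarrow> (nat \<Rightarrow> 'a \<Rightarrow> real) \<Rightarrow> real \<Rightarrow> 'a \<Rightarrow> real" where
  "simple_int \<epsilon> m g v \<omega> = (\<Sum>k<m. g k \<omega> * (W (min v (real (Suc k) * \<epsilon>)) \<omega> - W (min v (real k * \<epsilon>)) \<omega>))"

context
  fixes \<epsilon> :: real and m :: nat and g :: "nat \<Rightarrow> 'a \<Rightarrow> real"
  assumes eps: "0 < \<epsilon>"
    and g_adapted: "\<And>k. k < m \<Longrightarrow> g k \<in> borel_measurable (Fil (real k * \<epsilon>))"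
    and g_square: "\<And>k. k < m \<Longrightarrow> integrable M (\<lambda>\<omega>. (g k \<omega>)\<^sup>2)"
begin

text \<open>A summand either does not change between \<open>v\<close> and \<open>w\<close> or gains
  \<open>g k\<close> times an increment of \<open>W\<close> that starts no earlier than
  \<open>v\<close> and the left end of the cell. At that starting time \<open>g k\<close> and
  everything known at \<open>v\<close> are known, so the gain is orthogonal to the past.\<close>

lemma term_cases:
  assumes "0 \<le> v" "v \<le> w" "k < m"
  shows "(\<forall>\<omega>. g k \<omega> * (W (min w (real (Suc k) * \<epsilon>)) \<omega> - W (min w (real k * \<epsilon>)) \<omega>)
       - g k \<omega> * (W (min v (real (Suc k) * \<epsilon>)) \<omega> - W (min v (real k * \<epsilon>)) \<omega>) = 0)
    \<or> (max v (real k * \<epsilon>) \<le> min w (real (Suc k) * \<epsilon>) \<and>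
      (\<forall>\<omega>. g k \<omega> * (W (min w (real (Suc k) * \<epsilon>)) \<omega> - W (min w (real k * \<epsilon>)) \<omega>)
       - g k \<omega> * (W (min v (real (Suc k) * \<epsilon>)) \<omega> - W (min v (real k * \<epsilon>)) \<omega>)
       = g k \<omega> * (W (min w (real (Suc k) * \<epsilon>)) \<omega> - W (max v (real k * \<epsilon>)) \<omega>)))"
proof -
  define a b where "a = real k * \<epsilon>" and "b = real (Suc k) * \<epsilon>"
  have ab: "a < b" using eps by (simp add: a_def b_def)
  consider "b \<le> v" | "w \<le> a" | "v < b" "a < w" "v \<le> a" | "v < b" "a < w" "a < v" by linarith
  then show ?thesis
  proof cases
    case 1
    then have m: "min w b = b" "min v b = b" "min w a = a" "min v a = a" using ab assms by auto
    show ?thesis unfolding a_def[symmetric] b_def[symmetric] m by simp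
  next
    case 2
    then have m: "min w b = w" "min v b = v" "min w a = w" "min v a = v" using ab assms by auto
    show ?thesis unfolding a_def[symmetric] b_def[symmetric] m by simp
  next
    case 3
    then have m: "min v b = v" "min w a = a" "min v a = v" "max v a = a" and "a \<le> min w b" using ab assms by auto
    then show ?thesis unfolding a_def[symmetric] b_def[symmetric] m by (intro disjI2) simp
  next
    case 4
    then have m: "min v b = v" "min w a = a" "min v a = a" "max v a = v" and "v \<le> min w b" using ab assms by auto
    then show ?thesis unfolding a_def[symmetric] b_def[symmetric] m by (intro disjI2) (simp add: algebra_simps)
  qed
qed

text \<open>Cells beginning at or after \<open>v\<close> contribute nothing, so only coefficients
  already known at \<open>v\<close> occur.\<close>

lemma simple_int_adapted:
  assumes "0 \<le> v"
  shows "simple_int \<epsilon> m g v \<in> borel_measurable (Fil v)"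
proof -
  have "(\<lambda>\<omega>. g k \<omega> * (W (min v (real (Suc k) * \<epsilon>)) \<omega> - W (min v (real k * \<epsilon>)) \<omega>)) \<in> borel_measurable (Fil v)"
    if k: "k < m" for k
  proof (cases "v \<le> real k * \<epsilon>")
    case True
    moreover have "v \<le> real (Suc k) * \<epsilon>" using True eps by (simp add: algebra_simps)
    ultimately show ?thesis by (simp add: min_def)
  next
    case False
    have [measurable]: "g k \<in> borel_measurable (Fil v)"
      using False by (intro Fil_le[OF g_adapted[OF k]]) auto
    have "0 \<le> min v (real i * \<epsilon>)" for i using assms eps by simp
    then have [measurable]: "W (min v (real i * \<epsilon>)) \<in> borel_measurable (Fil v)" for i
      by (rule Fil_le[OF W_adapted]) simp
    show ?thesis by measurable
  qed
  then show ?thesis unfolding simple_int_def[abs_def] by (intro borel_measurable_sum) auto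
qed

lemma term_orthogonal:
  assumes v: "0 \<le> v" "v \<le> w" and k: "k < m"
    and Z: "Z \<in> borel_measurable (Fil v)" "integrable M (\<lambda>\<omega>. (Z \<omega>)\<^sup>2)"
  defines "d \<equiv> \<lambda>\<omega>. g k \<omega> * (W (min w (real (Suc k) * \<epsilon>)) \<omega> - W (min w (real k * \<epsilon>)) \<omega>)
       - g k \<omega> * (W (min v (real (Suc k) * \<epsilon>)) \<omega> - W (min v (real k * \<epsilon>)) \<omega>)"
  shows "integrable M (\<lambda>\<omega>. (d \<omega>)\<^sup>2)" "integrable M (\<lambda>\<omega>. Z \<omega> * d \<omega>)" "(\<integral>\<omega>. Z \<omega> * d \<omega> \<partial>M) = 0"
proof -
  have "integrable M (\<lambda>\<omega>. (d \<omega>)\<^sup>2) \<and> integrable M (\<lambda>\<omega>. Z \<omega> * d \<omega>) \<and> (\<integral>\<omega>. Z \<omega> * d \<omega> \<partial>M) = 0"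
    using term_cases[OF v k]
  proof (elim disjE conjE)
    assume "\<forall>\<omega>. g k \<omega> * (W (min w (real (Suc k) * \<epsilon>)) \<omega> - W (min w (real k * \<epsilon>)) \<omega>)
       - g k \<omega> * (W (min v (real (Suc k) * \<epsilon>)) \<omega> - W (min v (real k * \<epsilon>)) \<omega>) = 0"
    then have "d = (\<lambda>_. 0)" by (simp add: d_def fun_eq_iff)
    then show ?thesis by simp
  next
    define a b where "a = max v (real k * \<epsilon>)" and "b = min w (real (Suc k) * \<epsilon>)"
    assume le: "max v (real k * \<epsilon>) \<le> min w (real (Suc k) * \<epsilon>)"
      and eq: "\<forall>\<omega>. g k \<omega> * (W (min w (real (Suc k) * \<epsilon>)) \<omega> - W (min w (real k * \<epsilon>)) \<omega>)
       - g k \<omega> * (W (min v (real (Suc k) * \<epsilon>)) \<omega> - W (min v (real k * \<epsilon>)) \<omega>)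
       = g k \<omega> * (W (min w (real (Suc k) * \<epsilon>)) \<omega> - W (max v (real k * \<epsilon>)) \<omega>)"
    have d: "d = (\<lambda>\<omega>. g k \<omega> * (W b \<omega> - W a \<omega>))"
      unfolding d_def a_def b_def by (rule ext) (rule eq[rule_format])
    have ab: "a \<le> b" "0 \<le> a"
      using le v unfolding a_def b_def by (blast intro: order_trans max.cobounded1)+
    have ga: "g k \<in> borel_measurable (Fil a)" and Za: "Z \<in> borel_measurable (Fil a)"
      by (rule Fil_le[OF g_adapted[OF k]] Fil_le[OF Z(1)], simp add: a_def)+
    show ?thesis
      unfolding d using square_mult_increment(1)[OF ab(2,1) ga g_square[OF k]]
        orthogonal_increment[OF ab(2,1) ga g_square[OF k] Za Z(2)] by blast
  qed
  then show "integrable M (\<lambda>\<omega>. (d \<omega>)\<^sup>2)" "integrable M (\<lambda>\<omega>. Z \<omega> * d \<omega>)" "(\<integral>\<omega>. Z \<omega> * d \<omega> \<partial>M) = 0"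
    by auto
qed

text \<open>The weak form of the martingale property that Doob's inequality needs, obtained summand
  by summand.\<close>

lemma simple_int_orthogonal:
  assumes v: "0 \<le> v" "v \<le> w"
    and Z: "Z \<in> borel_measurable (Fil v)" "integrable M (\<lambda>\<omega>. (Z \<omega>)\<^sup>2)"
  shows "integrable M (\<lambda>\<omega>. Z \<omega> * (simple_int \<epsilon> m g w \<omega> - simple_int \<epsilon> m g v \<omega>))"
    and "(\<integral>\<omega>. Z \<omega> * (simple_int \<epsilon> m g w \<omega> - simple_int \<epsilon> m g v \<omega>) \<partial>M) = 0"
proof -
  define d where "d k \<omega> = g k \<omega> * (W (min w (real (Suc k) * \<epsilon>)) \<omega> - W (min w (real k * \<epsilon>)) \<omega>)
       - g k \<omega> * (W (min v (real (Suc k) * \<epsilon>)) \<omega> - W (min v (real k * \<epsilon>)) \<omega>)" for k \<omega>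
  have eq: "Z \<omega> * (simple_int \<epsilon> m g w \<omega> - simple_int \<epsilon> m g v \<omega>) = (\<Sum>k<m. Z \<omega> * d k \<omega>)" for \<omega>
    unfolding simple_int_def d_def by (simp only: sum_subtractf sum_distrib_left right_diff_distrib)
  have t: "integrable M (\<lambda>\<omega>. Z \<omega> * d k \<omega>)" "(\<integral>\<omega>. Z \<omega> * d k \<omega> \<partial>M) = 0" if "k < m" for k
    using term_orthogonal(2,3)[OF v that Z] unfolding d_def by blast+
  show "integrable M (\<lambda>\<omega>. Z \<omega> * (simple_int \<epsilon> m g w \<omega> - simple_int \<epsilon> m g v \<omega>))"
    unfolding eq using t by (intro Bochner_Integration.integrable_sum) auto
  show "(\<integral>\<omega>. Z \<omega> * (simple_int \<epsilon> m g w \<omega> - simple_int \<epsilon> m g v \<omega>) \<partial>M) = 0"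
    unfolding eq using t by (subst Bochner_Integration.integral_sum) auto
qed

lemma simple_int_square:
  assumes v: "0 \<le> v"
  shows "integrable M (\<lambda>\<omega>. (simple_int \<epsilon> m g v \<omega>)\<^sup>2)"
  unfolding simple_int_def
proof (rule integrable_sum_square)
  fix k assume "k \<in> {..<m}"
  then have k: "k < m" by simp
  show "integrable M (\<lambda>\<omega>. (g k \<omega> * (W (min v (real (Suc k) * \<epsilon>)) \<omega> - W (min v (real k * \<epsilon>)) \<omega>))\<^sup>2)"
  proof -
    \<comment> \<open>At time 0 every summand vanishes, so square integrability of a summand is that
      of its increment from 0 to \<open>v\<close>.\<close>
    have min0: "min 0 (real i * \<epsilon>) = 0" for i using eps by simp
    have "(\<lambda>_. 0::real) \<in> borel_measurable (Fil 0)" "integrable M (\<lambda>_. (0::real)\<^sup>2)" by simp_all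
    from term_orthogonal(1)[OF order_refl v k this] show ?thesis
      unfolding min0 diff_self mult_zero_right diff_zero .
  qed
  have [measurable]: "g k \<in> borel_measurable M" by (rule Fil_M[OF g_adapted[OF k]])
  have "0 \<le> min v (real i * \<epsilon>)" for i using v eps by simp
  then have [measurable]: "W (min v (real i * \<epsilon>)) \<in> borel_measurable M" for i by (rule W_meas)
  show "(\<lambda>\<omega>. g k \<omega> * (W (min v (real (Suc k) * \<epsilon>)) \<omega> - W (min v (real k * \<epsilon>)) \<omega>)) \<in> borel_measurable M"
    by measurable
qed simp

lemma simple_int_isometry:
  "(\<integral>\<omega>. (simple_int \<epsilon> m g (real m * \<epsilon>) \<omega>)\<^sup>2 \<partial>M) = (\<Sum>k<m. \<epsilon> * (\<integral>\<omega>. (g k \<omega>)\<^sup>2 \<partial>M))"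
proof -
  define P where "P i \<omega> = (\<Sum>k<i. g k \<omega> * (W (real (Suc k) * \<epsilon>) \<omega> - W (real k * \<epsilon>) \<omega>))" for i \<omega>
  have "i \<le> m \<Longrightarrow> P i \<in> borel_measurable (Fil (real i * \<epsilon>)) \<and> integrable M (\<lambda>\<omega>. (P i \<omega>)\<^sup>2) \<and>
      (\<integral>\<omega>. (P i \<omega>)\<^sup>2 \<partial>M) = (\<Sum>k<i. \<epsilon> * (\<integral>\<omega>. (g k \<omega>)\<^sup>2 \<partial>M))" for i
  proof (induction i)
    case 0
    then show ?case by (simp add: P_def[abs_def])
  next
    case (Suc i)
    then have im: "i < m" and IH: "P i \<in> borel_measurable (Fil (real i * \<epsilon>))" "integrable M (\<lambda>\<omega>. (P i \<omega>)\<^sup>2)"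
      "(\<integral>\<omega>. (P i \<omega>)\<^sup>2 \<partial>M) = (\<Sum>k<i. \<epsilon> * (\<integral>\<omega>. (g k \<omega>)\<^sup>2 \<partial>M))" by auto
    define q where "q \<omega> = g i \<omega> * (W (real (Suc i) * \<epsilon>) \<omega> - W (real i * \<epsilon>) \<omega>)" for \<omega>
    have P: "P (Suc i) \<omega> = P i \<omega> + q \<omega>" for \<omega> by (simp add: P_def q_def)
    have t: "0 \<le> real i * \<epsilon>" "real i * \<epsilon> \<le> real (Suc i) * \<epsilon>" using eps by (auto simp: algebra_simps)
    have q2: "integrable M (\<lambda>\<omega>. (q \<omega>)\<^sup>2)" "(\<integral>\<omega>. (q \<omega>)\<^sup>2 \<partial>M) = \<epsilon> * (\<integral>\<omega>. (g i \<omega>)\<^sup>2 \<partial>M)"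
      using square_mult_increment[OF t g_adapted[OF im] g_square[OF im]] unfolding q_def
      by (auto simp: algebra_simps)
    have Pq: "integrable M (\<lambda>\<omega>. P i \<omega> * q \<omega>)" "(\<integral>\<omega>. P i \<omega> * q \<omega> \<partial>M) = 0"
      using orthogonal_increment[OF t g_adapted[OF im] g_square[OF im] IH(1,2)] unfolding q_def by auto
    have eq: "(P (Suc i) \<omega>)\<^sup>2 = (P i \<omega>)\<^sup>2 + (q \<omega>)\<^sup>2 + 2 * (P i \<omega> * q \<omega>)" for \<omega>
      by (simp add: P power2_sum)
    have [measurable]: "P i \<in> borel_measurable (Fil (real (Suc i) * \<epsilon>))" "g i \<in> borel_measurable (Fil (real (Suc i) * \<epsilon>))"
      "W (real (Suc i) * \<epsilon>) \<in> borel_measurable (Fil (real (Suc i) * \<epsilon>))" "W (real i * \<epsilon>) \<in> borel_measurable (Fil (real (Suc i) * \<epsilon>))"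
      using t eps by (auto intro: Fil_le[OF IH(1)] Fil_le[OF g_adapted[OF im]] W_adapted Fil_le[OF W_adapted[OF t(1)]])
    have "P (Suc i) \<in> borel_measurable (Fil (real (Suc i) * \<epsilon>))"
      unfolding P[abs_def] q_def by measurable
    then show ?case using q2 Pq IH unfolding eq by simp
  qed
  from this[of m] have "(\<integral>\<omega>. (P m \<omega>)\<^sup>2 \<partial>M) = (\<Sum>k<m. \<epsilon> * (\<integral>\<omega>. (g k \<omega>)\<^sup>2 \<partial>M))" by simp
  moreover have "simple_int \<epsilon> m g (real m * \<epsilon>) \<omega> = P m \<omega>" for \<omega>
    unfolding simple_int_def P_def using eps
  proof (intro sum.cong refl)
    fix k assume "k \<in> {..<m}"
    then have "real k * \<epsilon> \<le> real m * \<epsilon>" "real (Suc k) * \<epsilon> \<le> real m * \<epsilon>"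
      using eps by (auto simp del: of_nat_Suc)
    then show "g k \<omega> * (W (min (real m * \<epsilon>) (real (Suc k) * \<epsilon>)) \<omega> - W (min (real m * \<epsilon>) (real k * \<epsilon>)) \<omega>) =
      g k \<omega> * (W (real (Suc k) * \<epsilon>) \<omega> - W (real k * \<epsilon>) \<omega>)"
      by (simp only: min_absorb2)
  qed
  ultimately show ?thesis by simp
qed

text \<open>Because \<open>sgn x * (y - x) \<le> \<bar>y\<bar> - \<bar>x\<bar>\<close>, the
  multiplier \<open>S i * sgn (N i)\<close> bounds the sum in \<open>pathwise_doob\<close> below by
  a sum over increments of the martingale \<open>N\<close> itself, and that sum has mean zero by
  orthogonality.\<close>

lemma discrete_doob:
  fixes t :: "nat \<Rightarrow> real"
  assumes t0: "0 \<le> t 0" and t: "\<And>i. t i \<le> t (Suc i)"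
  defines "S \<equiv> \<lambda>i \<omega>. running_max (\<lambda>j. \<bar>simple_int \<epsilon> m g (t j) \<omega>\<bar>) i"
  shows "S n \<in> borel_measurable M" "integrable M (\<lambda>\<omega>. (S n \<omega>)\<^sup>2)"
    "(\<integral>\<omega>. (S n \<omega>)\<^sup>2 \<partial>M) \<le> 4 * (\<integral>\<omega>. (simple_int \<epsilon> m g (t n) \<omega>)\<^sup>2 \<partial>M)"
proof -
  define N where "N j = simple_int \<epsilon> m g (t j)" for j
  have tm: "t i \<le> t j" if "i \<le> j" for i j by (rule lift_Suc_mono_le[of t, OF t that])
  have tp: "0 \<le> t j" for j using tm[of 0 j] t0 by simp
  have S0: "S 0 \<omega> = \<bar>N 0 \<omega>\<bar>" and SS: "S (Suc i) \<omega> = max (S i \<omega>) \<bar>N (Suc i) \<omega>\<bar>" for i \<omega>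
    by (simp_all add: S_def N_def)
  have Na: "N j \<in> borel_measurable (Fil (t j))" for j unfolding N_def by (rule simple_int_adapted[OF tp])
  have N2: "integrable M (\<lambda>\<omega>. (N j \<omega>)\<^sup>2)" for j unfolding N_def by (rule simple_int_square[OF tp])
  have Sa: "S i \<in> borel_measurable (Fil (t i))" for i
  proof (induction i)
    case 0
    then show ?case using Na[of 0] unfolding S0[abs_def] by measurable
  next
    case (Suc i)
    have [measurable]: "S i \<in> borel_measurable (Fil (t (Suc i)))" "N (Suc i) \<in> borel_measurable (Fil (t (Suc i)))"
      using Fil_le[OF Suc t] Na by auto
    show ?case unfolding SS[abs_def] by measurable
  qed
  then show Sm: "S n \<in> borel_measurable M" for n using Fil_M by blast
  have Spos: "0 \<le> S i \<omega>" for i \<omega> using le_running_max[of 0 i "\<lambda>j. \<bar>simple_int \<epsilon> m g (t j) \<omega>\<bar>"] by (simp add: S_def)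
  have S2: "integrable M (\<lambda>\<omega>. (S i \<omega>)\<^sup>2)" for i
  proof (rule Bochner_Integration.integrable_bound)
    show "integrable M (\<lambda>\<omega>. (\<Sum>j\<le>i. \<bar>N j \<omega>\<bar>)\<^sup>2)"
      using N2 Fil_M[OF Na] by (intro integrable_sum_square) auto
    show "AE \<omega> in M. norm ((S i \<omega>)\<^sup>2) \<le> norm ((\<Sum>j\<le>i. \<bar>N j \<omega>\<bar>)\<^sup>2)"
    proof (rule AE_I2)
      fix \<omega>
      have "S i \<omega> \<le> (\<Sum>j\<le>i. \<bar>N j \<omega>\<bar>)" unfolding S_def N_def by (rule running_max_le_sum) simp
      then have "(S i \<omega>)\<^sup>2 \<le> (\<Sum>j\<le>i. \<bar>N j \<omega>\<bar>)\<^sup>2" using Spos by (rule power_mono)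
      then show "norm ((S i \<omega>)\<^sup>2) \<le> norm ((\<Sum>j\<le>i. \<bar>N j \<omega>\<bar>)\<^sup>2)" by simp
    qed
  qed (use Sm in measurable)
  then show "integrable M (\<lambda>\<omega>. (S n \<omega>)\<^sup>2)" .
  define Z where "Z i \<omega> = S i \<omega> * sgn (N i \<omega>)" for i \<omega>
  have Za: "Z i \<in> borel_measurable (Fil (t i))" for i
    unfolding Z_def[abs_def] using Sa Na by measurable
  have Z2: "integrable M (\<lambda>\<omega>. (Z i \<omega>)\<^sup>2)" for i
  proof (rule Bochner_Integration.integrable_bound[OF S2[of i]])
    show "AE \<omega> in M. norm ((Z i \<omega>)\<^sup>2) \<le> norm ((S i \<omega>)\<^sup>2)"
      by (rule AE_I2) (auto simp: Z_def power_mult_distrib sgn_if)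
  qed (use Fil_M[OF Za] in measurable)
  have orth: "integrable M (\<lambda>\<omega>. Z i \<omega> * (N (Suc i) \<omega> - N i \<omega>))" "(\<integral>\<omega>. Z i \<omega> * (N (Suc i) \<omega> - N i \<omega>) \<partial>M) = 0" for i
    unfolding N_def using simple_int_orthogonal[OF tp t Za Z2] by auto
  have pw: "(S n \<omega>)\<^sup>2 \<le> 4 * (N n \<omega>)\<^sup>2 - 4 * (\<Sum>k<n. Z k \<omega> * (N (Suc k) \<omega> - N k \<omega>))" for \<omega>
  proof -
    have "Z k \<omega> * (N (Suc k) \<omega> - N k \<omega>) \<le> S k \<omega> * (\<bar>N (Suc k) \<omega>\<bar> - \<bar>N k \<omega>\<bar>)" for k
    proof -
      have "sgn (N k \<omega>) * (N (Suc k) \<omega> - N k \<omega>) \<le> \<bar>N (Suc k) \<omega>\<bar> - \<bar>N k \<omega>\<bar>"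
        by (auto simp: sgn_if)
      from mult_left_mono[OF this Spos[of k \<omega>]] show ?thesis by (simp add: Z_def mult.assoc)
    qed
    then have "(\<Sum>k<n. Z k \<omega> * (N (Suc k) \<omega> - N k \<omega>)) \<le> (\<Sum>k<n. S k \<omega> * (\<bar>N (Suc k) \<omega>\<bar> - \<bar>N k \<omega>\<bar>))"
      by (rule sum_mono)
    moreover have "(S n \<omega>)\<^sup>2 \<le> 4 * (N n \<omega>)\<^sup>2 - 4 * (\<Sum>k<n. S k \<omega> * (\<bar>N (Suc k) \<omega>\<bar> - \<bar>N k \<omega>\<bar>))"
      using pathwise_doob[of "\<lambda>j. \<bar>N j \<omega>\<bar>" n] by (simp add: S_def N_def)
    ultimately show ?thesis by linarith
  qed
  have "(\<integral>\<omega>. (S n \<omega>)\<^sup>2 \<partial>M) \<le> (\<integral>\<omega>. 4 * (N n \<omega>)\<^sup>2 - 4 * (\<Sum>k<n. Z k \<omega> * (N (Suc k) \<omega> - N k \<omega>)) \<partial>M)"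
    using pw S2 N2 orth(1) by (intro integral_mono) auto
  also have "\<dots> = 4 * (\<integral>\<omega>. (N n \<omega>)\<^sup>2 \<partial>M)"
    using N2 orth by (simp add: Bochner_Integration.integral_sum)
  finally show "(\<integral>\<omega>. (S n \<omega>)\<^sup>2 \<partial>M) \<le> 4 * (\<integral>\<omega>. (simple_int \<epsilon> m g (t n) \<omega>)\<^sup>2 \<partial>M)" by (simp add: N_def)
qed

lemma simple_int_continuous:
  assumes "\<omega> \<in> space M"
  shows "continuous_on {0..} (\<lambda>v. simple_int \<epsilon> m g v \<omega>)"
  unfolding simple_int_def using eps
  by (intro continuous_intros continuous_on_compose2[OF W_cont[OF assms]]) auto

text \<open>Maxima over finer and finer equidistant points converge to the supremum by path
  continuity, which also makes the supremum measurable; Fatou's lemma carries the discrete bound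
  over.\<close>

lemma continuous_doob:
  obtains V where "V \<in> borel_measurable M" "integrable M (\<lambda>\<omega>. (V \<omega>)\<^sup>2)"
    "\<And>v \<omega>. \<omega> \<in> space M \<Longrightarrow> 0 \<le> v \<Longrightarrow> v \<le> real m * \<epsilon> \<Longrightarrow> \<bar>simple_int \<epsilon> m g v \<omega>\<bar> \<le> V \<omega>"
    "(\<integral>\<omega>. (V \<omega>)\<^sup>2 \<partial>M) \<le> 4 * (\<Sum>k<m. \<epsilon> * (\<integral>\<omega>. (g k \<omega>)\<^sup>2 \<partial>M))"
proof -
  define u where "u = real m * \<epsilon>"
  have u: "0 \<le> u" using eps by (simp add: u_def)
  define N where "N v \<omega> = \<bar>simple_int \<epsilon> m g v \<omega>\<bar>" for v \<omega>
  define V where "V \<omega> = (SUP v\<in>{0..u}. N v \<omega>)" for \<omega>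
  \<comment> \<open>The cap at \<open>u\<close> gives a nondecreasing sequence over all indices, as
    \<open>discrete_doob\<close> demands; the index \<open>Suc j\<close> hits
    \<open>u\<close>.\<close>
  define t where "t j i = min u (real i * (u / real (Suc j)))" for j i :: nat
  define S where "S j \<omega> = running_max (\<lambda>i. N (t j i) \<omega>) (Suc j)" for j \<omega>
  have tj: "t j (Suc j) = u" for j using u by (simp add: t_def)
  have t: "0 \<le> t j 0" "t j i \<le> t j (Suc i)" for j i
    unfolding t_def using u by (simp, intro min.mono order_refl mult_right_mono) auto
  note dd = discrete_doob[of "t j" for j, OF t, folded N_def]
  have Sm: "S j \<in> borel_measurable M" for j unfolding S_def[abs_def] by (rule dd)
  have S2: "integrable M (\<lambda>\<omega>. (S j \<omega>)\<^sup>2)" for j unfolding S_def by (rule dd)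
  have SE: "(\<integral>\<omega>. (S j \<omega>)\<^sup>2 \<partial>M) \<le> 4 * (\<Sum>k<m. \<epsilon> * (\<integral>\<omega>. (g k \<omega>)\<^sup>2 \<partial>M))" for j
    using dd(3)[of j "Suc j"] simple_int_isometry unfolding tj u_def[symmetric] S_def N_def by simp
  have bdd: "bdd_above ((\<lambda>v. N v \<omega>) ` {0..u})" if "\<omega> \<in> space M" for \<omega>
    unfolding N_def
    by (intro bounded_imp_bdd_above compact_imp_bounded compact_continuous_image continuous_intros
        continuous_on_subset[OF simple_int_continuous[OF that]]) auto
  have NV: "N v \<omega> \<le> V \<omega>" if "\<omega> \<in> space M" "0 \<le> v" "v \<le> u" for v \<omega>
    unfolding V_def by (rule cSUP_upper[OF _ bdd]) (use that in auto)
  have lim: "(\<lambda>j. S j \<omega>) \<longlonglongrightarrow> V \<omega>" if w: "\<omega> \<in> space M" for \<omega>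
  proof (rule order_tendstoI)
    fix a assume "V \<omega> < a"
    moreover have "S j \<omega> \<le> V \<omega>" for j
      unfolding S_def using u by (intro running_max_le NV w) (auto simp: t_def)
    ultimately show "\<forall>\<^sub>F j in sequentially. S j \<omega> < a" by (intro always_eventually) (meson le_less_trans)
  next
    fix a assume "a < V \<omega>"
    then obtain v where v: "v \<in> {0..u}" "a < N v \<omega>"
      unfolding V_def using less_cSUP_iff[OF _ bdd[OF w]] u by auto
    show "\<forall>\<^sub>F j in sequentially. a < S j \<omega>"
    proof (cases "u = 0")
      case True
      have "N v \<omega> \<le> S j \<omega>" for j
        unfolding S_def using True v le_running_max[of 0 "Suc j" "\<lambda>i. N (t j i) \<omega>"] by (simp add: t_def)
      then show ?thesis using v by (intro always_eventually) (meson less_le_trans)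
    next
      case False
      then have up: "0 < u" using u by simp
      \<comment> \<open>The index of the last grid point not beyond \<open>v\<close>. These points
        tend to \<open>v\<close>, so \<open>N\<close> eventually exceeds \<open>a\<close>
        there.\<close>
      define i where "i j = nat \<lfloor>v * real (Suc j) / u\<rfloor>" for j
      have i0: "real (i j) \<le> v * real (Suc j) / u" "v * real (Suc j) / u - 1 \<le> real (i j)" for j
        unfolding i_def using v up by auto
      have ile: "i j \<le> Suc j" for j
      proof -
        have "v * real (Suc j) / u \<le> real (Suc j)" using v up by (simp add: field_simps del: of_nat_Suc)
        then have "real (i j) \<le> real (Suc j)" using i0(1)[of j] by linarith
        then show ?thesis by simp
      qed
      have tl: "v - u / real (Suc j) \<le> real (i j) * (u / real (Suc j))" "real (i j) * (u / real (Suc j)) \<le> v" for j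
      proof -
        define n where "n = real (Suc j)"
        have n: "0 < n" by (simp add: n_def)
        have "(v * n / u - 1) * (u / n) \<le> real (i j) * (u / n)" "real (i j) * (u / n) \<le> v * n / u * (u / n)"
          using i0[of j] up n unfolding n_def[symmetric] by (intro mult_right_mono; simp)+
        moreover have "(v * n / u - 1) * (u / n) = v - u / n" "v * n / u * (u / n) = v"
          using up n by (auto simp: field_simps)
        ultimately show "v - u / real (Suc j) \<le> real (i j) * (u / real (Suc j))" "real (i j) * (u / real (Suc j)) \<le> v"
          unfolding n_def by simp_all
      qed
      have "(\<lambda>j. real (i j) * (u / real (Suc j))) \<longlonglongrightarrow> v"
      proof (rule tendsto_sandwich[OF _ _ _ tendsto_const])
        have "(\<lambda>j. u / real (Suc j)) \<longlonglongrightarrow> 0"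
          using LIMSEQ_Suc[OF lim_const_over_n[of u]] by simp
        then show "(\<lambda>j. v - u / real (Suc j)) \<longlonglongrightarrow> v"
          using tendsto_diff[OF tendsto_const[of v], of "\<lambda>j. u / real (Suc j)" 0] by simp
      qed (use tl in auto)
      moreover have teq: "t j (i j) = real (i j) * (u / real (Suc j))" for j
        unfolding t_def using tl[of j] v by simp
      ultimately have "(\<lambda>j. t j (i j)) \<longlonglongrightarrow> v" by simp
      moreover have "continuous_on {0..} (\<lambda>v. N v \<omega>)"
        unfolding N_def by (intro continuous_intros simple_int_continuous w)
      ultimately have "(\<lambda>j. N (t j (i j)) \<omega>) \<longlonglongrightarrow> N v \<omega>"
        by (rule_tac continuous_on_tendsto_compose[where s="{0..}"])
           (use v up in \<open>auto simp: t_def\<close>)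
      then have "\<forall>\<^sub>F j in sequentially. a < N (t j (i j)) \<omega>" using v(2) by (rule order_tendstoD)
      then show ?thesis
      proof eventually_elim
        case (elim j)
        then show ?case using le_running_max[OF ile, of "\<lambda>i. N (t j i) \<omega>" j] by (simp add: S_def)
      qed
    qed
  qed
  have Vm: "V \<in> borel_measurable M" by (rule borel_measurable_LIMSEQ_real[OF lim Sm])
  define c where "c = 4 * (\<Sum>k<m. \<epsilon> * (\<integral>\<omega>. (g k \<omega>)\<^sup>2 \<partial>M))"
  have c: "0 \<le> c" unfolding c_def using eps by (intro mult_nonneg_nonneg sum_nonneg) auto
  have "(\<integral>\<^sup>+\<omega>. ennreal ((V \<omega>)\<^sup>2) \<partial>M) = (\<integral>\<^sup>+\<omega>. liminf (\<lambda>j. ennreal ((S j \<omega>)\<^sup>2)) \<partial>M)"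
  proof (rule nn_integral_cong)
    fix \<omega> assume "\<omega> \<in> space M"
    then have "(\<lambda>j. ennreal ((S j \<omega>)\<^sup>2)) \<longlonglongrightarrow> ennreal ((V \<omega>)\<^sup>2)"
      by (intro tendsto_ennrealI tendsto_power lim)
    then show "ennreal ((V \<omega>)\<^sup>2) = liminf (\<lambda>j. ennreal ((S j \<omega>)\<^sup>2))"
      by (rule lim_imp_Liminf[OF sequentially_bot, symmetric])
  qed
  also have "\<dots> \<le> liminf (\<lambda>j. \<integral>\<^sup>+\<omega>. ennreal ((S j \<omega>)\<^sup>2) \<partial>M)"
    using Sm by (intro nn_integral_liminf) measurable
  also have "\<dots> \<le> ennreal c"
    using S2 SE by (intro Liminf_le always_eventually) (auto simp: nn_integral_eq_integral c_def intro!: ennreal_leI)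
  finally have VE: "(\<integral>\<^sup>+\<omega>. ennreal ((V \<omega>)\<^sup>2) \<partial>M) \<le> ennreal c" .
  have V2: "integrable M (\<lambda>\<omega>. (V \<omega>)\<^sup>2)"
    by (rule integrableI_nonneg) (use Vm VE in \<open>auto simp: less_top[symmetric] top_unique\<close>)
  have "(\<integral>\<omega>. (V \<omega>)\<^sup>2 \<partial>M) \<le> c"
    using VE c by (simp add: nn_integral_eq_integral[OF V2])
  then show ?thesis using that[OF Vm V2] NV unfolding c_def N_def u_def by blast
qed

end

end

text \<open>Independence from \<open>\<F> s\<close> becomes independence of the variables
  \<open>Y\<close> and \<open>X\<close>, so that expectations factorise. The case
  \<open>s = t\<close> is left out because the normal density needs a positive variance.\<close>

lemma brownian_increment_moments:
  assumes M: "prob_space M" and sub: "subalgebra M (\<F> s)" and bm: "brownian_motion M \<F> W"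
    and st: "0 \<le> s" "s < t" and Y: "Y \<in> borel_measurable (\<F> s)" "integrable M Y"
  shows "integrable M (\<lambda>\<omega>. Y \<omega> * (W t \<omega> - W s \<omega>)) \<and> (\<integral>\<omega>. Y \<omega> * (W t \<omega> - W s \<omega>) \<partial>M) = (0::real)"
    "integrable M (\<lambda>\<omega>. Y \<omega> * (W t \<omega> - W s \<omega>)\<^sup>2) \<and>
      (\<integral>\<omega>. Y \<omega> * (W t \<omega> - W s \<omega>)\<^sup>2 \<partial>M) = (t - s) * (\<integral>\<omega>. Y \<omega> \<partial>M)"
proof -
  interpret prob_space M by (rule M)
  define X where "X \<omega> = W t \<omega> - W s \<omega>" for \<omega>
  have dist: "distributed M lborel X (\<lambda>x. ennreal (normal_density 0 (sqrt (t - s)) x))"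
    and ind: "indep_set (sets (\<F> s)) (sets (vimage_algebra (space M) X borel))"
    using bm st unfolding brownian_motion_def X_def by blast+
  have sd: "0 < sqrt (t - s)" using st by simp
  have Xm [measurable]: "X \<in> borel_measurable M"
    using distributed_measurable[OF dist] by simp
  have Ym [measurable]: "Y \<in> borel_measurable M" by (rule measurable_from_subalg[OF sub Y(1)])
  have "indep_var borel Y borel X"
    unfolding indep_var_eq
  proof (intro conjI Ym Xm)
    have "{Y -` A \<inter> space M |A. A \<in> sets borel} \<subseteq> sets (\<F> s)"
      using measurable_sets[OF Y(1)] sub by (auto simp: subalgebra_def)
    then have "sigma_sets (space M) {Y -` A \<inter> space M |A. A \<in> sets borel} \<subseteq> sets (\<F> s)"
      using sets.sigma_sets_subset[of _ "\<F> s"] sub by (simp add: subalgebra_def)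
    then show "indep_set (sigma_sets (space M) {Y -` A \<inter> space M |A. A \<in> sets borel})
      (sigma_sets (space M) {X -` A \<inter> space M |A. A \<in> sets borel})"
      using ind unfolding sets_vimage_algebra indep_sets2_eq by blast
  qed
  note ind2 = this
  have X1: "integrable M X" and X2: "integrable M (\<lambda>\<omega>. (X \<omega>)\<^sup>2)"
    using integrable_normal_moment[OF sd, of 0 1] integrable_normal_moment[OF sd, of 0 2]
      distributed_integrable[OF dist, of "\<lambda>x. x"] distributed_integrable[OF dist, of "\<lambda>x. x\<^sup>2"] by simp_all
  have E1: "expectation X = 0" using normal_distributed_expectation[OF sd dist] .
  have E2: "expectation (\<lambda>\<omega>. (X \<omega>)\<^sup>2) = t - s"
    using normal_distributed_variance[OF sd dist] st E1 by simp
  show "integrable M (\<lambda>\<omega>. Y \<omega> * (W t \<omega> - W s \<omega>)) \<and> (\<integral>\<omega>. Y \<omega> * (W t \<omega> - W s \<omega>) \<partial>M) = 0"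
    using indep_var_integrable[OF ind2 Y(2) X1] indep_var_lebesgue_integral[OF ind2 Y(2) X1] E1
    by (simp add: X_def[abs_def])
  have ind3: "indep_var borel Y borel (\<lambda>\<omega>. (X \<omega>)\<^sup>2)"
    using indep_var_compose[OF ind2, of "\<lambda>x. x" borel "\<lambda>x. x\<^sup>2" borel] by (simp add: comp_def)
  show "integrable M (\<lambda>\<omega>. Y \<omega> * (W t \<omega> - W s \<omega>)\<^sup>2) \<and>
      (\<integral>\<omega>. Y \<omega> * (W t \<omega> - W s \<omega>)\<^sup>2 \<partial>M) = (t - s) * (\<integral>\<omega>. Y \<omega> \<partial>M)"
    using indep_var_integrable[OF ind3 Y(2) X2] indep_var_lebesgue_integral[OF ind3 Y(2) X2] E2
    by (simp add: X_def[abs_def] mult.commute)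
qed

subsection \<open>Tail of the inverse subordinator\<close>

lemma dyadic_scale:
  fixes s0 u :: real
  assumes "0 < s0" "s0 \<le> u"
  obtains k :: nat where "2 ^ k * s0 \<le> u" "u < 2 ^ Suc k * s0"
proof -
  have "\<exists>k. u < 2 ^ Suc k * s0"
  proof -
    obtain k :: nat where "u / s0 < 2 ^ k" using real_arch_pow[of 2 "u / s0"] by auto
    then have "u < 2 ^ k * s0" using assms by (simp add: field_simps)
    also have "\<dots> \<le> 2 ^ Suc k * s0" using assms by simp
    finally show ?thesis by blast
  qed
  then obtain k where k: "u < 2 ^ Suc k * s0" "\<And>j. j < k \<Longrightarrow> \<not> u < 2 ^ Suc j * s0"
    using exists_least_iff[of "\<lambda>k. u < 2 ^ Suc k * s0"] by blast
  have "2 ^ k * s0 \<le> u" using k(2)[of "k - 1"] assms by (cases k) auto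
  with k(1) that show ?thesis by blast
qed

lemma powr_2_power: "2 powr (real k * p) = (2 powr p) ^ k"
  by (simp add: powr_powr mult.commute flip: powr_realpow)

text \<open>For monotone functions, Potter's bounds follow from the doubling behaviour alone.\<close>

lemma regularly_varying_upper:
  assumes f: "regularly_varying f p" and mono: "\<And>u v. 0 < u \<Longrightarrow> u \<le> v \<Longrightarrow> f u \<le> f v" and p: "p < p'" "0 \<le> p'"
  shows "\<exists>C>0. \<forall>u>0. f u \<le> C * (1 + u) powr p'"
proof -
  have pos: "\<And>s. 0 < s \<Longrightarrow> 0 < f s" and lim: "((\<lambda>s. f (2 * s) / f s) \<longlongrightarrow> 2 powr p) at_top"
    using f unfolding regularly_varying_def by auto
  have "2 powr p < (2::real) powr p'" using p by simp
  from order_tendstoD(2)[OF lim this] obtain s1 where s1: "\<And>s. s1 \<le> s \<Longrightarrow> f (2 * s) / f s < 2 powr p'"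
    unfolding eventually_at_top_linorder by blast
  define s0 where "s0 = max 1 s1"
  have s0: "1 \<le> s0" by (simp add: s0_def)
  have step: "f (2 * s) \<le> 2 powr p' * f s" if "s0 \<le> s" for s
    using s1[of s] that pos[of s] by (simp add: s0_def field_simps)
  have iter: "f (2 ^ k * s0) \<le> (2 powr p') ^ k * f s0" for k
  proof (induction k)
    case (Suc k)
    have "s0 \<le> 2 ^ k * s0" using s0 by simp
    from step[OF this] have "f (2 ^ Suc k * s0) \<le> 2 powr p' * f (2 ^ k * s0)" by (simp add: mult.assoc)
    also have "\<dots> \<le> 2 powr p' * ((2 powr p') ^ k * f s0)" using Suc by (intro mult_left_mono) auto
    finally show ?case by simp
  qed simp
  have fs0: "0 < f s0" using pos s0 by simp
  \<comment> \<open>The extra factor \<open>2 powr p'\<close> pays for rounding \<open>u\<close> up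
    to a dyadic multiple of \<open>s0\<close>.\<close>
  define C where "C = 2 powr p' * f s0"
  have C: "0 < C" using fs0 by (simp add: C_def)
  have "f u \<le> C * (1 + u) powr p'" if u: "0 < u" for u
  proof (cases "s0 \<le> u")
    case True
    then obtain k where k: "2 ^ k * s0 \<le> u" "u < 2 ^ Suc k * s0" using dyadic_scale[of s0 u] s0 by auto
    have "2 ^ k * 1 \<le> 2 ^ k * s0" using s0 by (intro mult_left_mono) auto
    then have ku: "2 ^ k \<le> 1 + u" using k u by linarith
    have "f u \<le> f (2 ^ Suc k * s0)" using k u by (intro mono) auto
    also have "\<dots> \<le> (2 powr p') ^ Suc k * f s0" by (rule iter)
    also have "\<dots> = C * (2 powr p') ^ k" by (simp add: C_def)
    also have "(2 powr p') ^ k = (2 ^ k) powr p'"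
      using powr_2_power[of k p'] by (simp add: powr_powr flip: powr_realpow)
    also have "C * (2 ^ k) powr p' \<le> C * (1 + u) powr p'"
      using C ku p by (intro mult_left_mono powr_mono2) auto
    finally show ?thesis .
  next
    case False
    have "f u \<le> f s0" using False u by (intro mono) auto
    also have "\<dots> \<le> C" unfolding C_def using fs0 p ge_one_powr_ge_zero[of 2 p'] by simp
    also have "\<dots> \<le> C * (1 + u) powr p'"
      using C ge_one_powr_ge_zero[of "1 + u" p'] u p by simp
    finally show ?thesis .
  qed
  then show ?thesis using C by blast
qed

lemma regularly_varying_lower:
  assumes f: "regularly_varying f p" and mono: "\<And>u v. 0 < u \<Longrightarrow> u \<le> v \<Longrightarrow> f u \<le> f v" and p: "p' < p" "0 \<le> p'"
  shows "\<exists>c>0. \<exists>s0>0. \<forall>u\<ge>s0. c * u powr p' \<le> f u"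
proof -
  have pos: "\<And>s. 0 < s \<Longrightarrow> 0 < f s" and lim: "((\<lambda>s. f (2 * s) / f s) \<longlongrightarrow> 2 powr p) at_top"
    using f unfolding regularly_varying_def by auto
  have "2 powr p' < (2::real) powr p" using p by simp
  from order_tendstoD(1)[OF lim this] obtain s1 where s1: "\<And>s. s1 \<le> s \<Longrightarrow> 2 powr p' < f (2 * s) / f s"
    unfolding eventually_at_top_linorder by blast
  define s0 where "s0 = max 1 s1"
  have s0: "1 \<le> s0" by (simp add: s0_def)
  have step: "2 powr p' * f s \<le> f (2 * s)" if "s0 \<le> s" for s
    using s1[of s] that pos[of s] by (simp add: s0_def field_simps)
  have iter: "(2 powr p') ^ k * f s0 \<le> f (2 ^ k * s0)" for k
  proof (induction k)
    case (Suc k)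
    have "s0 \<le> 2 ^ k * s0" using s0 by simp
    from step[OF this] have "2 powr p' * f (2 ^ k * s0) \<le> f (2 ^ Suc k * s0)" by (simp add: mult.assoc)
    moreover have "2 powr p' * ((2 powr p') ^ k * f s0) \<le> 2 powr p' * f (2 ^ k * s0)"
      using Suc by (intro mult_left_mono) auto
    ultimately have "2 powr p' * ((2 powr p') ^ k * f s0) \<le> f (2 ^ Suc k * s0)" by linarith
    then show ?case by (simp add: mult.assoc)
  qed simp
  have fs0: "0 < f s0" using pos s0 by simp
  \<comment> \<open>Dividing by \<open>2 * s0\<close> inside the power pays for rounding
    \<open>u\<close> down to a dyadic multiple of \<open>s0\<close>.\<close>
  define c where "c = f s0 / (2 * s0) powr p'"
  have c: "0 < c" using fs0 s0 by (simp add: c_def)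
  have "c * u powr p' \<le> f u" if u: "s0 \<le> u" for u
  proof -
    obtain k where k: "2 ^ k * s0 \<le> u" "u < 2 ^ Suc k * s0" using dyadic_scale[of s0 u] s0 u by auto
    have "u / (2 * s0) \<le> 2 ^ k" using k s0 by (simp add: field_simps)
    then have "(u / (2 * s0)) powr p' \<le> (2 ^ k) powr p'" using u s0 p by (intro powr_mono2) auto
    also have "\<dots> = (2 powr p') ^ k"
      using powr_2_power[of k p'] by (simp add: powr_powr flip: powr_realpow)
    finally have "(u / (2 * s0)) powr p' * f s0 \<le> (2 powr p') ^ k * f s0"
      using fs0 by (intro mult_right_mono) auto
    also have "\<dots> \<le> f (2 ^ k * s0)" by (rule iter)
    also have "\<dots> \<le> f u" using k s0 by (intro mono) auto
    finally show ?thesis using u s0 by (simp add: c_def powr_divide mult.commute)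
  qed
  then show ?thesis using c s0 by (intro exI[of _ c] conjI exI[of _ s0]) auto
qed

text \<open>A Bochner integral of a nonintegrable function is 0, so the pointwise comparison needs
  integrability. It follows from \<open>1 - exp (- r * y) \<le> max 1 r * min 1 y\<close> and the
  integrability condition on the Levy measure.\<close>

lemma laplace_exponent_mono:
  assumes nu: "subordinator_levy_measure \<nu>" and s: "0 < s" "s \<le> t"
  shows "laplace_exponent \<nu> s \<le> laplace_exponent \<nu> t"
proof -
  have sets [measurable_cong]: "sets \<nu> = sets borel" and z: "emeasure \<nu> {..0} = 0"
    and fin: "(\<integral>\<^sup>+ y. ennreal (min 1 y) \<partial>\<nu>) < \<infinity>"
    using nu by (auto simp: subordinator_levy_measure_def)
  have "AE y in \<nu>. y \<notin> {..0}" using z by (intro AE_not_in) (auto simp: null_sets_def sets)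
  then have pos: "AE y in \<nu>. 0 < y" by eventually_elim auto
  have int: "integrable \<nu> (\<lambda>y. 1 - exp (- r * y))" if r: "0 < r" for r :: real
  proof (rule Bochner_Integration.integrable_bound)
    show "integrable \<nu> (\<lambda>y. max 1 r * min 1 y)"
    proof (intro integrable_mult_right integrableI_nonneg)
      show "AE y in \<nu>. 0 \<le> min 1 y" using pos by eventually_elim auto
    qed (use fin in \<open>auto\<close>)
    show "AE y in \<nu>. norm (1 - exp (- r * y)) \<le> norm (max 1 r * min 1 y)"
      using pos
    proof eventually_elim
      fix y :: real assume y: "0 < y"
      have e1: "1 - exp (- r * y) \<le> r * y" using exp_ge_add_one_self[of "- r * y"] by simp
      have e2: "0 \<le> 1 - exp (- r * y)" using y r by simp
      have e3: "1 - exp (- r * y) \<le> 1" by simp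
      have "1 - exp (- r * y) \<le> max 1 r * min 1 y"
      proof (cases "y \<le> 1")
        case True
        have "r * y \<le> max 1 r * y" using y by (intro mult_right_mono) auto
        then show ?thesis using e1 True by simp
      next
        case False
        then show ?thesis using order_trans[OF e3 max.cobounded1[of 1 r]] by simp
      qed
      moreover have "0 \<le> max 1 r * min 1 y" using y by simp
      ultimately show "norm (1 - exp (- r * y)) \<le> norm (max 1 r * min 1 y)" using e2 by simp
    qed
  qed measurable
  show ?thesis
    unfolding laplace_exponent_def
  proof (rule integral_mono_AE)
    show "AE y in \<nu>. 1 - exp (- s * y) \<le> 1 - exp (- t * y)"
      using pos by eventually_elim (use s in \<open>simp add: mult_right_mono\<close>)
  qed (use int s in auto)
qed

lemma (in prob_space) laplace_tail:
  assumes X: "X \<in> borel_measurable M" and E: "(\<integral>\<omega>. exp (- s * X \<omega>) \<partial>M) = exp (- c)" and s: "0 \<le> s"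
  shows "prob {\<omega>\<in>space M. X \<omega> \<le> T} \<le> exp (s * T - c)"
proof -
  \<comment> \<open>A nonintegrable function would have integral 0, which differs from
    \<open>exp (- c)\<close>.\<close>
  have int: "integrable M (\<lambda>\<omega>. exp (- s * X \<omega>))"
    using E not_integrable_integral_eq[of M "\<lambda>\<omega>. exp (- s * X \<omega>)"] by force
  have A: "{\<omega>\<in>space M. X \<omega> \<le> T} \<in> sets M" using X by measurable
  have "exp (- s * T) * prob {\<omega>\<in>space M. X \<omega> \<le> T}
      = (\<integral>\<omega>. exp (- s * T) * indicator {\<omega>\<in>space M. X \<omega> \<le> T} \<omega> \<partial>M)"
    using A by simp
  also have "\<dots> \<le> (\<integral>\<omega>. exp (- s * X \<omega>) \<partial>M)"
  proof (rule integral_mono[OF _ int])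
    show "integrable M (\<lambda>\<omega>. exp (- s * T) * indicator {\<omega>\<in>space M. X \<omega> \<le> T} \<omega>)"
      using A by (intro integrable_mult_right integrable_real_indicator) (auto simp: less_top[symmetric])
  qed (use s in \<open>auto simp: indicator_def mult_left_mono\<close>)
  also have "\<dots> = exp (- c)" by (rule E)
  finally show ?thesis by (simp add: exp_diff exp_minus field_simps)
qed

text \<open>In the Chernoff bound \<open>s\<close> is chosen with
  \<open>s powr (1 - b) = v * c / (2 * T)\<close>. Then \<open>v * \<psi> s\<close> is at least
  \<open>2 * s * T\<close>, and the exponent is at most \<open>- s * T\<close>, which equals
  \<open>- a * v powr p\<close>.\<close>

lemma (in prob_space) subordinator_tail:
  assumes X: "\<And>v. 0 \<le> v \<Longrightarrow> X v \<in> borel_measurable M"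
    and E: "\<And>s v. 0 \<le> s \<Longrightarrow> 0 \<le> v \<Longrightarrow> (\<integral>\<omega>. exp (- s * X v \<omega>) \<partial>M) = exp (- v * \<psi> s)"
    and \<psi>: "0 < c" "0 < s0" "\<And>s. s0 \<le> s \<Longrightarrow> c * s powr b \<le> \<psi> s"
    and b: "0 \<le> b" "b < 1" and T: "0 < T"
  shows "\<exists>C>0. \<exists>a>0. \<forall>v\<ge>0. prob {\<omega>\<in>space M. X v \<omega> \<le> T} \<le> C * exp (- a * v powr (1 / (1 - b)))"
proof -
  define p where "p = 1 / (1 - b)"
  have p: "0 < p" using b by (simp add: p_def)
  \<comment> \<open>From \<open>v0\<close> on the chosen \<open>s\<close> is at least
    \<open>s0\<close>, where the lower bound for \<open>\<psi>\<close> is available.\<close>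
  define v0 where "v0 = 2 * T * s0 powr (1 - b) / c"
  have v0: "0 < v0" using T \<psi> by (simp add: v0_def)
  define a where "a = T * (c / (2 * T)) powr p"
  have a: "0 < a" using T \<psi> by (simp add: a_def)
  have big: "prob {\<omega>\<in>space M. X v \<omega> \<le> T} \<le> exp (- a * v powr p)" if v: "v0 \<le> v" for v
  proof -
    have vp: "0 < v" using v v0 by simp
    define s where "s = (v * c / (2 * T)) powr p"
    have sp: "0 < s" using vp T \<psi> by (simp add: s_def)
    have s1: "s powr (1 - b) = v * c / (2 * T)"
      using vp T \<psi> b by (simp add: s_def p_def powr_powr)
    have "s0 powr (1 - b) \<le> s powr (1 - b)"
      unfolding s1 using v T \<psi> by (simp add: v0_def field_simps)
    then have ss: "s0 \<le> s" using powr_less_mono2[of "1 - b" s s0] b \<psi> sp by (auto simp: not_le[symmetric])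
    have "s = s powr (1 - b) * s powr b" using sp by (simp add: powr_add[symmetric])
    then have eq: "2 * T * s = v * (c * s powr b)" using T unfolding s1 by (simp add: field_simps)
    have "prob {\<omega>\<in>space M. X v \<omega> \<le> T} \<le> exp (s * T - v * \<psi> s)"
      using laplace_tail[OF X, of v s "v * \<psi> s" T] E[of s v] sp vp by simp
    also have "\<dots> \<le> exp (s * T - v * (c * s powr b))"
      using \<psi>(3)[OF ss] vp by simp
    also have "\<dots> = exp (- a * v powr p)"
    proof -
      have "s = (c / (2 * T)) powr p * v powr p"
        unfolding s_def using vp T \<psi> by (simp add: powr_mult[symmetric] mult.commute)
      then have "a * v powr p = T * s" by (simp add: a_def)
      then have "s * T - v * (c * s powr b) = - a * v powr p" unfolding eq[symmetric] by (simp add: algebra_simps)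
      then show ?thesis by simp
    qed
    finally show ?thesis .
  qed
  \<comment> \<open>For \<open>v\<close> below \<open>v0\<close> this constant lifts the claimed
    bound to at least 1, which any probability satisfies.\<close>
  define C where "C = exp (a * v0 powr p)"
  have C1: "1 \<le> C" using a v0 by (simp add: C_def)
  have "prob {\<omega>\<in>space M. X v \<omega> \<le> T} \<le> C * exp (- a * v powr p)" if v: "0 \<le> v" for v
  proof (cases "v0 \<le> v")
    case True
    have "1 * exp (- a * v powr p) \<le> C * exp (- a * v powr p)" using C1 by (intro mult_right_mono) auto
    then show ?thesis using big[OF True] by linarith
  next
    case False
    then have "v powr p \<le> v0 powr p" using v p by (intro powr_mono2) auto
    then have "1 \<le> C * exp (- a * v powr p)" unfolding C_def exp_add[symmetric] using a by (simp add: exp_add[symmetric])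
    then show ?thesis using prob_le_1 order_trans by blast
  qed
  then show ?thesis using C1 a unfolding p_def by (intro exI[of _ C] conjI exI[of _ a]) auto
qed

subsection \<open>The scheme in operational time\<close>

lemma square_sum3_le: "(a + b + c)\<^sup>2 \<le> 3 * a\<^sup>2 + 3 * b\<^sup>2 + 3 * (c::real)\<^sup>2"
proof -
  have "0 \<le> (a - b)\<^sup>2 + (b - c)\<^sup>2 + (a - c)\<^sup>2" by simp
  then show ?thesis by (simp add: power2_eq_square algebra_simps)
qed

lemma square_weighted_sum_le:
  fixes y :: "nat \<Rightarrow> real"
  assumes "0 \<le> e"
  shows "(\<Sum>k<m. e * y k)\<^sup>2 \<le> (real m * e) * (\<Sum>k<m. e * (y k)\<^sup>2)"
proof -
  have "(\<Sum>k<m. y k * 1)\<^sup>2 \<le> (\<Sum>k<m. (y k)\<^sup>2) * (\<Sum>k<m. 1\<^sup>2)"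
    by (rule Cauchy_Schwarz_ineq_sum)
  then have "e\<^sup>2 * (\<Sum>k<m. y k)\<^sup>2 \<le> e\<^sup>2 * ((\<Sum>k<m. (y k)\<^sup>2) * real m)"
    by (intro mult_left_mono) auto
  then show ?thesis by (simp add: sum_distrib_left[symmetric] power_mult_distrib power2_eq_square ac_simps)
qed

lemma discrete_gronwall:
  fixes f :: "nat \<Rightarrow> real"
  assumes f: "\<And>n. n \<le> N \<Longrightarrow> f n \<le> c + b * (\<Sum>k<n. f k)" and b: "0 \<le> b"
  shows "n \<le> N \<Longrightarrow> f n \<le> c * (1 + b) ^ n"
proof (induction n rule: less_induct)
  case (less n)
  have "b * (\<Sum>k<n. f k) \<le> b * (\<Sum>k<n. c * (1 + b) ^ k)"
    using less b by (intro mult_left_mono sum_mono) auto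
  moreover have "c + b * (\<Sum>k<n. c * (1 + b) ^ k) = c * (1 + b) ^ n"
    by (induction n) (auto simp: algebra_simps)
  ultimately show ?case using f[of n] less.prems by linarith
qed

text \<open>Approximation from the left matters for step processes on left-open cells: rationals to
  the right of \<open>t\<close> may already belong to the next cell. Passing to rational times keeps
  suprema measurable.\<close>

lemma left_rational_bound:
  fixes f :: "real \<Rightarrow> real"
  assumes f: "continuous_on {a..b} f" and t: "a < t" "t \<le> b"
    and c: "\<And>r. r \<in> \<rat> \<Longrightarrow> a < r \<Longrightarrow> r < t \<Longrightarrow> f r \<le> c"
  shows "f t \<le> c"
proof (rule ccontr)
  assume "\<not> f t \<le> c"
  then have pos: "0 < f t - c" by simp
  have "t \<in> {a..b}" using t by simp
  with f[unfolded continuous_on_iff] pos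
  have "\<exists>d>0. \<forall>x\<in>{a..b}. dist x t < d \<longrightarrow> dist (f x) (f t) < f t - c" by blast
  then obtain d where d: "0 < d" "\<And>x. x \<in> {a..b} \<Longrightarrow> dist x t < d \<Longrightarrow> dist (f x) (f t) < f t - c"
    by blast
  have "max a (t - d) < t" using t d by auto
  then obtain r where r: "r \<in> \<rat>" "max a (t - d) < r" "r < t" using Rats_dense_in_real by blast
  then have "dist (f r) (f t) < f t - c" using t by (intro d(2)) (auto simp: dist_real_def)
  moreover have "f r \<le> c" using r by (intro c) auto
  ultimately show False by (auto simp: dist_real_def)
qed

lemma rational_bound:
  fixes f :: "real \<Rightarrow> real"
  assumes f: "continuous_on {0..T} f" and r: "0 \<le> r" "r \<le> T"
    and b: "\<And>t. t \<in> \<rat> \<Longrightarrow> 0 \<le> t \<Longrightarrow> t \<le> r \<Longrightarrow> f t \<le> c"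
  shows "f r \<le> c"
proof (cases "r = 0")
  case True
  then show ?thesis using b[of 0] by simp
next
  case False
  show ?thesis
  proof (rule left_rational_bound[OF f _ r(2)])
    show "0 < r" using False r by simp
    show "f s \<le> c" if "s \<in> \<rat>" "0 < s" "s < r" for s using that by (intro b) auto
  qed
qed

text \<open>Uniform continuity, phrased for the mesh \<open>T / real (Suc n)\<close> of the
  partitions used in the Riemann sums.\<close>

lemma uniform_modulus:
  fixes f :: "real \<Rightarrow> real"
  assumes "continuous_on {0..T} f" "0 < \<kappa>"
  shows "\<forall>\<^sub>F n in sequentially. \<forall>a b. 0 \<le> a \<longrightarrow> a \<le> T \<longrightarrow> 0 \<le> b \<longrightarrow> b \<le> T \<longrightarrow>
    \<bar>a - b\<bar> \<le> T / real (Suc n) \<longrightarrow> \<bar>f a - f b\<bar> \<le> \<kappa>"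
proof -
  have "uniformly_continuous_on {0..T} f"
    by (rule compact_uniformly_continuous[OF assms(1)]) simp
  then obtain d where d: "0 < d" "\<And>a b. a \<in> {0..T} \<Longrightarrow> b \<in> {0..T} \<Longrightarrow> dist b a < d \<Longrightarrow> dist (f b) (f a) < \<kappa>"
    unfolding uniformly_continuous_on_def using assms(2) by blast
  have "(\<lambda>n. T / real (Suc n)) \<longlonglongrightarrow> 0" by (rule LIMSEQ_Suc[OF lim_const_over_n])
  then have "\<forall>\<^sub>F n in sequentially. T / real (Suc n) < d" using d(1) by (rule order_tendstoD)
  then show ?thesis
  proof eventually_elim
    case (elim n)
    show ?case
    proof (intro allI impI)
      fix a b assume "0 \<le> a" "a \<le> T" "0 \<le> b" "b \<le> T" "\<bar>a - b\<bar> \<le> T / real (Suc n)"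
      then have "dist (f a) (f b) < \<kappa>" using elim by (intro d(2)) (auto simp: dist_real_def)
      then show "\<bar>f a - f b\<bar> \<le> \<kappa>" by (simp add: dist_real_def)
    qed
  qed
qed

text \<open>The random time is rounded up to a multiple of \<open>1 / (n + 1)\<close>, where only
  countably many variables \<open>W t\<close> occur; path continuity gives the limit.\<close>

lemma continuous_process_random_time:
  fixes W :: "real \<Rightarrow> 'a \<Rightarrow> real"
  assumes W_meas: "\<And>t. 0 \<le> t \<Longrightarrow> W t \<in> borel_measurable M"
    and W_cont: "\<And>\<omega>. \<omega> \<in> space M \<Longrightarrow> continuous_on {0..} (\<lambda>t. W t \<omega>)"
    and [measurable]: "\<tau> \<in> borel_measurable M" and \<tau>: "\<And>\<omega>. \<omega> \<in> space M \<Longrightarrow> 0 \<le> \<tau> \<omega>"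
  shows "(\<lambda>\<omega>. W (\<tau> \<omega>) \<omega>) \<in> borel_measurable M"
proof (rule borel_measurable_LIMSEQ_real)
  fix n
  have "(\<lambda>\<omega>. (\<lambda>k \<omega>. W (real k / real (Suc n)) \<omega>) (nat \<lceil>\<tau> \<omega> * real (Suc n)\<rceil>) \<omega>) \<in> borel_measurable M"
    by (rule measurable_compose_countable) (auto intro: W_meas)
  then show "(\<lambda>\<omega>. W (real (nat \<lceil>\<tau> \<omega> * real (Suc n)\<rceil>) / real (Suc n)) \<omega>) \<in> borel_measurable M" by simp
next
  fix \<omega> assume w: "\<omega> \<in> space M"
  have "(\<lambda>n. real (nat \<lceil>\<tau> \<omega> * real (Suc n)\<rceil>) / real (Suc n)) \<longlonglongrightarrow> \<tau> \<omega>"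
  proof (rule tendsto_sandwich[OF _ _ tendsto_const])
    have b: "\<tau> \<omega> * real (Suc n) \<le> real (nat \<lceil>\<tau> \<omega> * real (Suc n)\<rceil>)"
      "real (nat \<lceil>\<tau> \<omega> * real (Suc n)\<rceil>) \<le> \<tau> \<omega> * real (Suc n) + 1" for n
    proof -
      have "0 \<le> \<tau> \<omega> * real (Suc n)" using \<tau>[OF w] by simp
      then show "\<tau> \<omega> * real (Suc n) \<le> real (nat \<lceil>\<tau> \<omega> * real (Suc n)\<rceil>)"
        "real (nat \<lceil>\<tau> \<omega> * real (Suc n)\<rceil>) \<le> \<tau> \<omega> * real (Suc n) + 1"
        by linarith+
    qed
    show "\<forall>\<^sub>F n in sequentially. \<tau> \<omega> \<le> real (nat \<lceil>\<tau> \<omega> * real (Suc n)\<rceil>) / real (Suc n)"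
      using b(1) by (intro always_eventually allI) (simp add: pos_le_divide_eq del: of_nat_Suc)
    have "real (nat \<lceil>\<tau> \<omega> * real (Suc n)\<rceil>) / real (Suc n) \<le> \<tau> \<omega> + 1 / real (Suc n)" for n
    proof -
      have "real (nat \<lceil>\<tau> \<omega> * real (Suc n)\<rceil>) / real (Suc n) \<le> (\<tau> \<omega> * real (Suc n) + 1) / real (Suc n)"
        by (intro divide_right_mono b) simp
      also have "\<dots> = \<tau> \<omega> + 1 / real (Suc n)" by (simp add: add_divide_distrib del: of_nat_Suc)
      finally show ?thesis .
    qed
    then show "\<forall>\<^sub>F n in sequentially. real (nat \<lceil>\<tau> \<omega> * real (Suc n)\<rceil>) / real (Suc n) \<le> \<tau> \<omega> + 1 / real (Suc n)"
      by (intro always_eventually) auto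
    show "(\<lambda>n. \<tau> \<omega> + 1 / real (Suc n)) \<longlonglongrightarrow> \<tau> \<omega>"
      using tendsto_add[OF tendsto_const LIMSEQ_Suc[OF lim_1_over_n], of "\<tau> \<omega>"] by simp
  qed
  then show "(\<lambda>n. W (real (nat \<lceil>\<tau> \<omega> * real (Suc n)\<rceil>) / real (Suc n)) \<omega>) \<longlonglongrightarrow> W (\<tau> \<omega>) \<omega>"
  proof (rule continuous_on_tendsto_compose[OF W_cont[OF w]])
    show "\<tau> \<omega> \<in> {0..}" using \<tau>[OF w] by simp
    show "\<forall>\<^sub>F n in sequentially. real (nat \<lceil>\<tau> \<omega> * real (Suc n)\<rceil>) / real (Suc n) \<in> {0..}"
      unfolding atLeast_iff by (intro always_eventually allI divide_nonneg_nonneg of_nat_0_le_iff)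
  qed
qed

text \<open>Path properties are required for every \<open>\<omega>\<close>, after a modification on
  a null set. \<open>X_adapted\<close> is adaptedness to the time-changed filtration, read in
  operational time: on \<open>t \<le> D v\<close> the value of \<open>X t\<close> is known at
  \<open>v\<close>. In \<open>I_limit\<close> the sequence \<open>r\<close> selects partitions along
  which the left Riemann sums converge almost surely.\<close>

locale euler_setup = filtered_brownian M Fil W + sde_coefficients H h F G K \<theta>
  for M :: "'a measure" and Fil W H h F G K \<theta> +
  fixes D X I :: "real \<Rightarrow> 'a \<Rightarrow> real" and T x0 :: real
  assumes paths: "\<And>\<omega>. \<omega> \<in> space M \<Longrightarrow> time_change_path (\<lambda>u. D u \<omega>)"
    and D_adapted: "\<And>v. 0 \<le> v \<Longrightarrow> D v \<in> borel_measurable (Fil v)"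
    and T_pos: "0 < T"
    and X_cont: "\<And>\<omega>. \<omega> \<in> space M \<Longrightarrow> continuous_on {0..T} (\<lambda>t. X t \<omega>)"
    and X_meas: "\<And>t. 0 \<le> t \<Longrightarrow> t \<le> T \<Longrightarrow> X t \<in> borel_measurable M"
    and X_adapted: "\<And>t v. 0 \<le> t \<Longrightarrow> t \<le> T \<Longrightarrow> 0 \<le> v \<Longrightarrow>
      (\<lambda>\<omega>. if t \<le> D v \<omega> then X t \<omega> else 0) \<in> borel_measurable (Fil v)"
    and sde: "AE \<omega> in M. \<forall>t\<in>{0..T}. X t \<omega> = x0
       + (LINT r:{0<..t}|lborel. H (inverse_path (\<lambda>u. D u \<omega>) r))
       + (LINT r:{0<..t}|interval_measure (inverse_path (\<lambda>u. D u \<omega>)).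
            F (inverse_path (\<lambda>u. D u \<omega>) r) (X r \<omega>)) + I t \<omega>"
    and I_limit: "\<exists>r. filterlim r at_top sequentially \<and> (AE \<omega> in M. \<forall>q\<in>\<rat> \<inter> {0..T}.
       (\<lambda>n. \<Sum>i<Suc (r n). G (inverse_path (\<lambda>u. D u \<omega>) (real i * T / real (Suc (r n)))) (X (real i * T / real (Suc (r n))) \<omega>)
          * (W (inverse_path (\<lambda>u. D u \<omega>) (min q (real (Suc i) * T / real (Suc (r n))))) \<omega>
           - W (inverse_path (\<lambda>u. D u \<omega>) (min q (real i * T / real (Suc (r n))))) \<omega>)) \<longlonglongrightarrow> I q \<omega>)"
begin

definition E :: "real \<Rightarrow> 'a \<Rightarrow> real" where
  "E t \<omega> = inverse_path (\<lambda>u. D u \<omega>) t"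

lemma D_meas: "0 \<le> v \<Longrightarrow> D v \<in> borel_measurable M"
  using Fil_M[OF D_adapted] .

text \<open>Below the level \<open>v\<close> the event \<open>E t \<le> y\<close> is
  \<open>t \<le> D y\<close>, which is known at time \<open>y\<close> and hence at
  \<open>v\<close>.\<close>

lemma E_min_adapted:
  assumes "0 \<le> v"
  shows "(\<lambda>\<omega>. min (E t \<omega>) v) \<in> borel_measurable (Fil v)"
proof (rule borel_measurableI_le)
  fix y :: real
  show "{\<omega> \<in> space (Fil v). min (E t \<omega>) v \<le> y} \<in> sets (Fil v)"
  proof (cases "v \<le> y")
    case True
    then have "{\<omega> \<in> space (Fil v). min (E t \<omega>) v \<le> y} = space (Fil v)" by auto
    then show ?thesis using sets.top[of "Fil v"] by metis
  next
    case vy: False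
    show ?thesis
    proof (cases "0 \<le> y")
      case True
      have [measurable]: "D y \<in> borel_measurable (Fil v)" using vy True by (intro Fil_le[OF D_adapted]) auto
      have "{\<omega> \<in> space (Fil v). min (E t \<omega>) v \<le> y} = {\<omega> \<in> space (Fil v). t \<le> D y \<omega>}"
        using vy time_change_path.inv_le_iff[OF paths True] by (auto simp: E_def min_le_iff_disj)
      moreover have "{\<omega> \<in> space (Fil v). t \<le> D y \<omega>} \<in> sets (Fil v)" by measurable
      ultimately show ?thesis by simp
    next
      case False
      then have "{\<omega> \<in> space (Fil v). min (E t \<omega>) v \<le> y} = {}"
        using vy assms time_change_path.inv_nonneg[OF paths, of _ t] by (force simp: E_def min_le_iff_disj)
      then show ?thesis by (simp only: sets.empty_sets)
    qed
  qed
qed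

lemma E_nonneg: "\<omega> \<in> space M \<Longrightarrow> 0 \<le> E t \<omega>"
  unfolding E_def by (rule time_change_path.inv_nonneg[OF paths])

lemma E_le_iff: "\<omega> \<in> space M \<Longrightarrow> 0 \<le> v \<Longrightarrow> E t \<omega> \<le> v \<longleftrightarrow> t \<le> D v \<omega>"
  unfolding E_def by (rule time_change_path.inv_le_iff[OF paths])

lemma E_meas [measurable]: "E t \<in> borel_measurable M"
proof (rule borel_measurable_LIMSEQ_real)
  fix \<omega> assume "\<omega> \<in> space M"
  have "\<forall>\<^sub>F n in sequentially. E t \<omega> \<le> real n"
    using filterlim_real_sequentially by (simp add: filterlim_at_top)
  then have "\<forall>\<^sub>F n in sequentially. min (E t \<omega>) (real n) = E t \<omega>" by eventually_elim simp
  then show "(\<lambda>n. min (E t \<omega>) (real n)) \<longlonglongrightarrow> E t \<omega>" by (rule tendsto_eventually)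
qed (rule Fil_M[OF E_min_adapted], simp)

lemma W_random_time:
  assumes "\<tau> \<in> borel_measurable M" "\<And>\<omega>. \<omega> \<in> space M \<Longrightarrow> 0 \<le> \<tau> \<omega>"
  shows "(\<lambda>\<omega>. W (\<tau> \<omega>) \<omega>) \<in> borel_measurable M"
  by (rule continuous_process_random_time[OF W_meas W_cont assms])

lemma coefficient_cont: "0 \<le> u \<Longrightarrow> continuous_on UNIV (F u)" "0 \<le> u \<Longrightarrow> continuous_on UNIV (G u)"
proof -
  assume u: "0 \<le> u"
  have p: "continuous_on UNIV (\<lambda>x::real. (u, x))" by (intro continuous_intros)
  show "continuous_on UNIV (F u)"
    using continuous_on_compose2[OF F_cont p] u by auto
  show "continuous_on UNIV (G u)"
    using continuous_on_compose2[OF G_cont p] u by auto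
qed

lemma coefficient_meas: "0 \<le> u \<Longrightarrow> F u \<in> borel_measurable borel" "0 \<le> u \<Longrightarrow> G u \<in> borel_measurable borel"
  using coefficient_cont by (auto intro: borel_measurable_continuous_onI)

end

section \<open>Second moments of the scheme up to operational time \<open>U\<close>\<close>

locale euler_step = euler_setup M Fil W H h F G K \<theta> D X I T x0
  for M :: "'a measure" and Fil W H h F G K \<theta> D X I T x0 +
  fixes \<delta> :: real and m0 :: nat
  assumes delta: "0 < \<delta>" "\<delta> < 1"
begin

definition xg :: "nat \<Rightarrow> 'a \<Rightarrow> real" where
  "xg n \<omega> = euler_grid H F G x0 \<delta> (\<lambda>u. D u \<omega>) (\<lambda>u. W u \<omega>) n"

definition xd :: "real \<Rightarrow> 'a \<Rightarrow> real" where
  "xd t \<omega> = euler_maruyama H F G x0 \<delta> (\<lambda>u. D u \<omega>) (\<lambda>u. W u \<omega>) t"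

definition U :: real where "U = real m0 * \<delta>"

text \<open>The grid values inherit from \<open>D\<close> a possible lack of moments, through
  \<open>H\<close>. On \<open>D (n * \<delta>) \<le> T\<close> this part is at most
  \<open>h U * T\<close>, hence the cut-off. It is known at \<open>n * \<delta>\<close>, so
  \<open>z n\<close> may multiply the following Brownian increment.\<close>

definition z :: "nat \<Rightarrow> 'a \<Rightarrow> real" where
  "z n \<omega> = (if D (real n * \<delta>) \<omega> \<le> T then 1 + \<bar>xg n \<omega>\<bar> else 0)"

lemma error_path: "\<omega> \<in> space M \<Longrightarrow> euler_error_path H h F G K \<theta> (\<lambda>u. D u \<omega>) \<delta>"
  using delta by (intro euler_error_path.intro sde_coefficients_axioms euler_path.intro paths euler_path_axioms.intro)

lemma U_nonneg: "0 \<le> U" using delta by (simp add: U_def)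

lemma hU_nonneg: "0 \<le> h U" using h_nonneg U_nonneg by simp

lemma grid_le_U: "n \<le> m0 \<Longrightarrow> real n * \<delta> \<le> U"
  using delta by (simp add: U_def)

lemma xg_adapted: "xg n \<in> borel_measurable (Fil (real n * \<delta>))"
proof (induction n)
  case 0
  then show ?case by (simp add: xg_def[abs_def])
next
  case (Suc n)
  have t: "0 \<le> real n * \<delta>" "real n * \<delta> \<le> real (Suc n) * \<delta>" using delta by (auto simp: algebra_simps)
  have [measurable]: "xg n \<in> borel_measurable (Fil (real (Suc n) * \<delta>))"
    "D (real n * \<delta>) \<in> borel_measurable (Fil (real (Suc n) * \<delta>))" "W (real n * \<delta>) \<in> borel_measurable (Fil (real (Suc n) * \<delta>))"
    by (rule Fil_le[OF Suc t(2)] Fil_le[OF D_adapted[OF t(1)] t(2)] Fil_le[OF W_adapted[OF t(1)] t(2)])+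
  have [measurable]: "D (real (Suc n) * \<delta>) \<in> borel_measurable (Fil (real (Suc n) * \<delta>))"
     "W (real (Suc n) * \<delta>) \<in> borel_measurable (Fil (real (Suc n) * \<delta>))"
    by (rule D_adapted W_adapted, use t in linarith)+
  note [measurable] = coefficient_meas[OF t(1)]
  have eq: "xg (Suc n) \<omega> = xg n \<omega> + H (real n * \<delta>) * (D (real (Suc n) * \<delta>) \<omega> - D (real n * \<delta>) \<omega>)
    + F (real n * \<delta>) (xg n \<omega>) * \<delta> + G (real n * \<delta>) (xg n \<omega>) * (W (real (Suc n) * \<delta>) \<omega> - W (real n * \<delta>) \<omega>)" for \<omega>
    by (simp add: xg_def Let_def)
  show ?case unfolding eq[abs_def] by measurable
qed

lemma xg_meas [measurable]: "xg n \<in> borel_measurable M"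
  by (rule Fil_M[OF xg_adapted])

lemma z_adapted: "z n \<in> borel_measurable (Fil (real n * \<delta>))"
proof -
  have [measurable]: "xg n \<in> borel_measurable (Fil (real n * \<delta>))" "D (real n * \<delta>) \<in> borel_measurable (Fil (real n * \<delta>))"
    using delta by (auto intro: xg_adapted D_adapted)
  show ?thesis unfolding z_def[abs_def] by measurable
qed

lemma z_meas [measurable]: "z n \<in> borel_measurable M"
  by (rule Fil_M[OF z_adapted])

lemma z_nonneg: "0 \<le> z n \<omega>" by (simp add: z_def)

definition c0 :: real where "c0 = 1 + \<bar>x0\<bar> + h U * T"

text \<open>The bound of the discrete Gronwall inequality with factor
  \<open>3 * (h U)\<^sup>2 * (U + 1) * \<delta>\<close> over at most \<open>m0\<close> steps;
  \<open>\<delta>\<close> enters it only through \<open>U\<close>.\<close>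

definition A :: real where "A = 3 * c0\<^sup>2 * exp (3 * (h U)\<^sup>2 * (U + 1) * U)"

lemma D_grid_mono: "\<omega> \<in> space M \<Longrightarrow> k \<le> n \<Longrightarrow> D (real k * \<delta>) \<omega> \<le> D (real n * \<delta>) \<omega>"
  using time_change_path.le_iff[OF paths, of \<omega> "real k * \<delta>" "real n * \<delta>"] delta by simp

text \<open>If step \<open>n\<close> is not cut off, no earlier one is, so the indicators may be
  inserted into the Brownian sum. The increments of \<open>D\<close> in the \<open>H\<close> sum
  telescope to \<open>D (n * \<delta>) \<le> T\<close>.\<close>

lemma z_le:
  assumes w: "\<omega> \<in> space M" and n: "n \<le> m0"
  shows "z n \<omega> \<le> c0 + (\<Sum>k<n. \<delta> * (h U * z k \<omega>))
    + \<bar>\<Sum>k<n. (if D (real k * \<delta>) \<omega> \<le> T then G (real k * \<delta>) (xg k \<omega>) else 0) * (W (real (Suc k) * \<delta>) \<omega> - W (real k * \<delta>) \<omega>)\<bar>"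
proof (cases "D (real n * \<delta>) \<omega> \<le> T")
  case False
  then show ?thesis
    using hU_nonneg T_pos delta z_nonneg
    by (simp add: z_def[of n] c0_def add_nonneg_nonneg sum_nonneg)
next
  case True
  have ind: "D (real k * \<delta>) \<omega> \<le> T" if "k \<le> n" for k
    using D_grid_mono[OF w that] True by simp
  have "xg i \<omega> = x0 + (\<Sum>k<i. H (real k * \<delta>) * (D (real (Suc k) * \<delta>) \<omega> - D (real k * \<delta>) \<omega>))
      + (\<Sum>k<i. F (real k * \<delta>) (xg k \<omega>) * \<delta>)
      + (\<Sum>k<i. G (real k * \<delta>) (xg k \<omega>) * (W (real (Suc k) * \<delta>) \<omega> - W (real k * \<delta>) \<omega>))" for i
    by (induction i) (simp_all add: xg_def Let_def)
  note eq = this[of n]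
  have "\<bar>\<Sum>k<n. H (real k * \<delta>) * (D (real (Suc k) * \<delta>) \<omega> - D (real k * \<delta>) \<omega>)\<bar>
      \<le> (\<Sum>k<n. h U * (D (real (Suc k) * \<delta>) \<omega> - D (real k * \<delta>) \<omega>))"
  proof (rule order_trans[OF sum_abs sum_mono])
    fix k assume "k \<in> {..<n}"
    then have "real k * \<delta> \<le> U" using grid_le_U[of k] n by simp
    then show "\<bar>H (real k * \<delta>) * (D (real (Suc k) * \<delta>) \<omega> - D (real k * \<delta>) \<omega>)\<bar> \<le> h U * (D (real (Suc k) * \<delta>) \<omega> - D (real k * \<delta>) \<omega>)"
      unfolding abs_mult using growth_le(1)[of "real k * \<delta>" U] delta D_grid_mono[OF w, of k "Suc k"]
      by (intro mult_mono) auto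
  qed
  also have "\<dots> = h U * (D (real n * \<delta>) \<omega> - D 0 \<omega>)"
    using sum_lessThan_telescope[of "\<lambda>k. D (real k * \<delta>) \<omega>" n] by (simp add: sum_distrib_left[symmetric])
  also have "\<dots> \<le> h U * T"
    using True time_change_path.zero[OF paths[OF w]] hU_nonneg by (intro mult_left_mono) auto
  finally have 1: "\<bar>\<Sum>k<n. H (real k * \<delta>) * (D (real (Suc k) * \<delta>) \<omega> - D (real k * \<delta>) \<omega>)\<bar> \<le> h U * T" .
  have 2: "\<bar>\<Sum>k<n. F (real k * \<delta>) (xg k \<omega>) * \<delta>\<bar> \<le> (\<Sum>k<n. \<delta> * (h U * z k \<omega>))"
  proof (rule order_trans[OF sum_abs sum_mono])
    fix k assume k: "k \<in> {..<n}"
    then have "real k * \<delta> \<le> U" using grid_le_U[of k] n by simp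
    then show "\<bar>F (real k * \<delta>) (xg k \<omega>) * \<delta>\<bar> \<le> \<delta> * (h U * z k \<omega>)"
      using growth_le(2)[of "real k * \<delta>" U "xg k \<omega>"] delta ind[of k] k by (simp add: abs_mult z_def)
  qed
  have 3: "(\<Sum>k<n. (if D (real k * \<delta>) \<omega> \<le> T then G (real k * \<delta>) (xg k \<omega>) else 0) * (W (real (Suc k) * \<delta>) \<omega> - W (real k * \<delta>) \<omega>))
     = (\<Sum>k<n. G (real k * \<delta>) (xg k \<omega>) * (W (real (Suc k) * \<delta>) \<omega> - W (real k * \<delta>) \<omega>))"
    by (intro sum.cong refl) (use ind in auto)
  have "z n \<omega> = 1 + \<bar>xg n \<omega>\<bar>" using True by (simp add: z_def)
  then show ?thesis unfolding 3 c0_def using 1 2 eq by linarith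
qed

definition gg :: "nat \<Rightarrow> 'a \<Rightarrow> real" where
  "gg k \<omega> = (if D (real k * \<delta>) \<omega> \<le> T then G (real k * \<delta>) (xg k \<omega>) else 0)"

lemma gg_adapted: "gg k \<in> borel_measurable (Fil (real k * \<delta>))"
proof -
  have k: "0 \<le> real k * \<delta>" using delta by simp
  have [measurable]: "xg k \<in> borel_measurable (Fil (real k * \<delta>))" "D (real k * \<delta>) \<in> borel_measurable (Fil (real k * \<delta>))"
    using k by (auto intro: xg_adapted D_adapted)
  note [measurable] = coefficient_meas[OF k]
  show ?thesis unfolding gg_def[abs_def] by measurable
qed

lemma gg_le: "k \<le> m0 \<Longrightarrow> \<bar>gg k \<omega>\<bar> \<le> h U * z k \<omega>"
  using growth_le(3)[of "real k * \<delta>" U "xg k \<omega>"] delta grid_le_U[of k] by (simp add: gg_def z_def)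

text \<open>Integrability and estimate share one strong induction, since the isometry at step
  \<open>n\<close> needs the earlier moments to be finite. In \<open>U + 1\<close> the
  \<open>U\<close> comes from the Cauchy-Schwarz inequality for the \<open>F\<close> sum and the 1
  from the isometry.\<close>

lemma z_square:
  assumes "n \<le> m0"
  shows "integrable M (\<lambda>\<omega>. (z n \<omega>)\<^sup>2) \<and>
    (\<integral>\<omega>. (z n \<omega>)\<^sup>2 \<partial>M) \<le> 3 * c0\<^sup>2 + (3 * (h U)\<^sup>2 * (U + 1) * \<delta>) * (\<Sum>k<n. (\<integral>\<omega>. (z k \<omega>)\<^sup>2 \<partial>M))"
  using assms
proof (induction n rule: less_induct)
  case (less n)
  have zi: "integrable M (\<lambda>\<omega>. (z k \<omega>)\<^sup>2)" if "k < n" for k using less that by auto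
  have gi: "integrable M (\<lambda>\<omega>. (gg k \<omega>)\<^sup>2)" "(\<integral>\<omega>. (gg k \<omega>)\<^sup>2 \<partial>M) \<le> (h U)\<^sup>2 * (\<integral>\<omega>. (z k \<omega>)\<^sup>2 \<partial>M)" if k: "k < n" for k
  proof -
    have le: "(gg k \<omega>)\<^sup>2 \<le> (h U)\<^sup>2 * (z k \<omega>)\<^sup>2" for \<omega>
      using gg_le[of k \<omega>] k less.prems power_mono[of "\<bar>gg k \<omega>\<bar>" "h U * z k \<omega>" 2] by (simp add: power_mult_distrib)
    show i: "integrable M (\<lambda>\<omega>. (gg k \<omega>)\<^sup>2)"
    proof (rule Bochner_Integration.integrable_bound)
      show "integrable M (\<lambda>\<omega>. (h U)\<^sup>2 * (z k \<omega>)\<^sup>2)" using zi[OF k] by simp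
    qed (use le Fil_M[OF gg_adapted] in auto)
    show "(\<integral>\<omega>. (gg k \<omega>)\<^sup>2 \<partial>M) \<le> (h U)\<^sup>2 * (\<integral>\<omega>. (z k \<omega>)\<^sup>2 \<partial>M)"
      using integral_mono[OF i, of "\<lambda>\<omega>. (h U)\<^sup>2 * (z k \<omega>)\<^sup>2"] zi[OF k] le by simp
  qed
  define P where "P \<omega> = simple_int \<delta> n gg (real n * \<delta>) \<omega>" for \<omega>
  have P_eq: "P \<omega> = (\<Sum>k<n. gg k \<omega> * (W (real (Suc k) * \<delta>) \<omega> - W (real k * \<delta>) \<omega>))" for \<omega>
    unfolding P_def simple_int_def
  proof (intro sum.cong refl)
    fix k assume "k \<in> {..<n}"
    then have "real k * \<delta> \<le> real n * \<delta>" "real (Suc k) * \<delta> \<le> real n * \<delta>"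
      using delta by (auto simp del: of_nat_Suc)
    then show "gg k \<omega> * (W (min (real n * \<delta>) (real (Suc k) * \<delta>)) \<omega> - W (min (real n * \<delta>) (real k * \<delta>)) \<omega>) =
      gg k \<omega> * (W (real (Suc k) * \<delta>) \<omega> - W (real k * \<delta>) \<omega>)"
      by (simp only: min_absorb2)
  qed
  have n0: "0 \<le> real n * \<delta>" using delta by simp
  have P2: "integrable M (\<lambda>\<omega>. (P \<omega>)\<^sup>2)" unfolding P_def
    by (rule simple_int_square[OF delta(1) gg_adapted gi(1) n0])
  have "(\<integral>\<omega>. (P \<omega>)\<^sup>2 \<partial>M) = (\<Sum>k<n. \<delta> * (\<integral>\<omega>. (gg k \<omega>)\<^sup>2 \<partial>M))"
    unfolding P_def by (rule simple_int_isometry[OF delta(1) gg_adapted gi(1)])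
  also have "\<dots> \<le> (\<Sum>k<n. \<delta> * ((h U)\<^sup>2 * (\<integral>\<omega>. (z k \<omega>)\<^sup>2 \<partial>M)))"
    using delta gi(2) by (intro sum_mono mult_left_mono) auto
  finally have PE: "(\<integral>\<omega>. (P \<omega>)\<^sup>2 \<partial>M) \<le> (\<Sum>k<n. \<delta> * ((h U)\<^sup>2 * (\<integral>\<omega>. (z k \<omega>)\<^sup>2 \<partial>M)))" .
  define B where "B \<omega> = 3 * c0\<^sup>2 + 3 * (U * (\<Sum>k<n. \<delta> * ((h U)\<^sup>2 * (z k \<omega>)\<^sup>2))) + 3 * (P \<omega>)\<^sup>2" for \<omega>
  have zB: "(z n \<omega>)\<^sup>2 \<le> B \<omega>" if w: "\<omega> \<in> space M" for \<omega>
  proof -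
    have "(z n \<omega>)\<^sup>2 \<le> (c0 + (\<Sum>k<n. \<delta> * (h U * z k \<omega>)) + \<bar>P \<omega>\<bar>)\<^sup>2"
      using z_le[OF w less.prems] z_nonneg unfolding P_eq gg_def by (intro power_mono) auto
    also have "\<dots> \<le> 3 * c0\<^sup>2 + 3 * (\<Sum>k<n. \<delta> * (h U * z k \<omega>))\<^sup>2 + 3 * (P \<omega>)\<^sup>2"
      using square_sum3_le[of c0 "\<Sum>k<n. \<delta> * (h U * z k \<omega>)" "\<bar>P \<omega>\<bar>"] by simp
    also have "(\<Sum>k<n. \<delta> * (h U * z k \<omega>))\<^sup>2 \<le> (real n * \<delta>) * (\<Sum>k<n. \<delta> * (h U * z k \<omega>)\<^sup>2)"
      using delta by (intro square_weighted_sum_le) auto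
    also have "\<dots> \<le> U * (\<Sum>k<n. \<delta> * (h U * z k \<omega>)\<^sup>2)"
      using grid_le_U[OF less.prems] delta by (intro mult_right_mono sum_nonneg) auto
    finally show ?thesis by (simp add: B_def power_mult_distrib)
  qed
  have Bi: "integrable M B"
    unfolding B_def[abs_def] using zi P2
    by (intro Bochner_Integration.integrable_add integrable_mult_right Bochner_Integration.integrable_sum) auto
  have zn: "integrable M (\<lambda>\<omega>. (z n \<omega>)\<^sup>2)"
  proof (rule Bochner_Integration.integrable_bound[OF Bi])
    show "AE \<omega> in M. norm ((z n \<omega>)\<^sup>2) \<le> norm (B \<omega>)"
      using zB by (intro AE_I2) (smt (verit) real_norm_def zero_le_power2)
  qed measurable
  have "(\<integral>\<omega>. (z n \<omega>)\<^sup>2 \<partial>M) \<le> (\<integral>\<omega>. B \<omega> \<partial>M)"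
    using zB by (intro integral_mono zn Bi)
  also have "\<dots> = 3 * c0\<^sup>2 + 3 * (U * (\<Sum>k<n. \<delta> * ((h U)\<^sup>2 * (\<integral>\<omega>. (z k \<omega>)\<^sup>2 \<partial>M)))) + 3 * (\<integral>\<omega>. (P \<omega>)\<^sup>2 \<partial>M)"
  proof -
    define Y where "Y \<omega> = (\<Sum>k<n. \<delta> * ((h U)\<^sup>2 * (z k \<omega>)\<^sup>2))" for \<omega>
    have Yi: "integrable M Y" unfolding Y_def[abs_def] using zi by (intro Bochner_Integration.integrable_sum) auto
    have "(\<integral>\<omega>. Y \<omega> \<partial>M) = (\<Sum>k<n. \<integral>\<omega>. \<delta> * ((h U)\<^sup>2 * (z k \<omega>)\<^sup>2) \<partial>M)"
      unfolding Y_def[abs_def] using zi by (intro Bochner_Integration.integral_sum) auto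
    then have "(\<integral>\<omega>. Y \<omega> \<partial>M) = (\<Sum>k<n. \<delta> * ((h U)\<^sup>2 * (\<integral>\<omega>. (z k \<omega>)\<^sup>2 \<partial>M)))" by simp
    moreover have "(\<integral>\<omega>. B \<omega> \<partial>M) = 3 * c0\<^sup>2 + 3 * (U * (\<integral>\<omega>. Y \<omega> \<partial>M)) + 3 * (\<integral>\<omega>. (P \<omega>)\<^sup>2 \<partial>M)"
      unfolding B_def[abs_def] Y_def[symmetric] using Yi P2 by (simp add: prob_space)
    ultimately show ?thesis by simp
  qed
  also have "\<dots> \<le> 3 * c0\<^sup>2 + (3 * (h U)\<^sup>2 * (U + 1) * \<delta>) * (\<Sum>k<n. (\<integral>\<omega>. (z k \<omega>)\<^sup>2 \<partial>M))"
    using PE by (simp add: sum_distrib_left[symmetric] algebra_simps)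
  finally show ?case using zn by blast
qed

lemma A_nonneg: "0 \<le> A" by (simp add: A_def)

lemma z_moment: "n \<le> m0 \<Longrightarrow> (\<integral>\<omega>. (z n \<omega>)\<^sup>2 \<partial>M) \<le> A"
proof -
  assume n: "n \<le> m0"
  define b where "b = 3 * (h U)\<^sup>2 * (U + 1) * \<delta>"
  have b: "0 \<le> b" using U_nonneg delta by (simp add: b_def)
  have "(\<integral>\<omega>. (z n \<omega>)\<^sup>2 \<partial>M) \<le> 3 * c0\<^sup>2 * (1 + b) ^ n"
    by (rule discrete_gronwall[where N=m0]) (use z_square b n in \<open>auto simp: b_def\<close>)
  also have "\<dots> \<le> 3 * c0\<^sup>2 * exp b ^ n"
    using b by (intro mult_left_mono power_mono exp_ge_add_one_self) auto
  also have "exp b ^ n = exp (real n * b)" by (simp add: exp_of_nat_mult)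
  also have "3 * c0\<^sup>2 * exp (real n * b) \<le> A"
  proof -
    have "real n * b \<le> real m0 * b" using n b by (intro mult_right_mono) auto
    also have "\<dots> = 3 * (h U)\<^sup>2 * (U + 1) * U" by (simp add: b_def U_def)
    finally show ?thesis unfolding A_def by (intro mult_left_mono) auto
  qed
  finally show ?thesis .
qed

text \<open>Doob's inequality for the integral whose only nonzero coefficient is \<open>z n\<close>,
  on block \<open>n\<close>.\<close>

lemma ex_block_sup:
  assumes n: "n < m0"
  shows "\<exists>V. V \<in> borel_measurable M \<and> integrable M (\<lambda>\<omega>. (V \<omega>)\<^sup>2) \<and>
    (\<forall>v \<omega>. \<omega> \<in> space M \<longrightarrow> real n * \<delta> \<le> v \<longrightarrow> v \<le> real (Suc n) * \<delta> \<longrightarrow>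
       z n \<omega> * \<bar>W v \<omega> - W (real n * \<delta>) \<omega>\<bar> \<le> V \<omega>) \<and>
    (\<integral>\<omega>. (V \<omega>)\<^sup>2 \<partial>M) \<le> 4 * \<delta> * A"
proof -
  define g where "g k = (if k = n then z n else (\<lambda>_. 0))" for k
  have ga: "g k \<in> borel_measurable (Fil (real k * \<delta>))" for k by (simp add: g_def z_adapted)
  have gi: "integrable M (\<lambda>\<omega>. (g k \<omega>)\<^sup>2)" for k using z_square[of n] n by (simp add: g_def)
  obtain V where V: "V \<in> borel_measurable M" "integrable M (\<lambda>\<omega>. (V \<omega>)\<^sup>2)"
    "\<And>v \<omega>. \<omega> \<in> space M \<Longrightarrow> 0 \<le> v \<Longrightarrow> v \<le> real (Suc n) * \<delta> \<Longrightarrow> \<bar>simple_int \<delta> (Suc n) g v \<omega>\<bar> \<le> V \<omega>"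
    "(\<integral>\<omega>. (V \<omega>)\<^sup>2 \<partial>M) \<le> 4 * (\<Sum>k<Suc n. \<delta> * (\<integral>\<omega>. (g k \<omega>)\<^sup>2 \<partial>M))"
    using continuous_doob[of \<delta> "Suc n" g] delta ga gi by blast
  have "(\<Sum>k<Suc n. \<delta> * (\<integral>\<omega>. (g k \<omega>)\<^sup>2 \<partial>M)) = \<delta> * (\<integral>\<omega>. (z n \<omega>)\<^sup>2 \<partial>M)"
    by (simp add: g_def)
  also have "\<dots> \<le> \<delta> * A" using z_moment[of n] n delta by (intro mult_left_mono) auto
  finally have "(\<integral>\<omega>. (V \<omega>)\<^sup>2 \<partial>M) \<le> 4 * \<delta> * A" using V(4) by linarith
  moreover have "z n \<omega> * \<bar>W v \<omega> - W (real n * \<delta>) \<omega>\<bar> \<le> V \<omega>"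
    if "\<omega> \<in> space M" "real n * \<delta> \<le> v" "v \<le> real (Suc n) * \<delta>" for v \<omega>
  proof -
    have v0: "0 \<le> v" using that(2) delta by (meson mult_nonneg_nonneg of_nat_0_le_iff less_imp_le order_trans)
    have "simple_int \<delta> (Suc n) g v \<omega> = z n \<omega> * (W v \<omega> - W (real n * \<delta>) \<omega>)"
      unfolding simple_int_def sum.lessThan_Suc using that by (simp add: g_def min_absorb1 min_absorb2)
    then show ?thesis using V(3)[OF that(1) v0 that(3)] z_nonneg[of n \<omega>] by (simp add: abs_mult)
  qed
  ultimately show ?thesis using V(1,2) by blast
qed

end

section \<open>Oscillation of the scheme inside a block\<close>

context euler_step
begin

definition V :: "nat \<Rightarrow> 'a \<Rightarrow> real" where
  "V n = (SOME V. V \<in> borel_measurable M \<and> integrable M (\<lambda>\<omega>. (V \<omega>)\<^sup>2) \<and>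
    (\<forall>v \<omega>. \<omega> \<in> space M \<longrightarrow> real n * \<delta> \<le> v \<longrightarrow> v \<le> real (Suc n) * \<delta> \<longrightarrow>
       z n \<omega> * \<bar>W v \<omega> - W (real n * \<delta>) \<omega>\<bar> \<le> V \<omega>) \<and>
    (\<integral>\<omega>. (V \<omega>)\<^sup>2 \<partial>M) \<le> 4 * \<delta> * A)"

lemma V_properties:
  assumes "n < m0"
  shows "V n \<in> borel_measurable M" "integrable M (\<lambda>\<omega>. (V n \<omega>)\<^sup>2)"
    "\<And>v \<omega>. \<omega> \<in> space M \<Longrightarrow> real n * \<delta> \<le> v \<Longrightarrow> v \<le> real (Suc n) * \<delta> \<Longrightarrow>
       z n \<omega> * \<bar>W v \<omega> - W (real n * \<delta>) \<omega>\<bar> \<le> V n \<omega>"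
    "(\<integral>\<omega>. (V n \<omega>)\<^sup>2 \<partial>M) \<le> 4 * \<delta> * A"
  using someI_ex[OF ex_block_sup[OF assms]] unfolding V_def by blast+

text \<open>The part of block \<open>n\<close> inside \<open>[0, T]\<close>, bounded even where
  \<open>D\<close> has no moments.\<close>

definition \<Delta> :: "nat \<Rightarrow> 'a \<Rightarrow> real" where
  "\<Delta> n \<omega> = min T (D (real (Suc n) * \<delta>) \<omega>) - min T (D (real n * \<delta>) \<omega>)"

text \<open>The summands bound the contributions of \<open>H\<close>, \<open>F\<close> and
  \<open>G\<close> to the oscillation in block \<open>n\<close>, in this order.\<close>

definition q :: "nat \<Rightarrow> 'a \<Rightarrow> real" where
  "q n \<omega> = h U * \<Delta> n \<omega> + h U * \<delta> * z n \<omega> + h U * V n \<omega>"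

lemma \<Delta>_meas [measurable]: "\<Delta> n \<in> borel_measurable M"
proof -
  have [measurable]: "D (real k * \<delta>) \<in> borel_measurable M" for k using delta by (intro D_meas) simp
  show ?thesis unfolding \<Delta>_def[abs_def] by measurable
qed

lemma \<Delta>_bounds:
  assumes "\<omega> \<in> space M"
  shows "0 \<le> \<Delta> n \<omega>" "\<Delta> n \<omega> \<le> T" "(\<Sum>k<n. \<Delta> k \<omega>) \<le> T"
proof -
  have "0 \<le> D (real k * \<delta>) \<omega>" for k
    using time_change_path.nonneg[OF paths[OF assms], of "real k * \<delta>"] delta by simp
  then have "0 \<le> min T (D (real n * \<delta>) \<omega>)" using T_pos by simp
  moreover have "min T (D (real n * \<delta>) \<omega>) \<le> min T (D (real (Suc n) * \<delta>) \<omega>)"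
    by (intro min.mono order_refl D_grid_mono assms) simp
  ultimately show "0 \<le> \<Delta> n \<omega>" "\<Delta> n \<omega> \<le> T"
    unfolding \<Delta>_def by linarith+
  have "(\<Sum>k<n. \<Delta> k \<omega>) = min T (D (real n * \<delta>) \<omega>) - min T (D (real 0 * \<delta>) \<omega>)"
    unfolding \<Delta>_def by (rule sum_lessThan_telescope)
  also have "\<dots> \<le> T" using time_change_path.zero[OF paths[OF assms]] T_pos by simp
  finally show "(\<Sum>k<n. \<Delta> k \<omega>) \<le> T" .
qed

lemma xd_block_le:
  assumes w: "\<omega> \<in> space M" and n: "n < m0"
    and r: "D (real n * \<delta>) \<omega> \<le> r" "r \<le> D (real (Suc n) * \<delta>) \<omega>" "r \<le> T"
  shows "\<bar>xd r \<omega> - xg n \<omega>\<bar> \<le> q n \<omega>"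
proof -
  interpret p: euler_error_path H h F G K \<theta> "\<lambda>u. D u \<omega>" "\<lambda>u. W u \<omega>" x0 \<delta> by (rule error_path[OF w])
  have z: "z n \<omega> = 1 + \<bar>xg n \<omega>\<bar>" using r by (simp add: z_def)
  have U: "real (Suc n) * \<delta> \<le> U" using grid_le_U[of "Suc n"] n by simp
  have "(1 + \<bar>xg n \<omega>\<bar>) * \<bar>W v \<omega> - W (real n * \<delta>) \<omega>\<bar> \<le> V n \<omega>"
    if "real n * \<delta> \<le> v" "v \<le> real (Suc n) * \<delta>" for v
    using V_properties(3)[OF n w that] unfolding z .
  from p.xd_block_error[OF r U, folded xg_def xd_def, OF this]
  have "\<bar>xd r \<omega> - xg n \<omega>\<bar> \<le> h U * \<Delta> n \<omega> + h U * (1 + \<bar>xg n \<omega>\<bar>) * \<delta> + h U * V n \<omega>"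
    unfolding \<Delta>_def .
  then show ?thesis unfolding q_def z by (simp only: mult_ac)
qed

lemma q_nonneg:
  assumes w: "\<omega> \<in> space M" and n: "n < m0"
  shows "0 \<le> q n \<omega>"
proof -
  have "real n * \<delta> \<le> real (Suc n) * \<delta>" using delta by simp
  from V_properties(3)[OF n w order_refl this] have "0 \<le> V n \<omega>" by simp
  then show ?thesis
    using \<Delta>_bounds(1)[OF w] z_nonneg hU_nonneg delta by (simp add: q_def)
qed

lemma q_square:
  assumes n: "n < m0"
  shows "q n \<in> borel_measurable M" "integrable M (\<lambda>\<omega>. (q n \<omega>)\<^sup>2)" "integrable M (\<lambda>\<omega>. (\<Delta> n \<omega>)\<^sup>2)"
    "(\<integral>\<omega>. (q n \<omega>)\<^sup>2 \<partial>M) \<le> 3 * (h U)\<^sup>2 * ((\<integral>\<omega>. (\<Delta> n \<omega>)\<^sup>2 \<partial>M) + \<delta>\<^sup>2 * A + 4 * \<delta> * A)"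
proof -
  note [measurable] = V_properties(1)[OF n]
  show qm: "q n \<in> borel_measurable M" unfolding q_def[abs_def] by measurable
  show D2: "integrable M (\<lambda>\<omega>. (\<Delta> n \<omega>)\<^sup>2)"
  proof (rule integrable_const_bound[where B="T\<^sup>2"])
    show "AE \<omega> in M. norm ((\<Delta> n \<omega>)\<^sup>2) \<le> T\<^sup>2"
      using \<Delta>_bounds(1,2) by (intro AE_I2) (simp add: power_mono)
  qed measurable
  note z2 = z_square[of n, THEN conjunct1] and V2 = V_properties(2)[OF n]
  define B where "B \<omega> = 3 * (h U)\<^sup>2 * (\<Delta> n \<omega>)\<^sup>2 + 3 * (h U * \<delta>)\<^sup>2 * (z n \<omega>)\<^sup>2 + 3 * (h U)\<^sup>2 * (V n \<omega>)\<^sup>2" for \<omega>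
  have qB: "(q n \<omega>)\<^sup>2 \<le> B \<omega>" for \<omega>
    unfolding q_def B_def using square_sum3_le[of "h U * \<Delta> n \<omega>" "h U * \<delta> * z n \<omega>" "h U * V n \<omega>"]
    by (simp add: power_mult_distrib mult.assoc)
  have Bi: "integrable M B" unfolding B_def[abs_def] using D2 z2 V2 n by simp
  show q2: "integrable M (\<lambda>\<omega>. (q n \<omega>)\<^sup>2)"
    by (rule Bochner_Integration.integrable_bound[OF Bi]) (use qm order_trans[OF qB abs_ge_self] in auto)
  have "(\<integral>\<omega>. (q n \<omega>)\<^sup>2 \<partial>M) \<le> (\<integral>\<omega>. B \<omega> \<partial>M)" using qB by (intro integral_mono q2 Bi)
  also have "\<dots> = 3 * (h U)\<^sup>2 * (\<integral>\<omega>. (\<Delta> n \<omega>)\<^sup>2 \<partial>M) + 3 * (h U * \<delta>)\<^sup>2 * (\<integral>\<omega>. (z n \<omega>)\<^sup>2 \<partial>M)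
      + 3 * (h U)\<^sup>2 * (\<integral>\<omega>. (V n \<omega>)\<^sup>2 \<partial>M)"
    unfolding B_def[abs_def] using D2 z2 V2 n by simp
  also have "\<dots> \<le> 3 * (h U)\<^sup>2 * (\<integral>\<omega>. (\<Delta> n \<omega>)\<^sup>2 \<partial>M) + 3 * (h U * \<delta>)\<^sup>2 * A + 3 * (h U)\<^sup>2 * (4 * \<delta> * A)"
    using z_moment[of n] V_properties(4)[OF n] n by (intro add_mono mult_left_mono) auto
  also have "\<dots> = 3 * (h U)\<^sup>2 * ((\<integral>\<omega>. (\<Delta> n \<omega>)\<^sup>2 \<partial>M) + \<delta>\<^sup>2 * A + 4 * \<delta> * A)"
    by (simp add: power_mult_distrib algebra_simps)
  finally show "(\<integral>\<omega>. (q n \<omega>)\<^sup>2 \<partial>M) \<le> \<dots>" .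
qed

text \<open>A single \<open>\<Delta> n\<close> may be as large as \<open>T\<close>, so a block need
  not be small by itself. Summed over the blocks, however, the squares are at most \<open>T\<close>
  times the sum of the \<open>\<Delta> n\<close>, hence at most \<open>T\<^sup>2\<close>. The factor
  \<open>\<delta>\<close> left in front is the source of the order 1/2.\<close>

lemma sum_q_square: "(\<Sum>n<m0. \<delta> * (\<integral>\<omega>. (q n \<omega>)\<^sup>2 \<partial>M)) \<le> 3 * (h U)\<^sup>2 * (T\<^sup>2 + 5 * U * A) * \<delta>"
proof -
  have D2: "integrable M (\<lambda>\<omega>. (\<Delta> n \<omega>)\<^sup>2)" if "n < m0" for n using q_square(3)[OF that] .
  have "(\<Sum>n<m0. \<integral>\<omega>. (\<Delta> n \<omega>)\<^sup>2 \<partial>M) = (\<integral>\<omega>. (\<Sum>n<m0. (\<Delta> n \<omega>)\<^sup>2) \<partial>M)"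
    using D2 by (intro Bochner_Integration.integral_sum[symmetric]) auto
  also have "\<dots> \<le> (\<integral>\<omega>. T\<^sup>2 \<partial>M)"
  proof (rule integral_mono)
    show "integrable M (\<lambda>\<omega>. \<Sum>n<m0. (\<Delta> n \<omega>)\<^sup>2)"
      using D2 by (intro Bochner_Integration.integrable_sum) auto
    fix \<omega> assume w: "\<omega> \<in> space M"
    have "(\<Sum>n<m0. (\<Delta> n \<omega>)\<^sup>2) \<le> (\<Sum>n<m0. T * \<Delta> n \<omega>)"
      unfolding power2_eq_square using \<Delta>_bounds[OF w] by (intro sum_mono mult_right_mono) auto
    also have "\<dots> = T * (\<Sum>n<m0. \<Delta> n \<omega>)" by (simp add: sum_distrib_left)
    also have "\<dots> \<le> T * T" using \<Delta>_bounds(3)[OF w] T_pos by (intro mult_left_mono) auto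
    finally show "(\<Sum>n<m0. (\<Delta> n \<omega>)\<^sup>2) \<le> T\<^sup>2" by (simp add: power2_eq_square)
  qed simp
  finally have 1: "(\<Sum>n<m0. \<integral>\<omega>. (\<Delta> n \<omega>)\<^sup>2 \<partial>M) \<le> T\<^sup>2" by (simp add: prob_space)
  have "(\<Sum>n<m0. \<delta> * (\<integral>\<omega>. (q n \<omega>)\<^sup>2 \<partial>M))
      \<le> (\<Sum>n<m0. \<delta> * (3 * (h U)\<^sup>2 * ((\<integral>\<omega>. (\<Delta> n \<omega>)\<^sup>2 \<partial>M) + 5 * \<delta> * A)))"
  proof (intro sum_mono mult_left_mono)
    fix n assume "n \<in> {..<m0}"
    then have n: "n < m0" by simp
    have "\<delta>\<^sup>2 * A \<le> \<delta> * A" unfolding power2_eq_square using delta A_nonneg by (intro mult_right_mono) auto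
    then have "3 * (h U)\<^sup>2 * ((\<integral>\<omega>. (\<Delta> n \<omega>)\<^sup>2 \<partial>M) + \<delta>\<^sup>2 * A + 4 * \<delta> * A)
        \<le> 3 * (h U)\<^sup>2 * ((\<integral>\<omega>. (\<Delta> n \<omega>)\<^sup>2 \<partial>M) + 5 * \<delta> * A)"
      by (intro mult_left_mono) auto
    then show "(\<integral>\<omega>. (q n \<omega>)\<^sup>2 \<partial>M) \<le> 3 * (h U)\<^sup>2 * ((\<integral>\<omega>. (\<Delta> n \<omega>)\<^sup>2 \<partial>M) + 5 * \<delta> * A)"
      using q_square(4)[OF n] by linarith
  qed (use delta in auto)
  also have "\<dots> = 3 * (h U)\<^sup>2 * \<delta> * ((\<Sum>n<m0. \<integral>\<omega>. (\<Delta> n \<omega>)\<^sup>2 \<partial>M) + 5 * (real m0 * \<delta>) * A)"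
    by (simp add: sum_distrib_left sum.distrib algebra_simps)
  also have "\<dots> \<le> 3 * (h U)\<^sup>2 * \<delta> * (T\<^sup>2 + 5 * (real m0 * \<delta>) * A)"
    using 1 delta by (intro mult_left_mono) auto
  finally show ?thesis by (simp add: U_def algebra_simps)
qed

lemma ex_grid_ge:
  assumes "\<omega> \<in> space M"
  shows "\<exists>m. t \<le> D (real m * \<delta>) \<omega>"
proof -
  interpret p: time_change_path "\<lambda>u. D u \<omega>" by (rule paths[OF assms])
  obtain u where u: "0 \<le> u" "t < D u \<omega>" using p.unbounded by blast
  obtain m where "u < real m * \<delta>" using reals_Archimedean3[OF delta(1)] by blast
  then have "D u \<omega> \<le> D (real m * \<delta>) \<omega>" using u delta by (simp add: p.le_iff)
  then show ?thesis using u by (intro exI[of _ m]) simp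
qed

lemma xd_formula:
  assumes w: "\<omega> \<in> space M" and s: "0 \<le> s" "s \<le> D (real m * \<delta>) \<omega>"
  shows "xd s \<omega> = x0 + (\<Sum>k<m. H (real k * \<delta>) * (min s (D (real (Suc k) * \<delta>) \<omega>) - min s (D (real k * \<delta>) \<omega>)))
      + (\<Sum>k<m. F (real k * \<delta>) (xg k \<omega>) * (min (E s \<omega>) (real (Suc k) * \<delta>) - min (E s \<omega>) (real k * \<delta>)))
      + (\<Sum>k<m. G (real k * \<delta>) (xg k \<omega>)
             * (W (min (E s \<omega>) (real (Suc k) * \<delta>)) \<omega> - W (min (E s \<omega>) (real k * \<delta>)) \<omega>))"
proof -
  interpret p: euler_error_path H h F G K \<theta> "\<lambda>u. D u \<omega>" "\<lambda>u. W u \<omega>" x0 \<delta> by (rule error_path[OF w])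
  show ?thesis
    using p.xd_cells[of 1 \<delta> s m] s unfolding xd_def xg_def E_def by simp
qed

text \<open>The block that contains \<open>t\<close> is random. Sums over the first \<open>m\<close>
  blocks are measurable and, for each path, agree with the scheme once \<open>m\<close> is
  large.\<close>

lemma xd_meas:
  assumes "0 \<le> t"
  shows "xd t \<in> borel_measurable M"
proof (rule borel_measurable_LIMSEQ_real)
  define f where "f m \<omega> = x0 + (\<Sum>k<m. H (real k * \<delta>) * (min t (D (real (Suc k) * \<delta>) \<omega>) - min t (D (real k * \<delta>) \<omega>)))
      + (\<Sum>k<m. F (real k * \<delta>) (xg k \<omega>) * (min (E t \<omega>) (real (Suc k) * \<delta>) - min (E t \<omega>) (real k * \<delta>)))
      + (\<Sum>k<m. G (real k * \<delta>) (xg k \<omega>)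
             * (W (min (E t \<omega>) (real (Suc k) * \<delta>)) \<omega> - W (min (E t \<omega>) (real k * \<delta>)) \<omega>))" for m \<omega>
  fix m
  have [measurable]: "D (real k * \<delta>) \<in> borel_measurable M" for k using delta by (intro D_meas) simp
  have [measurable]: "(\<lambda>\<omega>. W (min (E t \<omega>) (real k * \<delta>)) \<omega>) \<in> borel_measurable M" for k
  proof (rule W_random_time)
    show "0 \<le> min (E t \<omega>) (real k * \<delta>)" if "\<omega> \<in> space M" for \<omega> using E_nonneg[OF that] delta by simp
  qed measurable
  have k: "0 \<le> real k * \<delta>" for k using delta by simp
  note [measurable] = coefficient_meas[OF k]
  show "f m \<in> borel_measurable M" unfolding f_def[abs_def] by measurable
next
  fix \<omega> assume w: "\<omega> \<in> space M"
  obtain m where m: "t \<le> D (real m * \<delta>) \<omega>" using ex_grid_ge[OF w] by blast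
  show "(\<lambda>m. x0 + (\<Sum>k<m. H (real k * \<delta>) * (min t (D (real (Suc k) * \<delta>) \<omega>) - min t (D (real k * \<delta>) \<omega>)))
      + (\<Sum>k<m. F (real k * \<delta>) (xg k \<omega>) * (min (E t \<omega>) (real (Suc k) * \<delta>) - min (E t \<omega>) (real k * \<delta>)))
      + (\<Sum>k<m. G (real k * \<delta>) (xg k \<omega>)
             * (W (min (E t \<omega>) (real (Suc k) * \<delta>)) \<omega> - W (min (E t \<omega>) (real k * \<delta>)) \<omega>))) \<longlonglongrightarrow> xd t \<omega>"
  proof (rule tendsto_eventually, unfold eventually_sequentially, intro exI allI impI)
    fix j assume "m \<le> j"
    then have "t \<le> D (real j * \<delta>) \<omega>" using D_grid_mono[OF w] m order_trans by blast
    from xd_formula[OF w assms this, symmetric] show "x0 + (\<Sum>k<j. H (real k * \<delta>) * (min t (D (real (Suc k) * \<delta>) \<omega>) - min t (D (real k * \<delta>) \<omega>)))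
      + (\<Sum>k<j. F (real k * \<delta>) (xg k \<omega>) * (min (E t \<omega>) (real (Suc k) * \<delta>) - min (E t \<omega>) (real k * \<delta>)))
      + (\<Sum>k<j. G (real k * \<delta>) (xg k \<omega>)
             * (W (min (E t \<omega>) (real (Suc k) * \<delta>)) \<omega> - W (min (E t \<omega>) (real k * \<delta>)) \<omega>)) = xd t \<omega>" .
  qed
qed

lemma E_cont: "\<omega> \<in> space M \<Longrightarrow> continuous_on S (\<lambda>t. E t \<omega>)"
  unfolding E_def by (intro continuous_at_imp_continuous_on ballI time_change_path.inv_cont[OF paths])

lemma xd_cont:
  assumes w: "\<omega> \<in> space M"
  shows "continuous_on {0..T} (\<lambda>t. xd t \<omega>)"
proof -
  obtain m where m: "T \<le> D (real m * \<delta>) \<omega>" using ex_grid_ge[OF w] by blast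
  have Wc: "continuous_on {0..T} (\<lambda>s. W (min (E s \<omega>) (real k * \<delta>)) \<omega>)" for k
    using delta E_nonneg[OF w]
    by (intro continuous_on_compose2[OF W_cont[OF w]] continuous_intros E_cont[OF w]) auto
  have "continuous_on {0..T} (\<lambda>s. x0 + (\<Sum>k<m. H (real k * \<delta>) * (min s (D (real (Suc k) * \<delta>) \<omega>) - min s (D (real k * \<delta>) \<omega>)))
      + (\<Sum>k<m. F (real k * \<delta>) (xg k \<omega>) * (min (E s \<omega>) (real (Suc k) * \<delta>) - min (E s \<omega>) (real k * \<delta>)))
      + (\<Sum>k<m. G (real k * \<delta>) (xg k \<omega>)
             * (W (min (E s \<omega>) (real (Suc k) * \<delta>)) \<omega> - W (min (E s \<omega>) (real k * \<delta>)) \<omega>)))"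
    by (intro continuous_intros E_cont[OF w] Wc)
  then show ?thesis
    by (rule continuous_on_eq) (use xd_formula[OF w, of _ m] m in auto)
qed

end

section \<open>The localised error process\<close>

locale euler_local = euler_step M Fil W H h F G K \<theta> D X I T x0 \<delta> m0
  for M :: "'a measure" and Fil W H h F G K \<theta> D X I T x0 \<delta> m0 +
  fixes R :: real and L :: nat
  assumes R: "0 \<le> R" and L: "0 < L" and m0: "0 < m0"
begin

definition e :: real where "e = \<delta> / real L"

text \<open>Localisation at level \<open>R\<close>, tested at rational times to be measurable; path
  continuity extends the bound on \<open>X\<close> to all times up to \<open>t\<close>.\<close>

definition alive :: "real \<Rightarrow> 'a \<Rightarrow> bool" where
  "alive t \<omega> \<longleftrightarrow> (\<forall>r\<in>\<rat> \<inter> {0..t}. \<bar>X r \<omega>\<bar> \<le> R)"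

text \<open>The error up to real time \<open>min T (D v)\<close>, restricted to times at which the
  path is still alive. The restriction gives a finite second moment in advance, as a Gronwall
  argument requires.\<close>

definition S :: "real \<Rightarrow> 'a \<Rightarrow> real" where
  "S v \<omega> = (SUP t\<in>\<rat> \<inter> {0..T}. if t \<le> D v \<omega> \<and> alive t \<omega> then \<bar>X t \<omega> - xd t \<omega>\<bar> else 0)"

lemma e_pos: "0 < e" and delta_eq: "\<delta> = real L * e"
  using delta L by (auto simp: e_def)

lemma alive_mono: "alive t \<omega> \<Longrightarrow> s \<le> t \<Longrightarrow> alive s \<omega>"
  by (auto simp: alive_def)

lemma error_cont: "\<omega> \<in> space M \<Longrightarrow> continuous_on {0..T} (\<lambda>t. \<bar>X t \<omega> - xd t \<omega>\<bar>)"
  by (intro continuous_intros X_cont xd_cont)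

lemma alive_bound: "\<omega> \<in> space M \<Longrightarrow> 0 \<le> t \<Longrightarrow> t \<le> T \<Longrightarrow> alive t \<omega> \<Longrightarrow> \<bar>X t \<omega>\<bar> \<le> R"
  by (rule rational_bound[where f="\<lambda>t. \<bar>X t \<omega>\<bar>"]) (auto simp: alive_def intro!: continuous_on_rabs X_cont)

lemma S_bdd:
  assumes "\<omega> \<in> space M"
  shows "bdd_above ((\<lambda>t. if t \<le> D v \<omega> \<and> alive t \<omega> then \<bar>X t \<omega> - xd t \<omega>\<bar> else 0) ` (\<rat> \<inter> {0..T}))"
proof -
  have "bdd_above ((\<lambda>t. \<bar>X t \<omega> - xd t \<omega>\<bar>) ` {0..T})"
    by (intro bounded_imp_bdd_above compact_imp_bounded compact_continuous_image error_cont assms) auto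
  then obtain c where c: "\<And>t. t \<in> {0..T} \<Longrightarrow> \<bar>X t \<omega> - xd t \<omega>\<bar> \<le> c"
    unfolding bdd_above_def by blast
  have "0 \<le> c" using c[of 0] T_pos by simp
  then show ?thesis using c by (intro bdd_aboveI[of _ c]) auto
qed

lemma S_upper:
  assumes "\<omega> \<in> space M" "t \<in> \<rat>" "0 \<le> t" "t \<le> T" "t \<le> D v \<omega>" "alive t \<omega>"
  shows "\<bar>X t \<omega> - xd t \<omega>\<bar> \<le> S v \<omega>"
  using cSUP_upper[OF _ S_bdd[OF assms(1)], of t v] assms unfolding S_def by auto

lemma S_nonneg: "\<omega> \<in> space M \<Longrightarrow> 0 \<le> S v \<omega>"
  unfolding S_def by (rule cSUP_upper2[OF S_bdd, of _ 0]) (use T_pos in auto)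

lemma S_upper_real:
  assumes "\<omega> \<in> space M" "0 \<le> t" "t \<le> T" "t \<le> D v \<omega>" "alive t \<omega>"
  shows "\<bar>X t \<omega> - xd t \<omega>\<bar> \<le> S v \<omega>"
  by (rule rational_bound[where f="\<lambda>t. \<bar>X t \<omega> - xd t \<omega>\<bar>"])
     (use assms in \<open>auto intro!: error_cont S_upper alive_mono[of t \<omega>]\<close>)

lemma S_least:
  assumes "\<omega> \<in> space M" "0 \<le> c"
    "\<And>t. t \<in> \<rat> \<Longrightarrow> 0 \<le> t \<Longrightarrow> t \<le> T \<Longrightarrow> t \<le> D v \<omega> \<Longrightarrow> alive t \<omega> \<Longrightarrow> \<bar>X t \<omega> - xd t \<omega>\<bar> \<le> c"
  shows "S v \<omega> \<le> c"
  unfolding S_def using T_pos by (intro cSUP_least) (use assms in auto)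

lemma countable_times: "countable (\<rat> \<inter> {0..T::real})"
  using countable_rat by (rule countable_subset[rotated]) auto

lemma alive_meas [measurable]: "t \<le> T \<Longrightarrow> Measurable.pred M (alive t)"
  unfolding alive_def[abs_def]
proof (rule measurable_pred_countable(1))
  assume t: "t \<le> T"
  then have "\<rat> \<inter> {0..t} \<subseteq> \<rat> \<inter> {0..T}" by auto
  then show "countable (\<rat> \<inter> {0..t})" using countable_times by (rule countable_subset)
  fix r assume "r \<in> \<rat> \<inter> {0..t}"
  then have [measurable]: "X r \<in> borel_measurable M" using t by (intro X_meas) auto
  show "Measurable.pred M (\<lambda>\<omega>. \<bar>X r \<omega>\<bar> \<le> R)" by measurable
qed

lemma S_meas: "0 \<le> v \<Longrightarrow> S v \<in> borel_measurable M"
  unfolding S_def[abs_def]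
proof (rule borel_measurable_cSUP[OF countable_times _ S_bdd])
  fix t assume v: "0 \<le> v" and t: "t \<in> \<rat> \<inter> {0..T}"
  have [measurable]: "D v \<in> borel_measurable M" "X t \<in> borel_measurable M" "xd t \<in> borel_measurable M"
    "Measurable.pred M (alive t)"
    using t v by (auto intro: D_meas X_meas xd_meas alive_meas)
  show "(\<lambda>\<omega>. if t \<le> D v \<omega> \<and> alive t \<omega> then \<bar>X t \<omega> - xd t \<omega>\<bar> else 0) \<in> borel_measurable M" by measurable
qed

text \<open>Every admissible \<open>t\<close> lies in one of the first \<open>m0\<close> blocks,
  where \<open>X\<close> is at most \<open>R\<close> and the scheme at most \<open>z n + q n\<close>
  in absolute value.\<close>

lemma S_le_sum:
  assumes w: "\<omega> \<in> space M" and v: "0 \<le> v" "v \<le> U"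
  shows "S v \<omega> \<le> R + (\<Sum>n<m0. z n \<omega> + q n \<omega>)"
proof (rule S_least[OF w])
  have nn: "0 \<le> (\<Sum>n<m0. z n \<omega> + q n \<omega>)"
    using z_nonneg q_nonneg[OF w] by (intro sum_nonneg add_nonneg_nonneg) auto
  then show "0 \<le> R + (\<Sum>n<m0. z n \<omega> + q n \<omega>)" using R by simp
  fix t assume t: "0 \<le> t" "t \<le> T" "t \<le> D v \<omega>" "alive t \<omega>"
  interpret p: time_change_path "\<lambda>u. D u \<omega>" by (rule paths[OF w])
  have tU: "t \<le> D (real m0 * \<delta>) \<omega>"
    using t(3) p.le_iff[of v U] v U_nonneg by (simp add: U_def)
  obtain n where n: "n < m0" "D (real n * \<delta>) \<omega> \<le> t" "t \<le> D (real (Suc n) * \<delta>) \<omega>"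
  proof (cases "t < D (real m0 * \<delta>) \<omega>")
    case True
    obtain n where n: "D (real n * \<delta>) \<omega> \<le> t" "t < D (real (Suc n) * \<delta>) \<omega>"
      using p.ex_block[OF delta(1) t(1)] by blast
    have "D (real n * \<delta>) \<omega> < D (real m0 * \<delta>) \<omega>" using n True by linarith
    then have "real n * \<delta> < real m0 * \<delta>" using p.less_iff delta by auto
    then have "n < m0" using delta by simp
    then show ?thesis using that n by auto
  next
    \<comment> \<open>At the very end of the last block the half-open block containing
      \<open>t\<close> would have index \<open>m0\<close>; the closed block \<open>m0 - 1\<close>
      takes its place.\<close>
    case False
    then have "t = D (real m0 * \<delta>) \<omega>" using tU by simp
    then show ?thesis using that[of "m0 - 1"] m0 D_grid_mono[OF w, of "m0 - 1" m0] by simp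
  qed
  have "\<bar>X t \<omega> - xd t \<omega>\<bar> \<le> \<bar>X t \<omega>\<bar> + \<bar>xg n \<omega>\<bar> + \<bar>xd t \<omega> - xg n \<omega>\<bar>" by linarith
  also have "\<dots> \<le> R + z n \<omega> + q n \<omega>"
    using alive_bound[OF w t(1,2,4)] xd_block_le[OF w n t(2)] n t by (simp add: z_def)
  also have "\<dots> \<le> R + (\<Sum>n<m0. z n \<omega> + q n \<omega>)"
    using member_le_sum[of n "{..<m0}" "\<lambda>n. z n \<omega> + q n \<omega>"] n z_nonneg q_nonneg[OF w] by simp
  finally show "\<bar>X t \<omega> - xd t \<omega>\<bar> \<le> R + (\<Sum>n<m0. z n \<omega> + q n \<omega>)" .
qed

lemma S_square:
  assumes v: "0 \<le> v" "v \<le> U"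
  shows "integrable M (\<lambda>\<omega>. (S v \<omega>)\<^sup>2)"
proof (rule Bochner_Integration.integrable_bound)
  note [measurable] = S_meas[OF v(1)]
  have qm: "q n \<in> borel_measurable M" if "n < m0" for n using q_square(1)[OF that] .
  have q2: "integrable M (\<lambda>\<omega>. (z n \<omega> + q n \<omega>)\<^sup>2)" if n: "n < m0" for n
    using q_square(2)[OF n] z_square[THEN conjunct1, of n] n by (intro integrable_add_square z_meas qm) auto
  show "integrable M (\<lambda>\<omega>. (R + (\<Sum>n<m0. z n \<omega> + q n \<omega>))\<^sup>2)"
    by (intro integrable_add_square integrable_sum_square q2 borel_measurable_sum borel_measurable_add
        borel_measurable_const z_meas qm) auto
  show "AE \<omega> in M. norm ((S v \<omega>)\<^sup>2) \<le> norm ((R + (\<Sum>n<m0. z n \<omega> + q n \<omega>))\<^sup>2)"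
    using S_le_sum[OF _ v] S_nonneg by (intro AE_I2) (simp add: power_mono)
qed (use S_meas[OF v(1)] in measurable)

text \<open>A bound for the coefficient error on the fine cell \<open>k\<close>, made of the error
  of the scheme, the oscillation in the block and the Hoelder term. \<open>S\<close> is taken at the
  right end of the cell because its value at the left end does not control times inside.\<close>

definition y :: "nat \<Rightarrow> 'a \<Rightarrow> real" where
  "y k \<omega> = h U * S (real (Suc k) * e) \<omega> + h U * q (k div L) \<omega> + K * \<delta> powr \<theta> * z (k div L) \<omega>"

lemma cell_bounds:
  assumes "k < m0 * L"
  shows "k div L < m0" "real (Suc k) * e \<le> U" "0 \<le> real k * e" "0 \<le> real (Suc k) * e" "real (k div L) * \<delta> \<le> real k * e"
    "real (Suc k) * e \<le> real (Suc (k div L)) * \<delta>"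
proof -
  show "k div L < m0" using assms L by (simp add: div_less_iff_less_mult)
  have "real (Suc k) * e \<le> real (m0 * L) * e" using assms e_pos by (intro mult_right_mono of_nat_mono) auto
  also have "\<dots> = real m0 * (real L * e)" by simp
  also have "\<dots> = U" unfolding delta_eq[symmetric] U_def ..
  finally show "real (Suc k) * e \<le> U" .
  show "0 \<le> real k * e" "0 \<le> real (Suc k) * e" using e_pos by auto
  have "real (k div L * L) * e \<le> real k * e" using e_pos by (intro mult_right_mono of_nat_mono) auto
  then have "real (k div L) * (real L * e) \<le> real k * e" by simp
  then show "real (k div L) * \<delta> \<le> real k * e" unfolding delta_eq[symmetric] .
  have "Suc k \<le> Suc (k div L) * L" using L by (metis Suc_leI dividend_less_div_times mult.commute mult_Suc)
  then have "real (Suc k) * e \<le> real (Suc (k div L) * L) * e" using e_pos by (intro mult_right_mono of_nat_mono) auto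
  then have "real (Suc k) * e \<le> real (Suc (k div L)) * (real L * e)" by (simp add: algebra_simps)
  then show "real (Suc k) * e \<le> real (Suc (k div L)) * \<delta>" unfolding delta_eq[symmetric] .
qed

lemma y_nonneg: "\<omega> \<in> space M \<Longrightarrow> k < m0 * L \<Longrightarrow> 0 \<le> y k \<omega>"
  unfolding y_def using hU_nonneg S_nonneg q_nonneg cell_bounds(1) z_nonneg K_pos by simp

lemma y_square:
  assumes k: "k < m0 * L"
  shows "y k \<in> borel_measurable M" "integrable M (\<lambda>\<omega>. (y k \<omega>)\<^sup>2)"
    "(\<integral>\<omega>. (y k \<omega>)\<^sup>2 \<partial>M) \<le> 3 * (h U)\<^sup>2 * (\<integral>\<omega>. (S (real (Suc k) * e) \<omega>)\<^sup>2 \<partial>M)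
      + 3 * (h U)\<^sup>2 * (\<integral>\<omega>. (q (k div L) \<omega>)\<^sup>2 \<partial>M) + 3 * (K * \<delta> powr \<theta>)\<^sup>2 * A"
proof -
  note c = cell_bounds[OF k]
  note [measurable] = S_meas[OF c(4)] q_square(1)[OF c(1)]
  show ym: "y k \<in> borel_measurable M" unfolding y_def[abs_def] by measurable
  note S2 = S_square[OF c(4,2)] and q2 = q_square(2)[OF c(1)] and z2 = z_square[of "k div L", THEN conjunct1]
  define B where "B \<omega> = 3 * (h U)\<^sup>2 * (S (real (Suc k) * e) \<omega>)\<^sup>2 + 3 * (h U)\<^sup>2 * (q (k div L) \<omega>)\<^sup>2
     + 3 * (K * \<delta> powr \<theta>)\<^sup>2 * (z (k div L) \<omega>)\<^sup>2" for \<omega>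
  have yB: "(y k \<omega>)\<^sup>2 \<le> B \<omega>" for \<omega>
    unfolding y_def B_def using square_sum3_le[of "h U * S (real (Suc k) * e) \<omega>" "h U * q (k div L) \<omega>" "K * \<delta> powr \<theta> * z (k div L) \<omega>"]
    by (simp add: power_mult_distrib mult.assoc)
  have Bi: "integrable M B" unfolding B_def[abs_def] using S2 q2 z2 c(1) by simp
  show y2: "integrable M (\<lambda>\<omega>. (y k \<omega>)\<^sup>2)"
    by (rule Bochner_Integration.integrable_bound[OF Bi]) (use ym order_trans[OF yB abs_ge_self] in auto)
  have "(\<integral>\<omega>. (y k \<omega>)\<^sup>2 \<partial>M) \<le> (\<integral>\<omega>. B \<omega> \<partial>M)" using yB by (intro integral_mono y2 Bi)
  also have "\<dots> = 3 * (h U)\<^sup>2 * (\<integral>\<omega>. (S (real (Suc k) * e) \<omega>)\<^sup>2 \<partial>M)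
      + 3 * (h U)\<^sup>2 * (\<integral>\<omega>. (q (k div L) \<omega>)\<^sup>2 \<partial>M) + 3 * (K * \<delta> powr \<theta>)\<^sup>2 * (\<integral>\<omega>. (z (k div L) \<omega>)\<^sup>2 \<partial>M)"
    unfolding B_def[abs_def] using S2 q2 z2 c(1) by simp
  also have "\<dots> \<le> 3 * (h U)\<^sup>2 * (\<integral>\<omega>. (S (real (Suc k) * e) \<omega>)\<^sup>2 \<partial>M)
      + 3 * (h U)\<^sup>2 * (\<integral>\<omega>. (q (k div L) \<omega>)\<^sup>2 \<partial>M) + 3 * (K * \<delta> powr \<theta>)\<^sup>2 * A"
    using z_moment[of "k div L"] c(1) by (intro add_mono mult_left_mono order_refl) auto
  finally show "(\<integral>\<omega>. (y k \<omega>)\<^sup>2 \<partial>M) \<le> \<dots>" .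
qed

text \<open>The Brownian part of the scheme at real time \<open>t\<close>, distributed over the fine
  cells.\<close>

definition Id :: "nat \<Rightarrow> real \<Rightarrow> 'a \<Rightarrow> real" where
  "Id m t \<omega> = (\<Sum>k<m. G (real (k div L) * \<delta>) (xg (k div L) \<omega>)
     * (W (min (E t \<omega>) (real (Suc k) * e)) \<omega> - W (min (E t \<omega>) (real k * e)) \<omega>))"

text \<open>Supplies the cell bound that \<open>error_le\<close> asks for: inside a cell
  \<open>X\<close> is compared with the grid value by way of the interpolated scheme, the first
  distance being covered by \<open>S\<close> and the second by \<open>q\<close>.\<close>

lemma error_bound:
  assumes w: "\<omega> \<in> space M" and m: "m \<le> m0 * L"
    and sde: "X t \<omega> = x0 + (LINT r:{0<..t}|lborel. H (E r \<omega>))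
       + (LINT r:{0<..t}|interval_measure (\<lambda>r. E r \<omega>). F (E r \<omega>) (X r \<omega>)) + I t \<omega>"
    and t: "0 \<le> t" "t \<le> T" "t \<le> D (real m * e) \<omega>" "alive t \<omega>"
  shows "\<bar>X t \<omega> - xd t \<omega>\<bar> \<le> K * \<delta> powr \<theta> * T + (\<Sum>k<m. e * y k \<omega>) + \<bar>I t \<omega> - Id m t \<omega>\<bar>"
proof -
  interpret p: euler_error_path H h F G K \<theta> "\<lambda>u. D u \<omega>" "\<lambda>u. W u \<omega>" x0 \<delta> by (rule error_path[OF w])
  have fb: "\<bar>F (E r \<omega>) (X r \<omega>) - F (real (k div L) * \<delta>) (xg (k div L) \<omega>)\<bar> \<le> y k \<omega>"
    if k: "k < m" and r: "D (real k * e) \<omega> < r" "r \<le> D (real (Suc k) * e) \<omega>" "r \<le> t" for k r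
  proof -
    define n where "n = k div L"
    have km: "k < m0 * L" using k m by simp
    note c = cell_bounds[OF km, folded n_def]
    have n0: "0 \<le> real n * \<delta>" using delta by simp
    have r0: "0 \<le> r" using p.nonneg[OF c(3)] r(1) by simp
    have rT: "r \<le> T" using r t by simp
    have Er: "real k * e \<le> E r \<omega>" "E r \<omega> \<le> real (Suc k) * e"
      using p.inv_mono[of "D (real k * e) \<omega>" r] r c unfolding E_def by (auto simp: p.inv_le_iff)
    have Dn: "D (real n * \<delta>) \<omega> \<le> D (real k * e) \<omega>" "D (real (Suc k) * e) \<omega> \<le> D (real (Suc n) * \<delta>) \<omega>"
      using c delta e_pos by (simp_all add: p.le_iff)
    have zn: "z n \<omega> = 1 + \<bar>xg n \<omega>\<bar>" using Dn r rT by (simp add: z_def)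
    have "\<bar>X r \<omega> - xg n \<omega>\<bar> \<le> \<bar>X r \<omega> - xd r \<omega>\<bar> + \<bar>xd r \<omega> - xg n \<omega>\<bar>" by linarith
    also have "\<dots> \<le> S (real (Suc k) * e) \<omega> + q n \<omega>"
      using Dn r rT r0 by (intro add_mono S_upper_real[OF w] xd_block_le[OF w c(1)] alive_mono[OF t(4)]) auto
    finally have Xr: "\<bar>X r \<omega> - xg n \<omega>\<bar> \<le> S (real (Suc k) * e) \<omega> + q n \<omega>" .
    have "\<bar>E r \<omega> - real n * \<delta>\<bar> \<le> \<delta>" using Er c by (simp add: abs_if algebra_simps)
    then have "\<bar>F (E r \<omega>) (X r \<omega>) - F (real n * \<delta>) (xg n \<omega>)\<bar>
        \<le> h U * \<bar>X r \<omega> - xg n \<omega>\<bar> + K * \<delta> powr \<theta> * (1 + \<bar>xg n \<omega>\<bar>)"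
      using Er c E_nonneg[OF w] by (intro increment_le(2) n0) auto
    also have "\<dots> \<le> h U * (S (real (Suc k) * e) \<omega> + q n \<omega>) + K * \<delta> powr \<theta> * z n \<omega>"
      unfolding zn using Xr hU_nonneg K_pos by (intro add_mono mult_left_mono) auto
    finally show ?thesis by (simp add: y_def n_def algebra_simps)
  qed
  have e: "inverse_path (\<lambda>u. D u \<omega>) = (\<lambda>r. E r \<omega>)" by (simp add: E_def fun_eq_iff)
  show ?thesis
    using p.error_le[OF L delta_eq t(1-3) X_cont[OF w], of "I t \<omega>" "\<lambda>k. y k \<omega>", unfolded e, OF sde,
      folded xg_def xd_def, OF _ fb, folded Id_def] y_nonneg[OF w] m by simp
qed

end

subsection \<open>The stochastic integral error\<close>

lemma sum_blocks:
  fixes f :: "nat \<Rightarrow> 'b::comm_monoid_add"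
  shows "(\<Sum>k<m * N. f k) = (\<Sum>j<m. \<Sum>i<N. f (j * N + i))"
proof -
  have "(\<Sum>i<N. f (j * N + i)) = sum f {j * N..<j * N + N}" for j
    using sum.shift_bounds_nat_ivl[of f 0 "j * N" N] by (simp add: lessThan_atLeast0 add.commute)
  then show ?thesis by (simp add: sum.nat_group)
qed

lemma sum_indicator_telescope:
  fixes w :: "nat \<Rightarrow> real"
  shows "(\<Sum>k<n. (if c \<le> k then w (Suc k) - w k else 0)) = w n - w (min c n)"
  by (induction n) (auto simp: min_def le_Suc_eq)

lemma fine_grid_end: "real (m * Suc J) * (e / real (Suc J)) = real m * e"
  unfolding of_nat_mult by (simp del: of_nat_Suc)

text \<open>The selected increments telescope to one between the first grid points at or after
  \<open>a\<close> and \<open>b\<close>, and \<open>w\<close> is continuous. Constancy of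
  \<open>w\<close> beyond \<open>real m * e\<close> takes care of end points outside the
  grid.\<close>

lemma telescope_limit:
  fixes w :: "real \<Rightarrow> real" and e :: real
  assumes e: "0 < e" and w: "continuous_on {0..} w" and const: "\<And>x. real m * e \<le> x \<Longrightarrow> w x = w (real m * e)"
    and a: "0 \<le> a" "a \<le> b"
  shows "(\<lambda>J. \<Sum>k<m * Suc J. (if a \<le> real k * (e / real (Suc J)) \<and> real k * (e / real (Suc J)) < b
      then w (real (Suc k) * (e / real (Suc J))) - w (real k * (e / real (Suc J))) else 0)) \<longlonglongrightarrow> w b - w a"
proof -
  have lim: "(\<lambda>J. \<Sum>k<m * Suc J. (if a \<le> real k * (e / real (Suc J))
      then w (real (Suc k) * (e / real (Suc J))) - w (real k * (e / real (Suc J))) else 0)) \<longlonglongrightarrow> w (real m * e) - w a"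
    if a: "0 \<le> a" for a
  proof -
    \<comment> \<open>The index of the first grid point at or after \<open>a\<close>; that point
      exceeds \<open>a\<close> by at most one mesh width.\<close>
    define c where "c J = nat \<lceil>a / (e / real (Suc J))\<rceil>" for J
    have ep: "0 < e / real (Suc J)" for J using e by simp
    have cb: "a \<le> real (c J) * (e / real (Suc J))" "real (c J) * (e / real (Suc J)) \<le> a + e / real (Suc J)" for J
    proof -
      have "0 \<le> a / (e / real (Suc J))" using a ep[of J] by (rule divide_nonneg_pos)
      then have "a / (e / real (Suc J)) \<le> real (c J)" "real (c J) \<le> a / (e / real (Suc J)) + 1"
        unfolding c_def by linarith+
      then show "a \<le> real (c J) * (e / real (Suc J))" "real (c J) * (e / real (Suc J)) \<le> a + e / real (Suc J)"
        using ep[of J] e by (simp_all add: pos_divide_le_eq field_simps del: of_nat_Suc)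
    qed
    have ci: "a \<le> real k * (e / real (Suc J)) \<longleftrightarrow> c J \<le> k" for k J
    proof -
      have "a \<le> real k * (e / real (Suc J)) \<longleftrightarrow> a / (e / real (Suc J)) \<le> real k"
        using ep[of J] by (simp only: pos_divide_le_eq)
      also have "\<dots> \<longleftrightarrow> c J \<le> k" unfolding c_def by (simp add: nat_le_iff ceiling_le_iff)
      finally show ?thesis .
    qed
    have "(\<Sum>k<m * Suc J. (if a \<le> real k * (e / real (Suc J))
      then w (real (Suc k) * (e / real (Suc J))) - w (real k * (e / real (Suc J))) else 0))
      = w (real m * e) - w (real (c J) * (e / real (Suc J)))" for J
    proof -
      have top: "real (m * Suc J) * (e / real (Suc J)) = real m * e" by (rule fine_grid_end)
      have "(\<Sum>k<m * Suc J. (if a \<le> real k * (e / real (Suc J))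
        then w (real (Suc k) * (e / real (Suc J))) - w (real k * (e / real (Suc J))) else 0))
        = w (real (m * Suc J) * (e / real (Suc J))) - w (real (min (c J) (m * Suc J)) * (e / real (Suc J)))"
        unfolding ci by (rule sum_indicator_telescope)
      also have "w (real (min (c J) (m * Suc J)) * (e / real (Suc J))) = w (real (c J) * (e / real (Suc J)))"
      proof (cases "c J \<le> m * Suc J")
        case True
        then show ?thesis by (simp add: min_def)
      next
        case False
        then have "real (m * Suc J) * (e / real (Suc J)) \<le> real (c J) * (e / real (Suc J))"
          using ep[of J] by (intro mult_right_mono of_nat_mono) auto
        then have "w (real (c J) * (e / real (Suc J))) = w (real m * e)" unfolding top by (rule const)
        moreover have "min (c J) (m * Suc J) = m * Suc J" using False by simp
        ultimately show ?thesis by (simp only: top)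
      qed
      finally show ?thesis unfolding top .
    qed
    moreover have "(\<lambda>J. real (c J) * (e / real (Suc J))) \<longlonglongrightarrow> a"
    proof (rule tendsto_sandwich[OF _ _ tendsto_const])
      show "\<forall>\<^sub>F J in sequentially. a \<le> real (c J) * (e / real (Suc J))" using cb by simp
      show "\<forall>\<^sub>F J in sequentially. real (c J) * (e / real (Suc J)) \<le> a + e / real (Suc J)"
        using cb(2) by (intro always_eventually allI)
      show "(\<lambda>J. a + e / real (Suc J)) \<longlonglongrightarrow> a"
        using tendsto_add[OF tendsto_const LIMSEQ_Suc[OF lim_const_over_n[of e]], of a] by simp
    qed
    then have "(\<lambda>J. w (real (c J) * (e / real (Suc J)))) \<longlonglongrightarrow> w a"
    proof (rule continuous_on_tendsto_compose[OF w])
      show "\<forall>\<^sub>F J in sequentially. real (c J) * (e / real (Suc J)) \<in> {0..}"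
        using order_trans[OF a cb(1)] by (intro always_eventually) simp
    qed (use a in simp)
    ultimately show ?thesis by (simp only: tendsto_diff tendsto_const)
  qed
  have split: "(\<Sum>k<m * Suc J. (if a \<le> real k * (e / real (Suc J)) \<and> real k * (e / real (Suc J)) < b
      then w (real (Suc k) * (e / real (Suc J))) - w (real k * (e / real (Suc J))) else 0))
    = (\<Sum>k<m * Suc J. (if a \<le> real k * (e / real (Suc J))
      then w (real (Suc k) * (e / real (Suc J))) - w (real k * (e / real (Suc J))) else 0))
    - (\<Sum>k<m * Suc J. (if b \<le> real k * (e / real (Suc J))
      then w (real (Suc k) * (e / real (Suc J))) - w (real k * (e / real (Suc J))) else 0))" for J
    unfolding sum_subtractf[symmetric] using a(2) by (intro sum.cong refl) auto
  have "w b - w a = (w (real m * e) - w a) - (w (real m * e) - w b)" by simp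
  then show ?thesis unfolding split using tendsto_diff[OF lim[OF a(1)] lim[of b]] a by simp
qed

text \<open>Continuity of \<open>G\<close> is known for nonnegative times only; the
  \<open>max\<close> extends it continuously to the whole plane.\<close>

lemma (in sde_coefficients) G_comp_meas:
  assumes "f \<in> borel_measurable N" "g \<in> borel_measurable N"
  shows "(\<lambda>\<omega>. G (max 0 (f \<omega>)) (g \<omega>)) \<in> borel_measurable N"
proof -
  have "continuous_on UNIV (\<lambda>p :: real \<times> real. case (max 0 (fst p), snd p) of (u, x) \<Rightarrow> G u x)"
    by (rule continuous_on_compose2[OF G_cont]) (auto intro!: continuous_intros)
  then have "continuous_on UNIV (\<lambda>p :: real \<times> real. G (max 0 (fst p)) (snd p))" by simp
  from borel_measurable_continuous_Pair[OF assms, of "\<lambda>u x. G (max 0 u) x", OF this] show ?thesis .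
qed

section \<open>Riemann sums on a deterministic operational grid\<close>

context euler_local
begin

definition part :: "nat \<Rightarrow> nat \<Rightarrow> real" where
  "part n i = real i * T / real (Suc n)"

lemma part_mono: "i \<le> j \<Longrightarrow> part n i \<le> part n j"
  unfolding part_def using T_pos by (intro divide_right_mono mult_right_mono) auto

lemma part_bounds: "0 \<le> part n i" "i \<le> Suc n \<Longrightarrow> part n i \<le> T"
  using part_mono[of 0 i n] part_mono[of i "Suc n" n] by (simp_all add: part_def del: of_nat_Suc)

lemma part_diff: "part n (Suc i) = part n i + T / real (Suc n)"
  by (simp add: part_def add_divide_distrib distrib_right)

lemma part_ex:
  assumes "0 \<le> x" "x < T"
  shows "\<exists>i<Suc n. part n i \<le> x \<and> x < part n (Suc i)"
proof -
  have "\<exists>i. x < part n (Suc i)"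
    using assms by (intro exI[of _ n]) (simp add: part_def del: of_nat_Suc)
  then obtain i where i: "x < part n (Suc i)" "\<And>j. j < i \<Longrightarrow> \<not> x < part n (Suc j)"
    using exists_least_iff[of "\<lambda>i. x < part n (Suc i)"] by blast
  have "part n i \<le> x" using i(2)[of "i - 1"] assms by (cases i) (auto simp: part_def)
  moreover have "i < Suc n"
  proof (rule ccontr)
    assume "\<not> i < Suc n"
    then have "n < i" by simp
    from i(2)[OF this] show False using assms by (simp add: part_def del: of_nat_Suc)
  qed
  ultimately show ?thesis using i(1) by blast
qed

lemma part_unique:
  assumes "part n i \<le> x" "x < part n (Suc i)" "part n j \<le> x" "x < part n (Suc j)"
  shows "i = j"
proof (rule ccontr)
  assume "i \<noteq> j"
  then consider "Suc i \<le> j" | "Suc j \<le> i" by linarith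
  then show False using part_mono[of "Suc i" j n] part_mono[of "Suc j" i n] assms by cases auto
qed

text \<open>The integrand error on the operational time grid of mesh \<open>e / (J + 1)\<close>, for the partition of
  \<open>[0, T]\<close> into \<open>n + 1\<close> intervals.\<close>

definition gJ :: "nat \<Rightarrow> nat \<Rightarrow> nat \<Rightarrow> 'a \<Rightarrow> real" where
  "gJ n J k \<omega> = (\<Sum>i<Suc n. if part n i \<le> D (real k * (e / real (Suc J))) \<omega> \<and>
       D (real k * (e / real (Suc J))) \<omega> < part n (Suc i) \<and> alive (part n i) \<omega>
     then G (E (part n i) \<omega>) (X (part n i) \<omega>) - G (real (k div Suc J div L) * \<delta>) (xg (k div Suc J div L) \<omega>) else 0)"

text \<open>The partition intervals are disjoint, so at most one term of the sum survives.\<close>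

lemma gJ_active:
  assumes i: "i < Suc n" "part n i \<le> D (real k * (e / real (Suc J))) \<omega>"
       "D (real k * (e / real (Suc J))) \<omega> < part n (Suc i)" "alive (part n i) \<omega>"
  shows "gJ n J k \<omega> = G (E (part n i) \<omega>) (X (part n i) \<omega>) - G (real (k div Suc J div L) * \<delta>) (xg (k div Suc J div L) \<omega>)"
proof -
  have "gJ n J k \<omega> = (\<Sum>j<Suc n. if j = i then G (E (part n i) \<omega>) (X (part n i) \<omega>)
      - G (real (k div Suc J div L) * \<delta>) (xg (k div Suc J div L) \<omega>) else 0)"
    unfolding gJ_def
  proof (intro sum.cong refl)
    fix j
    show "(if part n j \<le> D (real k * (e / real (Suc J))) \<omega> \<and>
       D (real k * (e / real (Suc J))) \<omega> < part n (Suc j) \<and> alive (part n j) \<omega>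
     then G (E (part n j) \<omega>) (X (part n j) \<omega>) - G (real (k div Suc J div L) * \<delta>) (xg (k div Suc J div L) \<omega>) else 0)
     = (if j = i then G (E (part n i) \<omega>) (X (part n i) \<omega>)
      - G (real (k div Suc J div L) * \<delta>) (xg (k div Suc J div L) \<omega>) else 0)"
    proof (cases "j = i")
      case True
      then show ?thesis using i by simp
    next
      case False
      then have "\<not> (part n j \<le> D (real k * (e / real (Suc J))) \<omega> \<and> D (real k * (e / real (Suc J))) \<omega> < part n (Suc j))"
        using part_unique[OF i(2,3)] by blast
      then show ?thesis using False by (simp only: if_False) (simp only: conj_assoc[symmetric] simp_thms if_False)
    qed
  qed
  then show ?thesis using i(1) by simp
qed

lemma gJ_cases:
  obtains "gJ n J k \<omega> = 0"
  | i where "i < Suc n" "part n i \<le> D (real k * (e / real (Suc J))) \<omega>"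
       "D (real k * (e / real (Suc J))) \<omega> < part n (Suc i)" "alive (part n i) \<omega>"
       "gJ n J k \<omega> = G (E (part n i) \<omega>) (X (part n i) \<omega>) - G (real (k div Suc J div L) * \<delta>) (xg (k div Suc J div L) \<omega>)"
proof (cases "\<exists>i<Suc n. part n i \<le> D (real k * (e / real (Suc J))) \<omega> \<and>
       D (real k * (e / real (Suc J))) \<omega> < part n (Suc i) \<and> alive (part n i) \<omega>")
  case True
  then show ?thesis using that(2) gJ_active by blast
next
  case False
  then have "gJ n J k \<omega> = 0" unfolding gJ_def by (intro sum.neutral) auto
  then show ?thesis by (rule that(1))
qed

lemma fine_cell:
  assumes k: "k < m * Suc J"
  shows "k div Suc J < m" "real (k div Suc J) * e \<le> real k * (e / real (Suc J))"
    "real k * (e / real (Suc J)) \<le> real (Suc (k div Suc J)) * e" "0 \<le> real k * (e / real (Suc J))"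
proof -
  show "k div Suc J < m" using k by (simp add: div_less_iff_less_mult)
  have ep: "0 \<le> e / real (Suc J)" using e_pos by simp
  have "real (k div Suc J * Suc J) * (e / real (Suc J)) \<le> real k * (e / real (Suc J))"
    using ep by (intro mult_right_mono of_nat_mono div_times_less_eq_dividend)
  then show "real (k div Suc J) * e \<le> real k * (e / real (Suc J))" unfolding fine_grid_end .
  have "k \<le> Suc (k div Suc J) * Suc J" by (metis Suc_leI dividend_less_div_times mult.commute mult_Suc zero_less_Suc less_imp_le)
  then have "real k * (e / real (Suc J)) \<le> real (Suc (k div Suc J) * Suc J) * (e / real (Suc J))"
    using ep by (intro mult_right_mono of_nat_mono) auto
  then show "real k * (e / real (Suc J)) \<le> real (Suc (k div Suc J)) * e" unfolding fine_grid_end .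
  show "0 \<le> real k * (e / real (Suc J))" by (intro mult_nonneg_nonneg of_nat_0_le_iff ep)
qed

text \<open>At operational time \<open>v\<close> the real times up to \<open>D v\<close> are known.
  On \<open>part n i \<le> D v\<close> the value of \<open>X\<close>, the localisation and
  \<open>E (part n i)\<close> therefore coincide with versions cut off at \<open>v\<close>, which
  are measurable for \<open>Fil v\<close>.\<close>

lemma gJ_adapted:
  assumes m: "m \<le> m0 * L" and k: "k < m * Suc J"
  shows "gJ n J k \<in> borel_measurable (Fil (real k * (e / real (Suc J))))"
proof -
  define v where "v = real k * (e / real (Suc J))"
  define l where "l = k div Suc J div L"
  note f = fine_cell[OF k, folded v_def]
  have "k div Suc J < m0 * L" using f(1) m by simp
  note c = cell_bounds[OF this, folded l_def]
  have lv: "real l * \<delta> \<le> v" using c f by linarith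
  have [measurable]: "xg l \<in> borel_measurable (Fil v)" by (rule Fil_le[OF xg_adapted lv])
  have l0: "0 \<le> real l * \<delta>" using delta by simp
  note [measurable] = coefficient_meas(2)[OF l0] D_adapted[OF f(4)]
  define X' where "X' t \<omega> = (if t \<le> D v \<omega> then X t \<omega> else 0)" for t \<omega>
  have X': "X' t \<in> borel_measurable (Fil v)" if "0 \<le> t" "t \<le> T" for t
    unfolding X'_def[abs_def] by (rule X_adapted[OF that f(4)])
  define al where "al i \<omega> \<longleftrightarrow> (\<forall>r\<in>\<rat> \<inter> {0..part n i}. \<bar>X' r \<omega>\<bar> \<le> R)" for i \<omega>
  have trm: "(\<lambda>\<omega>. if part n i \<le> D v \<omega> \<and> D v \<omega> < part n (Suc i) \<and> al i \<omega>
     then G (max 0 (min (E (part n i) \<omega>) v)) (X' (part n i) \<omega>) - G (real l * \<delta>) (xg l \<omega>) else 0) \<in> borel_measurable (Fil v)"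
    if i: "i < Suc n" for i
  proof -
    have [measurable]: "Measurable.pred (Fil v) (al i)"
      unfolding al_def[abs_def]
    proof (rule measurable_pred_countable(1))
      show "countable (\<rat> \<inter> {0..part n i})" using part_bounds(2)[of i n] i
        by (intro countable_subset[OF _ countable_times]) auto
      fix r assume "r \<in> \<rat> \<inter> {0..part n i}"
      then have [measurable]: "X' r \<in> borel_measurable (Fil v)" using part_bounds(2)[of i n] i by (intro X') auto
      show "Measurable.pred (Fil v) (\<lambda>\<omega>. \<bar>X' r \<omega>\<bar> \<le> R)" by measurable
    qed
    have [measurable]: "(\<lambda>\<omega>. G (max 0 (min (E (part n i) \<omega>) v)) (X' (part n i) \<omega>)) \<in> borel_measurable (Fil v)"
      using part_bounds[of n i] part_bounds(2)[of i n] i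
      by (intro G_comp_meas E_min_adapted f X') auto
    show ?thesis by measurable
  qed
  have "(\<lambda>\<omega>. \<Sum>i<Suc n. if part n i \<le> D v \<omega> \<and> D v \<omega> < part n (Suc i) \<and> al i \<omega>
     then G (max 0 (min (E (part n i) \<omega>) v)) (X' (part n i) \<omega>) - G (real l * \<delta>) (xg l \<omega>) else 0) \<in> borel_measurable (Fil v)"
    using trm by (intro borel_measurable_sum) auto
  also have "?this \<longleftrightarrow> gJ n J k \<in> borel_measurable (Fil v)"
  proof (rule measurable_cong)
    fix \<omega> assume "\<omega> \<in> space (Fil v)"
    then have w: "\<omega> \<in> space M" by simp
    show "(\<Sum>i<Suc n. if part n i \<le> D v \<omega> \<and> D v \<omega> < part n (Suc i) \<and> al i \<omega>
     then G (max 0 (min (E (part n i) \<omega>) v)) (X' (part n i) \<omega>) - G (real l * \<delta>) (xg l \<omega>) else 0) = gJ n J k \<omega>"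
      unfolding gJ_def v_def[symmetric] l_def[symmetric]
    proof (intro sum.cong refl)
      fix i
      show "(if part n i \<le> D v \<omega> \<and> D v \<omega> < part n (Suc i) \<and> al i \<omega>
         then G (max 0 (min (E (part n i) \<omega>) v)) (X' (part n i) \<omega>) - G (real l * \<delta>) (xg l \<omega>) else 0)
        = (if part n i \<le> D v \<omega> \<and> D v \<omega> < part n (Suc i) \<and> alive (part n i) \<omega>
         then G (E (part n i) \<omega>) (X (part n i) \<omega>) - G (real l * \<delta>) (xg l \<omega>) else 0)"
      proof (cases "part n i \<le> D v \<omega>")
        case True
        then have "al i \<omega> \<longleftrightarrow> alive (part n i) \<omega>" by (auto simp: al_def alive_def X'_def)
        moreover have "min (E (part n i) \<omega>) v = E (part n i) \<omega>" using True E_le_iff[OF w f(4)] by simp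
        moreover have "max 0 (E (part n i) \<omega>) = E (part n i) \<omega>" using E_nonneg[OF w] by simp
        ultimately show ?thesis using True by (simp add: X'_def)
      qed simp
    qed
  qed
  finally show ?thesis unfolding v_def .
qed

text \<open>For an active grid point, \<open>b\<close> is its real time, \<open>j\<close> the index
  of its cell of mesh \<open>e\<close> and \<open>l\<close> that of its block. All places where
  cells, blocks and partition have to match are settled here.\<close>

lemma active_bounds:
  assumes w: "\<omega> \<in> space M" and m: "m \<le> m0 * L" and k: "k < m * Suc J" and i: "i < Suc n"
     "part n i \<le> D (real k * (e / real (Suc J))) \<omega>" "D (real k * (e / real (Suc J))) \<omega> < part n (Suc i)"
  defines "b \<equiv> D (real k * (e / real (Suc J))) \<omega>" and "j \<equiv> k div Suc J" and "l \<equiv> k div Suc J div L"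
  shows "0 \<le> b" "b \<le> T" "E b \<omega> = real k * (e / real (Suc J))" "D (real l * \<delta>) \<omega> \<le> b" "b \<le> D (real (Suc l) * \<delta>) \<omega>"
    "b \<le> D (real (Suc j) * e) \<omega>" "z l \<omega> = 1 + \<bar>xg l \<omega>\<bar>" "l < m0" "j < m" "E (part n i) \<omega> \<le> U"
    "\<bar>part n i - b\<bar> \<le> T / real (Suc n)" "\<bar>E b \<omega> - real l * \<delta>\<bar> \<le> \<delta>"
proof -
  interpret p: time_change_path "\<lambda>u. D u \<omega>" by (rule paths[OF w])
  note f = fine_cell[OF k, folded j_def]
  have jm: "j < m0 * L" using f(1) m by simp
  note c = cell_bounds[OF jm]
  have l: "j div L = l" by (simp add: j_def l_def)
  note c = c[unfolded l]
  show "l < m0" "j < m" by (fact c f)+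
  show b0: "0 \<le> b" unfolding b_def by (rule p.nonneg[OF f(4)])
  show bT: "b \<le> T" using i(3) part_bounds(2)[of "Suc i" n] i(1) unfolding b_def by simp
  show Eb: "E b \<omega> = real k * (e / real (Suc J))" unfolding E_def b_def by (rule p.inv_d[OF f(4)])
  have l0: "0 \<le> real l * \<delta>" "0 \<le> real (Suc l) * \<delta>" using delta by auto
  show Dl: "D (real l * \<delta>) \<omega> \<le> b"
    unfolding b_def by (subst p.le_iff[OF l0(1) f(4)]) (use c f in linarith)
  show "b \<le> D (real (Suc l) * \<delta>) \<omega>"
    unfolding b_def by (subst p.le_iff[OF f(4) l0(2)]) (use c f in linarith)
  show "b \<le> D (real (Suc j) * e) \<omega>"
    unfolding b_def by (subst p.le_iff[OF f(4) c(4)]) (use c f in linarith)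
  show "z l \<omega> = 1 + \<bar>xg l \<omega>\<bar>" using Dl bT by (simp add: z_def)
  have "E (part n i) \<omega> \<le> E b \<omega>" unfolding E_def by (rule p.inv_mono) (use i(2) in \<open>simp add: b_def\<close>)
  then show "E (part n i) \<omega> \<le> U" using Eb c f by linarith
  show "\<bar>part n i - b\<bar> \<le> T / real (Suc n)" using i part_diff[of n i] unfolding b_def by linarith
  have "real (Suc l) * \<delta> = real l * \<delta> + \<delta>" by (simp add: algebra_simps)
  then show "\<bar>E b \<omega> - real l * \<delta>\<bar> \<le> \<delta>" using Eb c f by linarith
qed

text \<open>A majorant independent of \<open>n\<close>, \<open>J\<close> and \<open>k\<close>. It
  gives integrability of the coefficients and later the domination in the reverse Fatou
  lemma.\<close>

definition crude :: "'a \<Rightarrow> real" where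
  "crude \<omega> = h U * (1 + R) + (\<Sum>l<m0. h U * z l \<omega>)"

lemma crude_square: "crude \<in> borel_measurable M" "integrable M (\<lambda>\<omega>. (crude \<omega>)\<^sup>2)"
proof -
  show "crude \<in> borel_measurable M" unfolding crude_def[abs_def] by measurable
  have "integrable M (\<lambda>\<omega>. (h U * z l \<omega>)\<^sup>2)" if "l < m0" for l
    unfolding power_mult_distrib using z_square[of l, THEN conjunct1] that by simp
  then show "integrable M (\<lambda>\<omega>. (crude \<omega>)\<^sup>2)"
    unfolding crude_def by (intro integrable_add_square integrable_sum_square) auto
qed

lemma gJ_crude:
  assumes w: "\<omega> \<in> space M" and m: "m \<le> m0 * L" and k: "k < m * Suc J"
  shows "\<bar>gJ n J k \<omega>\<bar> \<le> crude \<omega>"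
proof (cases rule: gJ_cases[of n J k \<omega>])
  case 1
  then show ?thesis unfolding crude_def using hU_nonneg R z_nonneg by (simp add: sum_nonneg)
next
  case (2 i)
  define l where "l = k div Suc J div L"
  note a = active_bounds[OF w m k 2(1-3), folded l_def]
  have p: "0 \<le> part n i" "part n i \<le> T" using part_bounds[of n i] part_bounds(2)[of i n] 2(1) by auto
  have "\<bar>G (E (part n i) \<omega>) (X (part n i) \<omega>)\<bar> \<le> h U * (1 + \<bar>X (part n i) \<omega>\<bar>)"
    by (rule growth_le(3)[OF E_nonneg[OF w] a(10)])
  also have "\<dots> \<le> h U * (1 + R)" using alive_bound[OF w p 2(4)] hU_nonneg by (intro mult_left_mono) auto
  finally have 1: "\<bar>G (E (part n i) \<omega>) (X (part n i) \<omega>)\<bar> \<le> h U * (1 + R)" .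
  have "\<bar>G (real l * \<delta>) (xg l \<omega>)\<bar> \<le> h U * (1 + \<bar>xg l \<omega>\<bar>)"
    using delta a(8) by (intro growth_le(3) grid_le_U) auto
  also have "\<dots> = h U * z l \<omega>" using a(7) by simp
  also have "\<dots> \<le> (\<Sum>l<m0. h U * z l \<omega>)"
    using a(8) z_nonneg hU_nonneg by (intro member_le_sum) auto
  finally show ?thesis using 1 2(5) unfolding crude_def l_def by linarith
qed

lemma gJ_square:
  assumes m: "m \<le> m0 * L" and k: "k < m * Suc J"
  shows "integrable M (\<lambda>\<omega>. (gJ n J k \<omega>)\<^sup>2)"
proof (rule Bochner_Integration.integrable_bound[OF crude_square(2)])
  show "AE \<omega> in M. norm ((gJ n J k \<omega>)\<^sup>2) \<le> norm ((crude \<omega>)\<^sup>2)"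
  proof (rule AE_I2)
    fix \<omega> assume "\<omega> \<in> space M"
    from power_mono[OF gJ_crude[OF this m k] abs_ge_zero, of n 2]
    show "norm ((gJ n J k \<omega>)\<^sup>2) \<le> norm ((crude \<omega>)\<^sup>2)" by simp
  qed
qed (use Fil_M[OF gJ_adapted[OF m k]] in measurable)

text \<open>The bound \<open>y\<close> with a slack: a Riemann sum freezes the integrand at a
  partition point up to one mesh width before the time of the cell, and \<open>\<kappa>\<close>
  bounds the change of \<open>xd\<close> and of \<open>E\<close> in between.\<close>

definition yk :: "real \<Rightarrow> nat \<Rightarrow> 'a \<Rightarrow> real" where
  "yk \<kappa> j \<omega> = h U * (S (real (Suc j) * e) \<omega> + \<kappa> + q (j div L) \<omega>) + K * (\<delta> + \<kappa>) powr \<theta> * z (j div L) \<omega>"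

text \<open>From \<open>X\<close> at the partition point the comparison passes to the scheme at the
  same point, then to the scheme at \<open>b\<close>, then to the grid value, so the modulus of
  continuity enters only through the scheme and the clock.\<close>

lemma gJ_le:
  assumes w: "\<omega> \<in> space M" and m: "m \<le> m0 * L" and k: "k < m * Suc J" and \<kappa>: "0 < \<kappa>"
    and mod: "\<And>a b. 0 \<le> a \<Longrightarrow> a \<le> T \<Longrightarrow> 0 \<le> b \<Longrightarrow> b \<le> T \<Longrightarrow> \<bar>a - b\<bar> \<le> T / real (Suc n) \<Longrightarrow>
        \<bar>xd a \<omega> - xd b \<omega>\<bar> \<le> \<kappa> \<and> \<bar>E a \<omega> - E b \<omega>\<bar> \<le> \<kappa>"
  shows "\<bar>gJ n J k \<omega>\<bar> \<le> yk \<kappa> (k div Suc J) \<omega>"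
proof (cases rule: gJ_cases[of n J k \<omega>])
  case 1
  have "k div Suc J < m0 * L" using fine_cell(1)[OF k] m by simp
  then have "k div Suc J div L < m0" by (rule cell_bounds(1))
  then show ?thesis unfolding yk_def 1 using hU_nonneg S_nonneg[OF w] q_nonneg[OF w] z_nonneg K_pos \<kappa>
    by (simp add: add_nonneg_nonneg)
next
  case (2 i)
  define l where "l = k div Suc J div L"
  define j where "j = k div Suc J"
  define b where "b = D (real k * (e / real (Suc J))) \<omega>"
  define s where "s = part n i"
  note a = active_bounds[OF w m k 2(1-3), folded l_def j_def b_def s_def]
  have p: "0 \<le> s" "s \<le> T" using part_bounds[of n i] part_bounds(2)[of i n] 2(1) by (auto simp: s_def)
  note md = mod[OF p a(1,2,11)]
  have sD: "s \<le> D (real (Suc j) * e) \<omega>" using 2(2) a(6) unfolding s_def b_def by linarith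
  have "\<bar>X s \<omega> - xg l \<omega>\<bar> \<le> \<bar>X s \<omega> - xd s \<omega>\<bar> + \<bar>xd s \<omega> - xd b \<omega>\<bar> + \<bar>xd b \<omega> - xg l \<omega>\<bar>" by linarith
  also have "\<dots> \<le> S (real (Suc j) * e) \<omega> + \<kappa> + q l \<omega>"
    using md 2(4) by (intro add_mono S_upper_real[OF w p sD] xd_block_le[OF w a(8,4,5,2)]) (auto simp: s_def)
  finally have Xs: "\<bar>X s \<omega> - xg l \<omega>\<bar> \<le> S (real (Suc j) * e) \<omega> + \<kappa> + q l \<omega>" .
  have "\<bar>E s \<omega> - real l * \<delta>\<bar> \<le> \<delta> + \<kappa>" using md a(12) by linarith
  then have "\<bar>G (E s \<omega>) (X s \<omega>) - G (real l * \<delta>) (xg l \<omega>)\<bar>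
      \<le> h U * \<bar>X s \<omega> - xg l \<omega>\<bar> + K * (\<delta> + \<kappa>) powr \<theta> * (1 + \<bar>xg l \<omega>\<bar>)"
    using delta by (intro increment_le(3) E_nonneg[OF w] a(10)) auto
  also have "\<dots> \<le> h U * (S (real (Suc j) * e) \<omega> + \<kappa> + q l \<omega>) + K * (\<delta> + \<kappa>) powr \<theta> * z l \<omega>"
    unfolding a(7) using Xs hU_nonneg by (intro add_mono mult_left_mono order_refl) auto
  finally show ?thesis using 2(5) by (simp add: yk_def j_def l_def s_def)
qed

text \<open>Its expectation is the isometry sum for the coefficients \<open>gJ n J\<close>. The
  pathwise form permits limits under the integral, where the modulus of continuity depends on the
  path.\<close>

definition P :: "nat \<Rightarrow> nat \<Rightarrow> nat \<Rightarrow> 'a \<Rightarrow> real" where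
  "P m n J \<omega> = (\<Sum>k<m * Suc J. e / real (Suc J) * (gJ n J k \<omega>)\<^sup>2)"

lemma block_sum_le:
  assumes f: "\<And>k. k < m * Suc J \<Longrightarrow> \<bar>f k\<bar> \<le> c (k div Suc J)"
  shows "(\<Sum>k<m * Suc J. e / real (Suc J) * (f k)\<^sup>2) \<le> (\<Sum>j<m. e * (c j)\<^sup>2)"
  unfolding sum_blocks
proof (rule sum_mono)
  fix j assume "j \<in> {..<m}"
  then have j: "j < m" by simp
  have "(\<Sum>i<Suc J. e / real (Suc J) * (f (j * Suc J + i))\<^sup>2) \<le> (\<Sum>i<Suc J. e / real (Suc J) * (c j)\<^sup>2)"
  proof (rule sum_mono)
    fix i assume "i \<in> {..<Suc J}"
    then have i: "i < Suc J" by simp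
    have "j * Suc J + i < Suc j * Suc J" using i by simp
    also have "\<dots> \<le> m * Suc J" using j by (intro mult_right_mono) auto
    finally have "\<bar>f (j * Suc J + i)\<bar> \<le> c ((j * Suc J + i) div Suc J)" by (rule f)
    also have "(j * Suc J + i) div Suc J = j"
      using div_mult_self3[of "Suc J" j i] i by (simp only: div_less add_0_right)
    finally have "(f (j * Suc J + i))\<^sup>2 \<le> (c j)\<^sup>2" using power_mono[of "\<bar>f (j * Suc J + i)\<bar>" "c j" 2] by simp
    then show "e / real (Suc J) * (f (j * Suc J + i))\<^sup>2 \<le> e / real (Suc J) * (c j)\<^sup>2"
      using e_pos by (intro mult_left_mono) auto
  qed
  also have "\<dots> = e * (c j)\<^sup>2" by (simp del: of_nat_Suc)
  finally show "(\<Sum>i<Suc J. e / real (Suc J) * (f (j * Suc J + i))\<^sup>2) \<le> e * (c j)\<^sup>2" .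
qed

end

section \<open>Limits in the grid and along the partitions\<close>

context euler_local
begin

lemma P_meas: "m \<le> m0 * L \<Longrightarrow> P m n J \<in> borel_measurable M"
  unfolding P_def[abs_def]
  by (intro borel_measurable_sum borel_measurable_times borel_measurable_power borel_measurable_const Fil_M[OF gJ_adapted]) auto

lemma P_le:
  assumes w: "\<omega> \<in> space M" and m: "m \<le> m0 * L" and c: "\<And>k. k < m * Suc J \<Longrightarrow> \<bar>gJ n J k \<omega>\<bar> \<le> c (k div Suc J)"
  shows "P m n J \<omega> \<le> (\<Sum>j<m. e * (c j)\<^sup>2)"
  unfolding P_def by (rule block_sum_le) (rule c)

lemma P_integral:
  assumes m: "m \<le> m0 * L"
  shows "integrable M (P m n J)"
    "(\<integral>\<omega>. P m n J \<omega> \<partial>M) = (\<Sum>k<m * Suc J. e / real (Suc J) * (\<integral>\<omega>. (gJ n J k \<omega>)\<^sup>2 \<partial>M))"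
proof -
  have i: "integrable M (\<lambda>\<omega>. e / real (Suc J) * (gJ n J k \<omega>)\<^sup>2)" if "k < m * Suc J" for k
    by (intro integrable_mult_right gJ_square[OF m that])
  show "integrable M (P m n J)" unfolding P_def[abs_def] by (intro Bochner_Integration.integrable_sum i) simp
  have "(\<integral>\<omega>. P m n J \<omega> \<partial>M) = (\<Sum>k<m * Suc J. \<integral>\<omega>. e / real (Suc J) * (gJ n J k \<omega>)\<^sup>2 \<partial>M)"
    unfolding P_def by (intro Bochner_Integration.integral_sum i) simp
  then show "(\<integral>\<omega>. P m n J \<omega> \<partial>M) = (\<Sum>k<m * Suc J. e / real (Suc J) * (\<integral>\<omega>. (gJ n J k \<omega>)\<^sup>2 \<partial>M))"
    by (simp only: integral_mult_right_zero)
qed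

lemma P_nonneg: "0 \<le> P m n J \<omega>"
  unfolding P_def using e_pos by (intro sum_nonneg mult_nonneg_nonneg) auto

lemma ex_fine_sup:
  assumes m: "m \<le> m0 * L"
  shows "\<exists>V. V \<in> borel_measurable M \<and> integrable M (\<lambda>\<omega>. (V \<omega>)\<^sup>2) \<and>
    (\<forall>v \<omega>. \<omega> \<in> space M \<longrightarrow> 0 \<le> v \<longrightarrow> v \<le> real m * e \<longrightarrow>
       \<bar>simple_int (e / real (Suc J)) (m * Suc J) (gJ n J) v \<omega>\<bar> \<le> V \<omega>) \<and>
    (\<integral>\<omega>. (V \<omega>)\<^sup>2 \<partial>M) \<le> 4 * (\<integral>\<omega>. P m n J \<omega> \<partial>M)"
proof -
  have ep: "0 < e / real (Suc J)" using e_pos by simp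
  show ?thesis
  proof (rule continuous_doob[OF ep, of "m * Suc J" "gJ n J"])
    fix V :: "'a \<Rightarrow> real"
    assume V: "V \<in> borel_measurable M" "integrable M (\<lambda>\<omega>. (V \<omega>)\<^sup>2)"
      "\<And>v \<omega>. \<omega> \<in> space M \<Longrightarrow> 0 \<le> v \<Longrightarrow> v \<le> real (m * Suc J) * (e / real (Suc J)) \<Longrightarrow>
        \<bar>simple_int (e / real (Suc J)) (m * Suc J) (gJ n J) v \<omega>\<bar> \<le> V \<omega>"
      "(\<integral>\<omega>. (V \<omega>)\<^sup>2 \<partial>M) \<le> 4 * (\<Sum>k<m * Suc J. e / real (Suc J) * (\<integral>\<omega>. (gJ n J k \<omega>)\<^sup>2 \<partial>M))"
    show ?thesis
      using V(1,2) V(3)[unfolded fine_grid_end] V(4)[folded P_integral(2)[OF m]]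
      by (intro exI[of _ V] conjI allI impI)
  qed (fact gJ_adapted[OF m], fact gJ_square[OF m])
qed

definition In :: "nat \<Rightarrow> real \<Rightarrow> 'a \<Rightarrow> real" where
  "In n t \<omega> = (\<Sum>i<Suc n. G (E (part n i) \<omega>) (X (part n i) \<omega>)
     * (W (E (min t (part n (Suc i))) \<omega>) \<omega> - W (E (min t (part n i)) \<omega>) \<omega>))"

text \<open>The coefficient of partition interval \<open>i\<close> is attached to the grid points
  from \<open>E (part n i)\<close> up to \<open>E (part n (Suc i))\<close>. As the grid is refined,
  \<open>telescope_limit\<close> turns their increments into the increment between these two random
  times.\<close>

lemma fine_limit:
  assumes w: "\<omega> \<in> space M" and t: "0 \<le> t" "t \<le> T" "t \<le> D (real m * e) \<omega>" "alive t \<omega>"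
  shows "(\<lambda>J. simple_int (e / real (Suc J)) (m * Suc J) (gJ n J) (E t \<omega>) \<omega>) \<longlonglongrightarrow> In n t \<omega> - Id m t \<omega>"
proof -
  interpret p: time_change_path "\<lambda>u. D u \<omega>" by (rule paths[OF w])
  define f where "f x = W (min (E t \<omega>) x) \<omega>" for x
  have Et: "0 \<le> E t \<omega>" "E t \<omega> \<le> real m * e" using E_nonneg[OF w] E_le_iff[OF w] t e_pos by auto
  have fc: "continuous_on {0..} f"
    unfolding f_def by (intro continuous_on_compose2[OF W_cont[OF w]] continuous_intros) (use Et in auto)
  have fconst: "f x = f (real m * e)" if "real m * e \<le> x" for x
    using that Et by (simp add: f_def min_def)
  define Gd where "Gd j = G (real (j div L) * \<delta>) (xg (j div L) \<omega>)" for j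
  define Gi where "Gi i = G (E (part n i) \<omega>) (X (part n i) \<omega>)" for i
  define df where "df J k = f (real (Suc k) * (e / real (Suc J))) - f (real k * (e / real (Suc J)))" for J k
  define act where "act J k i \<longleftrightarrow> E (part n i) \<omega> \<le> real k * (e / real (Suc J)) \<and>
     real k * (e / real (Suc J)) < E (part n (Suc i)) \<omega>" for J k i
  have grid0: "0 \<le> real k * (e / real (Suc J))" for k J using e_pos by (intro mult_nonneg_nonneg) auto
  have act_iff: "act J k i \<longleftrightarrow> part n i \<le> D (real k * (e / real (Suc J))) \<omega> \<and>
      D (real k * (e / real (Suc J))) \<omega> < part n (Suc i)" for J k i
    unfolding act_def not_le[symmetric] E_le_iff[OF w grid0] ..
  \<comment> \<open>Past \<open>E t\<close> the increments of the stopped path vanish. Before it the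
    grid point has real time \<open>b < t\<close>, so it lies in a partition interval, whose left
    end is alive because \<open>t\<close> is.\<close>
  have key: "gJ n J k \<omega> * df J k = (\<Sum>i<Suc n. if act J k i then Gi i * df J k else 0) - Gd (k div Suc J) * df J k" for J k
  proof (cases "E t \<omega> \<le> real k * (e / real (Suc J))")
    case True
    moreover have "real k * (e / real (Suc J)) \<le> real (Suc k) * (e / real (Suc J))"
      using e_pos by (intro mult_right_mono) auto
    ultimately have "df J k = 0" by (simp add: df_def f_def min_absorb1 del: of_nat_Suc)
    then show ?thesis by (simp only: mult_zero_right if_cancel sum.neutral_const diff_self)
  next
    case False
    define b where "b = D (real k * (e / real (Suc J))) \<omega>"
    have bt: "b < t" using False E_le_iff[OF w grid0, of t k J] unfolding b_def by simp
    have b0: "0 \<le> b" unfolding b_def by (rule p.nonneg[OF grid0])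
    obtain i where i: "i < Suc n" "part n i \<le> b" "b < part n (Suc i)"
      using part_ex[of b n] b0 bt t by auto
    have "alive (part n i) \<omega>" using alive_mono[OF t(4)] i bt by simp
    then have g: "gJ n J k \<omega> = Gi i - Gd (k div Suc J)"
      using gJ_active[OF i(1), of k J \<omega>] i unfolding b_def Gi_def Gd_def by blast
    have "(\<Sum>j<Suc n. if act J k j then Gi j * df J k else 0) = (\<Sum>j<Suc n. if j = i then Gi i * df J k else 0)"
    proof (intro sum.cong refl)
      fix j
      have "act J k j \<longleftrightarrow> j = i"
        unfolding act_iff b_def[symmetric] using part_unique[OF i(2,3), of j] i by blast
      then show "(if act J k j then Gi j * df J k else 0) = (if j = i then Gi i * df J k else 0)" by auto
    qed
    also have "\<dots> = Gi i * df J k" using i(1) by simp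
    finally show ?thesis unfolding g by (simp only: left_diff_distrib)
  qed
  have "simple_int (e / real (Suc J)) (m * Suc J) (gJ n J) (E t \<omega>) \<omega>
      = (\<Sum>i<Suc n. Gi i * (\<Sum>k<m * Suc J. if act J k i then df J k else 0)) - Id m t \<omega>" for J
  proof -
    have "simple_int (e / real (Suc J)) (m * Suc J) (gJ n J) (E t \<omega>) \<omega> = (\<Sum>k<m * Suc J. gJ n J k \<omega> * df J k)"
      unfolding simple_int_def df_def f_def ..
    also have "\<dots> = (\<Sum>k<m * Suc J. \<Sum>i<Suc n. if act J k i then Gi i * df J k else 0)
        - (\<Sum>k<m * Suc J. Gd (k div Suc J) * df J k)"
      unfolding key sum_subtractf ..
    also have "(\<Sum>k<m * Suc J. \<Sum>i<Suc n. if act J k i then Gi i * df J k else 0)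
        = (\<Sum>i<Suc n. \<Sum>k<m * Suc J. if act J k i then Gi i * df J k else 0)" by (rule sum.swap)
    also have "\<dots> = (\<Sum>i<Suc n. Gi i * (\<Sum>k<m * Suc J. if act J k i then df J k else 0))"
      unfolding sum_distrib_left by (intro sum.cong refl) auto
    also have "(\<Sum>k<m * Suc J. Gd (k div Suc J) * df J k) = Id m t \<omega>"
    proof -
      have "(\<Sum>k<m * Suc J. Gd (k div Suc J) * df J k) = (\<Sum>j<m. \<Sum>i<Suc J. Gd j * df J (j * Suc J + i))"
        unfolding sum_blocks
      proof (intro sum.cong refl)
        fix j i assume "i \<in> {..<Suc J}"
        then have "(j * Suc J + i) div Suc J = j"
          using div_mult_self3[of "Suc J" j i] by (simp only: div_less add_0_right lessThan_iff)
        then show "Gd ((j * Suc J + i) div Suc J) * df J (j * Suc J + i) = Gd j * df J (j * Suc J + i)" by (simp only:)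
      qed
      also have "\<dots> = (\<Sum>j<m. Gd j * (f (real (Suc j) * e) - f (real j * e)))"
      proof (intro sum.cong refl)
        fix j
        have "(\<Sum>i<Suc J. df J (j * Suc J + i)) =
            (\<Sum>i<Suc J. f (real (j * Suc J + Suc i) * (e / real (Suc J))) - f (real (j * Suc J + i) * (e / real (Suc J))))"
          by (simp only: df_def add_Suc_right)
        also have "\<dots> = f (real (j * Suc J + Suc J) * (e / real (Suc J))) - f (real (j * Suc J + 0) * (e / real (Suc J)))"
          by (rule sum_lessThan_telescope)
        also have "real (j * Suc J + Suc J) * (e / real (Suc J)) = real (Suc j) * e"
          using fine_grid_end[of "Suc j" J e] by (simp only: mult_Suc add.commute)
        also have "real (j * Suc J + 0) * (e / real (Suc J)) = real j * e"
          using fine_grid_end[of j J e] by (simp only: add_0_right)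
        finally show "(\<Sum>i<Suc J. Gd j * df J (j * Suc J + i)) = Gd j * (f (real (Suc j) * e) - f (real j * e))"
          by (simp only: sum_distrib_left[symmetric])
      qed
      finally show ?thesis unfolding Id_def Gd_def f_def .
    qed
    finally show ?thesis .
  qed
  moreover have "(\<lambda>J. (\<Sum>i<Suc n. Gi i * (\<Sum>k<m * Suc J. if act J k i then df J k else 0)) - Id m t \<omega>)
      \<longlonglongrightarrow> (\<Sum>i<Suc n. Gi i * (f (E (part n (Suc i)) \<omega>) - f (E (part n i) \<omega>))) - Id m t \<omega>"
  proof (intro tendsto_diff tendsto_const tendsto_sum tendsto_mult)
    fix i
    have "E (part n i) \<omega> \<le> E (part n (Suc i)) \<omega>"
      unfolding E_def by (intro p.inv_mono part_mono) simp
    from telescope_limit[OF e_pos fc fconst E_nonneg[OF w] this]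
    show "(\<lambda>J. \<Sum>k<m * Suc J. if act J k i then df J k else 0) \<longlonglongrightarrow> f (E (part n (Suc i)) \<omega>) - f (E (part n i) \<omega>)"
      unfolding act_def df_def .
  qed
  moreover have "(\<Sum>i<Suc n. Gi i * (f (E (part n (Suc i)) \<omega>) - f (E (part n i) \<omega>))) = In n t \<omega>"
    unfolding In_def Gi_def f_def E_def p.inv_min ..
  ultimately show ?thesis by simp
qed

text \<open>For each path a given \<open>\<kappa>\<close> becomes admissible once the mesh is small,
  for all \<open>J\<close> at once; afterwards \<open>\<kappa>\<close> tends to 0 along
  \<open>1 / (i + 1)\<close>. The supremum over \<open>J\<close> provides a majorant to which the
  limit along the partitions can be applied.\<close>

lemma P_limit:
  assumes w: "\<omega> \<in> space M" and m: "m \<le> m0 * L" and r: "filterlim r at_top sequentially"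
  shows "limsup (\<lambda>n. SUP J. ennreal (4 * P m (r n) J \<omega>)) \<le> ennreal (4 * (\<Sum>j<m. e * (y j \<omega>)\<^sup>2))"
proof -
  have bound: "limsup (\<lambda>n. SUP J. ennreal (4 * P m (r n) J \<omega>)) \<le> ennreal (4 * (\<Sum>j<m. e * (yk \<kappa> j \<omega>)\<^sup>2))"
    if \<kappa>: "0 < \<kappa>" for \<kappa>
  proof (rule Limsup_bounded)
    have "\<forall>\<^sub>F n in sequentially. \<forall>J. P m n J \<omega> \<le> (\<Sum>j<m. e * (yk \<kappa> j \<omega>)\<^sup>2)"
      using uniform_modulus[OF xd_cont[OF w] \<kappa>] uniform_modulus[OF E_cont[OF w, of "{0..T}"] \<kappa>]
    proof eventually_elim
      case (elim n)
      show ?case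
        by (intro allI P_le[OF w m] gJ_le[OF w m _ \<kappa>] conjI) (use elim in auto)
    qed
    then have "\<forall>\<^sub>F n in sequentially. \<forall>J. P m (r n) J \<omega> \<le> (\<Sum>j<m. e * (yk \<kappa> j \<omega>)\<^sup>2)"
      by (rule eventually_compose_filterlim[OF _ r])
    then show "\<forall>\<^sub>F n in sequentially. (SUP J. ennreal (4 * P m (r n) J \<omega>)) \<le> ennreal (4 * (\<Sum>j<m. e * (yk \<kappa> j \<omega>)\<^sup>2))"
      by eventually_elim (auto intro!: SUP_least ennreal_leI)
  qed
  have c0: "(\<lambda>i. 1 / real (Suc i)) \<longlonglongrightarrow> 0" by (rule LIMSEQ_Suc[OF lim_1_over_n])
  have "(\<lambda>i. (\<delta> + 1 / real (Suc i)) powr \<theta>) \<longlonglongrightarrow> (\<delta> + 0) powr \<theta>"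
    using delta by (intro tendsto_intros c0) auto
  then have "(\<lambda>i. yk (1 / real (Suc i)) j \<omega>) \<longlonglongrightarrow> h U * (S (real (Suc j) * e) \<omega> + 0 + q (j div L) \<omega>)
      + K * (\<delta> + 0) powr \<theta> * z (j div L) \<omega>" for j
    unfolding yk_def by (intro tendsto_add tendsto_mult tendsto_const c0) assumption
  then have "(\<lambda>i. yk (1 / real (Suc i)) j \<omega>) \<longlonglongrightarrow> y j \<omega>" for j
    by (simp add: y_def distrib_left)
  then have lim: "(\<lambda>i. ennreal (4 * (\<Sum>j<m. e * (yk (1 / real (Suc i)) j \<omega>)\<^sup>2))) \<longlonglongrightarrow> ennreal (4 * (\<Sum>j<m. e * (y j \<omega>)\<^sup>2))"
    by (intro tendsto_ennrealI tendsto_intros)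
  show ?thesis
    by (rule LIMSEQ_le_const[OF lim]) (use bound in auto)
qed

text \<open>Fatou's lemma is used twice, for \<open>J \<rightarrow> \<infinity>\<close> and then along the partitions, so that no optional
  sampling theorem for the random times \<open>E\<close> is needed.\<close>

lemma ito_bound:
  assumes m: "m \<le> m0 * L"
  obtains \<Theta> where "\<Theta> \<in> borel_measurable M"
    "AE \<omega> in M. \<forall>t\<in>\<rat> \<inter> {0..T}. t \<le> D (real m * e) \<omega> \<longrightarrow> alive t \<omega> \<longrightarrow> ennreal ((I t \<omega> - Id m t \<omega>)\<^sup>2) \<le> \<Theta> \<omega>"
    "(\<integral>\<^sup>+\<omega>. \<Theta> \<omega> \<partial>M) \<le> (\<integral>\<^sup>+\<omega>. ennreal (4 * (\<Sum>j<m. e * (y j \<omega>)\<^sup>2)) \<partial>M)"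
proof -
  define Q where "Q n J V \<longleftrightarrow> V \<in> borel_measurable M \<and> integrable M (\<lambda>\<omega>. (V \<omega>)\<^sup>2) \<and>
    (\<forall>v \<omega>. \<omega> \<in> space M \<longrightarrow> 0 \<le> v \<longrightarrow> v \<le> real m * e \<longrightarrow>
       \<bar>simple_int (e / real (Suc J)) (m * Suc J) (gJ n J) v \<omega>\<bar> \<le> V \<omega>) \<and>
    (\<integral>\<omega>. (V \<omega>)\<^sup>2 \<partial>M) \<le> 4 * (\<integral>\<omega>. P m n J \<omega> \<partial>M)" for n J V
  define V where "V n J = (SOME V. Q n J V)" for n J
  have exQ: "\<exists>V. Q n J V" for n J unfolding Q_def by (rule ex_fine_sup[OF m])
  have "Q n J (V n J)" for n J unfolding V_def using exQ[of n J] by (rule someI_ex)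
  then have V: "\<And>n J. V n J \<in> borel_measurable M" "\<And>n J. integrable M (\<lambda>\<omega>. (V n J \<omega>)\<^sup>2)"
    "\<And>n J v \<omega>. \<omega> \<in> space M \<Longrightarrow> 0 \<le> v \<Longrightarrow> v \<le> real m * e \<Longrightarrow>
       \<bar>simple_int (e / real (Suc J)) (m * Suc J) (gJ n J) v \<omega>\<bar> \<le> V n J \<omega>"
    "\<And>n J. (\<integral>\<omega>. (V n J \<omega>)\<^sup>2 \<partial>M) \<le> 4 * (\<integral>\<omega>. P m n J \<omega> \<partial>M)"
    unfolding Q_def by blast+
  obtain r where r: "filterlim r at_top sequentially"
    and rI: "AE \<omega> in M. \<forall>t\<in>\<rat> \<inter> {0..T}. (\<lambda>n. In (r n) t \<omega>) \<longlonglongrightarrow> I t \<omega>"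
    using I_limit unfolding In_def part_def E_def by blast
  \<comment> \<open>The majorants do not involve \<open>t\<close>: \<open>\<Psi>\<close> survives
    the limit in the grid and \<open>\<Theta>\<close> the limit along the partitions, for all
    rational times simultaneously.\<close>
  define \<Psi> where "\<Psi> n \<omega> = liminf (\<lambda>J. ennreal ((V n J \<omega>)\<^sup>2))" for n \<omega>
  define Pb where "Pb n \<omega> = (SUP J. ennreal (4 * P m (r n) J \<omega>))" for n \<omega>
  define \<Theta> where "\<Theta> \<omega> = liminf (\<lambda>n. \<Psi> (r n) \<omega>)" for \<omega>
  note [measurable] = V(1) P_meas[OF m] crude_square(1)
  have \<Psi>m [measurable]: "\<Psi> n \<in> borel_measurable M" for n unfolding \<Psi>_def[abs_def] by measurable
  have Pbm [measurable]: "Pb n \<in> borel_measurable M" for n unfolding Pb_def[abs_def] by measurable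
  have \<Theta>m: "\<Theta> \<in> borel_measurable M" unfolding \<Theta>_def[abs_def] by measurable
  have \<Psi>b: "ennreal ((In n t \<omega> - Id m t \<omega>)\<^sup>2) \<le> \<Psi> n \<omega>"
    if w: "\<omega> \<in> space M" and t: "0 \<le> t" "t \<le> T" "t \<le> D (real m * e) \<omega>" "alive t \<omega>" for n t \<omega>
  proof -
    have me: "0 \<le> real m * e" using e_pos by simp
    have Et: "0 \<le> E t \<omega>" "E t \<omega> \<le> real m * e" using E_nonneg[OF w] E_le_iff[OF w me] t by auto
    have "(\<lambda>J. ennreal ((simple_int (e / real (Suc J)) (m * Suc J) (gJ n J) (E t \<omega>) \<omega>)\<^sup>2)) \<longlonglongrightarrow> ennreal ((In n t \<omega> - Id m t \<omega>)\<^sup>2)"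
      by (intro tendsto_ennrealI tendsto_power fine_limit[OF w t])
    then have "ennreal ((In n t \<omega> - Id m t \<omega>)\<^sup>2)
        = liminf (\<lambda>J. ennreal ((simple_int (e / real (Suc J)) (m * Suc J) (gJ n J) (E t \<omega>) \<omega>)\<^sup>2))"
      by (rule lim_imp_Liminf[OF sequentially_bot, symmetric])
    also have "\<dots> \<le> \<Psi> n \<omega>"
      unfolding \<Psi>_def
    proof (intro Liminf_mono always_eventually allI ennreal_leI)
      fix J
      show "(simple_int (e / real (Suc J)) (m * Suc J) (gJ n J) (E t \<omega>) \<omega>)\<^sup>2 \<le> (V n J \<omega>)\<^sup>2"
        using power_mono[OF V(3)[OF w Et, of J n] abs_ge_zero, of 2] by simp
    qed
    finally show ?thesis .
  qed
  have AE: "AE \<omega> in M. \<forall>t\<in>\<rat> \<inter> {0..T}. t \<le> D (real m * e) \<omega> \<longrightarrow> alive t \<omega> \<longrightarrow> ennreal ((I t \<omega> - Id m t \<omega>)\<^sup>2) \<le> \<Theta> \<omega>"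
    using rI AE_space
  proof eventually_elim
    case (elim \<omega>)
    show ?case
    proof (intro ballI impI)
      fix t assume t: "t \<in> \<rat> \<inter> {0..T}" "t \<le> D (real m * e) \<omega>" "alive t \<omega>"
      have "(\<lambda>n. ennreal ((In (r n) t \<omega> - Id m t \<omega>)\<^sup>2)) \<longlonglongrightarrow> ennreal ((I t \<omega> - Id m t \<omega>)\<^sup>2)"
        using elim(1) t(1) by (intro tendsto_ennrealI tendsto_power tendsto_diff tendsto_const) blast
      then have "ennreal ((I t \<omega> - Id m t \<omega>)\<^sup>2) = liminf (\<lambda>n. ennreal ((In (r n) t \<omega> - Id m t \<omega>)\<^sup>2))"
        by (rule lim_imp_Liminf[OF sequentially_bot, symmetric])
      also have "\<dots> \<le> \<Theta> \<omega>"
        unfolding \<Theta>_def using t by (intro Liminf_mono always_eventually allI \<Psi>b[OF elim(2)]) auto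
      finally show "ennreal ((I t \<omega> - Id m t \<omega>)\<^sup>2) \<le> \<Theta> \<omega>" .
    qed
  qed
  have \<Psi>i: "(\<integral>\<^sup>+\<omega>. \<Psi> (r n) \<omega> \<partial>M) \<le> (\<integral>\<^sup>+\<omega>. Pb n \<omega> \<partial>M)" for n
  proof -
    have "(\<integral>\<^sup>+\<omega>. \<Psi> (r n) \<omega> \<partial>M) \<le> liminf (\<lambda>J. \<integral>\<^sup>+\<omega>. ennreal ((V (r n) J \<omega>)\<^sup>2) \<partial>M)"
      unfolding \<Psi>_def by (rule nn_integral_liminf) measurable
    also have "\<dots> \<le> (\<integral>\<^sup>+\<omega>. Pb n \<omega> \<partial>M)"
    proof (intro Liminf_le always_eventually allI sequentially_bot)
      fix J
      have "(\<integral>\<^sup>+\<omega>. ennreal ((V (r n) J \<omega>)\<^sup>2) \<partial>M) = ennreal (\<integral>\<omega>. (V (r n) J \<omega>)\<^sup>2 \<partial>M)"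
        by (rule nn_integral_eq_integral[OF V(2)]) simp
      also have "\<dots> \<le> ennreal (\<integral>\<omega>. 4 * P m (r n) J \<omega> \<partial>M)"
        using V(4)[of "r n" J] by (intro ennreal_leI) simp
      also have "\<dots> = (\<integral>\<^sup>+\<omega>. ennreal (4 * P m (r n) J \<omega>) \<partial>M)"
        using P_integral(1)[OF m] P_nonneg by (intro nn_integral_eq_integral[symmetric]) auto
      also have "\<dots> \<le> (\<integral>\<^sup>+\<omega>. Pb n \<omega> \<partial>M)"
        unfolding Pb_def by (intro nn_integral_mono SUP_upper) simp
      finally show "(\<integral>\<^sup>+\<omega>. ennreal ((V (r n) J \<omega>)\<^sup>2) \<partial>M) \<le> (\<integral>\<^sup>+\<omega>. Pb n \<omega> \<partial>M)" .
    qed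
    finally show ?thesis .
  qed
  define dom where "dom \<omega> = 4 * (\<Sum>j<m. e * (crude \<omega>)\<^sup>2)" for \<omega>
  have domi: "integrable M dom" unfolding dom_def[abs_def]
    by (intro integrable_mult_right Bochner_Integration.integrable_sum crude_square)
  have "(\<integral>\<^sup>+\<omega>. \<Theta> \<omega> \<partial>M) \<le> liminf (\<lambda>n. \<integral>\<^sup>+\<omega>. \<Psi> (r n) \<omega> \<partial>M)"
    unfolding \<Theta>_def by (rule nn_integral_liminf) measurable
  also have "\<dots> \<le> liminf (\<lambda>n. \<integral>\<^sup>+\<omega>. Pb n \<omega> \<partial>M)"
    using \<Psi>i by (intro Liminf_mono always_eventually) auto
  also have "\<dots> \<le> limsup (\<lambda>n. \<integral>\<^sup>+\<omega>. Pb n \<omega> \<partial>M)" by (rule Liminf_le_Limsup) simp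
  \<comment> \<open>The reverse Fatou lemma. The domination holds because \<open>crude\<close>
    bounds every coefficient \<open>gJ\<close>.\<close>
  also have "\<dots> \<le> (\<integral>\<^sup>+\<omega>. limsup (\<lambda>n. Pb n \<omega>) \<partial>M)"
  proof (rule nn_integral_limsup)
    show "(\<lambda>\<omega>. ennreal (dom \<omega>)) \<in> borel_measurable M" using domi by measurable
    have "(\<integral>\<^sup>+\<omega>. ennreal (dom \<omega>) \<partial>M) = ennreal (\<integral>\<omega>. dom \<omega> \<partial>M)"
    proof (rule nn_integral_eq_integral[OF domi AE_I2])
      show "0 \<le> dom \<omega>" for \<omega> unfolding dom_def using e_pos by (intro mult_nonneg_nonneg sum_nonneg) auto
    qed
    then show "(\<integral>\<^sup>+\<omega>. ennreal (dom \<omega>) \<partial>M) < \<infinity>" by simp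
    show "AE \<omega> in M. Pb n \<omega> \<le> ennreal (dom \<omega>)" for n
      unfolding Pb_def dom_def
      by (intro AE_I2 SUP_least ennreal_leI mult_left_mono P_le[OF _ m] gJ_crude[OF _ m]) auto
  qed measurable
  also have "\<dots> \<le> (\<integral>\<^sup>+\<omega>. ennreal (4 * (\<Sum>j<m. e * (y j \<omega>)\<^sup>2)) \<partial>M)"
    unfolding Pb_def by (intro nn_integral_mono P_limit[OF _ m r])
  finally show ?thesis by (rule that[OF \<Theta>m AE])
qed

end

subsection \<open>Local mean square error\<close>

text \<open>Since \<open>b \<le> 1 / 2\<close>, the last summand is absorbed on the left at the
  price of a factor 2, which leaves an explicit inequality.\<close>

lemma implicit_gronwall:
  fixes f :: "nat \<Rightarrow> real"
  assumes f: "\<And>m. m \<le> N \<Longrightarrow> f m \<le> a + b * (\<Sum>k<m. f (Suc k))"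
    and nn: "\<And>m. 0 \<le> f m" and a: "0 \<le> a" and b: "0 \<le> b" "b \<le> 1 / 2" and N: "0 < N"
  shows "f N \<le> 2 * a * exp (2 * b * real N)"
proof -
  have step: "f (Suc n) \<le> 2 * a + 2 * b * (\<Sum>k<n. f (Suc k))" if "n \<le> N - 1" for n
  proof -
    have "f (Suc n) \<le> a + b * (\<Sum>k<n. f (Suc k)) + b * f (Suc n)"
      using f[of "Suc n"] that N by (simp add: algebra_simps)
    moreover have "b * f (Suc n) \<le> 1 / 2 * f (Suc n)" using b nn by (intro mult_right_mono) auto
    ultimately show ?thesis by simp
  qed
  have "f (Suc (N - 1)) \<le> 2 * a * (1 + 2 * b) ^ (N - 1)"
    by (rule discrete_gronwall[where N="N - 1" and f="\<lambda>n. f (Suc n)"]) (use step b in auto)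
  also have "\<dots> \<le> 2 * a * (1 + 2 * b) ^ N"
    using a b by (intro mult_left_mono power_increasing) auto
  also have "\<dots> \<le> 2 * a * exp (2 * b) ^ N"
    using a b by (intro mult_left_mono power_mono exp_ge_add_one_self) auto
  also have "exp (2 * b) ^ N = exp (2 * b * real N)" by (simp add: exp_of_nat_mult mult.commute)
  finally show ?thesis using N by simp
qed

context euler_local
begin

text \<open>The pathwise bound is squared and integrated. In \<open>U + 4\<close> the
  \<open>U\<close> is the Cauchy-Schwarz factor of the \<open>F\<close> sum and 4 the constant of
  Doob's inequality.\<close>

lemma S_recursion:
  assumes m: "m \<le> m0 * L"
  shows "(\<integral>\<omega>. (S (real m * e) \<omega>)\<^sup>2 \<partial>M) \<le> 3 * (K * \<delta> powr \<theta> * T)\<^sup>2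
      + 3 * (U + 4) * (\<Sum>k<m. e * (\<integral>\<omega>. (y k \<omega>)\<^sup>2 \<partial>M))"
proof -
  have me: "0 \<le> real m * e" using e_pos by simp
  have "real m * e \<le> real (m0 * L) * e" using m e_pos by (intro mult_right_mono of_nat_mono) auto
  also have "\<dots> = real m0 * (real L * e)" by simp
  also have "\<dots> = U" unfolding delta_eq[symmetric] U_def ..
  finally have meU: "real m * e \<le> U" .
  obtain \<Theta> where \<Theta>: "\<Theta> \<in> borel_measurable M"
    "AE \<omega> in M. \<forall>t\<in>\<rat> \<inter> {0..T}. t \<le> D (real m * e) \<omega> \<longrightarrow> alive t \<omega> \<longrightarrow> ennreal ((I t \<omega> - Id m t \<omega>)\<^sup>2) \<le> \<Theta> \<omega>"
    "(\<integral>\<^sup>+\<omega>. \<Theta> \<omega> \<partial>M) \<le> (\<integral>\<^sup>+\<omega>. ennreal (4 * (\<Sum>j<m. e * (y j \<omega>)\<^sup>2)) \<partial>M)"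
    by (rule ito_bound[OF m])
  define c where "c = K * \<delta> powr \<theta> * T"
  define Y where "Y \<omega> = (\<Sum>j<m. e * (y j \<omega>)\<^sup>2)" for \<omega>
  have c: "0 \<le> c" using K_pos T_pos by (simp add: c_def)
  have Y0: "0 \<le> Y \<omega>" for \<omega> unfolding Y_def using e_pos by (intro sum_nonneg) auto
  have y2: "integrable M (\<lambda>\<omega>. e * (y j \<omega>)\<^sup>2)" if "j < m" for j
    using y_square(2)[of j] that m by (intro integrable_mult_right) auto
  have Yi: "integrable M Y" unfolding Y_def[abs_def] by (intro Bochner_Integration.integrable_sum y2) simp
  have YE: "(\<integral>\<omega>. Y \<omega> \<partial>M) = (\<Sum>k<m. e * (\<integral>\<omega>. (y k \<omega>)\<^sup>2 \<partial>M))"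
  proof -
    have "(\<integral>\<omega>. Y \<omega> \<partial>M) = (\<Sum>k<m. \<integral>\<omega>. e * (y k \<omega>)\<^sup>2 \<partial>M)"
      unfolding Y_def by (intro Bochner_Integration.integral_sum y2) simp
    then show ?thesis by (simp only: integral_mult_right_zero)
  qed
  have "AE \<omega> in M. ennreal ((S (real m * e) \<omega>)\<^sup>2) \<le> ennreal (3 * c\<^sup>2 + 3 * (U * Y \<omega>)) + 3 * \<Theta> \<omega>"
    using \<Theta>(2) sde AE_space
  proof eventually_elim
    case (elim \<omega>)
    note w = elim(3)
    show ?case
    proof (cases "\<Theta> \<omega>")
      \<comment> \<open>\<open>\<Theta>\<close> is an extended real; where it is infinite the claim
        is void.\<close>
      case top
      then show ?thesis by (simp add: ennreal_mult_top)
    next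
      case (real \<tau>)
      define B where "B = 3 * c\<^sup>2 + 3 * (U * Y \<omega>) + 3 * \<tau>"
      have B: "0 \<le> B" using U_nonneg Y0 real by (simp add: B_def)
      have "S (real m * e) \<omega> \<le> sqrt B"
      proof (rule S_least[OF w])
        show "0 \<le> sqrt B" using B by simp
        fix t assume t: "t \<in> \<rat>" "0 \<le> t" "t \<le> T" "t \<le> D (real m * e) \<omega>" "alive t \<omega>"
        have "X t \<omega> = x0 + (LINT r:{0<..t}|lborel. H (E r \<omega>))
          + (LINT r:{0<..t}|interval_measure (\<lambda>r. E r \<omega>). F (E r \<omega>) (X r \<omega>)) + I t \<omega>"
        proof -
          have e: "inverse_path (\<lambda>u. D u \<omega>) = (\<lambda>r. E r \<omega>)" by (simp add: E_def fun_eq_iff)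
          show ?thesis using elim(2) t unfolding e by simp
        qed
        from error_bound[OF w m this t(2-5), folded c_def]
        have "\<bar>X t \<omega> - xd t \<omega>\<bar> \<le> c + (\<Sum>k<m. e * y k \<omega>) + \<bar>I t \<omega> - Id m t \<omega>\<bar>" .
        then have "\<bar>X t \<omega> - xd t \<omega>\<bar>\<^sup>2 \<le> (c + (\<Sum>k<m. e * y k \<omega>) + \<bar>I t \<omega> - Id m t \<omega>\<bar>)\<^sup>2"
          by (intro power_mono) auto
        also have "\<dots> \<le> 3 * c\<^sup>2 + 3 * (\<Sum>k<m. e * y k \<omega>)\<^sup>2 + 3 * \<bar>I t \<omega> - Id m t \<omega>\<bar>\<^sup>2"
          by (rule square_sum3_le)
        also have "\<dots> \<le> B"
        proof -
          have "(\<Sum>k<m. e * y k \<omega>)\<^sup>2 \<le> real m * e * Y \<omega>"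
            unfolding Y_def using e_pos by (intro square_weighted_sum_le) auto
          also have "\<dots> \<le> U * Y \<omega>" using meU Y0 by (intro mult_right_mono) auto
          finally have "(\<Sum>k<m. e * y k \<omega>)\<^sup>2 \<le> U * Y \<omega>" .
          moreover have "ennreal ((I t \<omega> - Id m t \<omega>)\<^sup>2) \<le> ennreal \<tau>" using elim(1) t real by auto
          then have "\<bar>I t \<omega> - Id m t \<omega>\<bar>\<^sup>2 \<le> \<tau>" using real by simp
          ultimately show ?thesis unfolding B_def by linarith
        qed
        finally show "\<bar>X t \<omega> - xd t \<omega>\<bar> \<le> sqrt B" by (simp add: real_le_rsqrt)
      qed
      then have "(S (real m * e) \<omega>)\<^sup>2 \<le> B"
        using power_mono[OF _ S_nonneg[OF w], of _ "sqrt B" 2] B by simp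
      then have "ennreal ((S (real m * e) \<omega>)\<^sup>2) \<le> ennreal B" by (rule ennreal_leI)
      also have "\<dots> = ennreal (3 * c\<^sup>2 + 3 * (U * Y \<omega>)) + ennreal (3 * \<tau>)"
        unfolding B_def using U_nonneg Y0 real by (intro ennreal_plus) auto
      also have "ennreal (3 * \<tau>) = 3 * \<Theta> \<omega>" using real by (simp add: ennreal_mult)
      finally show ?thesis .
    qed
  qed
  then have "(\<integral>\<^sup>+\<omega>. ennreal ((S (real m * e) \<omega>)\<^sup>2) \<partial>M) \<le> (\<integral>\<^sup>+\<omega>. (ennreal (3 * c\<^sup>2 + 3 * (U * Y \<omega>)) + 3 * \<Theta> \<omega>) \<partial>M)"
    by (rule nn_integral_mono_AE)
  also have "\<dots> = (\<integral>\<^sup>+\<omega>. ennreal (3 * c\<^sup>2 + 3 * (U * Y \<omega>)) \<partial>M) + 3 * (\<integral>\<^sup>+\<omega>. \<Theta> \<omega> \<partial>M)"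
    using Yi \<Theta>(1) by (subst nn_integral_add) (auto simp: nn_integral_cmult)
  also have "\<dots> \<le> (\<integral>\<^sup>+\<omega>. ennreal (3 * c\<^sup>2 + 3 * (U * Y \<omega>)) \<partial>M) + 3 * (\<integral>\<^sup>+\<omega>. ennreal (4 * Y \<omega>) \<partial>M)"
    using \<Theta>(3) unfolding Y_def by (intro add_left_mono mult_left_mono) auto
  also have "(\<integral>\<^sup>+\<omega>. ennreal (3 * c\<^sup>2 + 3 * (U * Y \<omega>)) \<partial>M) = ennreal (\<integral>\<omega>. 3 * c\<^sup>2 + 3 * (U * Y \<omega>) \<partial>M)"
    using Yi Y0 U_nonneg by (intro nn_integral_eq_integral) auto
  also have "(\<integral>\<omega>. 3 * c\<^sup>2 + 3 * (U * Y \<omega>) \<partial>M) = 3 * c\<^sup>2 + 3 * (U * (\<integral>\<omega>. Y \<omega> \<partial>M))"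
    using Yi by (simp add: prob_space)
  also have "(\<integral>\<^sup>+\<omega>. ennreal (4 * Y \<omega>) \<partial>M) = ennreal (4 * (\<integral>\<omega>. Y \<omega> \<partial>M))"
    using nn_integral_eq_integral[of M "\<lambda>\<omega>. 4 * Y \<omega>"] Yi Y0 by simp
  also have "3 * ennreal (4 * (\<integral>\<omega>. Y \<omega> \<partial>M)) = ennreal (3 * (4 * (\<integral>\<omega>. Y \<omega> \<partial>M)))"
    using Y0 by (subst ennreal_mult) (auto intro!: integral_nonneg)
  also have "ennreal (3 * c\<^sup>2 + 3 * (U * (\<integral>\<omega>. Y \<omega> \<partial>M))) + \<dots>
      = ennreal (3 * c\<^sup>2 + 3 * (U * (\<integral>\<omega>. Y \<omega> \<partial>M)) + 3 * (4 * (\<integral>\<omega>. Y \<omega> \<partial>M)))"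
    using U_nonneg Y0 by (intro ennreal_plus[symmetric]) (auto intro!: integral_nonneg mult_nonneg_nonneg add_nonneg_nonneg)
  also have "3 * c\<^sup>2 + 3 * (U * (\<integral>\<omega>. Y \<omega> \<partial>M)) + 3 * (4 * (\<integral>\<omega>. Y \<omega> \<partial>M)) = 3 * c\<^sup>2 + 3 * (U + 4) * (\<integral>\<omega>. Y \<omega> \<partial>M)"
    by (simp add: algebra_simps)
  finally have "ennreal (\<integral>\<omega>. (S (real m * e) \<omega>)\<^sup>2 \<partial>M) \<le> ennreal (3 * c\<^sup>2 + 3 * (U + 4) * (\<integral>\<omega>. Y \<omega> \<partial>M))"
    using nn_integral_eq_integral[OF S_square[OF me meU]] by simp
  moreover have "0 \<le> 3 * c\<^sup>2 + 3 * (U + 4) * (\<integral>\<omega>. Y \<omega> \<partial>M)"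
    using U_nonneg Y0 by (auto intro!: integral_nonneg mult_nonneg_nonneg add_nonneg_nonneg)
  ultimately show ?thesis unfolding YE c_def by simp
qed

text \<open>Each \<open>q n\<close> occurs on \<open>L\<close> cells of mesh \<open>e\<close>, and
  \<open>real L * e = \<delta>\<close> is the weight for which \<open>sum_q_square\<close> gives a
  small total.\<close>

lemma sum_y_le:
  assumes m: "m \<le> m0 * L"
  shows "(\<Sum>k<m. e * (\<integral>\<omega>. (y k \<omega>)\<^sup>2 \<partial>M)) \<le> 3 * (h U)\<^sup>2 * e * (\<Sum>k<m. \<integral>\<omega>. (S (real (Suc k) * e) \<omega>)\<^sup>2 \<partial>M)
      + 3 * (h U)\<^sup>2 * (3 * (h U)\<^sup>2 * (T\<^sup>2 + 5 * U * A) * \<delta>) + 3 * (K * \<delta> powr \<theta>)\<^sup>2 * A * U"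
proof -
  have "(\<Sum>k<m. e * (\<integral>\<omega>. (y k \<omega>)\<^sup>2 \<partial>M)) \<le> (\<Sum>k<m. e * (3 * (h U)\<^sup>2 * (\<integral>\<omega>. (S (real (Suc k) * e) \<omega>)\<^sup>2 \<partial>M)
      + 3 * (h U)\<^sup>2 * (\<integral>\<omega>. (q (k div L) \<omega>)\<^sup>2 \<partial>M) + 3 * (K * \<delta> powr \<theta>)\<^sup>2 * A))"
    using e_pos m by (intro sum_mono mult_left_mono y_square(3)) auto
  also have "\<dots> = 3 * (h U)\<^sup>2 * e * (\<Sum>k<m. \<integral>\<omega>. (S (real (Suc k) * e) \<omega>)\<^sup>2 \<partial>M)
      + 3 * (h U)\<^sup>2 * (\<Sum>k<m. e * (\<integral>\<omega>. (q (k div L) \<omega>)\<^sup>2 \<partial>M)) + 3 * (K * \<delta> powr \<theta>)\<^sup>2 * A * (real m * e)"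
    by (simp add: sum.distrib sum_distrib_left algebra_simps)
  also have "\<dots> \<le> 3 * (h U)\<^sup>2 * e * (\<Sum>k<m. \<integral>\<omega>. (S (real (Suc k) * e) \<omega>)\<^sup>2 \<partial>M)
      + 3 * (h U)\<^sup>2 * (3 * (h U)\<^sup>2 * (T\<^sup>2 + 5 * U * A) * \<delta>) + 3 * (K * \<delta> powr \<theta>)\<^sup>2 * A * U"
  proof (intro add_mono order_refl mult_left_mono)
    have "(\<Sum>k<m. e * (\<integral>\<omega>. (q (k div L) \<omega>)\<^sup>2 \<partial>M)) \<le> (\<Sum>k<m0 * L. e * (\<integral>\<omega>. (q (k div L) \<omega>)\<^sup>2 \<partial>M))"
      using m e_pos by (intro sum_mono2) auto
    also have "\<dots> = (\<Sum>n<m0. \<Sum>i<L. e * (\<integral>\<omega>. (q n \<omega>)\<^sup>2 \<partial>M))"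
      unfolding sum_blocks
    proof (intro sum.cong refl)
      fix n i assume "i \<in> {..<L}"
      then have "(n * L + i) div L = n" using L by simp
      then show "e * (\<integral>\<omega>. (q ((n * L + i) div L) \<omega>)\<^sup>2 \<partial>M) = e * (\<integral>\<omega>. (q n \<omega>)\<^sup>2 \<partial>M)" by (simp only:)
    qed
    also have "\<dots> = (\<Sum>n<m0. (real L * e) * (\<integral>\<omega>. (q n \<omega>)\<^sup>2 \<partial>M))" by (simp add: mult.assoc)
    also have "\<dots> = (\<Sum>n<m0. \<delta> * (\<integral>\<omega>. (q n \<omega>)\<^sup>2 \<partial>M))" unfolding delta_eq[symmetric] ..
    also note sum_q_square
    finally show "(\<Sum>k<m. e * (\<integral>\<omega>. (q (k div L) \<omega>)\<^sup>2 \<partial>M)) \<le> 3 * (h U)\<^sup>2 * (T\<^sup>2 + 5 * U * A) * \<delta>" .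
    have "real m * e \<le> real (m0 * L) * e" using m e_pos by (intro mult_right_mono of_nat_mono) auto
    also have "\<dots> = real m0 * (real L * e)" by simp
    also have "\<dots> = U" unfolding delta_eq[symmetric] U_def ..
    finally show "real m * e \<le> U" .
  qed (use A_nonneg in auto)
  finally show ?thesis .
qed

text \<open>The inhomogeneous term of the Gronwall inequality: everything except the error
  itself.\<close>

definition a_const :: real where
  "a_const = 3 * (K * \<delta> powr \<theta> * T)\<^sup>2 + 3 * (U + 4) * (3 * (h U)\<^sup>2 * (3 * (h U)\<^sup>2 * (T\<^sup>2 + 5 * U * A) * \<delta>)
     + 3 * (K * \<delta> powr \<theta>)\<^sup>2 * A * U)"

text \<open>The smallness condition is the \<open>b \<le> 1 / 2\<close> of the implicit Gronwall
  inequality. In the product of \<open>b\<close> with the number of cells the mesh cancels, so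
  neither \<open>L\<close> nor \<open>R\<close> appears in the result.\<close>

lemma S_bound:
  assumes small: "9 * (U + 4) * (h U)\<^sup>2 * e \<le> 1 / 2"
  shows "(\<integral>\<omega>. (S U \<omega>)\<^sup>2 \<partial>M) \<le> 2 * a_const * exp (18 * (U + 4) * (h U)\<^sup>2 * U)"
proof -
  define b where "b = 9 * (U + 4) * (h U)\<^sup>2 * e"
  have top: "real (m0 * L) * e = U"
  proof -
    have "real (m0 * L) * e = real m0 * (real L * e)" by simp
    also have "\<dots> = U" unfolding delta_eq[symmetric] U_def ..
    finally show ?thesis .
  qed
  have "(\<integral>\<omega>. (S (real (m0 * L) * e) \<omega>)\<^sup>2 \<partial>M) \<le> 2 * a_const * exp (2 * b * real (m0 * L))"
  proof (rule implicit_gronwall[where f="\<lambda>m. \<integral>\<omega>. (S (real m * e) \<omega>)\<^sup>2 \<partial>M"])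
    fix m assume m: "m \<le> m0 * L"
    have "(\<integral>\<omega>. (S (real m * e) \<omega>)\<^sup>2 \<partial>M) \<le> 3 * (K * \<delta> powr \<theta> * T)\<^sup>2
      + 3 * (U + 4) * (\<Sum>k<m. e * (\<integral>\<omega>. (y k \<omega>)\<^sup>2 \<partial>M))" by (rule S_recursion[OF m])
    also have "\<dots> \<le> 3 * (K * \<delta> powr \<theta> * T)\<^sup>2 + 3 * (U + 4) *
      (3 * (h U)\<^sup>2 * e * (\<Sum>k<m. \<integral>\<omega>. (S (real (Suc k) * e) \<omega>)\<^sup>2 \<partial>M)
      + 3 * (h U)\<^sup>2 * (3 * (h U)\<^sup>2 * (T\<^sup>2 + 5 * U * A) * \<delta>) + 3 * (K * \<delta> powr \<theta>)\<^sup>2 * A * U)"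
      using U_nonneg by (intro add_left_mono mult_left_mono sum_y_le[OF m]) auto
    also have "\<dots> = a_const + b * (\<Sum>k<m. \<integral>\<omega>. (S (real (Suc k) * e) \<omega>)\<^sup>2 \<partial>M)"
    proof -
      define Z where "Z = (\<Sum>k<m. \<integral>\<omega>. (S (real (Suc k) * e) \<omega>)\<^sup>2 \<partial>M)"
      show ?thesis unfolding a_const_def b_def Z_def[symmetric] by (simp add: algebra_simps)
    qed
    finally show "(\<integral>\<omega>. (S (real m * e) \<omega>)\<^sup>2 \<partial>M) \<le> a_const + b * (\<Sum>k<m. \<integral>\<omega>. (S (real (Suc k) * e) \<omega>)\<^sup>2 \<partial>M)" .
  next
    show "0 \<le> a_const" unfolding a_const_def using U_nonneg A_nonneg delta
      by (intro add_nonneg_nonneg mult_nonneg_nonneg) auto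
    show "0 \<le> b" unfolding b_def using U_nonneg e_pos by simp
    show "b \<le> 1 / 2" unfolding b_def by (rule small)
    show "0 < m0 * L" using m0 L by simp
  qed simp
  also have "2 * b * real (m0 * L) = 18 * (U + 4) * (h U)\<^sup>2 * (real (m0 * L) * e)" by (simp add: b_def)
  finally show ?thesis unfolding top .
qed

end

section \<open>Constants depending on the operational horizon only\<close>

context euler_setup
begin

definition moment_const :: "real \<Rightarrow> real" where
  "moment_const u = 3 * (1 + \<bar>x0\<bar> + h u * T)\<^sup>2 * exp (3 * (h u)\<^sup>2 * (u + 1) * u)"

text \<open>The bound of \<open>S_bound\<close> with the powers of \<open>\<delta>\<close> taken
  out, as a function of the horizon alone.\<close>

definition error_const :: "real \<Rightarrow> real" where
  "error_const u = 2 * (3 * (K * T)\<^sup>2 + 3 * (u + 4) * (3 * (h u)\<^sup>2 * (3 * (h u)\<^sup>2 * (T\<^sup>2 + 5 * u * moment_const u))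
     + 3 * K\<^sup>2 * moment_const u * u)) * exp (18 * (u + 4) * (h u)\<^sup>2 * u)"

text \<open>Two squared rates meet here: \<open>(\<delta> powr \<theta>)\<^sup>2\<close> from the
  Hoelder terms and \<open>\<delta>\<close> from the oscillation inside the blocks. The slower one
  decides the order.\<close>

lemma powr_min_theta_bounds:
  assumes "0 < \<delta>" "\<delta> < 1"
  shows "(\<delta> powr \<theta>)\<^sup>2 \<le> \<delta> powr (2 * min \<theta> (1 / 2))" "\<delta> \<le> \<delta> powr (2 * min \<theta> (1 / 2))"
proof -
  have "(\<delta> powr \<theta>)\<^sup>2 = \<delta> powr (2 * \<theta>)" using assms by (simp add: powr_power mult.commute)
  also have "\<dots> \<le> \<delta> powr (2 * min \<theta> (1 / 2))" using assms by (intro powr_mono') auto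
  finally show "(\<delta> powr \<theta>)\<^sup>2 \<le> \<delta> powr (2 * min \<theta> (1 / 2))" .
  have "\<delta> powr 1 \<le> \<delta> powr (2 * min \<theta> (1 / 2))" using assms by (intro powr_mono') auto
  then show "\<delta> \<le> \<delta> powr (2 * min \<theta> (1 / 2))" using assms by simp
qed

end

lemma (in euler_local) a_const_le:
  "2 * a_const * exp (18 * (U + 4) * (h U)\<^sup>2 * U) \<le> error_const U * \<delta> powr (2 * min \<theta> (1 / 2))"
proof -
  define p where "p = \<delta> powr (2 * min \<theta> (1 / 2))"
  note p = powr_min_theta_bounds[OF delta, folded p_def]
  have A: "moment_const U = A" unfolding moment_const_def A_def c0_def ..
  have 1: "3 * (K * \<delta> powr \<theta> * T)\<^sup>2 \<le> 3 * (K * T)\<^sup>2 * p"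
    using mult_left_mono[OF p(1), of "3 * (K * T)\<^sup>2"] by (simp add: power_mult_distrib mult_ac)
  have 2: "3 * (h U)\<^sup>2 * (3 * (h U)\<^sup>2 * (T\<^sup>2 + 5 * U * A) * \<delta>) \<le> 3 * (h U)\<^sup>2 * (3 * (h U)\<^sup>2 * (T\<^sup>2 + 5 * U * A)) * p"
  proof -
    have "0 \<le> 3 * (h U)\<^sup>2 * (3 * (h U)\<^sup>2 * (T\<^sup>2 + 5 * U * A))"
      using U_nonneg A_nonneg by (intro mult_nonneg_nonneg add_nonneg_nonneg) auto
    from mult_left_mono[OF p(2) this] show ?thesis by (simp only: mult.assoc)
  qed
  have 3: "3 * (K * \<delta> powr \<theta>)\<^sup>2 * A * U \<le> 3 * K\<^sup>2 * A * U * p"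
  proof -
    have "0 \<le> 3 * K\<^sup>2 * A * U" using U_nonneg A_nonneg by simp
    from mult_left_mono[OF p(1) this] show ?thesis by (simp only: power_mult_distrib mult_ac)
  qed
  have "a_const \<le> 3 * (K * T)\<^sup>2 * p + 3 * (U + 4) * (3 * (h U)\<^sup>2 * (3 * (h U)\<^sup>2 * (T\<^sup>2 + 5 * U * A)) * p + 3 * K\<^sup>2 * A * U * p)"
    unfolding a_const_def using 1 2 3 U_nonneg by (intro add_mono mult_left_mono) auto
  also have "\<dots> = (3 * (K * T)\<^sup>2 + 3 * (U + 4) * (3 * (h U)\<^sup>2 * (3 * (h U)\<^sup>2 * (T\<^sup>2 + 5 * U * A)) + 3 * K\<^sup>2 * A * U)) * p"
    by (simp only: distrib_left distrib_right mult.assoc)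
  finally have "2 * a_const * exp (18 * (U + 4) * (h U)\<^sup>2 * U)
     \<le> 2 * ((3 * (K * T)\<^sup>2 + 3 * (U + 4) * (3 * (h U)\<^sup>2 * (3 * (h U)\<^sup>2 * (T\<^sup>2 + 5 * U * A)) + 3 * K\<^sup>2 * A * U)) * p)
       * exp (18 * (U + 4) * (h U)\<^sup>2 * U)"
    by (intro mult_right_mono mult_left_mono) auto
  then show ?thesis unfolding error_const_def A p_def by (simp only: mult_ac)
qed

text \<open>The localisation is spelled out and \<open>S\<close> is hidden behind the existential
  quantifier, so that the result can be used outside the locale for varying \<open>R\<close> and
  \<open>L\<close>.\<close>

lemma (in euler_local) local_bound:
  assumes small: "9 * (U + 4) * (h U)\<^sup>2 * e \<le> 1 / 2"
  shows "\<exists>V. V \<in> borel_measurable M \<and>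
    (\<forall>\<omega>\<in>space M. \<forall>t\<in>\<rat> \<inter> {0..T}. t \<le> D U \<omega> \<longrightarrow> (\<forall>r\<in>\<rat> \<inter> {0..t}. \<bar>X r \<omega>\<bar> \<le> R) \<longrightarrow>
        ennreal ((X t \<omega> - xd t \<omega>)\<^sup>2) \<le> V \<omega>) \<and>
    (\<integral>\<^sup>+\<omega>. V \<omega> \<partial>M) \<le> ennreal (error_const U * \<delta> powr (2 * min \<theta> (1 / 2)))"
proof (intro exI[of _ "\<lambda>\<omega>. ennreal ((S U \<omega>)\<^sup>2)"] conjI ballI impI)
  show "(\<lambda>\<omega>. ennreal ((S U \<omega>)\<^sup>2)) \<in> borel_measurable M" using S_meas[OF U_nonneg] by measurable
  fix \<omega> t assume w: "\<omega> \<in> space M" and t: "t \<in> \<rat> \<inter> {0..T}" "t \<le> D U \<omega>" and a: "\<forall>r\<in>\<rat> \<inter> {0..t}. \<bar>X r \<omega>\<bar> \<le> R"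
  have "alive t \<omega>" using a by (simp add: alive_def)
  then have "\<bar>X t \<omega> - xd t \<omega>\<bar> \<le> S U \<omega>" using t by (intro S_upper[OF w]) auto
  from power_mono[OF this abs_ge_zero, of 2]
  show "ennreal ((X t \<omega> - xd t \<omega>)\<^sup>2) \<le> ennreal ((S U \<omega>)\<^sup>2)" by (simp add: ennreal_leI)
next
  have "(\<integral>\<^sup>+\<omega>. ennreal ((S U \<omega>)\<^sup>2) \<partial>M) = ennreal (\<integral>\<omega>. (S U \<omega>)\<^sup>2 \<partial>M)"
    by (rule nn_integral_eq_integral[OF S_square[OF U_nonneg order_refl]]) simp
  also have "\<dots> \<le> ennreal (error_const U * \<delta> powr (2 * min \<theta> (1 / 2)))"
    using S_bound[OF small] a_const_le by (intro ennreal_leI) linarith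
  finally show "(\<integral>\<^sup>+\<omega>. ennreal ((S U \<omega>)\<^sup>2) \<partial>M) \<le> ennreal (error_const U * \<delta> powr (2 * min \<theta> (1 / 2)))" .
qed

section \<open>Removal of the localisation\<close>

context euler_step
begin

text \<open>The local bounds are uniform in \<open>R\<close>. A continuous path is bounded on
  \<open>[0, T]\<close>, so the localisation is inactive for all large \<open>R = n\<close>, and
  Fatou's lemma removes it.\<close>

lemma error_square_bound:
  assumes m0: "0 < m0"
  shows "(\<integral>\<^sup>+\<omega>. (SUP t\<in>\<rat> \<inter> {0..T}. if t \<le> D U \<omega> then ennreal ((X t \<omega> - xd t \<omega>)\<^sup>2) else 0) \<partial>M)
    \<le> ennreal (error_const U * \<delta> powr (2 * min \<theta> (1 / 2)))"
proof -
  define b where "b = 9 * (U + 4) * (h U)\<^sup>2"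
  have b0: "0 \<le> b" using U_nonneg by (simp add: b_def)
  \<comment> \<open>This makes the mesh \<open>\<delta> / real L\<close> small enough for
    \<open>S_bound\<close>.\<close>
  obtain L where L: "2 * b * \<delta> < real (L :: nat)" using reals_Archimedean2 by blast
  have L0: "0 < L"
  proof (rule ccontr)
    assume "\<not> 0 < L"
    then have "2 * b * \<delta> < 0" using L by simp
    moreover have "0 \<le> 2 * b * \<delta>" using b0 delta by simp
    ultimately show False by simp
  qed
  have small: "b * (\<delta> / real L) \<le> 1 / 2" using L L0 by (simp add: field_simps)
  define Q where "Q R V \<longleftrightarrow> V \<in> borel_measurable M \<and>
    (\<forall>\<omega>\<in>space M. \<forall>t\<in>\<rat> \<inter> {0..T}. t \<le> D U \<omega> \<longrightarrow> (\<forall>r\<in>\<rat> \<inter> {0..t}. \<bar>X r \<omega>\<bar> \<le> R) \<longrightarrow>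
        ennreal ((X t \<omega> - xd t \<omega>)\<^sup>2) \<le> V \<omega>) \<and>
    (\<integral>\<^sup>+\<omega>. V \<omega> \<partial>M) \<le> ennreal (error_const U * \<delta> powr (2 * min \<theta> (1 / 2)))" for R V
  have exQ: "\<exists>V. Q (real n) V" for n :: nat
  proof -
    interpret l: euler_local M Fil W H h F G K \<theta> D X I T x0 \<delta> m0 "real n" L
      by unfold_locales (use L0 m0 in auto)
    show ?thesis unfolding Q_def
      by (rule l.local_bound) (use small in \<open>simp add: b_def l.e_def\<close>)
  qed
  define V where "V n = (SOME V. Q (real n) V)" for n :: nat
  have "Q (real n) (V n)" for n unfolding V_def using exQ[of n] by (rule someI_ex)
  then have V: "\<And>n. V n \<in> borel_measurable M"
    "\<And>n \<omega> t. \<omega> \<in> space M \<Longrightarrow> t \<in> \<rat> \<inter> {0..T} \<Longrightarrow> t \<le> D U \<omega> \<Longrightarrow> (\<forall>r\<in>\<rat> \<inter> {0..t}. \<bar>X r \<omega>\<bar> \<le> real n) \<Longrightarrow>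
        ennreal ((X t \<omega> - xd t \<omega>)\<^sup>2) \<le> V n \<omega>"
    "\<And>n. (\<integral>\<^sup>+\<omega>. V n \<omega> \<partial>M) \<le> ennreal (error_const U * \<delta> powr (2 * min \<theta> (1 / 2)))"
    unfolding Q_def by blast+
  have "(SUP t\<in>\<rat> \<inter> {0..T}. if t \<le> D U \<omega> then ennreal ((X t \<omega> - xd t \<omega>)\<^sup>2) else 0) \<le> liminf (\<lambda>n. V n \<omega>)"
    if w: "\<omega> \<in> space M" for \<omega>
  proof (rule Liminf_bounded)
    have "bounded ((\<lambda>t. X t \<omega>) ` {0..T})"
      by (intro compact_imp_bounded compact_continuous_image X_cont[OF w]) auto
    then obtain c where c: "\<And>t. t \<in> {0..T} \<Longrightarrow> \<bar>X t \<omega>\<bar> \<le> c" unfolding bounded_iff real_norm_def by blast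
    have "\<forall>\<^sub>F n in sequentially. c \<le> real n"
      using filterlim_real_sequentially by (simp add: filterlim_at_top)
    then show "\<forall>\<^sub>F n in sequentially. (SUP t\<in>\<rat> \<inter> {0..T}. if t \<le> D U \<omega> then ennreal ((X t \<omega> - xd t \<omega>)\<^sup>2) else 0) \<le> V n \<omega>"
    proof eventually_elim
      case (elim n)
      show ?case
      proof (rule SUP_least)
        fix t assume t: "t \<in> \<rat> \<inter> {0..T}"
        have "\<forall>r\<in>\<rat> \<inter> {0..t}. \<bar>X r \<omega>\<bar> \<le> real n"
        proof
          fix r assume "r \<in> \<rat> \<inter> {0..t}"
          then have "\<bar>X r \<omega>\<bar> \<le> c" using t by (intro c) auto
          then show "\<bar>X r \<omega>\<bar> \<le> real n" using elim by simp
        qed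
        then show "(if t \<le> D U \<omega> then ennreal ((X t \<omega> - xd t \<omega>)\<^sup>2) else 0) \<le> V n \<omega>"
          using V(2)[OF w t] by simp
      qed
    qed
  qed
  then have "(\<integral>\<^sup>+\<omega>. (SUP t\<in>\<rat> \<inter> {0..T}. if t \<le> D U \<omega> then ennreal ((X t \<omega> - xd t \<omega>)\<^sup>2) else 0) \<partial>M)
      \<le> (\<integral>\<^sup>+\<omega>. liminf (\<lambda>n. V n \<omega>) \<partial>M)"
    by (rule nn_integral_mono)
  also have "\<dots> \<le> liminf (\<lambda>n. \<integral>\<^sup>+\<omega>. V n \<omega> \<partial>M)" using V(1) by (rule nn_integral_liminf)
  also have "\<dots> \<le> ennreal (error_const U * \<delta> powr (2 * min \<theta> (1 / 2)))"
    using V(3) by (intro Liminf_le always_eventually) auto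
  finally show ?thesis .
qed

end

subsection \<open>Summation over the operational time\<close>

text \<open>A class closed under sums and products, so that the growth of \<open>error_const\<close>
  follows from that of its parts. The constant \<open>b\<close> is left open because the tail decays
  with a larger power.\<close>

definition exp_bounded :: "real \<Rightarrow> (real \<Rightarrow> real) \<Rightarrow> bool" where
  "exp_bounded r f \<longleftrightarrow> (\<exists>B\<ge>0. \<exists>b\<ge>0. \<forall>u\<ge>0. 0 \<le> f u \<and> f u \<le> B * exp (b * (1 + u) powr r))"

lemma exp_boundedI:
  "0 \<le> B \<Longrightarrow> 0 \<le> b \<Longrightarrow> (\<And>u. 0 \<le> u \<Longrightarrow> 0 \<le> f u) \<Longrightarrow> (\<And>u. 0 \<le> u \<Longrightarrow> f u \<le> B * exp (b * (1 + u) powr r)) \<Longrightarrow> exp_bounded r f"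
  unfolding exp_bounded_def by blast

lemma exp_bounded_const: "0 \<le> c \<Longrightarrow> exp_bounded r (\<lambda>_. c)"
  by (rule exp_boundedI[of c 0]) auto

lemma exp_bounded_mult:
  assumes "exp_bounded r f" "exp_bounded r g"
  shows "exp_bounded r (\<lambda>u. f u * g u)"
proof -
  obtain B b where f: "0 \<le> B" "0 \<le> b" "\<And>u. 0 \<le> u \<Longrightarrow> 0 \<le> f u \<and> f u \<le> B * exp (b * (1 + u) powr r)"
    using assms(1) unfolding exp_bounded_def by blast
  obtain C c where g: "0 \<le> C" "0 \<le> c" "\<And>u. 0 \<le> u \<Longrightarrow> 0 \<le> g u \<and> g u \<le> C * exp (c * (1 + u) powr r)"
    using assms(2) unfolding exp_bounded_def by blast
  show ?thesis
  proof (rule exp_boundedI[of "B * C" "b + c"])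
    fix u :: real assume u: "0 \<le> u"
    show "0 \<le> f u * g u" using f(3)[OF u] g(3)[OF u] by simp
    have "f u * g u \<le> (B * exp (b * (1 + u) powr r)) * (C * exp (c * (1 + u) powr r))"
      using f(3)[OF u] g(3)[OF u] f(1) by (intro mult_mono) auto
    then show "f u * g u \<le> B * C * exp ((b + c) * (1 + u) powr r)"
      by (simp add: distrib_right exp_add mult_ac)
  qed (use f g in auto)
qed

lemma exp_bounded_add:
  assumes "exp_bounded r f" "exp_bounded r g"
  shows "exp_bounded r (\<lambda>u. f u + g u)"
proof -
  obtain B b where f: "0 \<le> B" "0 \<le> b" "\<And>u. 0 \<le> u \<Longrightarrow> 0 \<le> f u \<and> f u \<le> B * exp (b * (1 + u) powr r)"
    using assms(1) unfolding exp_bounded_def by blast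
  obtain C c where g: "0 \<le> C" "0 \<le> c" "\<And>u. 0 \<le> u \<Longrightarrow> 0 \<le> g u \<and> g u \<le> C * exp (c * (1 + u) powr r)"
    using assms(2) unfolding exp_bounded_def by blast
  show ?thesis
  proof (rule exp_boundedI[of "B + C" "b + c"])
    fix u :: real assume u: "0 \<le> u"
    show "0 \<le> f u + g u" using f(3)[OF u] g(3)[OF u] by simp
    have "b * (1 + u) powr r \<le> (b + c) * (1 + u) powr r" "c * (1 + u) powr r \<le> (b + c) * (1 + u) powr r"
      using f(2) g(2) by (simp_all add: mult_right_mono)
    then have "exp (b * (1 + u) powr r) \<le> exp ((b + c) * (1 + u) powr r)"
      "exp (c * (1 + u) powr r) \<le> exp ((b + c) * (1 + u) powr r)" by (simp_all only: exp_le_cancel_iff)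
    from mult_left_mono[OF this(1) f(1)] mult_left_mono[OF this(2) g(1)]
    have "B * exp (b * (1 + u) powr r) \<le> B * exp ((b + c) * (1 + u) powr r)"
      "C * exp (c * (1 + u) powr r) \<le> C * exp ((b + c) * (1 + u) powr r)" .
    then show "f u + g u \<le> (B + C) * exp ((b + c) * (1 + u) powr r)"
      using f(3)[OF u] g(3)[OF u] unfolding distrib_right[of B C] by linarith
  qed (use f g in auto)
qed

lemma exp_bounded_exp:
  assumes "0 \<le> c" "\<And>u. 0 \<le> u \<Longrightarrow> f u \<le> c * (1 + u) powr r"
  shows "exp_bounded r (\<lambda>u. exp (f u))"
  by (rule exp_boundedI[of 1 c]) (use assms in auto)

lemma exp_bounded_le:
  assumes "exp_bounded r g" "\<And>u. 0 \<le> u \<Longrightarrow> 0 \<le> f u" "\<And>u. 0 \<le> u \<Longrightarrow> f u \<le> g u"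
  shows "exp_bounded r f"
  using assms unfolding exp_bounded_def by (meson order_trans)

lemma powr_ge_self: "1 \<le> r \<Longrightarrow> 0 \<le> u \<Longrightarrow> 1 + u \<le> (1 + u) powr (r :: real)"
  using powr_mono[of 1 r "1 + u"] by simp

lemma exp_bounded_id: "1 \<le> r \<Longrightarrow> exp_bounded r (\<lambda>u. u)"
proof (rule exp_boundedI[of 1 1])
  fix u :: real assume "1 \<le> r" "0 \<le> u"
  then have "1 + u \<le> (1 + u) powr r" by (rule powr_ge_self)
  also have "\<dots> \<le> exp ((1 + u) powr r)" using exp_ge_add_one_self[of "(1 + u) powr r"] by linarith
  finally show "u \<le> 1 * exp (1 * (1 + u) powr r)" by simp
qed auto

text \<open>Since \<open>r < p\<close>, the negative term eventually exceeds the positive one by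
  \<open>n\<close>, which gives a geometric majorant. The shift by 3 arises from horizons up to
  \<open>n + 2\<close> and the \<open>1 + u\<close> in \<open>exp_bounded\<close>.\<close>

lemma summable_exp_powr:
  fixes a b r p :: real
  assumes a: "0 < a" and b: "0 \<le> b" and r: "1 \<le> r" "r < p"
  shows "summable (\<lambda>n. exp (b * (real n + 3) powr r - a * real n powr p))"
proof (rule summable_comparison_test_ev)
  show "summable (\<lambda>n. exp (- 1 :: real) ^ n)" by (rule summable_geometric) simp
  \<comment> \<open>Once \<open>real n powr (p - r)\<close> is at least \<open>c\<close>, the term
    \<open>a * n powr p\<close> exceeds \<open>b * 4 powr r * n powr r\<close> by
    \<open>n powr r\<close>; the 4 comes from \<open>n + 3 \<le> 4 * n\<close>.\<close>
  define c where "c = (b * 4 powr r + 1) / a"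
  have c: "0 < c" using a b by (simp add: c_def add_nonneg_pos)
  have "\<forall>\<^sub>F n in sequentially. c powr (1 / (p - r)) \<le> real n"
    using filterlim_real_sequentially by (simp add: filterlim_at_top)
  then have "\<forall>\<^sub>F n in sequentially. c \<le> real n powr (p - r)"
  proof eventually_elim
    case (elim n)
    then have "(c powr (1 / (p - r))) powr (p - r) \<le> real n powr (p - r)" using r by (intro powr_mono2) auto
    then show ?case using r c by (simp add: powr_powr)
  qed
  then show "\<forall>\<^sub>F n in sequentially. norm (exp (b * (real n + 3) powr r - a * real n powr p)) \<le> exp (- 1) ^ n"
    using eventually_ge_at_top[of 1]
  proof eventually_elim
    case (elim n)
    have n: "1 \<le> real n" using elim by simp
    have "(real n + 3) powr r \<le> (4 * real n) powr r" using n r by (intro powr_mono2) auto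
    also have "\<dots> = 4 powr r * real n powr r" using n by (simp add: powr_mult)
    finally have 1: "b * (real n + 3) powr r \<le> b * (4 powr r * real n powr r)" using b by (rule mult_left_mono)
    have "b * 4 powr r + 1 \<le> a * real n powr (p - r)" using elim a by (simp add: c_def field_simps)
    then have "real n powr r * (b * 4 powr r + 1) \<le> real n powr r * (a * real n powr (p - r))"
      by (intro mult_left_mono) auto
    also have "\<dots> = a * real n powr p" using n by (simp add: powr_add[symmetric])
    finally have 2: "b * (4 powr r * real n powr r) + real n powr r \<le> a * real n powr p" by (simp add: algebra_simps)
    have "real n \<le> real n powr r" using n r powr_mono[of 1 r "real n"] by simp
    then have "b * (real n + 3) powr r - a * real n powr p \<le> real n * - 1" using 1 2 by linarith
    then show ?case by (simp add: exp_of_nat_mult[symmetric])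
  qed
qed

context euler_setup
begin

text \<open>Both exponentials have exponents bounded by multiples of
  \<open>(h u)\<^sup>2 * (1 + u)\<^sup>2\<close>, hence of order \<open>2 * q + 2\<close>.
  Polynomial factors are absorbed.\<close>

lemma error_const_bounded:
  assumes C0: "0 < C0" and q: "0 \<le> q" and h: "\<And>u. 0 \<le> u \<Longrightarrow> h u \<le> C0 * (1 + u) powr q"
  shows "exp_bounded (2 * q + 2) error_const"
proof -
  define r where "r = 2 * q + 2"
  have r1: "1 \<le> r" using q by (simp add: r_def)
  have h2: "(h u)\<^sup>2 * (1 + u)\<^sup>2 \<le> C0\<^sup>2 * (1 + u) powr r" if u: "0 \<le> u" for u
  proof -
    have "(h u)\<^sup>2 \<le> (C0 * (1 + u) powr q)\<^sup>2" using h[OF u] h_nonneg[OF u] by (rule power_mono)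
    then have "(h u)\<^sup>2 * (1 + u)\<^sup>2 \<le> (C0 * (1 + u) powr q)\<^sup>2 * (1 + u)\<^sup>2" by (rule mult_right_mono) simp
    also have "\<dots> = C0\<^sup>2 * (1 + u) powr r"
    proof -
      have "((1 + u) powr q)\<^sup>2 * (1 + u)\<^sup>2 = (1 + u) powr (2 * q) * (1 + u) powr 2"
        using u by (simp add: powr_power mult.commute)
      also have "\<dots> = (1 + u) powr r" unfolding r_def by (simp add: powr_add)
      finally show ?thesis by (simp add: power_mult_distrib mult.assoc)
    qed
    finally show ?thesis .
  qed
  have e: "exp_bounded r (\<lambda>u. exp (c * ((h u)\<^sup>2 * (1 + u)\<^sup>2)))" if "0 \<le> c" for c
    using that h2 C0 by (intro exp_bounded_exp[of "c * C0\<^sup>2"]) (auto simp: mult.assoc intro!: mult_left_mono)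
  have hh: "exp_bounded r (\<lambda>u. (h u)\<^sup>2)"
  proof (rule exp_bounded_le[OF e[of 1]])
    fix u :: real assume u: "0 \<le> u"
    have "(h u)\<^sup>2 * 1 \<le> (h u)\<^sup>2 * (1 + u)\<^sup>2" using u by (intro mult_left_mono) auto
    then show "(h u)\<^sup>2 \<le> exp (1 * ((h u)\<^sup>2 * (1 + u)\<^sup>2))"
      using exp_ge_add_one_self[of "1 * ((h u)\<^sup>2 * (1 + u)\<^sup>2)"] by linarith
  qed auto
  note cl = exp_bounded_mult exp_bounded_add exp_bounded_const exp_bounded_id[OF r1] hh
  have u1: "(u + 1) * u \<le> (1 + u)\<^sup>2" "(u + 4) * u \<le> 4 * (1 + u)\<^sup>2" if "0 \<le> u" for u :: real
    using that by (auto simp: power2_eq_square algebra_simps)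
  have "exp_bounded r (\<lambda>u. exp (3 * (h u)\<^sup>2 * (u + 1) * u))"
  proof (rule exp_bounded_le[OF e[of 3]])
    fix u :: real assume u: "0 \<le> u"
    have "3 * (h u)\<^sup>2 * ((u + 1) * u) \<le> 3 * (h u)\<^sup>2 * (1 + u)\<^sup>2" by (intro mult_left_mono u1 u) auto
    then show "exp (3 * (h u)\<^sup>2 * (u + 1) * u) \<le> exp (3 * ((h u)\<^sup>2 * (1 + u)\<^sup>2))" by (simp add: mult.assoc)
  qed auto
  note e1 = this
  have "exp_bounded r (\<lambda>u. exp (18 * (u + 4) * (h u)\<^sup>2 * u))"
  proof (rule exp_bounded_le[OF e[of 72]])
    fix u :: real assume u: "0 \<le> u"
    have "18 * (h u)\<^sup>2 * ((u + 4) * u) \<le> 18 * (h u)\<^sup>2 * (4 * (1 + u)\<^sup>2)" by (intro mult_left_mono u1 u) auto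
    moreover have "18 * (u + 4) * (h u)\<^sup>2 * u = 18 * (h u)\<^sup>2 * ((u + 4) * u)" by (simp only: mult_ac)
    moreover have "18 * (h u)\<^sup>2 * (4 * (1 + u)\<^sup>2) = 72 * ((h u)\<^sup>2 * (1 + u)\<^sup>2)" by simp
    ultimately show "exp (18 * (u + 4) * (h u)\<^sup>2 * u) \<le> exp (72 * ((h u)\<^sup>2 * (1 + u)\<^sup>2))"
      by (simp only: exp_le_cancel_iff)
  qed auto
  note e2 = this
  have "exp_bounded r (\<lambda>u. (1 + \<bar>x0\<bar> + h u * T)\<^sup>2)"
  proof (rule exp_bounded_le)
    show "exp_bounded r (\<lambda>u. 2 * (1 + \<bar>x0\<bar>)\<^sup>2 + 2 * T\<^sup>2 * (h u)\<^sup>2)" by (intro cl) auto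
    fix u :: real
    have "0 \<le> ((1 + \<bar>x0\<bar>) - h u * T)\<^sup>2" by simp
    then show "(1 + \<bar>x0\<bar> + h u * T)\<^sup>2 \<le> 2 * (1 + \<bar>x0\<bar>)\<^sup>2 + 2 * T\<^sup>2 * (h u)\<^sup>2"
      by (simp add: power2_eq_square algebra_simps)
  qed simp
  then have m: "exp_bounded r moment_const"
    unfolding moment_const_def[abs_def] by (intro cl e1) auto
  show ?thesis
    unfolding error_const_def[abs_def] r_def[symmetric] by (intro cl e2 m) auto
qed

abbreviation scheme :: "real \<Rightarrow> real \<Rightarrow> 'a \<Rightarrow> real" where
  "scheme \<delta> t \<omega> \<equiv> euler_maruyama H F G x0 \<delta> (\<lambda>u. D u \<omega>) (\<lambda>u. W u \<omega>) t"

text \<open>The horizon has to be a multiple of \<open>\<delta>\<close>. Rounding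
  \<open>n + 1\<close> up costs at most 1 because \<open>\<delta> < 1\<close>, which keeps the
  constant independent of the step size.\<close>

lemma layer_bound:
  assumes delta: "0 < \<delta>" "\<delta> < 1"
  shows "\<exists>V U. V \<in> borel_measurable M \<and> real n + 1 \<le> U \<and> U \<le> real n + 2 \<and>
    (\<forall>\<omega>\<in>space M. \<forall>t\<in>\<rat> \<inter> {0..T}. T \<le> D (real n + 1) \<omega> \<longrightarrow> ennreal ((X t \<omega> - scheme \<delta> t \<omega>)\<^sup>2) \<le> V \<omega>) \<and>
    (\<integral>\<^sup>+\<omega>. V \<omega> \<partial>M) \<le> ennreal (error_const U * \<delta> powr (2 * min \<theta> (1 / 2)))"
proof -
  define m where "m = nat \<lceil>(real n + 1) / \<delta>\<rceil>"
  have mp: "0 < (real n + 1) / \<delta>" using delta by simp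
  have m: "(real n + 1) / \<delta> \<le> real m" "real m \<le> (real n + 1) / \<delta> + 1" "0 < m"
    unfolding m_def using mp by linarith+
  interpret s: euler_step M Fil W H h F G K \<theta> D X I T x0 \<delta> m
    by unfold_locales (use delta in auto)
  have U: "real n + 1 \<le> s.U" "s.U \<le> real n + 2"
  proof -
    have "(real n + 1) / \<delta> * \<delta> \<le> real m * \<delta>" using m delta by (intro mult_right_mono) auto
    then show "real n + 1 \<le> s.U" using delta by (simp add: s.U_def)
    have "real m * \<delta> \<le> ((real n + 1) / \<delta> + 1) * \<delta>" using m delta by (intro mult_right_mono) auto
    also have "\<dots> = real n + 1 + \<delta>" using delta by (simp add: field_simps)
    finally show "s.U \<le> real n + 2" using delta by (simp add: s.U_def)
  qed
  define V where "V \<omega> = (SUP t\<in>\<rat> \<inter> {0..T}. if t \<le> D s.U \<omega> then ennreal ((X t \<omega> - s.xd t \<omega>)\<^sup>2) else 0)" for \<omega>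
  have c: "countable (\<rat> \<inter> {0..T})" using countable_rat by (rule countable_subset[rotated]) auto
  have "V \<in> borel_measurable M"
    unfolding V_def[abs_def]
  proof (rule borel_measurable_SUP[OF c])
    fix t assume "t \<in> \<rat> \<inter> {0..T}"
    then have [measurable]: "X t \<in> borel_measurable M" "s.xd t \<in> borel_measurable M" "D s.U \<in> borel_measurable M"
      using s.U_nonneg by (auto intro: X_meas s.xd_meas D_meas)
    show "(\<lambda>\<omega>. if t \<le> D s.U \<omega> then ennreal ((X t \<omega> - s.xd t \<omega>)\<^sup>2) else 0) \<in> borel_measurable M" by measurable
  qed
  moreover have "ennreal ((X t \<omega> - scheme \<delta> t \<omega>)\<^sup>2) \<le> V \<omega>"
    if w: "\<omega> \<in> space M" and t: "t \<in> \<rat> \<inter> {0..T}" and T: "T \<le> D (real n + 1) \<omega>" for \<omega> t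
  proof -
    have "D (real n + 1) \<omega> \<le> D s.U \<omega>"
      using U s.U_nonneg by (subst time_change_path.le_iff[OF paths[OF w]]) auto
    then have "t \<le> D s.U \<omega>" using t T by auto
    then show ?thesis unfolding V_def s.xd_def by (intro SUP_upper2[OF t]) auto
  qed
  moreover have "(\<integral>\<^sup>+\<omega>. V \<omega> \<partial>M) \<le> ennreal (error_const s.U * \<delta> powr (2 * min \<theta> (1 / 2)))"
    unfolding V_def by (rule s.error_square_bound[OF m(3)])
  ultimately show ?thesis using U by blast
qed

lemma error_le_rational_sup:
  assumes delta: "0 < \<delta>" "\<delta> < 1" and w: "\<omega> \<in> space M" and t: "0 \<le> t" "t \<le> T"
  shows "ennreal \<bar>X t \<omega> - scheme \<delta> t \<omega>\<bar> \<le> (SUP t\<in>\<rat> \<inter> {0..T}. ennreal \<bar>X t \<omega> - scheme \<delta> t \<omega>\<bar>)" (is "_ \<le> ?S")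
proof (cases ?S)
  case (real c)
  interpret s: euler_step M Fil W H h F G K \<theta> D X I T x0 \<delta> 0
    by unfold_locales (use delta in auto)
  have "\<bar>X t \<omega> - scheme \<delta> t \<omega>\<bar> \<le> c"
  proof (rule rational_bound[where f="\<lambda>t. \<bar>X t \<omega> - scheme \<delta> t \<omega>\<bar>", OF _ t])
    show "continuous_on {0..T} (\<lambda>t. \<bar>X t \<omega> - scheme \<delta> t \<omega>\<bar>)"
      using s.xd_cont[OF w] X_cont[OF w] unfolding s.xd_def by (intro continuous_intros)
    fix r assume "r \<in> \<rat>" "0 \<le> r" "r \<le> t"
    then have "ennreal \<bar>X r \<omega> - scheme \<delta> r \<omega>\<bar> \<le> ?S" using t by (intro SUP_upper) auto
    then show "\<bar>X r \<omega> - scheme \<delta> r \<omega>\<bar> \<le> c" using real by simp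
  qed
  then show ?thesis using real by (simp add: ennreal_leI)
next
  case top
  then show ?thesis by (simp only: top_greatest)
qed

text \<open>The error is split according to the integer part of the operational time needed to reach \<open>T\<close>;
  on each layer \<open>\<bar>x\<bar> \<le> x\<^sup>2 / w + w\<close> with a weight \<open>w\<close> that balances the growth of the error constants
  against the tail of the inverse subordinator.\<close>

lemma strong_error:
  assumes C0: "0 < C0" and q: "0 \<le> q" and h: "\<And>u. 0 \<le> u \<Longrightarrow> h u \<le> C0 * (1 + u) powr q"
    and tail: "0 < Ct" "0 < a" "\<And>v. 0 \<le> v \<Longrightarrow> prob {\<omega>\<in>space M. D v \<omega> \<le> T} \<le> Ct * exp (- a * v powr p)"
    and p: "2 * q + 2 < p"
  shows "\<exists>C>0. \<forall>\<delta>. 0 < \<delta> \<longrightarrow> \<delta> < 1 \<longrightarrow>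
    (\<integral>\<^sup>+\<omega>. (SUP t\<in>\<rat> \<inter> {0..T}. ennreal \<bar>X t \<omega> - scheme \<delta> t \<omega>\<bar>) \<partial>M) \<le> ennreal (C * \<delta> powr min \<theta> (1 / 2))"
proof -
  define r where "r = 2 * q + 2"
  have r1: "1 \<le> r" using q by (simp add: r_def)
  obtain B b where Bb: "0 \<le> B" "0 \<le> b" "\<And>u. 0 \<le> u \<Longrightarrow> error_const u \<le> B * exp (b * (1 + u) powr r)"
    using error_const_bounded[OF C0 q h] unfolding exp_bounded_def r_def by blast
  \<comment> \<open>The contribution of layer \<open>n\<close> divided by the rate: mean square
    error over weight, plus weight times tail. Half of the tail exponent \<open>a\<close> is spent
    on each.\<close>
  define s where "s n = B * exp (b * (real n + 3) powr r - a / 2 * real n powr p) + Ct * exp (- (a / 2) * real n powr p)" for n :: nat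
  have sn: "0 \<le> s n" for n using Bb tail by (simp add: s_def)
  have "summable (\<lambda>n. exp (b * (real n + 3) powr r - a / 2 * real n powr p))"
    using tail Bb r1 p by (intro summable_exp_powr) (auto simp: r_def)
  moreover have "summable (\<lambda>n. exp (0 * (real n + 3) powr r - a / 2 * real n powr p))"
    using tail r1 p by (intro summable_exp_powr) (auto simp: r_def)
  ultimately have summ: "summable s"
    unfolding s_def by (intro summable_add summable_mult) auto
  define C where "C = suminf s + 1"
  have Cs: "0 \<le> suminf s" using summ sn by (intro suminf_nonneg)
  have "(\<integral>\<^sup>+\<omega>. (SUP t\<in>\<rat> \<inter> {0..T}. ennreal \<bar>X t \<omega> - scheme \<delta> t \<omega>\<bar>) \<partial>M) \<le> ennreal (C * \<delta> powr min \<theta> (1 / 2))"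
    if delta: "0 < \<delta>" "\<delta> < 1" for \<delta>
  proof -
    define \<eta> where "\<eta> = \<delta> powr min \<theta> (1 / 2)"
    have \<eta>: "0 < \<eta>" using delta by (simp add: \<eta>_def)
    have \<eta>2: "\<delta> powr (2 * min \<theta> (1 / 2)) = \<eta> * \<eta>" unfolding \<eta>_def by (simp add: powr_add[symmetric])
    define Q where "Q n V \<longleftrightarrow> V \<in> borel_measurable M \<and>
      (\<forall>\<omega>\<in>space M. \<forall>t\<in>\<rat> \<inter> {0..T}. T \<le> D (real n + 1) \<omega> \<longrightarrow> ennreal ((X t \<omega> - scheme \<delta> t \<omega>)\<^sup>2) \<le> V \<omega>) \<and>
      (\<integral>\<^sup>+\<omega>. V \<omega> \<partial>M) \<le> ennreal (B * exp (b * (real n + 3) powr r) * (\<eta> * \<eta>))" for n :: nat and V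
    have exQ: "\<exists>V. Q n V" for n
    proof -
      obtain V U where V: "V \<in> borel_measurable M" "real n + 1 \<le> U" "U \<le> real n + 2"
        "\<forall>\<omega>\<in>space M. \<forall>t\<in>\<rat> \<inter> {0..T}. T \<le> D (real n + 1) \<omega> \<longrightarrow> ennreal ((X t \<omega> - scheme \<delta> t \<omega>)\<^sup>2) \<le> V \<omega>"
        "(\<integral>\<^sup>+\<omega>. V \<omega> \<partial>M) \<le> ennreal (error_const U * \<delta> powr (2 * min \<theta> (1 / 2)))"
        using layer_bound[OF delta, of n] by blast
      have "error_const U \<le> B * exp (b * (1 + U) powr r)" using V by (intro Bb) auto
      also have "\<dots> \<le> B * exp (b * (real n + 3) powr r)"
        using V Bb r1 by (intro mult_left_mono) (auto intro!: mult_left_mono powr_mono2)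
      finally have "error_const U * (\<eta> * \<eta>) \<le> B * exp (b * (real n + 3) powr r) * (\<eta> * \<eta>)"
        using \<eta> by (intro mult_right_mono) auto
      then have "(\<integral>\<^sup>+\<omega>. V \<omega> \<partial>M) \<le> ennreal (B * exp (b * (real n + 3) powr r) * (\<eta> * \<eta>))"
        using V(5) unfolding \<eta>2 by (meson ennreal_leI order_trans)
      then show ?thesis using V(1,4) unfolding Q_def by blast
    qed
    define V where "V n = (SOME V. Q n V)" for n
    have "Q n (V n)" for n unfolding V_def using exQ[of n] by (rule someI_ex)
    then have V: "\<And>n. V n \<in> borel_measurable M"
      "\<And>n \<omega> t. \<omega> \<in> space M \<Longrightarrow> t \<in> \<rat> \<inter> {0..T} \<Longrightarrow> T \<le> D (real n + 1) \<omega> \<Longrightarrow> ennreal ((X t \<omega> - scheme \<delta> t \<omega>)\<^sup>2) \<le> V n \<omega>"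
      "\<And>n. (\<integral>\<^sup>+\<omega>. V n \<omega> \<partial>M) \<le> ennreal (B * exp (b * (real n + 3) powr r) * (\<eta> * \<eta>))"
      unfolding Q_def by blast+
    \<comment> \<open>Besides half of the decay of the tail the weight carries
      \<open>\<eta>\<close>, so that both \<open>\<eta> * \<eta>\<close> over the weight and the
      weight itself are of order \<open>\<eta>\<close>.\<close>
    define w where "w n = \<eta> * exp (a / 2 * real n powr p)" for n :: nat
    have w: "0 < w n" for n using \<eta> by (simp add: w_def)
    define A where "A n = {\<omega>\<in>space M. D (real n) \<omega> \<le> T}" for n :: nat
    have Am [measurable]: "A n \<in> sets M" for n
    proof -
      have [measurable]: "D (real n) \<in> borel_measurable M" by (intro D_meas) simp
      show ?thesis unfolding A_def by measurable
    qed
    define f where "f n \<omega> = ennreal (1 / w n) * V n \<omega> + ennreal (w n) * indicator (A n) \<omega>" for n \<omega>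
    have fm [measurable]: "f n \<in> borel_measurable M" for n
      unfolding f_def[abs_def] using V(1) by measurable
    have fi: "(\<integral>\<^sup>+\<omega>. f n \<omega> \<partial>M) \<le> ennreal (\<eta> * s n)" for n
    proof -
      have "(\<integral>\<^sup>+\<omega>. f n \<omega> \<partial>M) = ennreal (1 / w n) * (\<integral>\<^sup>+\<omega>. V n \<omega> \<partial>M) + ennreal (w n) * emeasure M (A n)"
        unfolding f_def using V(1) by (simp add: nn_integral_add nn_integral_cmult nn_integral_cmult_indicator)
      also have "\<dots> \<le> ennreal (1 / w n) * ennreal (B * exp (b * (real n + 3) powr r) * (\<eta> * \<eta>))
          + ennreal (w n) * ennreal (Ct * exp (- a * real n powr p))"
        using V(3) tail(3)[of "real n"] unfolding A_def[symmetric] emeasure_eq_measure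
        by (intro add_mono mult_left_mono ennreal_leI) auto
      also have "\<dots> = ennreal (1 / w n * (B * exp (b * (real n + 3) powr r) * (\<eta> * \<eta>)) + w n * (Ct * exp (- a * real n powr p)))"
        using w[of n] Bb \<eta> tail by (simp add: ennreal_mult[symmetric] ennreal_plus[symmetric] del: ennreal_plus)
      also have "1 / w n * (B * exp (b * (real n + 3) powr r) * (\<eta> * \<eta>)) + w n * (Ct * exp (- a * real n powr p)) = \<eta> * s n"
      proof -
        have "1 / w n * (B * exp (b * (real n + 3) powr r) * (\<eta> * \<eta>)) = \<eta> * (B * exp (b * (real n + 3) powr r - a / 2 * real n powr p))"
          using \<eta> unfolding w_def exp_diff by (simp add: divide_simps)
        moreover have "exp (a / 2 * real n powr p) * exp (- a * real n powr p) = exp (- (a / 2) * real n powr p)"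
          unfolding exp_add[symmetric] by simp
        then have "w n * (Ct * exp (- a * real n powr p)) = \<eta> * (Ct * exp (- (a / 2) * real n powr p))"
          by (simp add: w_def mult_ac)
        ultimately show ?thesis by (simp add: s_def distrib_left)
      qed
      finally show ?thesis .
    qed
    have pw: "(SUP t\<in>\<rat> \<inter> {0..T}. ennreal \<bar>X t \<omega> - scheme \<delta> t \<omega>\<bar>) \<le> (\<Sum>n. f n \<omega>)" if om: "\<omega> \<in> space M" for \<omega>
    proof -
      have E0: "0 < E T \<omega>"
        using E_le_iff[OF om, of 0 T] time_change_path.zero[OF paths[OF om]] T_pos by (auto simp: not_le[symmetric])
      \<comment> \<open>The layer with \<open>n < E T \<le> n + 1\<close>; subtracting 1 from the
        ceiling puts integer values into the lower layer.\<close>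
      define n where "n = nat (\<lceil>E T \<omega>\<rceil> - 1)"
      have n: "real n < E T \<omega>" "E T \<omega> \<le> real n + 1" unfolding n_def using E0 by linarith+
      have Tn: "T \<le> D (real n + 1) \<omega>" using E_le_iff[OF om, of "real n + 1" T] n by simp
      have inA: "\<omega> \<in> A n" using E_le_iff[OF om, of "real n" T] n om by (simp add: A_def)
      have "(SUP t\<in>\<rat> \<inter> {0..T}. ennreal \<bar>X t \<omega> - scheme \<delta> t \<omega>\<bar>) \<le> f n \<omega>"
      proof (rule SUP_least)
        fix t assume t: "t \<in> \<rat> \<inter> {0..T}"
        define x where "x = X t \<omega> - scheme \<delta> t \<omega>"
        have "0 \<le> (\<bar>x\<bar> - w n)\<^sup>2" "0 \<le> \<bar>x\<bar> * w n" using w[of n] by simp_all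
        then have "\<bar>x\<bar> * w n \<le> x\<^sup>2 + w n * w n" unfolding power2_diff power2_abs power2_eq_square[of "w n"] by linarith
        then have "\<bar>x\<bar> \<le> (x\<^sup>2 + w n * w n) / w n" using w[of n] by (simp add: pos_le_divide_eq)
        also have "\<dots> = 1 / w n * x\<^sup>2 + w n" using w[of n] by (simp add: field_simps)
        finally have "ennreal \<bar>x\<bar> \<le> ennreal (1 / w n * x\<^sup>2 + w n)" by (rule ennreal_leI)
        also have "\<dots> = ennreal (1 / w n) * ennreal (x\<^sup>2) + ennreal (w n)"
          using w[of n] by (simp add: ennreal_mult[symmetric] ennreal_plus[symmetric] del: ennreal_plus)
        also have "\<dots> \<le> f n \<omega>"
          unfolding f_def x_def using V(2)[OF om t Tn] inA by (intro add_mono mult_left_mono) auto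
        finally show "ennreal \<bar>X t \<omega> - scheme \<delta> t \<omega>\<bar> \<le> f n \<omega>" unfolding x_def .
      qed
      also have "f n \<omega> \<le> (\<Sum>n. f n \<omega>)" using sum_le_suminf[of "\<lambda>n. f n \<omega>" "{n}"] by simp
      finally show ?thesis .
    qed
    have "(\<integral>\<^sup>+\<omega>. (SUP t\<in>\<rat> \<inter> {0..T}. ennreal \<bar>X t \<omega> - scheme \<delta> t \<omega>\<bar>) \<partial>M) \<le> (\<integral>\<^sup>+\<omega>. (\<Sum>n. f n \<omega>) \<partial>M)"
      by (intro nn_integral_mono pw)
    also have "\<dots> = (\<Sum>n. \<integral>\<^sup>+\<omega>. f n \<omega> \<partial>M)" by (rule nn_integral_suminf) measurable
    also have "\<dots> \<le> (\<Sum>n. ennreal (\<eta> * s n))" using fi by (intro suminf_le) auto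
    also have "\<dots> = ennreal (\<Sum>n. \<eta> * s n)"
      using \<eta> sn summ by (intro suminf_ennreal2) (auto intro: summable_mult)
    also have "\<dots> = ennreal (\<eta> * suminf s)" using suminf_mult[OF summ] by simp
    also have "\<dots> \<le> ennreal (C * \<delta> powr min \<theta> (1 / 2))"
      unfolding C_def \<eta>_def[symmetric] using \<eta> by (intro ennreal_leI) (simp add: algebra_simps)
    finally show ?thesis .
  qed
  then show ?thesis using Cs by (intro exI[of _ C] conjI allI impI) (auto simp: C_def)
qed

end

subsection \<open>Riemann sums of the time-changed integral\<close>

lemma measure_tendsto_0_AE:
  assumes "prob_space M" and A: "\<And>n. A n \<in> sets M"
    and ae: "AE \<omega> in M. \<forall>\<^sub>F n in sequentially. \<omega> \<notin> A n"
  shows "(\<lambda>n. measure M (A n)) \<longlonglongrightarrow> 0"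
proof -
  interpret prob_space M by fact
  have "(\<lambda>n. \<integral>\<omega>. indicator (A n) \<omega> \<partial>M) \<longlonglongrightarrow> (\<integral>\<omega>. (0 :: real) \<partial>M)"
  proof (rule integral_dominated_convergence[where w="\<lambda>_. 1"])
    show "AE \<omega> in M. (\<lambda>n. indicator (A n) \<omega> :: real) \<longlonglongrightarrow> 0"
      using ae
    proof eventually_elim
      case (elim \<omega>)
      show ?case by (rule tendsto_eventually) (use elim in eventually_elim, simp)
    qed
  qed (use A in auto)
  then show ?thesis using A by simp
qed

text \<open>Choosing \<open>r k\<close> at least \<open>k\<close> with value below
  \<open>(1 / 2) ^ k\<close> suffices. The indices need not increase, as only their divergence is
  used for limits.\<close>

lemma summable_subsequence:
  fixes f :: "nat \<Rightarrow> nat \<Rightarrow> real"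
  assumes "\<And>k. f k \<longlonglongrightarrow> 0" "\<And>k n. 0 \<le> f k n"
  shows "\<exists>r. filterlim r at_top sequentially \<and> summable (\<lambda>k. f k (r k))"
proof -
  have "\<exists>n\<ge>k. f k n < (1 / 2) ^ k" for k
  proof -
    have "\<forall>\<^sub>F n in sequentially. f k n < (1 / 2) ^ k" by (rule order_tendstoD(2)[OF assms(1)]) simp
    then obtain N where "\<And>n. N \<le> n \<Longrightarrow> f k n < (1 / 2) ^ k" unfolding eventually_sequentially by blast
    then show ?thesis by (intro exI[of _ "max N k"]) auto
  qed
  then obtain r where r: "\<And>k. k \<le> r k" "\<And>k. f k (r k) < (1 / 2) ^ k" by metis
  have "summable (\<lambda>k. f k (r k))"
  proof (rule summable_comparison_test')
    show "summable (\<lambda>k. (1 / 2 :: real) ^ k)" by (rule summable_geometric) simp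
    show "norm (f k (r k)) \<le> (1 / 2) ^ k" if "0 \<le> k" for k using r(2)[of k] assms(2) by (simp add: less_imp_le)
  qed
  moreover have "filterlim r at_top sequentially"
    by (rule filterlim_at_top_mono[OF filterlim_ident]) (use r(1) in auto)
  ultimately show ?thesis by blast
qed

text \<open>No independence of \<open>W\<close> and \<open>D\<close> is required: it enters the theorem only through the assumption that
  \<open>W\<close> is a Brownian motion for a filtration to which \<open>D\<close> is adapted.\<close>

locale time_changed_sde = prob_space M + complete_measure M + sde_coefficients H h F G K \<theta>
  for M :: "'a measure" and H h F G K \<theta> +
  fixes \<F> :: "real \<Rightarrow> 'a measure" and W D X :: "real \<Rightarrow> 'a \<Rightarrow> real" and \<nu> :: "real measure" and T x0 \<beta> :: real
  assumes usual: "usual_filtration M \<F>"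
    and bm: "brownian_motion M \<F> W"
    and sub: "pure_jump_subordinator M \<F> \<nu> D"
    and rv: "regularly_varying (laplace_exponent \<nu>) \<beta>" "0 < \<beta>" "\<beta> < 1"
    and T_pos: "0 < T"
    and sol: "solves_time_changed_SDE M (time_changed_filtration M \<F> (\<lambda>t \<omega>. inverse_path (\<lambda>u. D u \<omega>) t)) T x0 H F G
        (\<lambda>t \<omega>. inverse_path (\<lambda>u. D u \<omega>) t) W X"
begin

abbreviation E :: "real \<Rightarrow> 'a \<Rightarrow> real" where
  "E t \<omega> \<equiv> inverse_path (\<lambda>u. D u \<omega>) t"

abbreviation "\<G> \<equiv> time_changed_filtration M \<F> (\<lambda>t \<omega>. E t \<omega>)"

section \<open>Almost sure path properties of the subordinator\<close>

lemma subalg: "subalgebra M (\<F> t)"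
  using usual by (auto simp: usual_filtration_def)

lemma space_F [simp]: "space (\<F> t) = space M"
  using subalg[of t] by (simp add: subalgebra_def)

lemma filtration_F: "filtration (space M) \<F>"
  using usual by (auto simp: usual_filtration_def)

lemma null_F: "N \<in> null_sets M \<Longrightarrow> N \<in> sets (\<F> t)"
  using usual unfolding usual_filtration_def by blast

lemma F_mono: "s \<le> t \<Longrightarrow> sets (\<F> s) \<subseteq> sets (\<F> t)"
  using filtration.sets_F_mono[OF filtration_F] .

lemma F_M: "f \<in> measurable (\<F> t) N \<Longrightarrow> f \<in> measurable M N"
  by (rule measurable_from_subalg[OF subalg])

text \<open>Completeness makes \<open>B\<close> measurable, so the sets \<open>A\<close> and
  \<open>B\<close> differ by null sets, and these belong to every \<open>\<F> t\<close>.\<close>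

lemma sets_F_AE:
  assumes A: "A \<in> sets (\<F> t)" and ae: "AE \<omega> in M. \<omega> \<in> A \<longleftrightarrow> \<omega> \<in> B" and B: "B \<subseteq> space M"
  shows "B \<in> sets (\<F> t)"
proof -
  have AM: "A \<in> sets M" using A subalg[of t] by (auto simp: subalgebra_def)
  have BM: "B \<in> sets M" by (rule in_sets_AE[OF ae AM B])
  have "AE \<omega> in M. \<omega> \<notin> A - B" "AE \<omega> in M. \<omega> \<notin> B - A" using ae by auto
  then have "A - B \<in> null_sets M" "B - A \<in> null_sets M" using AM BM by (auto simp: AE_iff_null_sets[symmetric] null_sets_iff_AE intro: sets.sets_into_space[THEN subsetD])
  then have "A - B \<in> sets (\<F> t)" "B - A \<in> sets (\<F> t)" by (blast intro: null_F)+
  then have "(A - (A - B)) \<union> (B - A) \<in> sets (\<F> t)" by (rule sets.Un[OF sets.Diff[OF A]])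
  moreover have "(A - (A - B)) \<union> (B - A) = B" by blast
  ultimately show ?thesis by simp
qed

lemma D_adapted: "0 \<le> t \<Longrightarrow> D t \<in> borel_measurable (\<F> t)"
  using sub by (auto simp: pure_jump_subordinator_def subordinator_def)

lemma D_meas: "0 \<le> t \<Longrightarrow> D t \<in> borel_measurable M"
  using D_adapted F_M by blast

lemma laplace: "0 \<le> s \<Longrightarrow> 0 \<le> t \<Longrightarrow> (\<integral>\<omega>. exp (- s * D t \<omega>) \<partial>M) = exp (- t * laplace_exponent \<nu> s)"
  using sub by (auto simp: pure_jump_subordinator_def)

lemma exponent_mono: "0 < s \<Longrightarrow> s \<le> t \<Longrightarrow> laplace_exponent \<nu> s \<le> laplace_exponent \<nu> t"
  using sub by (intro laplace_exponent_mono) (auto simp: pure_jump_subordinator_def)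

lemma D_prob_le: "0 \<le> s \<Longrightarrow> 0 \<le> t \<Longrightarrow> prob {\<omega>\<in>space M. D t \<omega> \<le> x} \<le> exp (s * x - t * laplace_exponent \<nu> s)"
  using laplace_tail[OF D_meas, of t s "t * laplace_exponent \<nu> s" x] laplace by simp

text \<open>Regular variation with positive index yields a lower bound by a positive power. The
  strict increase of the paths ultimately comes from here.\<close>

lemma exponent_unbounded: "\<exists>s>0. x \<le> laplace_exponent \<nu> s"
proof -
  obtain c s0 where c: "0 < c" "0 < s0" "\<And>u. s0 \<le> u \<Longrightarrow> c * u powr (\<beta> / 2) \<le> laplace_exponent \<nu> u"
    using regularly_varying_lower[OF rv(1) exponent_mono, of "\<beta> / 2"] rv by auto
  define s where "s = max s0 ((\<bar>x\<bar> / c) powr (2 / \<beta>))"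
  have "\<bar>x\<bar> / c = ((\<bar>x\<bar> / c) powr (2 / \<beta>)) powr (\<beta> / 2)"
    using c rv by (simp add: powr_powr)
  also have "\<dots> \<le> s powr (\<beta> / 2)" using rv by (intro powr_mono2) (auto simp: s_def)
  finally have "\<bar>x\<bar> \<le> c * s powr (\<beta> / 2)" using c by (simp add: field_simps)
  also have "\<dots> \<le> laplace_exponent \<nu> s" by (intro c(3)) (simp add: s_def)
  finally have "x \<le> laplace_exponent \<nu> s" by simp
  moreover have "0 < s" using c by (simp add: s_def)
  ultimately show ?thesis by blast
qed

text \<open>In the Chernoff bound at level 0 the exponent is \<open>- t\<close> times the Laplace
  exponent, which can be made arbitrarily large.\<close>

lemma D_pos:
  assumes "0 < t"
  shows "prob {\<omega>\<in>space M. D t \<omega> \<le> 0} = 0"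
proof (rule antisym[OF _ measure_nonneg])
  have "prob {\<omega>\<in>space M. D t \<omega> \<le> 0} \<le> exp (- t) ^ n" for n
  proof -
    obtain s where s: "0 < s" "real n \<le> laplace_exponent \<nu> s" using exponent_unbounded by blast
    have "prob {\<omega>\<in>space M. D t \<omega> \<le> 0} \<le> exp (s * 0 - t * laplace_exponent \<nu> s)"
      using s assms by (intro D_prob_le) auto
    also have "\<dots> \<le> exp (real n * (- t))" using s assms by (simp add: mult.commute mult_left_mono)
    finally show ?thesis by (simp only: exp_of_nat_mult)
  qed
  moreover have "(\<lambda>n. exp (- t) ^ n) \<longlonglongrightarrow> 0" using assms by (intro LIMSEQ_realpow_zero) auto
  ultimately show "prob {\<omega>\<in>space M. D t \<omega> \<le> 0} \<le> 0" by (intro LIMSEQ_le_const[of "\<lambda>n. exp (- t) ^ n" 0]) auto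
qed

text \<open>By stationarity the increment has the law of \<open>D (t - s)\<close>, which is almost
  surely positive.\<close>

lemma D_increment:
  assumes "0 \<le> s" "s < t"
  shows "AE \<omega> in M. D s \<omega> \<noteq> D t \<omega>"
proof -
  have d: "distr M borel (\<lambda>\<omega>. D (s + (t - s)) \<omega> - D s \<omega>) = distr M borel (D (t - s))"
    using sub assms unfolding pure_jump_subordinator_def subordinator_def by (metis diff_ge_0_iff_ge less_imp_le)
  have [measurable]: "D s \<in> borel_measurable M" "D t \<in> borel_measurable M" "D (t - s) \<in> borel_measurable M"
    using assms by (auto intro: D_meas)
  have "emeasure M {\<omega>\<in>space M. D t \<omega> - D s \<omega> \<le> 0} = emeasure (distr M borel (\<lambda>\<omega>. D (s + (t - s)) \<omega> - D s \<omega>)) {..0}"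
    by (subst emeasure_distr) (auto intro!: arg_cong[of _ _ "emeasure M"])
  also have "\<dots> = emeasure M {\<omega>\<in>space M. D (t - s) \<omega> \<le> 0}"
    unfolding d by (subst emeasure_distr) (auto intro!: arg_cong[of _ _ "emeasure M"])
  also have "\<dots> = 0" using D_pos[of "t - s"] assms by (simp add: emeasure_eq_measure)
  finally have "AE \<omega> in M. \<not> D t \<omega> - D s \<omega> \<le> 0"
    by (subst AE_iff_measurable[OF _ refl]) auto
  then show ?thesis by eventually_elim auto
qed

text \<open>With parameter 1 the Chernoff bound for \<open>D n \<le> N\<close> decays geometrically
  in \<open>n\<close>.\<close>

lemma D_unbounded: "AE \<omega> in M. \<forall>x. \<exists>u\<ge>0. x < D u \<omega>"
proof -
  have "AE \<omega> in M. \<exists>n::nat. real N < D (real n) \<omega>" for N :: nat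
  proof -
    have [measurable]: "D (real n) \<in> borel_measurable M" for n :: nat by (rule D_meas) simp
    define A where "A = {\<omega>\<in>space M. \<forall>n::nat. D (real n) \<omega> \<le> real N}"
    have Am: "A \<in> sets M" unfolding A_def by measurable
    have \<psi>: "0 < laplace_exponent \<nu> 1" using rv by (simp add: regularly_varying_def)
    have "prob A \<le> exp (real N) * exp (- laplace_exponent \<nu> 1) ^ n" for n
    proof -
      have "prob A \<le> prob {\<omega>\<in>space M. D (real n) \<omega> \<le> real N}"
        by (rule finite_measure_mono) (auto simp: A_def)
      also have "\<dots> \<le> exp (1 * real N - real n * laplace_exponent \<nu> 1)" by (rule D_prob_le) auto
      also have "\<dots> = exp (real N) * exp (real n * (- laplace_exponent \<nu> 1))" by (simp add: exp_add[symmetric])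
      finally show ?thesis by (simp only: exp_of_nat_mult)
    qed
    note le = this
    have lim: "(\<lambda>n. exp (real N) * exp (- laplace_exponent \<nu> 1) ^ n) \<longlonglongrightarrow> exp (real N) * 0"
      using \<psi> by (intro tendsto_mult tendsto_const LIMSEQ_realpow_zero) auto
    have "prob A \<le> exp (real N) * 0" by (rule LIMSEQ_le_const[OF lim]) (use le in blast)
    then have "emeasure M A = 0" by (simp add: emeasure_eq_measure antisym)
    then have "AE \<omega> in M. \<omega> \<notin> A" using Am by (intro AE_not_in) auto
    then show ?thesis using AE_space by eventually_elim (auto simp: A_def not_le)
  qed
  then have "AE \<omega> in M. \<forall>N::nat. \<exists>n::nat. real N < D (real n) \<omega>" by (simp add: AE_all_countable)
  then show ?thesis
  proof eventually_elim
    case (elim \<omega>)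
    show ?case
    proof
      fix x
      obtain N :: nat where "x \<le> real N" using real_arch_simple by blast
      moreover obtain n :: nat where "real N < D (real n) \<omega>" using elim by blast
      ultimately show "\<exists>u\<ge>0. x < D u \<omega>" by (intro exI[of _ "real n"]) auto
    qed
  qed
qed

text \<open>Null sets are collected over pairs of rational times only. Between any two reals lie two
  such rationals, and monotonicity transfers the strict increase.\<close>

lemma AE_paths: "AE \<omega> in M. time_change_path (\<lambda>u. D u \<omega>)"
proof -
  have "AE \<omega> in M. \<forall>s\<in>\<rat> \<inter> {0..}. \<forall>t\<in>\<rat> \<inter> {s<..}. D s \<omega> \<noteq> D t \<omega>"
  proof (subst AE_ball_countable)
    show c: "countable (\<rat> \<inter> {0::real..})" using countable_rat by (rule countable_subset[rotated]) auto
    show "\<forall>s\<in>\<rat> \<inter> {0..}. AE \<omega> in M. \<forall>t\<in>\<rat> \<inter> {s<..}. D s \<omega> \<noteq> D t \<omega>"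
    proof
      fix s :: real assume s: "s \<in> \<rat> \<inter> {0..}"
      have "countable (\<rat> \<inter> {s<..})" using countable_rat by (rule countable_subset[rotated]) auto
      then show "AE \<omega> in M. \<forall>t\<in>\<rat> \<inter> {s<..}. D s \<omega> \<noteq> D t \<omega>"
        using s by (subst AE_ball_countable) (auto intro: D_increment)
    qed
  qed
  moreover have "AE \<omega> in M. D 0 \<omega> = 0" "AE \<omega> in M. mono_on {0..} (\<lambda>t. D t \<omega>) \<and> (\<forall>t\<ge>0. continuous (at_right t) (\<lambda>t. D t \<omega>))"
    using sub unfolding pure_jump_subordinator_def subordinator_def by blast+
  ultimately show ?thesis
    using D_unbounded
  proof eventually_elim
    case (elim \<omega>)
    show ?case
    proof
      show "D 0 \<omega> = 0" by (rule elim)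
      show "strict_mono_on {0..} (\<lambda>u. D u \<omega>)"
      proof (rule strict_mono_onI)
        fix r s :: real assume rs: "r \<in> {0..}" "s \<in> {0..}" "r < s"
        obtain a where a: "a \<in> \<rat>" "r < a" "a < s" using Rats_dense_in_real[OF rs(3)] by blast
        obtain b where b: "b \<in> \<rat>" "a < b" "b < s" using Rats_dense_in_real[OF a(3)] by blast
        have m: "D x \<omega> \<le> D y \<omega>" if "0 \<le> x" "x \<le> y" for x y
          using elim(3) that by (auto simp: mono_on_def)
        have "D a \<omega> \<noteq> D b \<omega>" using elim(1) a b rs by auto
        moreover have "D r \<omega> \<le> D a \<omega>" "D a \<omega> \<le> D b \<omega>" "D b \<omega> \<le> D s \<omega>" using a b rs by (auto intro!: m)
        ultimately show "D r \<omega> < D s \<omega>" by linarith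
      qed
    qed (use elim in auto)
  qed
qed

text \<open>Up to a null set the event \<open>E t \<le> v\<close> is \<open>t \<le> D v\<close>,
  known at \<open>v\<close>; the exceptional paths are covered because null sets belong to every
  \<open>\<F> v\<close>.\<close>

lemma E_stopping: "stopping_time \<F> (E t)"
proof (rule stopping_timeI)
  fix v :: real
  have "{\<omega>\<in>space M. E t \<omega> \<le> v} \<in> sets (\<F> v)"
  proof (cases "0 \<le> v")
    case True
    have [measurable]: "D v \<in> borel_measurable (\<F> v)" by (rule D_adapted[OF True])
    show ?thesis
    proof (rule sets_F_AE)
      have "{\<omega>\<in>space (\<F> v). t \<le> D v \<omega>} \<in> sets (\<F> v)" by measurable
      then show "{\<omega>\<in>space M. t \<le> D v \<omega>} \<in> sets (\<F> v)" by simp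
      show "AE \<omega> in M. (\<omega> \<in> {\<omega>\<in>space M. t \<le> D v \<omega>}) = (\<omega> \<in> {\<omega>\<in>space M. E t \<omega> \<le> v})"
        using AE_paths by eventually_elim (use True in \<open>auto simp: time_change_path.inv_le_iff\<close>)
    qed auto
  next
    case False
    show ?thesis
    proof (rule sets_F_AE[of "{}"])
      show "AE \<omega> in M. (\<omega> \<in> {}) = (\<omega> \<in> {\<omega>\<in>space M. E t \<omega> \<le> v})"
        using AE_paths
      proof eventually_elim
        case (elim \<omega>)
        then show ?case using time_change_path.inv_nonneg[OF elim, of t] False by auto
      qed
    qed auto
  qed
  then show "Measurable.pred (\<F> v) (\<lambda>\<omega>. E t \<omega> \<le> v)" by (simp add: pred_def)
qed

section \<open>The time-changed filtration\<close>

lemma \<G>_eq: "\<G> t = filtration.pre_sigma (space M) \<F> (E t)"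
  by (simp add: time_changed_filtration_def)

lemma space_\<G> [simp]: "space (\<G> t) = space M"
  unfolding \<G>_eq by (rule filtration.space_pre_sigma[OF filtration_F])

lemma sets_\<G>: "sets (\<G> t) = {A. \<forall>v. {\<omega>\<in>A. E t \<omega> \<le> v} \<in> sets (\<F> v)}"
  unfolding \<G>_eq by (rule filtration.sets_pre_sigma[OF filtration_F E_stopping])

lemma \<G>_mono:
  assumes "s \<le> t"
  shows "sets (\<G> s) \<subseteq> sets (\<G> t)"
proof
  fix A assume A: "A \<in> sets (\<G> s)"
  then have AM: "A \<subseteq> space M" using sets.sets_into_space by fastforce
  show "A \<in> sets (\<G> t)"
    unfolding sets_\<G>
  proof (intro CollectI allI)
    fix v
    have "{\<omega>\<in>A. E s \<omega> \<le> v} \<in> sets (\<F> v)" using A unfolding sets_\<G> by blast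
    moreover have "{\<omega>\<in>space (\<F> v). E t \<omega> \<le> v} \<in> sets (\<F> v)"
      using stopping_timeD[OF E_stopping] unfolding pred_def .
    ultimately have "{\<omega>\<in>A. E s \<omega> \<le> v} \<inter> {\<omega>\<in>space (\<F> v). E t \<omega> \<le> v} \<in> sets (\<F> v)" by (rule sets.Int)
    then show "{\<omega>\<in>A. E t \<omega> \<le> v} \<in> sets (\<F> v)"
    proof (rule sets_F_AE)
      show "AE \<omega> in M. (\<omega> \<in> {\<omega>\<in>A. E s \<omega> \<le> v} \<inter> {\<omega>\<in>space (\<F> v). E t \<omega> \<le> v}) = (\<omega> \<in> {\<omega>\<in>A. E t \<omega> \<le> v})"
        using AE_paths
      proof eventually_elim
        case (elim \<omega>)
        then show ?case using time_change_path.inv_mono[OF elim assms] AM by auto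
      qed
    qed (use AM in auto)
  qed
qed

lemma filtration_\<G>: "filtration (space M) \<G>"
  by unfold_locales (use \<G>_mono in auto)

lemma \<G>_meas: "f \<in> measurable (\<G> t) N \<Longrightarrow> f \<in> measurable M N"
proof -
  have "A \<in> sets M" if A: "A \<in> sets (\<G> t)" for A
  proof -
    have "{\<omega>\<in>A. E t \<omega> \<le> real n} \<in> sets M" for n :: nat
      using A subalg[of "real n"] unfolding sets_\<G> by (auto simp: subalgebra_def)
    then have "(\<Union>n::nat. {\<omega>\<in>A. E t \<omega> \<le> real n}) \<in> sets M" by blast
    moreover have "(\<Union>n::nat. {\<omega>\<in>A. E t \<omega> \<le> real n}) = A" using real_arch_simple by auto
    ultimately show ?thesis by simp
  qed
  then have "subalgebra M (\<G> t)" by (auto simp: subalgebra_def)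
  then show "f \<in> measurable (\<G> t) N \<Longrightarrow> f \<in> measurable M N" by (rule measurable_from_subalg)
qed

text \<open>Events of \<open>\<G> t\<close> intersected with \<open>E t \<le> v\<close> belong to
  \<open>\<F> v\<close> by the definition of the stopped sigma-algebra. This is the bridge from
  real-time to operational-time adaptedness.\<close>

lemma \<G>_adapted:
  assumes "f \<in> borel_measurable (\<G> t)"
  shows "(\<lambda>\<omega>. if E t \<omega> \<le> v then f \<omega> else (0::real)) \<in> borel_measurable (\<F> v)"
proof (rule borel_measurableI_le)
  fix x :: real
  have "{\<omega>\<in>space (\<G> t). f \<omega> \<le> x} \<in> sets (\<G> t)" using assms by measurable
  then have 1: "{\<omega>\<in>{\<omega>\<in>space M. f \<omega> \<le> x}. E t \<omega> \<le> v} \<in> sets (\<F> v)" unfolding sets_\<G> by simp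
  have 2: "{\<omega>\<in>space (\<F> v). \<not> E t \<omega> \<le> v} \<in> sets (\<F> v)"
    using stopping_timeD[OF E_stopping[of t], of v] unfolding pred_def by (rule sets.sets_Collect_neg)
  show "{\<omega> \<in> space (\<F> v). (if E t \<omega> \<le> v then f \<omega> else 0) \<le> x} \<in> sets (\<F> v)"
  proof (cases "0 \<le> x")
    case True
    then have "{\<omega> \<in> space (\<F> v). (if E t \<omega> \<le> v then f \<omega> else 0) \<le> x}
      = {\<omega>\<in>{\<omega>\<in>space M. f \<omega> \<le> x}. E t \<omega> \<le> v} \<union> {\<omega>\<in>space (\<F> v). \<not> E t \<omega> \<le> v}" by auto
    then show ?thesis using sets.Un[OF 1 2] by (simp only:)
  next
    case False
    then have "{\<omega> \<in> space (\<F> v). (if E t \<omega> \<le> v then f \<omega> else 0) \<le> x}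
      = {\<omega>\<in>{\<omega>\<in>space M. f \<omega> \<le> x}. E t \<omega> \<le> v}" by (auto split: if_splits)
    then show ?thesis using 1 by (simp only:)
  qed
qed

end

section \<open>Left Riemann sums as simple integrals\<close>

context time_changed_sde
begin

text \<open>The paths on which all pathwise arguments work. The complement is null and so belongs to
  every \<open>\<F> t\<close>, which keeps adaptedness when the processes are redefined
  there.\<close>

definition good :: "'a \<Rightarrow> bool" where
  "good \<omega> \<longleftrightarrow> time_change_path (\<lambda>u. D u \<omega>) \<and> continuous_on {0..} (\<lambda>t. W t \<omega>) \<and> continuous_on {0..T} (\<lambda>t. X t \<omega>)"

lemma AE_good: "AE \<omega> in M. good \<omega>"
proof -
  have "AE \<omega> in M. continuous_on {0..} (\<lambda>t. W t \<omega>)" using bm by (simp add: brownian_motion_def)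
  moreover have "AE \<omega> in M. continuous_on {0..T} (\<lambda>t. X t \<omega>)" using sol by (simp add: solves_time_changed_SDE_def)
  ultimately show ?thesis using AE_paths by eventually_elim (simp add: good_def)
qed

lemma not_good_null: "{\<omega>\<in>space M. \<not> good \<omega>} \<in> null_sets M"
  using AE_good by (simp add: AE_iff_null_sets)

lemma good_pred [measurable]: "Measurable.pred (\<F> t) good" "Measurable.pred M good"
proof -
  have n: "{\<omega>\<in>space (\<F> t). \<not> good \<omega>} \<in> sets (\<F> t)" for t using null_F[OF not_good_null] by simp
  have "{\<omega>\<in>space (\<F> t). \<not> \<not> good \<omega>} \<in> sets (\<F> t)" for t using n by (rule sets.sets_Collect_neg)
  then have p: "Measurable.pred (\<F> t) good" for t by (simp add: pred_def)
  show "Measurable.pred (\<F> t) good" by (rule p)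
  show "Measurable.pred M good" using p by (rule F_M)
qed

lemma X_\<G>: "0 \<le> t \<Longrightarrow> t \<le> T \<Longrightarrow> X t \<in> borel_measurable (\<G> t)"
  using sol by (simp add: solves_time_changed_SDE_def)

lemma E_\<G>: "E t \<in> borel_measurable (\<G> t)"
  unfolding \<G>_eq by (rule filtration.measurable_stopping_time_pre_sigma[OF filtration_F E_stopping])

text \<open>The integrand of the SDE on good paths. The \<open>max\<close> secures measurability on
  the exceptional ones, where nothing is known about \<open>E\<close>.\<close>

definition Y :: "real \<Rightarrow> 'a \<Rightarrow> real" where
  "Y t \<omega> = G (max 0 (E t \<omega>)) (X t \<omega>)"

definition pt :: "nat \<Rightarrow> nat \<Rightarrow> real" where
  "pt n i = real i * T / real (Suc n)"

definition Sn :: "nat \<Rightarrow> real \<Rightarrow> 'a \<Rightarrow> real" where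
  "Sn n t \<omega> = (\<Sum>i<Suc n. Y (pt n i) \<omega> * indicator {pt n i <.. pt n (Suc i)} t)"

definition Jn :: "nat \<Rightarrow> real \<Rightarrow> 'a \<Rightarrow> real" where
  "Jn n t \<omega> = (\<Sum>i<Suc n. Y (pt n i) \<omega> * (W (E (min t (pt n (Suc i))) \<omega>) \<omega> - W (E (min t (pt n i)) \<omega>) \<omega>))"

lemma pt_mono: "i \<le> j \<Longrightarrow> pt n i \<le> pt n j"
  unfolding pt_def using T_pos by (intro divide_right_mono mult_right_mono) auto

lemma pt_bounds: "0 \<le> pt n i" "i \<le> Suc n \<Longrightarrow> pt n i \<le> T"
  using pt_mono[of 0 i n] pt_mono[of i "Suc n" n] by (simp_all add: pt_def del: of_nat_Suc)

lemma Y_\<G>: "0 \<le> t \<Longrightarrow> t \<le> T \<Longrightarrow> Y t \<in> borel_measurable (\<G> t)"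
  unfolding Y_def[abs_def] by (intro G_comp_meas E_\<G> X_\<G>)

lemma Y_meas: "0 \<le> t \<Longrightarrow> t \<le> T \<Longrightarrow> Y t \<in> borel_measurable M"
  by (rule \<G>_meas[OF Y_\<G>])

lemma Y_good: "good \<omega> \<Longrightarrow> Y t \<omega> = G (E t \<omega>) (X t \<omega>)"
  unfolding Y_def using time_change_path.inv_nonneg[of "\<lambda>u. D u \<omega>" t] by (simp add: good_def)

lemma E_cont: "good \<omega> \<Longrightarrow> continuous_on S (\<lambda>t. E t \<omega>)"
  by (intro continuous_at_imp_continuous_on ballI time_change_path.inv_cont) (simp add: good_def)

lemma Y_cont: "good \<omega> \<Longrightarrow> continuous_on {0..T} (\<lambda>t. Y t \<omega>)"
proof -
  assume g: "good \<omega>"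
  have "continuous_on {0..T} (\<lambda>t. case (E t \<omega>, X t \<omega>) of (u, x) \<Rightarrow> G u x)"
    by (rule continuous_on_compose2[OF G_cont continuous_on_Pair[OF E_cont[OF g]]])
       (use g time_change_path.inv_nonneg[of "\<lambda>u. D u \<omega>"] in \<open>auto simp: good_def\<close>)
  then show ?thesis unfolding Y_good[OF g] by simp
qed

lemma Sn_eq:
  assumes i: "i < Suc n" "pt n i < t" "t \<le> pt n (Suc i)"
  shows "Sn n t \<omega> = Y (pt n i) \<omega>"
proof -
  have "Sn n t \<omega> = (\<Sum>j<Suc n. if j = i then Y (pt n i) \<omega> else 0)"
    unfolding Sn_def
  proof (intro sum.cong refl)
    fix j
    show "Y (pt n j) \<omega> * indicator {pt n j <.. pt n (Suc j)} t = (if j = i then Y (pt n i) \<omega> else 0)"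
    proof (cases "j = i")
      case True
      then show ?thesis using i by simp
    next
      case False
      then have "Suc i \<le> j \<or> Suc j \<le> i" by linarith
      then have "t \<notin> {pt n j <.. pt n (Suc j)}"
        using i pt_mono[of "Suc i" j n] pt_mono[of "Suc j" i n] by auto
      then show ?thesis using False by simp
    qed
  qed
  then show ?thesis using i(1) by simp
qed

lemma pt_ex:
  assumes "0 < t" "t \<le> T"
  shows "\<exists>i<Suc n. pt n i < t \<and> t \<le> pt n (Suc i) \<and> \<bar>pt n i - t\<bar> \<le> T / real (Suc n)"
proof -
  have "\<exists>i. t \<le> pt n (Suc i)"
    using assms by (intro exI[of _ n]) (simp add: pt_def del: of_nat_Suc)
  then obtain i where i: "t \<le> pt n (Suc i)" "\<And>j. j < i \<Longrightarrow> \<not> t \<le> pt n (Suc j)"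
    using exists_least_iff[of "\<lambda>i. t \<le> pt n (Suc i)"] by blast
  have "pt n i < t" using i(2)[of "i - 1"] assms by (cases i) (auto simp: pt_def)
  moreover have "i < Suc n"
  proof (rule ccontr)
    assume "\<not> i < Suc n"
    then have "n < i" by simp
    from i(2)[OF this] show False using assms by (simp add: pt_def del: of_nat_Suc)
  qed
  moreover have "pt n (Suc i) = pt n i + T / real (Suc n)"
    by (simp add: pt_def add_divide_distrib distrib_right)
  ultimately show ?thesis using i(1) by (intro exI[of _ i]) auto
qed

text \<open>The partition points are constants and hence stopping times, and the sigma-algebra
  stopped at a constant contains \<open>\<G>\<close> at that time.\<close>

lemma simple_pair: "simple_integral_pair (space M) \<G> (\<lambda>t \<omega>. W (E t \<omega>) \<omega>) (Sn n) (Jn n)"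
  unfolding simple_integral_pair_def
proof (rule exI[of _ "Suc n"], rule exI[of _ "\<lambda>i _. pt n i"], rule exI[of _ "\<lambda>i. Y (pt n i)"], intro conjI ballI allI impI)
  show "stopping_time \<G> (\<lambda>_. pt n i)" for i by (rule stopping_time_const)
  show "0 \<le> pt n 0" by (simp add: pt_def)
  show "pt n i \<le> pt n (Suc i)" for i by (rule pt_mono) simp
  show "Y (pt n i) \<in> borel_measurable (filtration.pre_sigma (space M) \<G> (\<lambda>_. pt n i))" if "i < Suc n" for i
  proof (rule measurableI)
    fix A :: "real set" assume A: "A \<in> sets borel"
    have p: "0 \<le> pt n i" "pt n i \<le> T" using pt_bounds(1)[of n i] pt_bounds(2)[of i n] that by auto
    have B: "Y (pt n i) -` A \<inter> space M \<in> sets (\<G> (pt n i))"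
      using measurable_sets[OF Y_\<G>[OF p] A] by simp
    have "Y (pt n i) -` A \<inter> space M \<in> sets (filtration.pre_sigma (space M) \<G> (\<lambda>_. pt n i))"
    proof (rule filtration.sets_pre_sigmaI[OF filtration_\<G> stopping_time_const])
      fix t
      show "{\<omega> \<in> Y (pt n i) -` A \<inter> space M. pt n i \<le> t} \<in> sets (\<G> t)"
      proof (cases "pt n i \<le> t")
        case True
        then have "{\<omega> \<in> Y (pt n i) -` A \<inter> space M. pt n i \<le> t} = Y (pt n i) -` A \<inter> space M" by auto
        then show ?thesis using subsetD[OF \<G>_mono[OF True] B] by (simp only:)
      qed simp
    qed
    then show "Y (pt n i) -` A \<inter> space (filtration.pre_sigma (space M) \<G> (\<lambda>_. pt n i))
        \<in> sets (filtration.pre_sigma (space M) \<G> (\<lambda>_. pt n i))"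
      by (simp only: filtration.space_pre_sigma[OF filtration_\<G>])
  qed simp
  show "Sn n = (\<lambda>t \<omega>. \<Sum>i<Suc n. Y (pt n i) \<omega> * indicator {pt n i<..pt n (Suc i)} t)"
    by (simp add: fun_eq_iff Sn_def)
  show "Jn n = (\<lambda>t \<omega>. \<Sum>i<Suc n. Y (pt n i) \<omega> * (W (E (min t (pt n (Suc i))) \<omega>) \<omega> - W (E (min t (pt n i)) \<omega>) \<omega>))"
    by (simp add: fun_eq_iff Jn_def)
qed

text \<open>On a good path uniform continuity makes the approximation uniform. The supremum is
  compared with the countable version \<open>B n\<close> over rationals, whose measurability is
  clear.\<close>

lemma Sn_ucp: "ucp_tendsto M {0<..T} Sn (\<lambda>t \<omega>. G (E t \<omega>) (X t \<omega>))"
  unfolding ucp_tendsto_def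
proof (intro allI impI)
  fix \<epsilon> :: real assume \<epsilon>: "0 < \<epsilon>"
  define A where "A n = {\<omega>\<in>space M. ennreal \<epsilon> < sup_dist {0<..T} (\<lambda>t. Sn n t \<omega>) (\<lambda>t. G (E t \<omega>) (X t \<omega>))}" for n
  define B where "B n = {\<omega>\<in>space M. \<exists>r\<in>\<rat> \<inter> {0<..T}. \<epsilon> < \<bar>Sn n r \<omega> - Y r \<omega>\<bar>}" for n
  define N where "N = {\<omega>\<in>space M. \<not> good \<omega>}"
  have Sm: "Sn n t \<in> borel_measurable M" for n t
    unfolding Sn_def[abs_def] by (intro borel_measurable_sum borel_measurable_times borel_measurable_const Y_meas pt_bounds) auto
  have Bm: "B n \<in> sets M" for n
  proof -
    have "Measurable.pred M (\<lambda>\<omega>. \<exists>r\<in>\<rat> \<inter> {0<..T}. \<epsilon> < \<bar>Sn n r \<omega> - Y r \<omega>\<bar>)"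
    proof (rule measurable_pred_countable(2))
      show "countable (\<rat> \<inter> {0<..T})" using countable_rat by (rule countable_subset[rotated]) auto
      fix r assume "r \<in> \<rat> \<inter> {0<..T}"
      then have [measurable]: "Y r \<in> borel_measurable M" "Sn n r \<in> borel_measurable M" by (auto intro: Y_meas Sm)
      show "Measurable.pred M (\<lambda>\<omega>. \<epsilon> < \<bar>Sn n r \<omega> - Y r \<omega>\<bar>)" by measurable
    qed
    then show ?thesis unfolding B_def pred_def .
  qed
  have AB: "A n \<subseteq> B n \<union> N" for n
  proof
    fix \<omega> assume w: "\<omega> \<in> A n"
    show "\<omega> \<in> B n \<union> N"
    proof (rule ccontr)
      assume n: "\<omega> \<notin> B n \<union> N"
      have wM: "\<omega> \<in> space M" using w by (simp add: A_def)
      have g: "good \<omega>" using n wM by (simp add: N_def)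
      have rb: "\<bar>Sn n r \<omega> - Y r \<omega>\<bar> \<le> \<epsilon>" if "r \<in> \<rat>" "0 < r" "r \<le> T" for r
        using n wM that by (auto simp: B_def not_less)
      have "sup_dist {0<..T} (\<lambda>t. Sn n t \<omega>) (\<lambda>t. G (E t \<omega>) (X t \<omega>)) \<le> ennreal \<epsilon>"
        unfolding sup_dist_def
      proof (rule SUP_least)
        fix t assume t: "t \<in> {0<..T}"
        obtain i where i: "i < Suc n" "pt n i < t" "t \<le> pt n (Suc i)" using pt_ex[of t n] t by auto
        \<comment> \<open>Inside the cell of \<open>t\<close> the step process is constant, so
          rationals slightly to the left of \<open>t\<close> carry the bound.\<close>
        have "\<bar>Y (pt n i) \<omega> - Y t \<omega>\<bar> \<le> \<epsilon>"
        proof (rule left_rational_bound[where f="\<lambda>t. \<bar>Y (pt n i) \<omega> - Y t \<omega>\<bar>" and a="pt n i" and b=T])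
          show "continuous_on {pt n i..T} (\<lambda>t. \<bar>Y (pt n i) \<omega> - Y t \<omega>\<bar>)"
            using pt_bounds(1)[of n i]
            by (intro continuous_intros continuous_on_subset[OF Y_cont[OF g]]) auto
          fix r assume r: "r \<in> \<rat>" "pt n i < r" "r < t"
          have "0 < r" "r \<le> T" using r t pt_bounds(1)[of n i] by auto
          then show "\<bar>Y (pt n i) \<omega> - Y r \<omega>\<bar> \<le> \<epsilon>" using rb[OF r(1)] Sn_eq[OF i(1), of r \<omega>] r i by simp
        qed (use i t in auto)
        then show "ennreal \<bar>Sn n t \<omega> - G (E t \<omega>) (X t \<omega>)\<bar> \<le> ennreal \<epsilon>"
          unfolding Sn_eq[OF i] Y_good[OF g, symmetric] by (rule ennreal_leI)
      qed
      then show False using w by (simp add: A_def not_le[symmetric])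
    qed
  qed
  have "AE \<omega> in M. \<forall>\<^sub>F n in sequentially. \<omega> \<notin> B n"
    using AE_good
  proof eventually_elim
    case (elim \<omega>)
    show ?case using uniform_modulus[OF Y_cont[OF elim] \<epsilon>]
    proof eventually_elim
      case (elim n)
      have "\<bar>Sn n r \<omega> - Y r \<omega>\<bar> \<le> \<epsilon>" if r: "0 < r" "r \<le> T" for r
      proof -
        obtain i where i: "i < Suc n" "pt n i < r" "r \<le> pt n (Suc i)" "\<bar>pt n i - r\<bar> \<le> T / real (Suc n)"
          using pt_ex[OF r] by blast
        show ?thesis unfolding Sn_eq[OF i(1-3)] using elim pt_bounds(1)[of n i] i r by auto
      qed
      then show ?case by (force simp: B_def)
    qed
  qed
  then have lim: "(\<lambda>n. measure M (B n)) \<longlonglongrightarrow> 0"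
    by (intro measure_tendsto_0_AE Bm prob_space_axioms)
  have le: "measure M (A n) \<le> measure M (B n)" for n
  proof -
    have "measure M (A n) \<le> measure M (B n \<union> N)"
      using AB not_good_null Bm by (intro finite_measure_mono) (auto simp: N_def null_sets_def)
    also have "\<dots> = measure M (B n)"
      using measure_Un_null_set[OF Bm not_good_null] by (simp add: N_def)
    finally show ?thesis .
  qed
  have "(\<lambda>n. measure M (A n)) \<longlonglongrightarrow> 0"
    by (rule tendsto_sandwich[OF _ _ tendsto_const lim]) (intro always_eventually allI measure_nonneg le)+
  then show "(\<lambda>n. measure M {\<omega>\<in>space M. ennreal \<epsilon> < sup_dist {0<..T} (\<lambda>t. Sn n t \<omega>) (\<lambda>t. G (E t \<omega>) (X t \<omega>))}) \<longlonglongrightarrow> 0"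
    unfolding A_def .
qed

lemma Z_meas: "(\<lambda>\<omega>. if good \<omega> then W (E t \<omega>) \<omega> else 0) \<in> borel_measurable M"
proof -
  have "(\<lambda>\<omega>. (\<lambda>s \<omega>. if good \<omega> then W s \<omega> else 0) ((\<lambda>\<omega>. if good \<omega> then E t \<omega> else 0) \<omega>) \<omega>) \<in> borel_measurable M"
  proof (rule continuous_process_random_time[where W="\<lambda>s \<omega>. if good \<omega> then W s \<omega> else 0"
        and \<tau>="\<lambda>\<omega>. if good \<omega> then E t \<omega> else 0"])
    fix s :: real assume "0 \<le> s"
    then have [measurable]: "W s \<in> borel_measurable M" using bm by (intro F_M) (auto simp: brownian_motion_def)
    show "(\<lambda>\<omega>. if good \<omega> then W s \<omega> else 0) \<in> borel_measurable M" by measurable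
  next
    fix \<omega>
    show "continuous_on {0..} (\<lambda>t. if good \<omega> then W t \<omega> else 0)" by (cases "good \<omega>") (auto simp: good_def)
    show "0 \<le> (if good \<omega> then E t \<omega> else 0)"
      using time_change_path.inv_nonneg[of "\<lambda>u. D u \<omega>" t] by (auto simp: good_def)
  next
    have [measurable]: "E t \<in> borel_measurable M" by (rule \<G>_meas[OF E_\<G>])
    show "(\<lambda>\<omega>. if good \<omega> then E t \<omega> else 0) \<in> borel_measurable M" by measurable
  qed
  then show ?thesis by (simp cong: if_cong)
qed

text \<open>Uniform convergence in probability gives a sequence of indices along which the
  exceedance probabilities of the thresholds \<open>1 / (k + 1)\<close> are summable; the
  Borel-Cantelli lemma turns this into almost sure uniform convergence.\<close>

lemma integral_limit:
  assumes I: "is_stochastic_integral M \<G> T (\<lambda>t \<omega>. W (E t \<omega>) \<omega>) (\<lambda>t \<omega>. G (E t \<omega>) (X t \<omega>)) I"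
  shows "\<exists>r. filterlim r at_top sequentially \<and> (AE \<omega> in M. \<forall>t\<in>{0..T}. (\<lambda>n. Jn (r n) t \<omega>) \<longlonglongrightarrow> I t \<omega>)"
proof -
  have Im: "I t \<in> borel_measurable M" if "0 \<le> t" "t \<le> T" for t
    using I that by (intro \<G>_meas) (auto simp: is_stochastic_integral_def)
  have Ic: "AE \<omega> in M. continuous_on {0..T} (\<lambda>t. I t \<omega>)" using I by (simp add: is_stochastic_integral_def)
  have ucp: "ucp_tendsto M {0..T} Jn I"
    using I simple_pair Sn_ucp unfolding is_stochastic_integral_def by blast
  define A where "A \<epsilon> n = {\<omega>\<in>space M. ennreal \<epsilon> < sup_dist {0..T} (\<lambda>t. Jn n t \<omega>) (\<lambda>t. I t \<omega>)}" for \<epsilon> n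
  have lim: "(\<lambda>n. measure M (A \<epsilon> n)) \<longlonglongrightarrow> 0" if "0 < \<epsilon>" for \<epsilon>
    using ucp that unfolding ucp_tendsto_def A_def by blast
  \<comment> \<open>A version of \<open>Jn\<close> altered off the good set, where measurability of
    \<open>W\<close> at the random time would fail to be available.\<close>
  define J' where "J' n t \<omega> = (\<Sum>i<Suc n. Y (pt n i) \<omega> * ((if good \<omega> then W (E (min t (pt n (Suc i))) \<omega>) \<omega> else 0)
      - (if good \<omega> then W (E (min t (pt n i)) \<omega>) \<omega> else 0)))" for n t \<omega>
  have J'm: "J' n t \<in> borel_measurable M" for n t
    unfolding J'_def[abs_def]
    by (intro borel_measurable_sum borel_measurable_times borel_measurable_diff Z_meas Y_meas pt_bounds) auto
  have J'_good: "J' n t \<omega> = Jn n t \<omega>" if "good \<omega>" for n t \<omega>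
    using that by (simp add: J'_def Jn_def)
  have Jc: "continuous_on {0..T} (\<lambda>t. Jn n t \<omega>)" if g: "good \<omega>" for n \<omega>
  proof -
    have "continuous_on {0..T} (\<lambda>t. W (E (min t (pt n i)) \<omega>) \<omega>)" for i
    proof (rule continuous_on_compose2[of "{0..}" "\<lambda>u. W u \<omega>"])
      show "continuous_on {0..T} (\<lambda>t. E (min t (pt n i)) \<omega>)"
        by (rule continuous_on_compose2[OF E_cont[OF g, of UNIV]]) (auto intro!: continuous_intros)
    qed (use g time_change_path.inv_nonneg[of "\<lambda>u. D u \<omega>"] in \<open>auto simp: good_def\<close>)
    then show ?thesis unfolding Jn_def by (intro continuous_intros)
  qed
  \<comment> \<open>A nonmeasurable set has measure 0 by convention, so the convergence would carry
    no information without this. Continuity of \<open>Jn\<close> and \<open>I\<close> reduces the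
    supremum to rational times up to a null set.\<close>
  have Am: "A \<epsilon> n \<in> sets M" if \<epsilon>: "0 < \<epsilon>" for \<epsilon> n
  proof (rule in_sets_AE)
    have "Measurable.pred M (\<lambda>\<omega>. \<exists>r\<in>\<rat> \<inter> {0..T}. \<epsilon> < \<bar>J' n r \<omega> - I r \<omega>\<bar>)"
    proof (rule measurable_pred_countable(2))
      show "countable (\<rat> \<inter> {0..T})" using countable_rat by (rule countable_subset[rotated]) auto
      fix r assume "r \<in> \<rat> \<inter> {0..T}"
      then have [measurable]: "I r \<in> borel_measurable M" "J' n r \<in> borel_measurable M" by (auto intro: Im J'm)
      show "Measurable.pred M (\<lambda>\<omega>. \<epsilon> < \<bar>J' n r \<omega> - I r \<omega>\<bar>)" by measurable
    qed
    then show "{\<omega>\<in>space M. \<exists>r\<in>\<rat> \<inter> {0..T}. \<epsilon> < \<bar>J' n r \<omega> - I r \<omega>\<bar>} \<in> sets M" unfolding pred_def .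
    show "AE \<omega> in M. (\<omega> \<in> {\<omega>\<in>space M. \<exists>r\<in>\<rat> \<inter> {0..T}. \<epsilon> < \<bar>J' n r \<omega> - I r \<omega>\<bar>}) = (\<omega> \<in> A \<epsilon> n)"
      using AE_good Ic AE_space
    proof eventually_elim
      case (elim \<omega>)
      have "(\<exists>r\<in>\<rat> \<inter> {0..T}. \<epsilon> < \<bar>Jn n r \<omega> - I r \<omega>\<bar>) \<longleftrightarrow> ennreal \<epsilon> < sup_dist {0..T} (\<lambda>t. Jn n t \<omega>) (\<lambda>t. I t \<omega>)"
      proof
        assume "\<exists>r\<in>\<rat> \<inter> {0..T}. \<epsilon> < \<bar>Jn n r \<omega> - I r \<omega>\<bar>"
        then obtain r where r: "r \<in> {0..T}" "\<epsilon> < \<bar>Jn n r \<omega> - I r \<omega>\<bar>" by blast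
        then have "ennreal \<epsilon> < ennreal \<bar>Jn n r \<omega> - I r \<omega>\<bar>" using \<epsilon> by (simp add: ennreal_less_iff)
        also have "\<dots> \<le> sup_dist {0..T} (\<lambda>t. Jn n t \<omega>) (\<lambda>t. I t \<omega>)"
          unfolding sup_dist_def by (rule SUP_upper[OF r(1)])
        finally show "ennreal \<epsilon> < sup_dist {0..T} (\<lambda>t. Jn n t \<omega>) (\<lambda>t. I t \<omega>)" .
      next
        assume lt: "ennreal \<epsilon> < sup_dist {0..T} (\<lambda>t. Jn n t \<omega>) (\<lambda>t. I t \<omega>)"
        show "\<exists>r\<in>\<rat> \<inter> {0..T}. \<epsilon> < \<bar>Jn n r \<omega> - I r \<omega>\<bar>"
        proof (rule ccontr)
          assume "\<not> (\<exists>r\<in>\<rat> \<inter> {0..T}. \<epsilon> < \<bar>Jn n r \<omega> - I r \<omega>\<bar>)"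
          then have b: "\<bar>Jn n r \<omega> - I r \<omega>\<bar> \<le> \<epsilon>" if "r \<in> \<rat>" "0 \<le> r" "r \<le> T" for r using that by (auto simp: not_less)
          have "sup_dist {0..T} (\<lambda>t. Jn n t \<omega>) (\<lambda>t. I t \<omega>) \<le> ennreal \<epsilon>"
            unfolding sup_dist_def
          proof (intro SUP_least ennreal_leI)
            fix t assume t: "t \<in> {0..T}"
            show "\<bar>Jn n t \<omega> - I t \<omega>\<bar> \<le> \<epsilon>"
            proof (rule rational_bound[where f="\<lambda>t. \<bar>Jn n t \<omega> - I t \<omega>\<bar>" and T=T])
              show "continuous_on {0..T} (\<lambda>t. \<bar>Jn n t \<omega> - I t \<omega>\<bar>)"
                by (intro continuous_intros Jc elim)
            qed (use t b in auto)
          qed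
          then show False using lt by (simp add: not_le[symmetric])
        qed
      qed
      then show ?case using elim(3) by (simp add: A_def J'_good[OF elim(1)])
    qed
    show "A \<epsilon> n \<subseteq> space M" by (auto simp: A_def)
  qed
  obtain r where r: "filterlim r at_top sequentially" "summable (\<lambda>k. measure M (A (1 / real (Suc k)) (r k)))"
    using summable_subsequence[of "\<lambda>k n. measure M (A (1 / real (Suc k)) n)"] lim by auto
  have "AE \<omega> in M. \<forall>\<^sub>F k in sequentially. \<omega> \<in> space M - A (1 / real (Suc k)) (r k)"
    by (rule borel_cantelli_AE1) (use r(2) Am in \<open>auto simp: less_top[symmetric]\<close>)
  then have "AE \<omega> in M. \<forall>t\<in>{0..T}. (\<lambda>n. Jn (r n) t \<omega>) \<longlonglongrightarrow> I t \<omega>"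
  proof eventually_elim
    case (elim \<omega>)
    show ?case
    proof
      fix t assume t: "t \<in> {0..T}"
      have "\<forall>\<^sub>F k in sequentially. norm (Jn (r k) t \<omega> - I t \<omega>) \<le> 1 / real (Suc k)"
        using elim
      proof eventually_elim
        case (elim k)
        then have "sup_dist {0..T} (\<lambda>t. Jn (r k) t \<omega>) (\<lambda>t. I t \<omega>) \<le> ennreal (1 / real (Suc k))"
          by (auto simp: A_def not_less)
        then have "ennreal \<bar>Jn (r k) t \<omega> - I t \<omega>\<bar> \<le> ennreal (1 / real (Suc k))"
          using SUP_upper[OF t, of "\<lambda>t. ennreal \<bar>Jn (r k) t \<omega> - I t \<omega>\<bar>"] unfolding sup_dist_def by (rule order_trans[rotated])
        then show ?case by (simp del: of_nat_Suc)
      qed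
      then have "(\<lambda>k. Jn (r k) t \<omega> - I t \<omega>) \<longlonglongrightarrow> 0"
        by (rule Lim_null_comparison) (rule LIMSEQ_Suc[OF lim_1_over_n])
      then show "(\<lambda>n. Jn (r n) t \<omega>) \<longlonglongrightarrow> I t \<omega>" by (rule LIM_zero_cancel)
    qed
  qed
  with r(1) show ?thesis by blast
qed

end

subsection \<open>Strong convergence\<close>

context time_changed_sde
begin

text \<open>Off the good set \<open>D\<close> becomes the identity, itself an admissible time
  change, while the other two processes become 0. Thus every path is regular.\<close>

definition D' :: "real \<Rightarrow> 'a \<Rightarrow> real" where "D' v \<omega> = (if good \<omega> then D v \<omega> else v)"
definition W' :: "real \<Rightarrow> 'a \<Rightarrow> real" where "W' v \<omega> = (if good \<omega> then W v \<omega> else 0)"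
definition X' :: "real \<Rightarrow> 'a \<Rightarrow> real" where "X' v \<omega> = (if good \<omega> then X v \<omega> else 0)"

lemma identity_path: "time_change_path (\<lambda>u. u)"
proof
  show "\<exists>u\<ge>0. x < u" for x :: real by (rule exI[of _ "\<bar>x\<bar> + 1"]) auto
qed (auto simp: strict_mono_on_def)

lemma W_adapted: "0 \<le> t \<Longrightarrow> W t \<in> borel_measurable (\<F> t)"
  using bm by (simp add: brownian_motion_def)

text \<open>\<open>W'\<close> agrees almost surely with \<open>W\<close>, so the moment identities
  carry over; the degenerate case \<open>s = t\<close> is added by hand.\<close>

lemma filtered_brownian: "filtered_brownian M \<F> W'"
proof
  show "subalgebra M (\<F> t)" for t by (rule subalg)
  show "sets (\<F> s) \<subseteq> sets (\<F> t)" if "s \<le> t" for s t by (rule F_mono[OF that])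
  show Wa: "W' t \<in> borel_measurable (\<F> t)" if "0 \<le> t" for t
  proof -
    note [measurable] = W_adapted[OF that]
    show ?thesis unfolding W'_def[abs_def] by measurable
  qed
  show "continuous_on {0..} (\<lambda>t. W' t \<omega>)" for \<omega> by (cases "good \<omega>") (auto simp: W'_def good_def)
  fix s t :: real and f :: "'a \<Rightarrow> real"
  assume st: "0 \<le> s" "s \<le> t" and f: "f \<in> borel_measurable (\<F> s)" "integrable M f"
  have [measurable]: "W t \<in> borel_measurable M" "W s \<in> borel_measurable M" "f \<in> borel_measurable M"
    "W' t \<in> borel_measurable M" "W' s \<in> borel_measurable M"
    using st f by (auto intro!: F_M[OF W_adapted] F_M[OF Wa])
  have ae: "AE \<omega> in M. W' t \<omega> - W' s \<omega> = W t \<omega> - W s \<omega>"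
    using AE_good by eventually_elim (simp add: W'_def)
  have "(integrable M (\<lambda>\<omega>. f \<omega> * (W t \<omega> - W s \<omega>)) \<and> (\<integral>\<omega>. f \<omega> * (W t \<omega> - W s \<omega>) \<partial>M) = 0) \<and>
    (integrable M (\<lambda>\<omega>. f \<omega> * (W t \<omega> - W s \<omega>)\<^sup>2) \<and>
      (\<integral>\<omega>. f \<omega> * (W t \<omega> - W s \<omega>)\<^sup>2 \<partial>M) = (t - s) * (\<integral>\<omega>. f \<omega> \<partial>M))"
  proof (cases "s = t")
    case True
    then show ?thesis by simp
  next
    case False
    then have "s < t" using st by simp
    then show ?thesis
      using brownian_increment_moments[OF prob_space_axioms subalg bm st(1) _ f] by blast
  qed
  note m = this
  have ae1: "AE \<omega> in M. f \<omega> * (W' t \<omega> - W' s \<omega>) = f \<omega> * (W t \<omega> - W s \<omega>)"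
    and ae2: "AE \<omega> in M. f \<omega> * (W' t \<omega> - W' s \<omega>)\<^sup>2 = f \<omega> * (W t \<omega> - W s \<omega>)\<^sup>2"
    using ae by (eventually_elim, simp)+
  have i1: "integrable M (\<lambda>\<omega>. f \<omega> * (W' t \<omega> - W' s \<omega>)) = integrable M (\<lambda>\<omega>. f \<omega> * (W t \<omega> - W s \<omega>))"
    by (rule integrable_cong_AE[OF _ _ ae1]) measurable
  have e1: "(\<integral>\<omega>. f \<omega> * (W' t \<omega> - W' s \<omega>) \<partial>M) = (\<integral>\<omega>. f \<omega> * (W t \<omega> - W s \<omega>) \<partial>M)"
    by (rule integral_cong_AE[OF _ _ ae1]) measurable
  have i2: "integrable M (\<lambda>\<omega>. f \<omega> * (W' t \<omega> - W' s \<omega>)\<^sup>2) = integrable M (\<lambda>\<omega>. f \<omega> * (W t \<omega> - W s \<omega>)\<^sup>2)"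
    by (rule integrable_cong_AE[OF _ _ ae2]) measurable
  have e2: "(\<integral>\<omega>. f \<omega> * (W' t \<omega> - W' s \<omega>)\<^sup>2 \<partial>M) = (\<integral>\<omega>. f \<omega> * (W t \<omega> - W s \<omega>)\<^sup>2 \<partial>M)"
    by (rule integral_cong_AE[OF _ _ ae2]) measurable
  show "integrable M (\<lambda>\<omega>. f \<omega> * (W' t \<omega> - W' s \<omega>)) \<and> (\<integral>\<omega>. f \<omega> * (W' t \<omega> - W' s \<omega>) \<partial>M) = 0"
    unfolding i1 e1 using m by (rule conjunct1)
  show "integrable M (\<lambda>\<omega>. f \<omega> * (W' t \<omega> - W' s \<omega>)\<^sup>2) \<and>
      (\<integral>\<omega>. f \<omega> * (W' t \<omega> - W' s \<omega>)\<^sup>2 \<partial>M) = (t - s) * (\<integral>\<omega>. f \<omega> \<partial>M)"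
    unfolding i2 e2 using m by (rule conjunct2)
qed

text \<open>Translates the given solution into operational time. On good paths
  \<open>E t \<le> v\<close> and \<open>t \<le> D v\<close> say the same, which turns adaptedness to
  \<open>\<G>\<close> into \<open>X_adapted\<close>; \<open>integral_limit\<close> supplies the
  Riemann sums.\<close>

lemma ex_euler_setup: "\<exists>I. euler_setup M \<F> W' H h F G K \<theta> D' X' I T x0"
proof -
  obtain I where I: "is_stochastic_integral M \<G> T (\<lambda>t \<omega>. W (E t \<omega>) \<omega>) (\<lambda>t \<omega>. G (E t \<omega>) (X t \<omega>)) I"
    and eq: "AE \<omega> in M. \<forall>t\<in>{0..T}. X t \<omega> = x0 + (LINT r:{0<..t}|lborel. H (E r \<omega>))
        + (LINT r:{0<..t}|interval_measure (\<lambda>r. E r \<omega>). F (E r \<omega>) (X r \<omega>)) + I t \<omega>"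
    using sol unfolding solves_time_changed_SDE_def by blast
  obtain r where r: "filterlim r at_top sequentially" "AE \<omega> in M. \<forall>t\<in>{0..T}. (\<lambda>n. Jn (r n) t \<omega>) \<longlonglongrightarrow> I t \<omega>"
    using integral_limit[OF I] by blast
  have path: "(\<lambda>u. D' u \<omega>) = (\<lambda>u. D u \<omega>)" if "good \<omega>" for \<omega> using that by (simp add: D'_def)
  have "euler_setup_axioms M \<F> W' H F G D' X' I T x0"
  proof (rule euler_setup_axioms.intro)
    fix \<omega>
    show "time_change_path (\<lambda>u. D' u \<omega>)"
      by (cases "good \<omega>") (simp_all add: D'_def identity_path, simp add: good_def)
    show "continuous_on {0..T} (\<lambda>t. X' t \<omega>)" by (cases "good \<omega>") (auto simp: X'_def good_def)
  next
    fix v :: real assume v: "0 \<le> v"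
    note [measurable] = D_adapted[OF v]
    show "D' v \<in> borel_measurable (\<F> v)" unfolding D'_def[abs_def] by measurable
  next
    fix t :: real assume t: "0 \<le> t" "t \<le> T"
    have [measurable]: "X t \<in> borel_measurable M" by (rule \<G>_meas[OF X_\<G>[OF t]])
    show "X' t \<in> borel_measurable M" unfolding X'_def[abs_def] by measurable
    fix v :: real assume v: "0 \<le> v"
    have [measurable]: "(\<lambda>\<omega>. if E t \<omega> \<le> v then X t \<omega> else 0) \<in> borel_measurable (\<F> v)"
      by (rule \<G>_adapted[OF X_\<G>[OF t]])
    have "(\<lambda>\<omega>. if good \<omega> then (if E t \<omega> \<le> v then X t \<omega> else 0) else 0) \<in> borel_measurable (\<F> v)" by measurable
    also have "(\<lambda>\<omega>. if good \<omega> then (if E t \<omega> \<le> v then X t \<omega> else 0) else 0) = (\<lambda>\<omega>. if t \<le> D' v \<omega> then X' t \<omega> else 0)"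
    proof
      fix \<omega>
      show "(if good \<omega> then (if E t \<omega> \<le> v then X t \<omega> else 0) else 0) = (if t \<le> D' v \<omega> then X' t \<omega> else 0)"
      proof (cases "good \<omega>")
        case True
        then have "E t \<omega> \<le> v \<longleftrightarrow> t \<le> D v \<omega>" using time_change_path.inv_le_iff[OF _ v] by (simp add: good_def)
        then show ?thesis using True by (simp add: D'_def X'_def)
      qed (simp add: X'_def)
    qed
    finally show "(\<lambda>\<omega>. if t \<le> D' v \<omega> then X' t \<omega> else 0) \<in> borel_measurable (\<F> v)" .
  next
    show "AE \<omega> in M. \<forall>t\<in>{0..T}. X' t \<omega> = x0
       + (LINT r:{0<..t}|lborel. H (inverse_path (\<lambda>u. D' u \<omega>) r))
       + (LINT r:{0<..t}|interval_measure (inverse_path (\<lambda>u. D' u \<omega>)).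
            F (inverse_path (\<lambda>u. D' u \<omega>) r) (X' r \<omega>)) + I t \<omega>"
      using AE_good eq
    proof eventually_elim
      case (elim \<omega>)
      have X: "X' t \<omega> = X t \<omega>" for t using elim(1) by (simp add: X'_def)
      show ?case unfolding path[OF elim(1)] X using elim(2) .
    qed
  next
    have "AE \<omega> in M. \<forall>q\<in>\<rat> \<inter> {0..T}.
       (\<lambda>n. \<Sum>i<Suc (r n). G (inverse_path (\<lambda>u. D' u \<omega>) (real i * T / real (Suc (r n)))) (X' (real i * T / real (Suc (r n))) \<omega>)
          * (W' (inverse_path (\<lambda>u. D' u \<omega>) (min q (real (Suc i) * T / real (Suc (r n))))) \<omega>
           - W' (inverse_path (\<lambda>u. D' u \<omega>) (min q (real i * T / real (Suc (r n))))) \<omega>)) \<longlonglongrightarrow> I q \<omega>"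
      using AE_good r(2)
    proof eventually_elim
      case (elim \<omega>)
      have X: "X' t \<omega> = X t \<omega>" and W: "W' t \<omega> = W t \<omega>" for t using elim(1) by (simp_all add: X'_def W'_def)
      show ?case
        unfolding path[OF elim(1)] X W using elim(2) unfolding Jn_def pt_def Y_good[OF elim(1)] by blast
    qed
    with r(1) show "\<exists>r. filterlim r at_top sequentially \<and> (AE \<omega> in M. \<forall>q\<in>\<rat> \<inter> {0..T}.
       (\<lambda>n. \<Sum>i<Suc (r n). G (inverse_path (\<lambda>u. D' u \<omega>) (real i * T / real (Suc (r n)))) (X' (real i * T / real (Suc (r n))) \<omega>)
          * (W' (inverse_path (\<lambda>u. D' u \<omega>) (min q (real (Suc i) * T / real (Suc (r n))))) \<omega>
           - W' (inverse_path (\<lambda>u. D' u \<omega>) (min q (real i * T / real (Suc (r n))))) \<omega>)) \<longlonglongrightarrow> I q \<omega>)" by blast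
  qed (rule T_pos)
  then have "euler_setup M \<F> W' H h F G K \<theta> D' X' I T x0"
    by (intro euler_setup.intro filtered_brownian sde_coefficients_axioms)
  then show ?thesis by (rule exI[of _ I])
qed

text \<open>Regular variation bounds the Laplace exponent below by powers \<open>b\<close> less than
  \<open>\<beta>\<close>, so every tail exponent less than \<open>1 / (1 - \<beta>)\<close> and at
  least 1 can be reached.\<close>

lemma tail_bound:
  assumes b: "0 \<le> b" "b < \<beta>"
  shows "\<exists>C>0. \<exists>a>0. \<forall>v\<ge>0. prob {\<omega>\<in>space M. D' v \<omega> \<le> T} \<le> C * exp (- a * v powr (1 / (1 - b)))"
proof -
  obtain c s0 where c: "0 < c" "0 < s0" "\<And>u. s0 \<le> u \<Longrightarrow> c * u powr b \<le> laplace_exponent \<nu> u"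
    using regularly_varying_lower[OF rv(1) exponent_mono b(2,1)] by blast
  have b1: "b < 1" using b rv by simp
  obtain C a where "0 < C" "0 < a" "\<And>v. 0 \<le> v \<Longrightarrow> prob {\<omega>\<in>space M. D v \<omega> \<le> T} \<le> C * exp (- a * v powr (1 / (1 - b)))"
    using subordinator_tail[OF D_meas laplace c b(1) b1 T_pos] by blast
  moreover have "prob {\<omega>\<in>space M. D' v \<omega> \<le> T} = prob {\<omega>\<in>space M. D v \<omega> \<le> T}" if "0 \<le> v" for v
  proof (rule measure_eq_AE)
    note [measurable] = D_meas[OF that]
    show "AE \<omega> in M. (\<omega> \<in> {\<omega>\<in>space M. D' v \<omega> \<le> T}) = (\<omega> \<in> {\<omega>\<in>space M. D v \<omega> \<le> T})"
      using AE_good by eventually_elim (simp add: D'_def)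
    show "{\<omega>\<in>space M. D v \<omega> \<le> T} \<in> sets M" by measurable
    have "D' v \<in> borel_measurable M" unfolding D'_def[abs_def] by measurable
    then show "{\<omega>\<in>space M. D' v \<omega> \<le> T} \<in> sets M" by measurable
  qed
  ultimately show ?thesis by (intro exI[of _ C] conjI exI[of _ a]) auto
qed

text \<open>Both conditions are brought to one form. A constant \<open>h\<close> has exponent 0. For
  a regularly varying \<open>h\<close> the power bound needs an exponent above its index, and the
  strict inequality for \<open>\<beta>\<close> leaves room for it.\<close>

lemma growth_exponent:
  assumes "((\<exists>c. \<forall>u\<ge>0. h u = c) \<and> 1 / 2 < \<beta>) \<or>
         (\<exists>q\<ge>0. regularly_varying h q \<and> (2 * q + 1) / (2 * q + 2) < \<beta>)"
  shows "\<exists>q\<ge>0. \<exists>C>0. 2 * q + 2 < 1 / (1 - \<beta>) \<and> (\<forall>u\<ge>0. h u \<le> C * (1 + u) powr q)"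
  using assms
proof (elim disjE conjE exE)
  fix c assume c: "\<forall>u\<ge>0. h u = c" and b: "1 / 2 < \<beta>"
  have "2 * 0 + 2 < 1 / (1 - \<beta>)" using b rv by (simp add: field_simps)
  moreover have "h u \<le> (\<bar>c\<bar> + 1) * (1 + u) powr 0" if "0 \<le> u" for u using c that by simp
  ultimately show ?thesis by (intro exI[of _ 0] conjI exI[of _ "\<bar>c\<bar> + 1"]) auto
next
  fix q assume q: "0 \<le> q" "regularly_varying h q" "(2 * q + 1) / (2 * q + 2) < \<beta>"
  define x where "x = 1 / (1 - \<beta>)"
  have "2 * q + 1 < \<beta> * (2 * q + 2)" using q by (simp add: pos_divide_less_eq)
  then have "(2 * q + 2) * (1 - \<beta>) < 1" by (simp add: algebra_simps)
  then have x: "2 * q + 2 < x" using rv by (simp add: x_def pos_less_divide_eq)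
  \<comment> \<open>Halfway between \<open>q\<close> and \<open>(x - 2) / 2\<close>, the limit that
    \<open>2 * p + 2 < x\<close> imposes.\<close>
  define p where "p = (q + (x - 2) / 2) / 2"
  have p: "q < p" "2 * p + 2 < x" "0 \<le> p" using x q by (auto simp: p_def field_simps)
  obtain C where C: "0 < C" "\<And>u. 0 < u \<Longrightarrow> h u \<le> C * (1 + u) powr p"
    using regularly_varying_upper[OF q(2) h_le p(1,3)] by (auto intro: less_imp_le)
  \<comment> \<open>The power bound is available for positive arguments only. At 0 it is borrowed
    from \<open>h 1\<close>, which costs the factor \<open>2 powr p\<close>.\<close>
  have one: "1 \<le> 2 powr p" using p by (simp add: ge_one_powr_ge_zero)
  have "h u \<le> (C * 2 powr p) * (1 + u) powr p" if u: "0 \<le> u" for u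
  proof (cases "u = 0")
    case True
    have "h 0 \<le> h 1" by (rule h_le) auto
    also have "\<dots> \<le> C * (1 + 1) powr p" by (rule C) simp
    finally show ?thesis using True by simp
  next
    case False
    then have "h u \<le> C * (1 + u) powr p" using u by (intro C) auto
    also have "\<dots> \<le> (C * 2 powr p) * (1 + u) powr p" using C one by (intro mult_right_mono) auto
    finally show ?thesis .
  qed
  then show ?thesis using p C unfolding x_def by (intro exI[of _ p] conjI exI[of _ "C * 2 powr p"]) auto
qed

theorem strong_convergence:
  assumes "((\<exists>c. \<forall>u\<ge>0. h u = c) \<and> 1 / 2 < \<beta>) \<or>
         (\<exists>q\<ge>0. regularly_varying h q \<and> (2 * q + 1) / (2 * q + 2) < \<beta>)"
  shows "\<exists>C>0. \<forall>\<delta>\<in>{0<..<1}. (\<integral>\<^sup>+ \<omega>. sup_dist {0..T} (\<lambda>t. X t \<omega>)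
      (\<lambda>t. euler_maruyama H F G x0 \<delta> (\<lambda>u. D u \<omega>) (\<lambda>u. W u \<omega>) t) \<partial>M) \<le> ennreal (C * \<delta> powr min \<theta> (1 / 2))"
proof -
  obtain I where "euler_setup M \<F> W' H h F G K \<theta> D' X' I T x0" using ex_euler_setup by blast
  then interpret s: euler_setup M \<F> W' H h F G K \<theta> D' X' I T x0 .
  obtain q C0 where q: "0 \<le> q" "0 < C0" "2 * q + 2 < 1 / (1 - \<beta>)" "\<And>u. 0 \<le> u \<Longrightarrow> h u \<le> C0 * (1 + u) powr q"
    using growth_exponent[OF assms] by blast
  \<comment> \<open>A tail exponent strictly inside the gap left by the hypothesis on
    \<open>\<beta>\<close>; \<open>b\<close> below is the power of the Laplace exponent that
    produces it.\<close>
  obtain p where p: "2 * q + 2 < p" "p < 1 / (1 - \<beta>)" using dense[OF q(3)] by blast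
  define b where "b = 1 - 1 / p"
  have p0: "2 \<le> p" using p q by simp
  have b: "0 \<le> b" using p0 by (simp add: b_def)
  have "1 - \<beta> < 1 / p" using p p0 rv by (simp add: field_simps)
  then have b\<beta>: "b < \<beta>" by (simp add: b_def)
  have pb: "1 / (1 - b) = p" using p0 by (simp add: b_def)
  obtain Ct a where t: "0 < Ct" "0 < a" "\<And>v. 0 \<le> v \<Longrightarrow> prob {\<omega>\<in>space M. D' v \<omega> \<le> T} \<le> Ct * exp (- a * v powr p)"
    using tail_bound[OF b b\<beta>] unfolding pb by blast
  obtain C where C: "0 < C" "\<And>\<delta>. 0 < \<delta> \<Longrightarrow> \<delta> < 1 \<Longrightarrow>
    (\<integral>\<^sup>+\<omega>. (SUP t\<in>\<rat> \<inter> {0..T}. ennreal \<bar>X' t \<omega> - s.scheme \<delta> t \<omega>\<bar>) \<partial>M) \<le> ennreal (C * \<delta> powr min \<theta> (1 / 2))"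
    using s.strong_error[OF q(2,1,4) t p(1)] by blast
  show ?thesis
  proof (intro exI[of _ C] conjI ballI)
    fix \<delta> :: real assume "\<delta> \<in> {0<..<1}"
    then have d: "0 < \<delta>" "\<delta> < 1" by auto
    have "AE \<omega> in M. sup_dist {0..T} (\<lambda>t. X t \<omega>) (\<lambda>t. euler_maruyama H F G x0 \<delta> (\<lambda>u. D u \<omega>) (\<lambda>u. W u \<omega>) t)
      \<le> (SUP t\<in>\<rat> \<inter> {0..T}. ennreal \<bar>X' t \<omega> - s.scheme \<delta> t \<omega>\<bar>)"
      using AE_good AE_space
    proof eventually_elim
      case (elim \<omega>)
      have eq: "\<bar>X t \<omega> - euler_maruyama H F G x0 \<delta> (\<lambda>u. D u \<omega>) (\<lambda>u. W u \<omega>) t\<bar> = \<bar>X' t \<omega> - s.scheme \<delta> t \<omega>\<bar>" for t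
        using elim(1) by (simp add: X'_def D'_def W'_def)
      show ?case
        unfolding sup_dist_def eq
        by (rule SUP_least) (rule s.error_le_rational_sup[OF d elim(2)], auto)
    qed
    then have "(\<integral>\<^sup>+ \<omega>. sup_dist {0..T} (\<lambda>t. X t \<omega>)
      (\<lambda>t. euler_maruyama H F G x0 \<delta> (\<lambda>u. D u \<omega>) (\<lambda>u. W u \<omega>) t) \<partial>M)
      \<le> (\<integral>\<^sup>+\<omega>. (SUP t\<in>\<rat> \<inter> {0..T}. ennreal \<bar>X' t \<omega> - s.scheme \<delta> t \<omega>\<bar>) \<partial>M)" by (rule nn_integral_mono_AE)
    also have "\<dots> \<le> ennreal (C * \<delta> powr min \<theta> (1 / 2))" by (rule C(2)[OF d])
    finally show "(\<integral>\<^sup>+ \<omega>. sup_dist {0..T} (\<lambda>t. X t \<omega>)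
      (\<lambda>t. euler_maruyama H F G x0 \<delta> (\<lambda>u. D u \<omega>) (\<lambda>u. W u \<omega>) t) \<partial>M) \<le> ennreal (C * \<delta> powr min \<theta> (1 / 2))" .
  qed (rule C(1))
qed

end

theorem theorem4p1:
  fixes MB :: "'b measure" and MD :: "'d measure" and M :: "('b \<times> 'd) measure"
    and \<F> \<G> :: "real \<Rightarrow> ('b \<times> 'd) measure"
    and B :: "real \<Rightarrow> 'b \<Rightarrow> real" and D :: "real \<Rightarrow> 'd \<Rightarrow> real"
    and E X :: "real \<Rightarrow> 'b \<times> 'd \<Rightarrow> real" and Xd :: "real \<Rightarrow> real \<Rightarrow> 'b \<times> 'd \<Rightarrow> real"
    and \<nu> :: "real measure"
    and T x0 K \<theta> \<beta> :: real
    and H h :: "real \<Rightarrow> real" and F G :: "real \<Rightarrow> real \<Rightarrow> real"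
  assumes "prob_space MB" and "prob_space MD"
    and M: "M = completion (MB \<Otimes>\<^sub>M MD)"
    and "usual_filtration M \<F>"
    and "\<And>t. 0 \<le> t \<Longrightarrow> B t \<in> borel_measurable MB"
    and "brownian_motion M \<F> (\<lambda>t \<omega>. B t (fst \<omega>))"
    and "\<And>t. 0 \<le> t \<Longrightarrow> D t \<in> borel_measurable MD"
    and "pure_jump_subordinator M \<F> \<nu> (\<lambda>t \<omega>. D t (snd \<omega>))"
    and "emeasure \<nu> UNIV = \<infinity>"
    and E: "E = (\<lambda>t \<omega>. inverse_path (\<lambda>u. D u (snd \<omega>)) t)"
    and G: "\<G> = time_changed_filtration M \<F> E"
    and "0 < T"
    and "continuous_on {0..} H"
    and "continuous_on ({0..} \<times> UNIV) (\<lambda>(u, x). F u x)"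
    and "continuous_on ({0..} \<times> UNIV) (\<lambda>(u, x). G u x)"
    and "continuous_on {0..} h" and "mono_on {0..} h" and "\<And>u. 0 \<le> u \<Longrightarrow> 0 \<le> h u"
    and "0 < K" and "0 < \<theta>" and "\<theta> \<le> 1"
    and "\<And>u x y. 0 \<le> u \<Longrightarrow> \<bar>F u x - F u y\<bar> + \<bar>G u x - G u y\<bar> \<le> h u * \<bar>x - y\<bar>"
    and "\<And>u x. 0 \<le> u \<Longrightarrow> \<bar>H u\<bar> + \<bar>F u x\<bar> + \<bar>G u x\<bar> \<le> h u * (1 + \<bar>x\<bar>)"
    and "\<And>u v x. 0 \<le> u \<Longrightarrow> 0 \<le> v \<Longrightarrow>
           \<bar>H u - H v\<bar> + \<bar>F u x - F v x\<bar> + \<bar>G u x - G v x\<bar> \<le> K * \<bar>u - v\<bar> powr \<theta> * (1 + \<bar>x\<bar>)"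
    and "solves_time_changed_SDE M \<G> T x0 H F G E (\<lambda>t \<omega>. B t (fst \<omega>)) X"
    and "0 < \<beta>" and "\<beta> < 1"
    and "regularly_varying (laplace_exponent \<nu>) \<beta>"
    and "((\<exists>c. \<forall>u\<ge>0. h u = c) \<and> 1 / 2 < \<beta>) \<or>
         (\<exists>q\<ge>0. regularly_varying h q \<and> (2 * q + 1) / (2 * q + 2) < \<beta>)"
    and Xd: "Xd = (\<lambda>\<delta> t \<omega>. euler_maruyama H F G x0 \<delta> (\<lambda>u. D u (snd \<omega>)) (\<lambda>u. B u (fst \<omega>)) t)"
  shows "(\<exists>C>0. \<forall>\<delta>\<in>{0<..<1}.
            (\<integral>\<^sup>+ \<omega>. sup_dist {0..T} (\<lambda>s. X s \<omega>) (\<lambda>s. Xd \<delta> s \<omega>) \<partial>M)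
              \<le> ennreal (C * \<delta> powr min \<theta> (1 / 2))) \<and>
         strongly_converges M T X Xd (min \<theta> (1 / 2))"
proof -
  interpret MB: prob_space MB by fact
  interpret MD: prob_space MD by fact
  interpret P: pair_prob_space MB MD ..
  have "prob_space M" unfolding M by (rule P.P.prob_space_completion)
  moreover have "complete_measure M" unfolding M by (rule completion.complete_measure_axioms)
  moreover have "sde_coefficients H h F G K \<theta>" by unfold_locales (fact assms)+
  moreover have "time_changed_sde_axioms M H F G \<F> (\<lambda>t \<omega>. B t (fst \<omega>)) (\<lambda>t \<omega>. D t (snd \<omega>)) X \<nu> T x0 \<beta>"
    by unfold_locales (use assms in \<open>simp_all only: E G\<close>)
  ultimately have set: "time_changed_sde M H h F G K \<theta> \<F> (\<lambda>t \<omega>. B t (fst \<omega>)) (\<lambda>t \<omega>. D t (snd \<omega>)) X \<nu> T x0 \<beta>"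
    by (intro time_changed_sde.intro)
  \<comment> \<open>\<open>assms(29)\<close> is the alternative between the two conditions on
    \<open>h\<close> and \<open>\<beta>\<close>.\<close>
  obtain C where C: "0 < C" "\<And>\<delta>. \<delta> \<in> {0<..<1} \<Longrightarrow>
      (\<integral>\<^sup>+ \<omega>. sup_dist {0..T} (\<lambda>s. X s \<omega>) (\<lambda>s. Xd \<delta> s \<omega>) \<partial>M) \<le> ennreal (C * \<delta> powr min \<theta> (1 / 2))"
    using time_changed_sde.strong_convergence[OF set assms(29)] unfolding Xd by blast
  have "strongly_converges M T X Xd (min \<theta> (1 / 2))"
    unfolding strongly_converges_def using C \<open>0 < \<theta>\<close> by (intro conjI exI[of _ C] exI[of _ 1]) auto
  then show ?thesis using C by blast
qed

end
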